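(* Let $\pi:P\to M$ be a fiber bundle with typical fiber $F$ over a complex manifold $M$, let $L\to P$ be a line bundle, and let $J\in\Gamma(\Lambda^2(J^1L)^*\otimes L)$ be a Jacobi structure giving $P$ the structure of a smooth family of contact manifolds. Then $P$ possesses a generalized contact structure (on the line bundle $L\to P$) with Jacobi structure $J$.
   Context: For a real line bundle $L\to P$, $DL\to P$ is the Lie algebroid whose sections are the derivations of $L$, i.e. $\mathbb R$-linear maps $\Delta:\Gamma(L)\to\Gamma(L)$ with $\Delta(f\lambda)=X(f)\lambda+f\Delta(\lambda)$ for some vector field $X=\sigma(\Delta)$ (the anchor $\sigma:DL\to TP$ is called the symbol), with the commutator bracket. $\Omega_L^k(P)=\Gamma(\Lambda^k(DL)^*\otimes L)$ with differential $d_L$ given by the Chevalley–Eilenberg formula for $DL$ with coefficients in its tautological representation $L$; $J^1L=(DL)^*\otimes L$. Jacobi tensor: $J\in\Gamma(\Lambda^2(J^1L)^*\otimes L)$ such that $\{\lambda,\mu\}=J(j^1\lambda,j^1\mu)$ is a Lie bracket on $\Gamma(L)$; $J^\sharp:J^1L\to DL$ is given by $\beta(J^\sharp\alpha)=J(\alpha,\beta)$. If $\operatorname{im}(J^\sharp)$ is a subbundle, it is a subalgebroid and the inverse $J^{-1}\in\Gamma(\Lambda^2\operatorname{im}(J^\sharp)^*\otimes L)$, $J^{-1}(J^\sharp\alpha,J^\sharp\beta)=\alpha(J^\sharp\beta)$, is closed and non-degenerate. Smooth family of contact manifolds: for a fiber bundle $\pi:P\to M$ and a line bundle $L\to P$ put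 $\mathrm{Ver}_L(P)=\sigma^{-1}(\mathrm{Ver}(P))\subseteq DL$, where $\mathrm{Ver}(P)=\ker T\pi$. A smooth family of contact manifolds is the datum of $L\to P$ together with a closed (for the Lie algebroid differential of $\mathrm{Ver}_L(P)$ with values in $L$) non-degenerate $\omega\in\Gamma(\Lambda^2(\mathrm{Ver}_L(P))^*\otimes L)$. A Jacobi structure $J$ gives $P$ this structure if $\operatorname{im}(J^\sharp)=\mathrm{Ver}_L(P)$, with $\omega=J^{-1}$. Generalized contact structures: on $\mathbb DL=DL\oplus J^1L$ consider the $L$-valued pairing $\langle\!\langle(\Delta_1,\psi_1),(\Delta_2,\psi_2)\rangle\!\rangle=\psi_1(\Delta_2)+\psi_2(\Delta_1)$ and the bracket $[\![(\Delta_1,\psi_1),(\Delta_2,\psi_2)]\!]=([\Delta_1,\Delta_2],\mathcal L_{\Delta_1}\psi_2-\iota_{\Delta_2}d_L\psi_1)$, $\mathcal L_\Delta=[\iota_\Delta,d_L]$. A generalized contact structure is a complex subbundle $\mathcal L\subseteq\mathbb D_{\mathbb C}L$ that is maximally isotropic, involutive, and satisfies $\mathcal L\cap\overline{\mathcal L}=\{0\}$. It is the $+i$-eigenbundle of a unique real endomorphism $\mathbb K=\begin{pmatrix}\phi&J^\sharp\\ \sigma^\flat&-\phi^*\end{pmatrix}$ of $DL\oplus J^1L$ with $\mathbb K^2=-\mathrm{id}$ preserving the pairing; the Jacobi tensor $J$ appearing there is the Jacobi structure of $\mathcal L$. *)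

theory Defs
  imports "HOL-Analysis.Analysis" "HOL-Library.Function_Algebras" "HOL-Library.FuncSet"
begin

section \<open>Linear preliminaries\<close>

instantiation "fun" :: (type, real_vector) real_vector
begin

definition scaleR_fun :: "real \<Rightarrow> ('a \<Rightarrow> 'b) \<Rightarrow> 'a \<Rightarrow> 'b"
  where "scaleR_fun a f = (\<lambda>x. a *\<^sub>R f x)"

instance
  by standard (simp_all add: scaleR_fun_def fun_eq_iff scaleR_add_right scaleR_add_left)

end

definition lin_on :: "'a::real_vector set \<Rightarrow> 'b::real_vector set \<Rightarrow> ('a \<Rightarrow> 'b) \<Rightarrow> bool"
  where "lin_on S T h \<longleftrightarrow>
    (\<forall>x\<in>S. h x \<in> T) \<and> (\<forall>x\<in>S. \<forall>y\<in>S. h (x + y) = h x + h y) \<and>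
    (\<forall>a. \<forall>x\<in>S. h (a *\<^sub>R x) = a *\<^sub>R h x)"

text \<open>Linear maps between subspaces \<open>S\<close> and \<open>T\<close>; the value \<open>0\<close> outside \<open>S\<close> is a convention
  that makes each linear map be represented by exactly one function.\<close>

definition Hom :: "'a::real_vector set \<Rightarrow> 'b::real_vector set \<Rightarrow> ('a \<Rightarrow> 'b) set"
  where "Hom S T = {h. lin_on S T h \<and> (\<forall>x. x \<notin> S \<longrightarrow> h x = 0)}"

definition alt_bilin :: "'a::real_vector set \<Rightarrow> 'b::real_vector set \<Rightarrow> ('a \<Rightarrow> 'a \<Rightarrow> 'b) \<Rightarrow> bool"
  where "alt_bilin S T B \<longleftrightarrow>
    (\<forall>x\<in>S. lin_on S T (B x)) \<and> (\<forall>y\<in>S. lin_on S T (\<lambda>x. B x y)) \<and> (\<forall>x\<in>S. B x x = 0)"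

definition lie_bracket_on :: "'a::real_vector set \<Rightarrow> ('a \<Rightarrow> 'a \<Rightarrow> 'a) \<Rightarrow> bool"
  where "lie_bracket_on V b \<longleftrightarrow> alt_bilin V V b \<and>
    (\<forall>x\<in>V. \<forall>y\<in>V. \<forall>z\<in>V. b x (b y z) + b y (b z x) + b z (b x y) = 0)"

text \<open>The complexification of a real vector space consists of pairs \<open>(x, y)\<close>, read as \<open>x + \<i>y\<close>.\<close>

definition cscale :: "complex \<Rightarrow> 'a::real_vector \<times> 'a \<Rightarrow> 'a \<times> 'a"
  where "cscale c z = (Re c *\<^sub>R fst z - Im c *\<^sub>R snd z, Re c *\<^sub>R snd z + Im c *\<^sub>R fst z)"

definition cconj :: "'a::real_vector \<times> 'a \<Rightarrow> 'a \<times> 'a"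
  where "cconj z = (fst z, - snd z)"

definition csubspace :: "('a::real_vector \<times> 'a) set \<Rightarrow> bool"
  where "csubspace W \<longleftrightarrow>
    0 \<in> W \<and> (\<forall>z\<in>W. \<forall>w\<in>W. z + w \<in> W) \<and> (\<forall>c. \<forall>z\<in>W. cscale c z \<in> W)"

definition cbilinear_ext ::
  "('a::real_vector \<Rightarrow> 'a \<Rightarrow> 'b::real_vector) \<Rightarrow> 'a \<times> 'a \<Rightarrow> 'a \<times> 'a \<Rightarrow> 'b \<times> 'b"
  where "cbilinear_ext B z w =
    (B (fst z) (fst w) - B (snd z) (snd w), B (fst z) (snd w) + B (snd z) (fst w))"


section \<open>Manifolds and fiber bundles\<close>

text \<open>The predicates \<open>Ck_on\<close> and \<open>smooth_on\<close> are meant for open \<open>S\<close> in a finite-dimensional space.\<close>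

primrec Ck_on :: "nat \<Rightarrow> ('a::real_normed_vector \<Rightarrow> 'b::real_normed_vector) \<Rightarrow> 'a set \<Rightarrow> bool"
  where
    "Ck_on 0 = (\<lambda>f S. continuous_on S f)"
  | "Ck_on (Suc k) = (\<lambda>f S. (\<forall>x\<in>S. f differentiable at x) \<and>
       (\<forall>v. Ck_on k (\<lambda>x. frechet_derivative f (at x) v) S))"

definition smooth_on :: "'a::real_normed_vector set \<Rightarrow> ('a \<Rightarrow> 'b::real_normed_vector) \<Rightarrow> bool"
  where "smooth_on S f \<longleftrightarrow> (\<forall>k. Ck_on k f S)"

text \<open>A manifold is a whole type with its topology and a (not necessarily maximal) atlas of charts
  with values in a finite-dimensional space, which may have dimension 0 (therefore
  the class is not \<open>euclidean_space\<close>).\<close>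

type_synonym ('p, 'e) atlas = "('p set \<times> ('p \<Rightarrow> 'e)) set"

definition smooth_manifold ::
  "('p::{t2_space, second_countable_topology}, 'e::real_normed_vector) atlas \<Rightarrow> bool"
  where "smooth_manifold A \<longleftrightarrow>
    (\<exists>B. finite B \<and> span B = (UNIV :: 'e set)) \<and>
    (\<Union>(U, \<phi>)\<in>A. U) = UNIV \<and>
    (\<forall>(U, \<phi>)\<in>A. open U \<and> open (\<phi> ` U) \<and> inj_on \<phi> U \<and>
      homeomorphism U (\<phi> ` U) \<phi> (inv_into U \<phi>)) \<and>
    (\<forall>(U, \<phi>)\<in>A. \<forall>(V, \<psi>)\<in>A. smooth_on (\<phi> ` (U \<inter> V)) (\<psi> \<circ> inv_into U \<phi>))"

text \<open>A finite-dimensional complex vector space is a real one with a linear \<open>I\<close> such that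
  \<open>I\<^sup>2 = -1\<close>; holomorphic means that the derivative is \<open>I\<close>-linear.\<close>

definition complex_manifold ::
  "('e \<Rightarrow> 'e) \<Rightarrow> ('m::{t2_space, second_countable_topology}, 'e::real_normed_vector) atlas \<Rightarrow> bool"
  where "complex_manifold I A \<longleftrightarrow>
    smooth_manifold A \<and> linear I \<and> (\<forall>v. I (I v) = - v) \<and>
    (\<forall>(U, \<phi>)\<in>A. \<forall>(V, \<psi>)\<in>A. \<forall>x\<in>\<phi> ` (U \<inter> V). \<forall>v.
      frechet_derivative (\<psi> \<circ> inv_into U \<phi>) (at x) (I v) =
      I (frechet_derivative (\<psi> \<circ> inv_into U \<phi>) (at x) v))"

definition smooth_map_on ::
  "('p::topological_space, 'e::real_normed_vector) atlas \<Rightarrow>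
   ('q::topological_space, 'f::real_normed_vector) atlas \<Rightarrow> 'p set \<Rightarrow> ('p \<Rightarrow> 'q) \<Rightarrow> bool"
  where "smooth_map_on A B W f \<longleftrightarrow> continuous_on W f \<and>
    (\<forall>(U, \<phi>)\<in>A. \<forall>(V, \<psi>)\<in>B. smooth_on (\<phi> ` (U \<inter> W \<inter> f -` V)) (\<psi> \<circ> f \<circ> inv_into U \<phi>))"

definition smooth_fun_on ::
  "('p::topological_space, 'e::real_normed_vector) atlas \<Rightarrow> 'p set \<Rightarrow> ('p \<Rightarrow> real) \<Rightarrow> bool"
  where "smooth_fun_on A W f \<longleftrightarrow> (\<forall>(U, \<phi>)\<in>A. smooth_on (\<phi> ` (U \<inter> W)) (f \<circ> inv_into U \<phi>))"

definition smooth_funs ::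
  "('p::topological_space, 'e::real_normed_vector) atlas \<Rightarrow> ('p \<Rightarrow> real) set"
  where "smooth_funs A = {f. smooth_fun_on A UNIV f}"

definition prod_atlas :: "('p, 'e) atlas \<Rightarrow> ('q, 'f) atlas \<Rightarrow> ('p \<times> 'q, 'e \<times> 'f) atlas"
  where "prod_atlas A B = {(U \<times> V, map_prod \<phi> \<psi>) | U \<phi> V \<psi>. (U, \<phi>) \<in> A \<and> (V, \<psi>) \<in> B}"

text \<open>\<open>\<pi>\<close> is a bundle from the manifold with atlas \<open>A\<close> to that with atlas \<open>B\<close>, with typical fiber
  the manifold with atlas \<open>C\<close>.\<close>

definition fiber_bundle ::
  "('p::{t2_space, second_countable_topology}, 'e::real_normed_vector) atlas \<Rightarrow>
   ('m::{t2_space, second_countable_topology}, 'c::real_normed_vector) atlas \<Rightarrow>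
   ('f::{t2_space, second_countable_topology}, 'd::real_normed_vector) atlas \<Rightarrow> ('p \<Rightarrow> 'm) \<Rightarrow> bool"
  where "fiber_bundle A B C \<pi> \<longleftrightarrow>
    smooth_manifold A \<and> smooth_manifold B \<and> smooth_manifold C \<and> smooth_map_on A B UNIV \<pi> \<and>
    (\<forall>m. \<exists>U h k. open U \<and> m \<in> U \<and>
      homeomorphism (\<pi> -` U) (U \<times> UNIV) h k \<and>
      smooth_map_on A (prod_atlas B C) (\<pi> -` U) h \<and>
      smooth_map_on (prod_atlas B C) A (U \<times> UNIV) k \<and>
      (\<forall>p\<in>\<pi> -` U. fst (h p) = \<pi> p))"

text \<open>Tangent vectors are point derivations of the algebra of smooth functions.\<close>

definition tangent_space ::
  "('p::topological_space, 'e::real_normed_vector) atlas \<Rightarrow> 'p \<Rightarrow> (('p \<Rightarrow> real) \<Rightarrow> real) set"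
  where "tangent_space A p = {X \<in> Hom (smooth_funs A) UNIV.
    \<forall>f\<in>smooth_funs A. \<forall>g\<in>smooth_funs A. X (\<lambda>q. f q * g q) = X f * g p + f p * X g}"

definition tangent_map ::
  "('m::topological_space, 'c::real_normed_vector) atlas \<Rightarrow> ('p \<Rightarrow> 'm) \<Rightarrow>
   (('p \<Rightarrow> real) \<Rightarrow> real) \<Rightarrow> ('m \<Rightarrow> real) \<Rightarrow> real"
  where "tangent_map B \<pi> X = (\<lambda>g. if g \<in> smooth_funs B then X (g \<circ> \<pi>) else 0)"

definition Ver ::
  "('p::topological_space, 'e::real_normed_vector) atlas \<Rightarrow>
   ('m::topological_space, 'c::real_normed_vector) atlas \<Rightarrow> ('p \<Rightarrow> 'm) \<Rightarrow> 'p \<Rightarrow>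
   (('p \<Rightarrow> real) \<Rightarrow> real) set"
  where "Ver A B \<pi> p = {X \<in> tangent_space A p. tangent_map B \<pi> X = 0}"


section \<open>Line bundles, derivations and jets\<close>

text \<open>\<open>der\<close>: points of \<open>DL\<close>; \<open>jet\<close>: points of \<open>J\<^sup>1L = (DL)\<^sup>* \<otimes> L\<close>; \<open>gen\<close>: points of
  \<open>DL \<oplus> J\<^sup>1L\<close>.\<close>

type_synonym ('p, 'v) der = "('p \<Rightarrow> 'v) \<Rightarrow> 'v"
type_synonym ('p, 'v) jet = "('p, 'v) der \<Rightarrow> 'v"
type_synonym ('p, 'v) gen = "('p, 'v) der \<times> ('p, 'v) jet"

text \<open>A line bundle is given by its fibers \<open>E p\<close>, which are lines in a vector space \<open>'v\<close> that only
  serves as a container (no relation between \<open>'v\<close> and the smooth structure is assumed),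
  and by a family \<open>Fr\<close> of local frames with smooth transition functions.\<close>

locale line_bundle =
  fixes A :: "('p::{t2_space, second_countable_topology}, 'e::real_normed_vector) atlas"
    and E :: "'p \<Rightarrow> 'v::real_vector set"
    and Fr :: "('p set \<times> ('p \<Rightarrow> 'v)) set"
  assumes manifold: "smooth_manifold A"
    and fiber: "subspace (E p)" "dim (E p) = 1"
    and frame: "(U, s) \<in> Fr \<Longrightarrow> open U"
      "(U, s) \<in> Fr \<Longrightarrow> p \<in> U \<Longrightarrow> s p \<in> E p \<and> s p \<noteq> 0"
    and frame_cover: "(\<Union>(U, s)\<in>Fr. U) = UNIV"
    and transition: "(U, s) \<in> Fr \<Longrightarrow> (V, t) \<in> Fr \<Longrightarrow>
      \<exists>g. smooth_fun_on A (U \<inter> V) g \<and> (\<forall>p\<in>U \<inter> V. t p = g p *\<^sub>R s p)"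
begin

definition sec :: "('p \<Rightarrow> 'v) set"
  where "sec = {l. (\<forall>p. l p \<in> E p) \<and>
    (\<forall>(U, s)\<in>Fr. \<exists>f. smooth_fun_on A U f \<and> (\<forall>p\<in>U. l p = f p *\<^sub>R s p))}"

definition has_symbol :: "'p \<Rightarrow> ('p, 'v) der \<Rightarrow> (('p \<Rightarrow> real) \<Rightarrow> real) \<Rightarrow> bool"
  where "has_symbol p \<delta> X \<longleftrightarrow> X \<in> tangent_space A p \<and>
    (\<forall>f\<in>smooth_funs A. \<forall>l\<in>sec. \<delta> (\<lambda>q. f q *\<^sub>R l q) = X f *\<^sub>R l p + f p *\<^sub>R \<delta> l)"

definition D :: "'p \<Rightarrow> ('p, 'v) der set"
  where "D p = {\<delta> \<in> Hom sec (E p). \<exists>X. has_symbol p \<delta> X}"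

definition J1 :: "'p \<Rightarrow> ('p, 'v) jet set"
  where "J1 p = Hom (D p) (E p)"

text \<open>Sections of \<open>DL\<close> are the fields \<open>\<Delta>\<close> of point derivations for which \<open>act \<Delta>\<close> preserves the
  smooth sections of \<open>L\<close>; the operators \<open>act \<Delta>\<close> are exactly the derivations of \<open>L\<close> (the symbol is
  automatically a smooth vector field). Dually, a field of elements of \<open>J\<^sup>1L\<close> is smooth if it maps
  sections of \<open>DL\<close> to sections of \<open>L\<close>.\<close>

definition act :: "('p \<Rightarrow> ('p, 'v) der) \<Rightarrow> ('p \<Rightarrow> 'v) \<Rightarrow> 'p \<Rightarrow> 'v"
  where "act \<Delta> l = (\<lambda>p. \<Delta> p l)"

definition dsec :: "('p \<Rightarrow> ('p, 'v) der) set"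
  where "dsec = {\<Delta>. (\<forall>p. \<Delta> p \<in> D p) \<and> (\<forall>l\<in>sec. act \<Delta> l \<in> sec)}"

definition jsec :: "('p \<Rightarrow> ('p, 'v) jet) set"
  where "jsec = {\<psi>. (\<forall>p. \<psi> p \<in> J1 p) \<and> (\<forall>\<Delta>\<in>dsec. (\<lambda>p. \<psi> p (\<Delta> p)) \<in> sec)}"

definition dbracket ::
  "('p \<Rightarrow> ('p, 'v) der) \<Rightarrow> ('p \<Rightarrow> ('p, 'v) der) \<Rightarrow> 'p \<Rightarrow> ('p, 'v) der"
  where "dbracket \<Delta>1 \<Delta>2 = (\<lambda>p l. \<Delta>1 p (act \<Delta>2 l) - \<Delta>2 p (act \<Delta>1 l))"

text \<open>The 1-jet of a section; this is also \<open>d\<^sub>L\<close> in degree 0.\<close>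

definition j1 :: "('p \<Rightarrow> 'v) \<Rightarrow> 'p \<Rightarrow> ('p, 'v) jet"
  where "j1 l = (\<lambda>p \<delta>. if \<delta> \<in> D p then \<delta> l else 0)"

text \<open>\<open>d\<^sub>L\<close> in degree 1. The value at a point does not depend on the choice of
  the extensions, since the Chevalley--Eilenberg formula is tensorial.\<close>

definition ext :: "'p \<Rightarrow> ('p, 'v) der \<Rightarrow> 'p \<Rightarrow> ('p, 'v) der"
  where "ext p \<delta> = (SOME \<Delta>. \<Delta> \<in> dsec \<and> \<Delta> p = \<delta>)"

definition d1 :: "('p \<Rightarrow> ('p, 'v) jet) \<Rightarrow> 'p \<Rightarrow> ('p, 'v) der \<Rightarrow> ('p, 'v) der \<Rightarrow> 'v"
  where "d1 \<psi> p \<delta>1 \<delta>2 = (if \<delta>1 \<in> D p \<and> \<delta>2 \<in> D p then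
    (let \<Delta>1 = ext p \<delta>1; \<Delta>2 = ext p \<delta>2 in
      \<Delta>1 p (\<lambda>q. \<psi> q (\<Delta>2 q)) - \<Delta>2 p (\<lambda>q. \<psi> q (\<Delta>1 q)) - \<psi> p (dbracket \<Delta>1 \<Delta>2 p)) else 0)"

text \<open>\<open>\<L>\<^sub>\<Delta> = \<iota>\<^sub>\<Delta> d\<^sub>L + d\<^sub>L \<iota>\<^sub>\<Delta>\<close> (graded commutator).\<close>

definition lieD :: "('p \<Rightarrow> ('p, 'v) der) \<Rightarrow> ('p \<Rightarrow> ('p, 'v) jet) \<Rightarrow> 'p \<Rightarrow> ('p, 'v) jet"
  where "lieD \<Delta> \<psi> = (\<lambda>p \<delta>. d1 \<psi> p (\<Delta> p) \<delta> + j1 (\<lambda>q. \<psi> q (\<Delta> q)) p \<delta>)"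


section \<open>Jacobi structures and smooth families of contact manifolds\<close>

definition jacobi_tensor :: "('p \<Rightarrow> ('p, 'v) jet \<Rightarrow> ('p, 'v) jet \<Rightarrow> 'v) \<Rightarrow> bool"
  where "jacobi_tensor J \<longleftrightarrow>
    (\<forall>p. alt_bilin (J1 p) (E p) (J p)) \<and>
    (\<forall>\<alpha>\<in>jsec. \<forall>\<beta>\<in>jsec. (\<lambda>p. J p (\<alpha> p) (\<beta> p)) \<in> sec) \<and>
    lie_bracket_on sec (\<lambda>l m p. J p (j1 l p) (j1 m p))"

definition sharp ::
  "('p \<Rightarrow> ('p, 'v) jet \<Rightarrow> ('p, 'v) jet \<Rightarrow> 'v) \<Rightarrow> 'p \<Rightarrow> ('p, 'v) jet \<Rightarrow> ('p, 'v) der"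
  where "sharp J p \<alpha> = (THE \<delta>. \<delta> \<in> D p \<and> (\<forall>\<beta>\<in>J1 p. \<beta> \<delta> = J p \<alpha> \<beta>))"

definition VerL ::
  "('m::topological_space, 'c::real_normed_vector) atlas \<Rightarrow> ('p \<Rightarrow> 'm) \<Rightarrow> 'p \<Rightarrow> ('p, 'v) der set"
  where "VerL B \<pi> p = {\<delta> \<in> D p. \<exists>X\<in>Ver A B \<pi> p. has_symbol p \<delta> X}"

definition vsec ::
  "('m::topological_space, 'c::real_normed_vector) atlas \<Rightarrow> ('p \<Rightarrow> 'm) \<Rightarrow> ('p \<Rightarrow> ('p, 'v) der) set"
  where "vsec B \<pi> = {\<Delta> \<in> dsec. \<forall>p. \<Delta> p \<in> VerL B \<pi> p}"

definition d2 ::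
  "('p \<Rightarrow> ('p, 'v) der \<Rightarrow> ('p, 'v) der \<Rightarrow> 'v) \<Rightarrow>
   ('p \<Rightarrow> ('p, 'v) der) \<Rightarrow> ('p \<Rightarrow> ('p, 'v) der) \<Rightarrow> ('p \<Rightarrow> ('p, 'v) der) \<Rightarrow> 'p \<Rightarrow> 'v"
  where "d2 \<omega> \<Delta>0 \<Delta>1 \<Delta>2 = (\<lambda>p.
      \<Delta>0 p (\<lambda>q. \<omega> q (\<Delta>1 q) (\<Delta>2 q)) - \<Delta>1 p (\<lambda>q. \<omega> q (\<Delta>0 q) (\<Delta>2 q))
    + \<Delta>2 p (\<lambda>q. \<omega> q (\<Delta>0 q) (\<Delta>1 q)) - \<omega> p (dbracket \<Delta>0 \<Delta>1 p) (\<Delta>2 p)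
    + \<omega> p (dbracket \<Delta>0 \<Delta>2 p) (\<Delta>1 p) - \<omega> p (dbracket \<Delta>1 \<Delta>2 p) (\<Delta>0 p))"

definition smooth_contact_family ::
  "('m::topological_space, 'c::real_normed_vector) atlas \<Rightarrow> ('p \<Rightarrow> 'm) \<Rightarrow>
   ('p \<Rightarrow> ('p, 'v) der \<Rightarrow> ('p, 'v) der \<Rightarrow> 'v) \<Rightarrow> bool"
  where "smooth_contact_family B \<pi> \<omega> \<longleftrightarrow>
    (\<forall>p. alt_bilin (VerL B \<pi> p) (E p) (\<omega> p)) \<and>
    (\<forall>\<Delta>1\<in>vsec B \<pi>. \<forall>\<Delta>2\<in>vsec B \<pi>. (\<lambda>p. \<omega> p (\<Delta>1 p) (\<Delta>2 p)) \<in> sec) \<and>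
    (\<forall>p. \<forall>\<delta>\<in>VerL B \<pi> p. (\<forall>\<delta>'\<in>VerL B \<pi> p. \<omega> p \<delta> \<delta>' = 0) \<longrightarrow> \<delta> = 0) \<and>
    (\<forall>\<Delta>0\<in>vsec B \<pi>. \<forall>\<Delta>1\<in>vsec B \<pi>. \<forall>\<Delta>2\<in>vsec B \<pi>. d2 \<omega> \<Delta>0 \<Delta>1 \<Delta>2 = 0)"

text \<open>The last clause says \<open>\<omega> = J\<^sup>-\<^sup>1\<close>. For a Jacobi tensor with image \<open>VerL\<close> such an \<open>\<omega>\<close>
  exists automatically, so that the first clause is the actual condition on \<open>J\<close>.\<close>

definition gives_contact_family ::
  "('m::topological_space, 'c::real_normed_vector) atlas \<Rightarrow> ('p \<Rightarrow> 'm) \<Rightarrow>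
   ('p \<Rightarrow> ('p, 'v) jet \<Rightarrow> ('p, 'v) jet \<Rightarrow> 'v) \<Rightarrow> bool"
  where "gives_contact_family B \<pi> J \<longleftrightarrow>
    (\<forall>p. sharp J p ` J1 p = VerL B \<pi> p) \<and>
    (\<exists>\<omega>. smooth_contact_family B \<pi> \<omega> \<and>
      (\<forall>p. \<forall>\<alpha>\<in>J1 p. \<forall>\<beta>\<in>J1 p. \<omega> p (sharp J p \<alpha>) (sharp J p \<beta>) = \<alpha> (sharp J p \<beta>)))"


section \<open>Generalized contact structures\<close>

definition pairing :: "('p, 'v) gen \<Rightarrow> ('p, 'v) gen \<Rightarrow> 'v"
  where "pairing z w = snd z (fst w) + snd w (fst z)"

definition gfib :: "'p \<Rightarrow> ('p, 'v) gen set"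
  where "gfib p = D p \<times> J1 p"

definition gsec :: "('p \<Rightarrow> ('p, 'v) gen) set"
  where "gsec = {z. fst \<circ> z \<in> dsec \<and> snd \<circ> z \<in> jsec}"

definition gbracket ::
  "('p \<Rightarrow> ('p, 'v) gen) \<Rightarrow> ('p \<Rightarrow> ('p, 'v) gen) \<Rightarrow> 'p \<Rightarrow> ('p, 'v) gen"
  where "gbracket z w = (\<lambda>p.
    (dbracket (fst \<circ> z) (fst \<circ> w) p,
     \<lambda>\<delta>. lieD (fst \<circ> z) (snd \<circ> w) p \<delta> - d1 (snd \<circ> z) p (fst (w p)) \<delta>))"

text \<open>Sections of the complexified bundle are pointwise pairs (real part, imaginary part).\<close>

definition cgsec :: "('p \<Rightarrow> ('p, 'v) gen \<times> ('p, 'v) gen) set"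
  where "cgsec = {z. fst \<circ> z \<in> gsec \<and> snd \<circ> z \<in> gsec}"

definition cgbracket ::
  "('p \<Rightarrow> ('p, 'v) gen \<times> ('p, 'v) gen) \<Rightarrow> ('p \<Rightarrow> ('p, 'v) gen \<times> ('p, 'v) gen) \<Rightarrow>
   'p \<Rightarrow> ('p, 'v) gen \<times> ('p, 'v) gen"
  where "cgbracket z w = (\<lambda>p.
    (gbracket (fst \<circ> z) (fst \<circ> w) p - gbracket (snd \<circ> z) (snd \<circ> w) p,
     gbracket (fst \<circ> z) (snd \<circ> w) p + gbracket (snd \<circ> z) (fst \<circ> w) p))"

text \<open>Local frames are taken to consist of (restrictions of) global sections, which is no loss of
  generality because of bump functions.\<close>

definition complex_subbundle :: "('p \<Rightarrow> (('p, 'v) gen \<times> ('p, 'v) gen) set) \<Rightarrow> bool"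
  where "complex_subbundle \<L> \<longleftrightarrow>
    (\<forall>p. csubspace (\<L> p) \<and> \<L> p \<subseteq> gfib p \<times> gfib p) \<and>
    (\<exists>k::nat. \<forall>p. \<exists>U e. open U \<and> p \<in> U \<and> (\<forall>i<k. e i \<in> cgsec) \<and>
      (\<forall>q\<in>U. bij_betw (\<lambda>c. \<Sum>i<k. cscale (c i) (e i q)) ({..<k} \<rightarrow>\<^sub>E (UNIV :: complex set)) (\<L> q)))"

definition isotropic :: "(('p, 'v) gen \<times> ('p, 'v) gen) set \<Rightarrow> bool"
  where "isotropic W \<longleftrightarrow> (\<forall>z\<in>W. \<forall>w\<in>W. cbilinear_ext pairing z w = 0)"

definition maximally_isotropic :: "('p \<Rightarrow> (('p, 'v) gen \<times> ('p, 'v) gen) set) \<Rightarrow> bool"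
  where "maximally_isotropic \<L> \<longleftrightarrow> (\<forall>p. isotropic (\<L> p) \<and>
    (\<forall>W. csubspace W \<and> W \<subseteq> gfib p \<times> gfib p \<and> isotropic W \<and> \<L> p \<subseteq> W \<longrightarrow> W = \<L> p))"

definition involutive :: "('p \<Rightarrow> (('p, 'v) gen \<times> ('p, 'v) gen) set) \<Rightarrow> bool"
  where "involutive \<L> \<longleftrightarrow>
    (\<forall>z\<in>cgsec. \<forall>w\<in>cgsec. (\<forall>p. z p \<in> \<L> p) \<and> (\<forall>p. w p \<in> \<L> p) \<longrightarrow> (\<forall>p. cgbracket z w p \<in> \<L> p))"

definition generalized_contact :: "('p \<Rightarrow> (('p, 'v) gen \<times> ('p, 'v) gen) set) \<Rightarrow> bool"
  where "generalized_contact \<L> \<longleftrightarrow>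
    complex_subbundle \<L> \<and> maximally_isotropic \<L> \<and> involutive \<L> \<and>
    (\<forall>p. \<L> p \<inter> cconj ` \<L> p = {0})"

text \<open>\<open>K\<close> is an endomorphism of \<open>DL \<oplus> J\<^sup>1L\<close> with \<open>K\<^sup>2 = -id\<close> that preserves the pairing and has
  \<open>+\<i>\<close>-eigenbundle \<open>\<L>\<close>.\<close>

definition gc_endomorphism ::
  "('p \<Rightarrow> (('p, 'v) gen \<times> ('p, 'v) gen) set) \<Rightarrow> ('p \<Rightarrow> ('p, 'v) gen \<Rightarrow> ('p, 'v) gen) \<Rightarrow> bool"
  where "gc_endomorphism \<L> K \<longleftrightarrow>
    (\<forall>p. lin_on (gfib p) (gfib p) (K p)) \<and>
    (\<forall>z\<in>gsec. (\<lambda>p. K p (z p)) \<in> gsec) \<and>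
    (\<forall>p. \<forall>z\<in>gfib p. K p (K p z) = - z) \<and>
    (\<forall>p. \<forall>z\<in>gfib p. \<forall>w\<in>gfib p. pairing (K p z) (K p w) = pairing z w) \<and>
    (\<forall>p. \<L> p = {z \<in> gfib p \<times> gfib p. map_prod (K p) (K p) z = cscale \<i> z})"

text \<open>\<open>J\<close> is the Jacobi structure of \<open>\<L>\<close>: \<open>K (\<delta>, \<alpha>) = (\<phi> \<delta> + J\<^sup>\<sharp> \<alpha>, \<sigma>\<^sup>\<flat> \<delta> - \<phi>\<^sup>* \<alpha>)\<close>.\<close>

definition jacobi_structure_of ::
  "('p \<Rightarrow> (('p, 'v) gen \<times> ('p, 'v) gen) set) \<Rightarrow>
   ('p \<Rightarrow> ('p, 'v) jet \<Rightarrow> ('p, 'v) jet \<Rightarrow> 'v) \<Rightarrow> bool"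
  where "jacobi_structure_of \<L> J \<longleftrightarrow>
    jacobi_tensor J \<and>
    (\<exists>K \<phi> \<sigma>. gc_endomorphism \<L> K \<and>
      (\<forall>p. \<phi> p \<in> Hom (D p) (D p) \<and> \<sigma> p \<in> Hom (D p) (J1 p)) \<and>
      (\<forall>p. \<forall>\<delta>\<in>D p. \<forall>\<alpha>\<in>J1 p. K p (\<delta>, \<alpha>) = (\<phi> p \<delta> + sharp J p \<alpha>, \<sigma> p \<delta> - \<alpha> \<circ> \<phi> p)))"

end

end

theory Submission
  imports Defs
begin

text \<open>The vertical form \<open>\<omega>\<close> is the differential of its contraction with the identity derivation,
  so that it extends to a closed \<open>L\<close>-valued 2-form \<open>\<Omega> = d\<^sub>L \<theta>\<close> on \<open>DL\<close>, where \<open>\<theta>\<close> is glued from local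
  extensions of that contraction. Let \<open>T01 \<subseteq> D\<^sub>\<complex>L\<close> consist of the derivations whose symbol projects to
  \<open>T\<^sup>0\<^sup>,\<^sup>1M\<close>; it contains the complexification of \<open>VerL\<close>, and on it \<open>\<i> \<Omega>\<close> is a closed form that is
  non-degenerate along \<open>VerL\<close>. Its graph
  \<open>{(\<delta>, \<alpha>). \<delta> \<in> T01 \<and> \<alpha> = \<i> \<Omega>(\<delta>, -) on T01}\<close> is the \<open>+\<i>\<close>-eigenbundle of the endomorphism
  \<open>(\<phi>, J\<^sup>\<sharp>; \<sigma>, -\<phi>\<^sup>*)\<close>, where \<open>\<phi>\<close> lifts \<open>-I\<close>, for the complex structure \<open>I\<close> of \<open>M\<close>, to the \<open>\<Omega>\<close>-orthogonal complement of
  \<open>VerL\<close> and is \<open>0\<close> on \<open>VerL\<close>.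

  In \<open>jacobi_structure_of\<close> the second component is parsed as \<open>(\<sigma> p \<delta> - \<alpha>) \<circ> \<phi> p\<close>, and for this reading
  \<open>\<phi>\<close> has to be invertible. Transforming the structure by the closed form \<open>\<Omega>\<close> (a B-field), i.e. replacing
  \<open>\<i> \<Omega>\<close> by \<open>(1 + \<i>) \<Omega>\<close>, leaves \<open>J\<close> unchanged and turns \<open>\<phi>\<close> into \<open>\<phi> - P\<close>, where
  \<open>P = J\<^sup>\<sharp> \<circ> \<Omega>\<close> is the projection onto \<open>VerL\<close>; the inverse of \<open>\<phi> - P\<close> is \<open>-\<phi> - P\<close>.\<close>

section \<open>Calculus in normed spaces\<close>

text \<open>Gluing with a partition of unity destroys closedness, so \<Omega> cannot be assembled
  from local closed extensions. Its primitive can: the only condition on \<theta> is affine, namely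
  its restriction to \<open>VerL\<close>, and the differential of any \<theta> is closed. This rests
  on the identity derivation, which is central and acts on \<open>L\<close>-valued forms by the Lie
  derivative as the identity, so that a closed form is the differential of its contraction with it.
  The \<Omega>-orthogonal complement of \<open>VerL\<close> then serves as a horizontal
  distribution. Its curvature is harmless, because involutivity uses only that \<open>T01\<close> is
  closed under brackets and that \<Omega> is closed on all of DL. The eigenbundle is handled as the
  graph of - \<open>K\<close> over the real bundle, which turns complex statements into real ones.
  Model spaces are finite-dimensional normed spaces, possibly of dimension 0, so coordinates, bump
  functions and Hadamard's lemma are derived from a finite spanning set.\<close>

lemma has_derivative_cong_open:
  assumes "open S" "x \<in> S" "\<And>y. y \<in> S \<Longrightarrow> f y = g y"
  shows "(f has_derivative f') (at x) \<longleftrightarrow> (g has_derivative f') (at x)"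
  using assms by (metis has_derivative_transform_within_open)

lemma frechet_derivative_cong_open:
  assumes "open S" "x \<in> S" "\<And>y. y \<in> S \<Longrightarrow> f y = g y"
  shows "frechet_derivative f (at x) = frechet_derivative g (at x)"
  unfolding frechet_derivative_def
  using has_derivative_cong_open[OF assms] by simp

lemma Ck_on_SucD:
  "Ck_on (Suc k) f S \<Longrightarrow> x \<in> S \<Longrightarrow> (f has_derivative frechet_derivative f (at x)) (at x)"
  by (simp add: frechet_derivative_works)

lemma Ck_on_cong:
  "open S \<Longrightarrow> (\<And>x. x \<in> S \<Longrightarrow> f x = g x) \<Longrightarrow> Ck_on k f S \<Longrightarrow> Ck_on k g S"
proof (induction k arbitrary: f g)
  case 0
  then show ?case by (simp cong: continuous_on_cong)
next
  case (Suc k)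
  have eq: "frechet_derivative f (at x) = frechet_derivative g (at x)" if "x \<in> S" for x
    using frechet_derivative_cong_open[of S x f g] Suc.prems that by blast
  have "g differentiable at x" if "x \<in> S" for x
    using Ck_on_SucD[OF Suc.prems(3) that] has_derivative_cong_open[of S x f g] Suc.prems that
    by (metis differentiableI)
  moreover have "Ck_on k (\<lambda>x. frechet_derivative g (at x) v) S" for v
    by (rule Suc.IH[of "\<lambda>x. frechet_derivative f (at x) v"]) (use Suc.prems eq in auto)
  ultimately show ?case by simp
qed

text \<open>\<open>Ck_on\<close> speaks of \<open>frechet_derivative\<close>. With this rule each
  closure property only has to exhibit a derivative formula, whose regularity is then the induction
  hypothesis.\<close>

lemma Ck_on_SucI:
  assumes "open S" "\<And>x. x \<in> S \<Longrightarrow> (f has_derivative f' x) (at x)"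
    and "\<And>v. Ck_on k (\<lambda>x. f' x v) S"
  shows "Ck_on (Suc k) f S"
proof -
  have eq: "f' x = frechet_derivative f (at x)" if "x \<in> S" for x
    using assms(2)[OF that] by (rule frechet_derivative_at)
  have "f differentiable at x" if "x \<in> S" for x
    using assms(2)[OF that] differentiableI by blast
  moreover have "Ck_on k (\<lambda>x. frechet_derivative f (at x) v) S" for v
    by (rule Ck_on_cong[OF assms(1) _ assms(3)[of v]]) (simp add: eq)
  ultimately show ?thesis by simp
qed

lemma Ck_on_subset: "T \<subseteq> S \<Longrightarrow> Ck_on k f S \<Longrightarrow> Ck_on k f T"
  by (induction k arbitrary: f) (auto intro: continuous_on_subset)

text \<open>Differentiability is asked at each point with respect to the whole space, so an open
  \<open>T\<close> around the point carries all the information, even if it reaches outside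
  \<open>S\<close>.\<close>

lemma Ck_on_local:
  assumes "\<And>x. x \<in> S \<Longrightarrow> \<exists>T. open T \<and> x \<in> T \<and> Ck_on k f T"
  shows "Ck_on k f S"
  using assms
proof (induction k arbitrary: f)
  case 0
  show ?case
  proof (simp, rule continuous_at_imp_continuous_on, rule ballI)
    fix x assume "x \<in> S"
    then obtain T where "open T" "x \<in> T" "continuous_on T f" using 0 by force
    then show "isCont f x" by (simp add: continuous_on_eq_continuous_at)
  qed
next
  case (Suc k)
  then show ?case by (simp) (meson)
qed

lemma Ck_on_Suc_imp: "Ck_on (Suc k) f S \<Longrightarrow> Ck_on k f S"
proof (induction k arbitrary: f)
  case 0
  then show ?case
    by (simp add: continuous_at_imp_continuous_on differentiable_imp_continuous_within)
next
  case (Suc k)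
  then show ?case by (metis Ck_on.simps(2))
qed

lemma Ck_on_const: "open S \<Longrightarrow> Ck_on k (\<lambda>_. c) S"
proof (induction k arbitrary: c)
  case (Suc k)
  show ?case
    by (rule Ck_on_SucI[where f' = "\<lambda>_ _. 0"]) (use Suc in auto)
qed simp

lemma Ck_on_add: "open S \<Longrightarrow> Ck_on k f S \<Longrightarrow> Ck_on k g S \<Longrightarrow> Ck_on k (\<lambda>x. f x + g x) S"
proof (induction k arbitrary: f g)
  case 0
  then show ?case by (simp add: continuous_on_add)
next
  case (Suc k)
  show ?case
  proof (rule Ck_on_SucI)
    show "((\<lambda>x. f x + g x) has_derivative
        (\<lambda>v. frechet_derivative f (at x) v + frechet_derivative g (at x) v)) (at x)" if "x \<in> S" for x
      using Suc.prems that by (intro has_derivative_add Ck_on_SucD)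
    show "Ck_on k (\<lambda>x. frechet_derivative f (at x) v + frechet_derivative g (at x) v) S" for v
      by (rule Suc.IH) (use Suc.prems in simp_all)
  qed (rule Suc.prems)
qed

lemma Ck_on_bounded_linear:
  assumes "open S" "bounded_linear h"
  shows "Ck_on k f S \<Longrightarrow> Ck_on k (\<lambda>x. h (f x)) S"
proof (induction k arbitrary: f)
  case 0
  then show ?case using assms(2) by (simp add: bounded_linear.continuous_on)
next
  case (Suc k)
  show ?case
  proof (rule Ck_on_SucI)
    show "((\<lambda>x. h (f x)) has_derivative (\<lambda>v. h (frechet_derivative f (at x) v))) (at x)"
      if "x \<in> S" for x
      by (rule bounded_linear.has_derivative[OF assms(2) Ck_on_SucD[OF Suc.prems that]])
    show "Ck_on k (\<lambda>x. h (frechet_derivative f (at x) v)) S" for v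
      by (rule Suc.IH) (use Suc.prems in simp)
  qed (rule assms)
qed

lemma Ck_on_linear:
  assumes "open S" "bounded_linear h"
  shows "Ck_on k h S"
proof (cases k)
  case 0
  then show ?thesis using assms by (simp add: linear_continuous_on)
next
  case (Suc j)
  show ?thesis unfolding Suc
    by (rule Ck_on_SucI[where f' = "\<lambda>x. h"])
      (use assms in \<open>auto intro!: Ck_on_const bounded_linear_imp_has_derivative\<close>)
qed

lemma Ck_on_scaleR:
  "open S \<Longrightarrow> Ck_on k f S \<Longrightarrow> Ck_on k g S \<Longrightarrow> Ck_on k (\<lambda>x. f x *\<^sub>R g x) S"
proof (induction k arbitrary: f g)
  case 0
  then show ?case by (simp add: continuous_on_scaleR)
next
  case (Suc k)
  \<comment> \<open>The product rule pairs a derivative with an undifferentiated factor, which has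
    to be lowered from level \<open>Suc k\<close> to \<open>k\<close>.\<close>
  have "Ck_on k f S" "Ck_on k g S" using Suc.prems Ck_on_Suc_imp by blast+
  then have *: "Ck_on k (\<lambda>x. f x *\<^sub>R frechet_derivative g (at x) v + frechet_derivative f (at x) v *\<^sub>R g x) S" for v
    using Suc.prems by (intro Ck_on_add Suc.IH) simp_all
  show ?case
  proof (rule Ck_on_SucI)
    show "((\<lambda>x. f x *\<^sub>R g x) has_derivative
        (\<lambda>v. f x *\<^sub>R frechet_derivative g (at x) v + frechet_derivative f (at x) v *\<^sub>R g x)) (at x)"
      if "x \<in> S" for x
      using Suc.prems that by (intro has_derivative_scaleR Ck_on_SucD)
  qed (use Suc.prems * in auto)
qed

lemma Ck_on_sum:
  "open S \<Longrightarrow> finite I \<Longrightarrow> (\<And>i. i \<in> I \<Longrightarrow> Ck_on k (f i) S) \<Longrightarrow> Ck_on k (\<lambda>x. \<Sum>i\<in>I. f i x) S"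
  by (induction I rule: infinite_finite_induct) (auto intro: Ck_on_add Ck_on_const)

lemma smooth_on_cong: "open S \<Longrightarrow> (\<And>x. x \<in> S \<Longrightarrow> f x = g x) \<Longrightarrow> smooth_on S f \<longleftrightarrow> smooth_on S g"
  unfolding smooth_on_def by (metis Ck_on_cong)

lemma smooth_on_subset: "smooth_on S f \<Longrightarrow> T \<subseteq> S \<Longrightarrow> smooth_on T f"
  unfolding smooth_on_def using Ck_on_subset by blast

lemma smooth_on_local:
  "(\<And>x. x \<in> S \<Longrightarrow> \<exists>T. open T \<and> x \<in> T \<and> smooth_on T f) \<Longrightarrow> smooth_on S f"
  unfolding smooth_on_def by (rule allI, rule Ck_on_local) meson

lemma smooth_on_const: "open S \<Longrightarrow> smooth_on S (\<lambda>_. c)"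
  unfolding smooth_on_def by (rule allI, rule Ck_on_const, auto)

lemma smooth_on_add: "open S \<Longrightarrow> smooth_on S f \<Longrightarrow> smooth_on S g \<Longrightarrow> smooth_on S (\<lambda>x. f x + g x)"
  unfolding smooth_on_def by (rule allI, rule Ck_on_add, auto)

lemma smooth_on_scaleR:
  "open S \<Longrightarrow> smooth_on S f \<Longrightarrow> smooth_on S g \<Longrightarrow> smooth_on S (\<lambda>x. f x *\<^sub>R g x)"
  unfolding smooth_on_def by (rule allI, rule Ck_on_scaleR, auto)

lemma smooth_on_mult:
  "open S \<Longrightarrow> smooth_on S f \<Longrightarrow> smooth_on S g \<Longrightarrow> smooth_on S (\<lambda>x. f x * g x :: real)"
  using smooth_on_scaleR[of S f g] by simp

lemma smooth_on_bounded_linear: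
  "open S \<Longrightarrow> bounded_linear h \<Longrightarrow> smooth_on S f \<Longrightarrow> smooth_on S (\<lambda>x. h (f x))"
  unfolding smooth_on_def by (rule allI, rule Ck_on_bounded_linear, auto)

lemma smooth_on_linear: "open S \<Longrightarrow> bounded_linear h \<Longrightarrow> smooth_on S h"
  unfolding smooth_on_def by (rule allI, rule Ck_on_linear, auto)

lemma smooth_on_diff:
  assumes "open S" "smooth_on S f" "smooth_on S g"
  shows "smooth_on S (\<lambda>x. f x - g x)"
  using smooth_on_add[OF assms(1,2) smooth_on_bounded_linear[OF assms(1) bounded_linear_minus[OF bounded_linear_ident] assms(3)]]
  by simp

lemma smooth_on_sum:
  "open S \<Longrightarrow> finite I \<Longrightarrow> (\<And>i. i \<in> I \<Longrightarrow> smooth_on S (f i)) \<Longrightarrow> smooth_on S (\<lambda>x. \<Sum>i\<in>I. f i x)"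
  unfolding smooth_on_def by (rule allI, rule Ck_on_sum, auto)

lemma smooth_on_derivative:
  "smooth_on S f \<Longrightarrow> smooth_on S (\<lambda>x. frechet_derivative f (at x) v)"
  unfolding smooth_on_def by (metis Ck_on.simps(2))

lemma smooth_on_has_derivative:
  "smooth_on S f \<Longrightarrow> x \<in> S \<Longrightarrow> (f has_derivative frechet_derivative f (at x)) (at x)"
  unfolding smooth_on_def using Ck_on_SucD by blast

lemma smooth_on_continuous: "smooth_on S f \<Longrightarrow> continuous_on S f"
  unfolding smooth_on_def by (metis Ck_on.simps(1))

subsection \<open>Flat functions\<close>

text \<open>The powers of 1/x in front of exp(-1/x) make the family closed under differentiation up
  to linear combinations. Smoothness of \<open>flat 0\<close>, the ingredient of cutoff functions,
  is then an induction over all members at once.\<close>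

definition flat :: "nat \<Rightarrow> real \<Rightarrow> real"
  where "flat j x = (if x > 0 then inverse x ^ j * exp (- inverse x) else 0)"

lemma flat_tendsto_0: "((\<lambda>x. flat j x) \<longlongrightarrow> 0) (at 0)"
proof -
  have "((\<lambda>x::real. inverse x ^ j / exp (inverse x)) \<longlongrightarrow> 0) (at_right 0)"
    by (rule filterlim_compose[OF tendsto_power_div_exp_0 filterlim_inverse_at_top_right])
  then have "((\<lambda>x. flat j x) \<longlongrightarrow> 0) (at_right 0)"
    by (rule Lim_transform_eventually)
      (auto simp: flat_def eventually_at_filter exp_minus field_simps)
  moreover have "((\<lambda>x. flat j x) \<longlongrightarrow> 0) (at_left 0)"
    by (rule Lim_transform_eventually[of "\<lambda>_. 0"])
      (auto simp: flat_def eventually_at_filter)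
  ultimately show ?thesis by (simp add: filterlim_at_split)
qed

lemma flat_has_derivative:
  "(flat j has_real_derivative flat (j + 2) x - real j * flat (Suc j) x) (at x)"
proof (cases x "0::real" rule: linorder_cases)
  case equal
  \<comment> \<open>The difference quotient of \<open>flat j\<close> at 0 is
    \<open>flat (Suc j)\<close>, which tends to 0, and the claimed derivative vanishes there as
    well.\<close>
  have "((\<lambda>h. (flat j (0 + h) - flat j 0) / h) \<longlongrightarrow> 0) (at 0)"
    by (rule Lim_transform_eventually[OF flat_tendsto_0[of "Suc j"]])
      (auto simp: flat_def eventually_at_filter divide_inverse)
  then show ?thesis unfolding DERIV_def using equal by (simp add: flat_def)
next
  case greater
  have "((\<lambda>x. inverse x ^ j) has_real_derivative - (real j * inverse x ^ Suc j)) (at x)"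
    by (rule DERIV_cong[OF DERIV_power[OF DERIV_inverse]])
      (use greater in \<open>cases j; simp add: power2_eq_square\<close>)+
  moreover have "((\<lambda>x. exp (- inverse x)) has_real_derivative exp (- inverse x) * inverse x ^ 2) (at x)"
    using greater by (auto intro!: derivative_eq_intros simp: power2_eq_square)
  ultimately have "((\<lambda>x. inverse x ^ j * exp (- inverse x)) has_real_derivative
      - (real j * inverse x ^ Suc j) * exp (- inverse x) + exp (- inverse x) * inverse x ^ 2 * inverse x ^ j) (at x)"
    by (rule DERIV_mult)
  also have "- (real j * inverse x ^ Suc j) * exp (- inverse x) + exp (- inverse x) * inverse x ^ 2 * inverse x ^ j =
      flat (j + 2) x - real j * flat (Suc j) x"
    using greater by (simp add: flat_def power2_eq_square)
  finally have "((\<lambda>x. inverse x ^ j * exp (- inverse x)) has_real_derivative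
      flat (j + 2) x - real j * flat (Suc j) x) (at x)" .
  then show ?thesis
    by (rule has_field_derivative_transform_within_open[of _ _ _ "{0<..}"]) (use greater in \<open>auto simp: flat_def\<close>)
next
  case less
  have "((\<lambda>x. 0) has_real_derivative flat (j + 2) x - real j * flat (Suc j) x) (at x)"
    using less by (simp add: flat_def)
  then show ?thesis
    by (rule has_field_derivative_transform_within_open[of _ _ _ "{..<0}"]) (use less in \<open>auto simp: flat_def\<close>)
qed

lemma Ck_on_flat: "Ck_on k (flat j) UNIV"
proof (induction k arbitrary: j)
  case 0
  then show ?case
    using DERIV_isCont[OF flat_has_derivative] by (simp add: continuous_at_imp_continuous_on)
next
  case (Suc k)
  have *: "Ck_on k (\<lambda>x. (flat (j + 2) x + (- real j) *\<^sub>R flat (Suc j) x)) UNIV"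
    by (intro Ck_on_add Ck_on_scaleR Ck_on_const Suc open_UNIV)
  show ?case
  proof (rule Ck_on_SucI)
    show "(flat j has_derivative (\<lambda>v. v *\<^sub>R (flat (j + 2) x + (- real j) *\<^sub>R flat (Suc j) x))) (at x)" for x
      using flat_has_derivative[of j x]
      by (simp add: has_field_derivative_def mult.commute[of "flat _ _ - _"] mult_commute_abs)
    show "Ck_on k (\<lambda>x. v *\<^sub>R (flat (j + 2) x + (- real j) *\<^sub>R flat (Suc j) x)) UNIV" for v
      by (rule Ck_on_scaleR[OF open_UNIV Ck_on_const[OF open_UNIV] *])
  qed simp
qed

text \<open>The derivative of \<open>inverse\<close> is a multiple of its own square, so the
  induction stays with one function.\<close>

lemma Ck_on_inverse: "Ck_on k inverse (- {0 :: real})"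
proof (induction k)
  case 0
  then show ?case by (auto intro!: continuous_intros)
next
  case (Suc k)
  have *: "Ck_on k (\<lambda>x. (- v) *\<^sub>R (inverse x *\<^sub>R inverse x)) (- {0::real})" for v
    by (intro Ck_on_scaleR Ck_on_const Suc) auto
  show ?case
    by (rule Ck_on_SucI[where f' = "\<lambda>x v. (- v) *\<^sub>R (inverse x *\<^sub>R inverse x)"])
      (use * in \<open>auto intro!: derivative_eq_intros simp: power2_eq_square\<close>)
qed

subsection \<open>Coordinates on finite-dimensional normed spaces\<close>

text \<open>A basis with its dual coordinate functions. Continuity of the coordinates belongs to the
  package because the norm of the model space is arbitrary; \<open>n = 0\<close> is allowed.\<close>

locale coords =
  fixes n :: nat and bas :: "nat \<Rightarrow> 'a::real_normed_vector" and co :: "nat \<Rightarrow> 'a \<Rightarrow> real"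
  assumes bl: "i < n \<Longrightarrow> bounded_linear (co i)"
    and expand: "(\<Sum>i<n. co i x *\<^sub>R bas i) = x"
    and dual: "i < n \<Longrightarrow> j < n \<Longrightarrow> co i (bas j) = (if i = j then 1 else 0)"
begin

lemma linear_expand:
  fixes h :: "'a \<Rightarrow> 'b::real_vector"
  assumes "linear h"
  shows "h v = (\<Sum>i<n. co i v *\<^sub>R h (bas i))"
proof -
  have "h v = h (\<Sum>i<n. co i v *\<^sub>R bas i)" by (simp add: expand)
  then show ?thesis by (simp add: linear_sum[OF assms] linear_scale[OF assms])
qed

lemma co_diff: "i < n \<Longrightarrow> co i (x - y) = co i x - co i y"
  using bl by (simp add: linear_diff bounded_linear.linear)

lemma linear_imp_bounded_linear:
  fixes h :: "'a \<Rightarrow> 'b::real_normed_vector"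
  assumes "linear h"
  shows "bounded_linear h"
proof -
  have "h = (\<lambda>v. \<Sum>i<n. co i v *\<^sub>R h (bas i))"
    using linear_expand[OF assms] by blast
  moreover have "bounded_linear (\<lambda>v. \<Sum>i<n. co i v *\<^sub>R h (bas i))"
    by (rule bounded_linear_sum) (auto intro!: bounded_linear_scaleR_const bl)
  ultimately show ?thesis by simp
qed

text \<open>The chain rule differentiates \<open>g\<close> in a direction that varies with the
  point. Expanded in the basis, this becomes a sum of products of coordinate functions with
  derivatives of \<open>g\<close> in fixed directions, to which the induction hypothesis
  applies.\<close>

lemma Ck_on_compose:
  fixes f :: "'x::real_normed_vector \<Rightarrow> 'a" and g :: "'a \<Rightarrow> 'y::real_normed_vector"
  assumes "open S" "open T" "f ` S \<subseteq> T" "Ck_on k f S" "Ck_on k g T"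
  shows "Ck_on k (\<lambda>x. g (f x)) S"
  using assms(4,5)
proof (induction k arbitrary: g)
  case 0
  then show ?case using assms(3) by (auto intro: continuous_on_compose2)
next
  case (Suc k)
  let ?D = "\<lambda>x v. \<Sum>i<n. co i (frechet_derivative f (at x) v) *\<^sub>R frechet_derivative g (at (f x)) (bas i)"
  have f: "(f has_derivative frechet_derivative f (at x)) (at x)" if "x \<in> S" for x
    using Ck_on_SucD[OF Suc.prems(1) that] .
  have g: "(g has_derivative frechet_derivative g (at (f x))) (at (f x))" if "x \<in> S" for x
    by (rule Ck_on_SucD[OF Suc.prems(2)]) (use assms(3) that in auto)
  have eq: "frechet_derivative g (at (f x)) (frechet_derivative f (at x) v) = ?D x v" if "x \<in> S" for x v
    by (rule linear_expand[OF has_derivative_linear[OF g[OF that]]])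
  have "Ck_on k (\<lambda>x. ?D x v) S" for v
  proof (rule Ck_on_sum[OF assms(1) finite_lessThan], rule Ck_on_scaleR[OF assms(1)])
    fix i assume "i \<in> {..<n}"
    then show "Ck_on k (\<lambda>x. co i (frechet_derivative f (at x) v)) S"
      using Suc.prems(1) by (intro Ck_on_bounded_linear[OF assms(1) bl, where f = "\<lambda>x. frechet_derivative f (at x) v"]) auto
    show "Ck_on k (\<lambda>x. frechet_derivative g (at (f x)) (bas i)) S"
      by (rule Suc.IH[OF Ck_on_Suc_imp[OF Suc.prems(1)]]) (use Suc.prems(2) in simp)
  qed
  moreover have "((\<lambda>x. g (f x)) has_derivative ?D x) (at x)" if "x \<in> S" for x
    using has_derivative_compose[OF f[OF that] g[OF that]] eq[OF that] by simp
  ultimately show ?case by (intro Ck_on_SucI[OF assms(1)])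
qed

lemma smooth_on_compose:
  fixes f :: "'x::real_normed_vector \<Rightarrow> 'a" and g :: "'a \<Rightarrow> 'y::real_normed_vector"
  assumes "open S" "open T" "f ` S \<subseteq> T" "smooth_on S f" "smooth_on T g"
  shows "smooth_on S (\<lambda>x. g (f x))"
  unfolding smooth_on_def
  by (rule allI, rule Ck_on_compose[OF assms(1-3)]) (use assms(4,5) in \<open>auto simp: smooth_on_def\<close>)

text \<open>Differentiation under the integral sign yields directional derivatives only; their
  continuity upgrades them. The mean value theorem on a segment reduces the error to a difference of
  derivatives at two points, and the coordinates bound it uniformly in the direction.\<close>

lemma has_derivative_gateaux:
  fixes G :: "'a \<Rightarrow> real"
  assumes S: "open S" "convex S" "x \<in> S"
    and der: "\<And>x v. x \<in> S \<Longrightarrow> ((\<lambda>r. G (x + r *\<^sub>R v)) has_real_derivative G' x v) (at 0)"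
    and lin: "\<And>x. x \<in> S \<Longrightarrow> linear (G' x)"
    and cont: "\<And>v. continuous_on S (\<lambda>x. G' x v)"
  shows "(G has_derivative G' x) (at x)"
  unfolding has_derivative_at_alt
proof (intro conjI allI impI)
  show "bounded_linear (G' x)" using lin[OF S(3)] linear_imp_bounded_linear by blast
next
  fix e :: real assume e: "e > 0"
  have "\<exists>C. \<forall>i<n. C i \<ge> 0 \<and> (\<forall>v. \<bar>co i v\<bar> \<le> norm v * C i)"
    using bounded_linear.nonneg_bounded[OF bl] by (metis real_norm_def)
  then obtain C where C: "\<And>i. i < n \<Longrightarrow> C i \<ge> 0" "\<And>i v. i < n \<Longrightarrow> \<bar>co i v\<bar> \<le> norm v * C i"
    by blast
  \<comment> \<open>Closeness \<open>e / B\<close> on the basis vectors adds up to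
    \<open>e * norm v\<close> on a vector \<open>v\<close>, since the \<open>C i\<close> bound its
    coordinates. The summand 1 keeps \<open>B\<close> positive, also for
    \<open>n = 0\<close>.\<close>
  define B where "B = 1 + (\<Sum>i<n. C i)"
  have B: "B > 0" unfolding B_def using C(1) by (smt (verit) lessThan_iff sum_nonneg)
  have "\<forall>\<^sub>F y in nhds x. dist (G' y (bas i)) (G' x (bas i)) < e / B" if "i < n" for i
  proof -
    have "isCont (\<lambda>y. G' y (bas i)) x"
      using cont S continuous_on_eq_continuous_at by blast
    then show ?thesis
      using e B by (auto simp: isCont_def dest!: tendstoD[of _ _ _ "e / B"] simp: eventually_at_filter elim!: eventually_mono)
  qed
  then have "\<forall>\<^sub>F y in nhds x. \<forall>i\<in>{..<n}. dist (G' y (bas i)) (G' x (bas i)) < e / B"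
    by (intro eventually_ball_finite) auto
  moreover have "\<forall>\<^sub>F y in nhds x. y \<in> S" using S by (simp add: eventually_nhds_in_open)
  ultimately have "\<forall>\<^sub>F y in nhds x. y \<in> S \<and> (\<forall>i\<in>{..<n}. dist (G' y (bas i)) (G' x (bas i)) < e / B)"
    by eventually_elim simp
  then obtain d where d: "d > 0"
    "\<And>y i. dist y x < d \<Longrightarrow> i < n \<Longrightarrow> \<bar>G' y (bas i) - G' x (bas i)\<bar> < e / B" "\<And>y. dist y x < d \<Longrightarrow> y \<in> S"
    unfolding eventually_nhds_metric by (auto simp: dist_real_def)
  show "\<exists>d>0. \<forall>y. norm (y - x) < d \<longrightarrow> norm (G y - G x - G' x (y - x)) \<le> e * norm (y - x)"
  proof (intro exI conjI allI impI, rule d(1))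
    fix y assume y: "norm (y - x) < d"
    define v where "v = y - x"
    have near: "dist (x + r *\<^sub>R v) x < d" if "0 \<le> r" "r \<le> 1" for r
    proof -
      have "norm (r *\<^sub>R v) \<le> norm v" using that by (simp add: mult_left_le_one_le)
      then show ?thesis using y by (simp add: dist_norm v_def)
    qed
    have "DERIV (\<lambda>r. G (x + r *\<^sub>R v)) r :> G' (x + r *\<^sub>R v) v" if "0 \<le> r" "r \<le> 1" for r
      using der[OF d(3)[OF near[OF that]], of v] DERIV_shift[of "\<lambda>r. G (x + r *\<^sub>R v)" _ 0 r]
      by (simp add: algebra_simps)
    then obtain z where z: "0 < z" "z < 1" "G (x + v) - G x = G' (x + z *\<^sub>R v) v"
      using MVT2[of 0 1 "\<lambda>r. G (x + r *\<^sub>R v)" "\<lambda>r. G' (x + r *\<^sub>R v) v"] by auto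
    let ?w = "x + z *\<^sub>R v"
    have w: "dist ?w x < d" using near z by simp
    have "\<bar>G' ?w v - G' x v\<bar> = \<bar>\<Sum>i<n. co i v * (G' ?w (bas i) - G' x (bas i))\<bar>"
      using linear_expand[OF lin[OF d(3)[OF w]], of v] linear_expand[OF lin[OF S(3)], of v]
      by (simp add: sum_subtractf right_diff_distrib)
    also have "\<dots> \<le> (\<Sum>i<n. (norm v * C i) * (e / B))"
    proof (rule order.trans[OF sum_abs], rule sum_mono)
      fix i assume "i \<in> {..<n}"
      then show "\<bar>co i v * (G' ?w (bas i) - G' x (bas i))\<bar> \<le> (norm v * C i) * (e / B)"
        unfolding abs_mult using C d(2)[OF w, of i] by (intro mult_mono) (auto intro: less_imp_le)
    qed
    also have "\<dots> = norm v * (e / B) * (\<Sum>i<n. C i)"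
      by (simp add: sum_distrib_left sum_divide_distrib mult_ac)
    also have "\<dots> \<le> norm v * (e / B) * B"
      using e B by (intro mult_left_mono) (auto simp: B_def)
    also have "\<dots> = e * norm v" using B by simp
    finally have "\<bar>G' ?w v - G' x v\<bar> \<le> e * norm v" .
    then show "norm (G y - G x - G' x (y - x)) \<le> e * norm (y - x)"
      using z(3) by (simp add: v_def)
  qed
qed

lemma in_ball_segment:
  fixes x x0 :: 'a
  assumes "x \<in> ball x0 R" "0 \<le> t" "t \<le> 1"
  shows "x0 + t *\<^sub>R (x - x0) \<in> ball x0 R"
proof -
  have "norm (t *\<^sub>R (x - x0)) \<le> norm (x - x0)" using assms(2,3) by (simp add: mult_left_le_one_le)
  then show ?thesis using assms(1) by (simp add: dist_norm norm_minus_commute)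
qed

lemma continuous_on_segment:
  fixes h :: "'a \<Rightarrow> real"
  assumes "continuous_on (ball x0 R) h"
  shows "continuous_on (ball x0 R \<times> cbox 0 1) (\<lambda>(x, t). t ^ m * h (x0 + t *\<^sub>R (x - x0)))"
  unfolding case_prod_unfold
  by (intro continuous_intros continuous_on_compose2[OF assms]) (auto intro: in_ball_segment)

text \<open>The weight \<open>t ^ m\<close> is carried along because differentiating h(x0 + t(x -
  x0)) in x produces a factor t. The derivative is an integral of the same kind, with exponent
  \<open>Suc m\<close> and a directional derivative of \<open>h\<close>, which is what the induction
  for \<open>Ck_on_pint\<close> requires.\<close>

lemma pint_has_derivative:
  fixes h :: "'a \<Rightarrow> real"
  assumes h: "Ck_on (Suc 0) h (ball x0 R)" and x: "x \<in> ball x0 R"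
  shows "((\<lambda>x. integral (cbox 0 1) (\<lambda>t. t ^ m * h (x0 + t *\<^sub>R (x - x0)))) has_derivative
    (\<lambda>v. integral (cbox 0 1) (\<lambda>t. t ^ Suc m * frechet_derivative h (at (x0 + t *\<^sub>R (x - x0))) v))) (at x)"
proof (rule has_derivative_gateaux[OF open_ball convex_ball x])
  let ?D = "\<lambda>y v. frechet_derivative h (at y) v"
  have hd: "(h has_derivative ?D y) (at y)" if "y \<in> ball x0 R" for y
    using Ck_on_SucD[OF h that] .
  have hc: "continuous_on (ball x0 R) h" using Ck_on_Suc_imp[OF h] by simp
  have Dc: "continuous_on (ball x0 R) (\<lambda>y. ?D y v)" for v using h by simp
  have lin: "linear (?D y)" if "y \<in> ball x0 R" for y
    by (rule has_derivative_linear[OF hd[OF that]])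
  have int: "(\<lambda>t. t ^ j * f (x0 + t *\<^sub>R (y - x0))) integrable_on cbox (0::real) 1"
    if "y \<in> ball x0 R" "continuous_on (ball x0 R) f" for y j and f :: "'a \<Rightarrow> real"
    by (intro integrable_continuous continuous_intros continuous_on_compose2[OF that(2)])
      (auto intro!: in_ball_segment[OF that(1)])
  show "continuous_on (ball x0 R) (\<lambda>x. integral (cbox 0 1) (\<lambda>t. t ^ Suc m * ?D (x0 + t *\<^sub>R (x - x0)) v))" for v
    by (rule integral_continuous_on_param, rule continuous_on_segment, rule Dc)
  show "linear (\<lambda>v. integral (cbox 0 1) (\<lambda>t. t ^ Suc m * ?D (x0 + t *\<^sub>R (y - x0)) v))"
    if y: "y \<in> ball x0 R" for y
  proof (rule linearI)
    fix v w :: 'a and c :: real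
    have "integral (cbox 0 1) (\<lambda>t. t ^ Suc m * ?D (x0 + t *\<^sub>R (y - x0)) (v + w)) =
      integral (cbox 0 1) (\<lambda>t. t ^ Suc m * ?D (x0 + t *\<^sub>R (y - x0)) v + t ^ Suc m * ?D (x0 + t *\<^sub>R (y - x0)) w)"
      by (rule integral_cong)
        (use in_ball_segment[OF y] lin in \<open>auto simp: linear_add distrib_left\<close>)
    then show "integral (cbox 0 1) (\<lambda>t. t ^ Suc m * ?D (x0 + t *\<^sub>R (y - x0)) (v + w)) =
      integral (cbox 0 1) (\<lambda>t. t ^ Suc m * ?D (x0 + t *\<^sub>R (y - x0)) v) +
      integral (cbox 0 1) (\<lambda>t. t ^ Suc m * ?D (x0 + t *\<^sub>R (y - x0)) w)"
      using integral_add[OF int[OF y Dc, of "Suc m" v] int[OF y Dc, of "Suc m" w]] by simp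
    have "integral (cbox 0 1) (\<lambda>t. t ^ Suc m * ?D (x0 + t *\<^sub>R (y - x0)) (c *\<^sub>R v)) =
      integral (cbox 0 1) (\<lambda>t. c * (t ^ Suc m * ?D (x0 + t *\<^sub>R (y - x0)) v))"
      by (rule integral_cong)
        (use in_ball_segment[OF y] lin in \<open>auto simp: linear_scale mult_ac\<close>)
    then show "integral (cbox 0 1) (\<lambda>t. t ^ Suc m * ?D (x0 + t *\<^sub>R (y - x0)) (c *\<^sub>R v)) =
      c *\<^sub>R integral (cbox 0 1) (\<lambda>t. t ^ Suc m * ?D (x0 + t *\<^sub>R (y - x0)) v)"
      by simp
  qed
  show "((\<lambda>r. integral (cbox 0 1) (\<lambda>t. t ^ m * h (x0 + t *\<^sub>R (y + r *\<^sub>R v - x0)))) has_real_derivative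
      integral (cbox 0 1) (\<lambda>t. t ^ Suc m * ?D (x0 + t *\<^sub>R (y - x0)) v)) (at 0)"
    if y: "y \<in> ball x0 R" for y v
  proof -
    \<comment> \<open>The Leibniz rule asks for a convex set of parameters: those for which the line
      through \<open>y\<close> stays in the ball. It is open, so the derivative within
      \<open>U\<close> is the full one.\<close>
    define U where "U = {r. y + r *\<^sub>R v \<in> ball x0 R}"
    have U: "U = (\<lambda>r. y + r *\<^sub>R v) -` ball x0 R" by (auto simp: U_def)
    have "open U" unfolding U by (intro open_vimage continuous_intros) auto
    have "convex U"
    proof (rule convexI)
      fix a b s t :: real assume *: "a \<in> U" "b \<in> U" "0 \<le> s" "0 \<le> t" "s + t = 1"
      then have "s *\<^sub>R (y + a *\<^sub>R v) + t *\<^sub>R (y + b *\<^sub>R v) \<in> ball x0 R"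
        by (intro convexD[OF convex_ball]) (auto simp: U_def)
      also have "s *\<^sub>R (y + a *\<^sub>R v) + t *\<^sub>R (y + b *\<^sub>R v) = y + (s *\<^sub>R a + t *\<^sub>R b) *\<^sub>R v"
        using *(5) by (simp add: algebra_simps flip: scaleR_add_left)
      finally show "s *\<^sub>R a + t *\<^sub>R b \<in> U" by (simp add: U_def)
    qed
    have "0 \<in> U" using y by (simp add: U_def)
    have "((\<lambda>r. integral (cbox 0 1) (\<lambda>t. t ^ m * h (x0 + t *\<^sub>R (y + r *\<^sub>R v - x0)))) has_real_derivative
        integral (cbox 0 1) (\<lambda>t. t ^ Suc m * ?D (x0 + t *\<^sub>R (y + 0 *\<^sub>R v - x0)) v)) (at 0 within U)"
    proof (rule leibniz_rule_field_derivative[OF _ _ _ \<open>0 \<in> U\<close> \<open>convex U\<close>,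
          where fx = "\<lambda>r t. t ^ Suc m * ?D (x0 + t *\<^sub>R (y + r *\<^sub>R v - x0)) v"])
      show "((\<lambda>r. t ^ m * h (x0 + t *\<^sub>R (y + r *\<^sub>R v - x0))) has_real_derivative
          t ^ Suc m * ?D (x0 + t *\<^sub>R (y + r *\<^sub>R v - x0)) v) (at r within U)"
        if "r \<in> U" "t \<in> cbox 0 1" for r t
      proof -
        have b: "x0 + t *\<^sub>R (y + r *\<^sub>R v - x0) \<in> ball x0 R"
          using that by (intro in_ball_segment) (auto simp: U_def)
        have "((\<lambda>r. x0 + t *\<^sub>R (y + r *\<^sub>R v - x0)) has_derivative (\<lambda>r. r *\<^sub>R (t *\<^sub>R v))) (at r within U)"
          by (auto intro!: derivative_eq_intros simp: mult.commute)
        from has_derivative_compose[OF this hd[OF b]]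
        have "((\<lambda>r. h (x0 + t *\<^sub>R (y + r *\<^sub>R v - x0))) has_derivative
            (\<lambda>s. s * (t * ?D (x0 + t *\<^sub>R (y + r *\<^sub>R v - x0)) v))) (at r within U)"
          using lin[OF b] by (simp add: linear_scale mult.assoc)
        then have "((\<lambda>r. h (x0 + t *\<^sub>R (y + r *\<^sub>R v - x0))) has_real_derivative
            t * ?D (x0 + t *\<^sub>R (y + r *\<^sub>R v - x0)) v) (at r within U)"
          by (simp add: has_field_derivative_def mult.commute[of _ "t * _"])
        from DERIV_cmult[OF this, of "t ^ m"] show ?thesis by (simp add: mult_ac)
      qed
      show "(\<lambda>t. t ^ m * h (x0 + t *\<^sub>R (y + r *\<^sub>R v - x0))) integrable_on cbox 0 1" if "r \<in> U" for r
        using int[OF _ hc, of "y + r *\<^sub>R v" m] that by (simp add: U_def)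
      show "continuous_on (U \<times> cbox 0 1) (\<lambda>(r, t). t ^ Suc m * ?D (x0 + t *\<^sub>R (y + r *\<^sub>R v - x0)) v)"
        unfolding case_prod_unfold
      proof (rule continuous_on_mult)
        show "continuous_on (U \<times> cbox 0 1) (\<lambda>p. ?D (x0 + snd p *\<^sub>R (y + fst p *\<^sub>R v - x0)) v)"
        proof (rule continuous_on_compose2[OF Dc])
          show "(\<lambda>p. x0 + snd p *\<^sub>R (y + fst p *\<^sub>R v - x0)) ` (U \<times> cbox 0 1) \<subseteq> ball x0 R"
            unfolding U_def by (rule image_subsetI, rule in_ball_segment) auto
        qed (intro continuous_intros)
      qed (intro continuous_intros)
    qed
    then show ?thesis unfolding at_within_open[OF \<open>0 \<in> U\<close> \<open>open U\<close>] by (simp only: scaleR_zero_left add_0_right)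
  qed
qed

lemma Ck_on_pint:
  fixes h :: "'a \<Rightarrow> real"
  shows "Ck_on k h (ball x0 R) \<Longrightarrow>
    Ck_on k (\<lambda>x. integral (cbox 0 1) (\<lambda>t. t ^ m * h (x0 + t *\<^sub>R (x - x0)))) (ball x0 R)"
proof (induction k arbitrary: h m)
  case 0
  then show ?case
    using integral_continuous_on_param[OF continuous_on_segment[of x0 R h m]] by simp
next
  case (Suc k)
  have "Ck_on (Suc 0) h (ball x0 R)"
    using Suc.prems by (induction k) (blast dest: Ck_on_Suc_imp)+
  then show ?case
    by (intro Ck_on_SucI[OF open_ball pint_has_derivative] Suc.IH) (use Suc.prems in auto)
qed

text \<open>The fundamental theorem of calculus along the segment from \<open>x0\<close> to
  \<open>x\<close> writes the increment as an integral of derivatives in direction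
  \<open>x - x0\<close>. Expanding that direction in the basis leaves the coefficient integrals
  \<open>H i\<close>.\<close>

lemma hadamard:
  fixes f :: "'a \<Rightarrow> real"
  assumes f: "smooth_on (ball x0 R) f"
  obtains H where "\<And>i. smooth_on (ball x0 R) (H i)"
    "\<And>i. H i x0 = frechet_derivative f (at x0) (bas i)"
    "\<And>x. x \<in> ball x0 R \<Longrightarrow> f x = f x0 + (\<Sum>i<n. (co i x - co i x0) * H i x)"
proof
  let ?D = "\<lambda>y v. frechet_derivative f (at y) v"
  \<comment> \<open>The factor \<open>t ^ 0\<close> brings the integral into the form of
    \<open>Ck_on_pint\<close>.\<close>
  let ?H = "\<lambda>i x. integral (cbox 0 1) (\<lambda>t::real. t ^ 0 * ?D (x0 + t *\<^sub>R (x - x0)) (bas i))"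
  show "smooth_on (ball x0 R) (?H i)" for i
    unfolding smooth_on_def
    by (intro allI Ck_on_pint) (use smooth_on_derivative[OF f] in \<open>simp add: smooth_on_def\<close>)
  show "?H i x0 = ?D x0 (bas i)" for i by simp
  fix x assume x: "x \<in> ball x0 R"
  have fd: "(f has_derivative ?D y) (at y)" if "y \<in> ball x0 R" for y
    using smooth_on_has_derivative[OF f that] .
  have lin: "linear (?D y)" if "y \<in> ball x0 R" for y
    by (rule has_derivative_linear[OF fd[OF that]])
  have Dc: "continuous_on (ball x0 R) (\<lambda>y. ?D y v)" for v
    using smooth_on_continuous[OF smooth_on_derivative[OF f]] .
  have int: "(\<lambda>t. ?D (x0 + t *\<^sub>R (x - x0)) v) integrable_on cbox (0::real) 1" for v
    by (intro integrable_continuous continuous_intros continuous_on_compose2[OF Dc])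
      (auto intro!: in_ball_segment[OF x])
  have "((\<lambda>t. f (x0 + t *\<^sub>R (x - x0))) has_vector_derivative ?D (x0 + t *\<^sub>R (x - x0)) (x - x0)) (at t within {0..1})"
    if "t \<in> {0..1}" for t
  proof -
    have b: "x0 + t *\<^sub>R (x - x0) \<in> ball x0 R" using that by (intro in_ball_segment[OF x]) auto
    have "((\<lambda>t. x0 + t *\<^sub>R (x - x0)) has_derivative (\<lambda>s. s *\<^sub>R (x - x0))) (at t within {0..1})"
      by (auto intro!: derivative_eq_intros)
    from has_derivative_compose[OF this fd[OF b]] show ?thesis
      using lin[OF b] by (simp add: has_vector_derivative_def linear_scale)
  qed
  then have "((\<lambda>t. ?D (x0 + t *\<^sub>R (x - x0)) (x - x0)) has_integral
      (f (x0 + 1 *\<^sub>R (x - x0)) - f (x0 + 0 *\<^sub>R (x - x0)))) {0..1}"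
    by (intro fundamental_theorem_of_calculus) auto
  from integral_unique[OF this]
  have "f x - f x0 = integral (cbox 0 1) (\<lambda>t. ?D (x0 + t *\<^sub>R (x - x0)) (x - x0))"
    by simp
  also have "\<dots> = integral (cbox 0 1) (\<lambda>t. \<Sum>i<n. co i (x - x0) * ?D (x0 + t *\<^sub>R (x - x0)) (bas i))"
    by (rule integral_cong)
      (use linear_expand[OF lin[OF in_ball_segment[OF x]], of _ "x - x0"] in auto)
  also have "\<dots> = (\<Sum>i<n. integral (cbox 0 1) (\<lambda>t. co i (x - x0) * ?D (x0 + t *\<^sub>R (x - x0)) (bas i)))"
    by (rule integral_sum[OF finite_lessThan integrable_on_mult_right[OF int]])
  finally show "f x = f x0 + (\<Sum>i<n. (co i x - co i x0) * ?H i x)"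
    by (simp add: co_diff)
qed

end

section \<open>Existence of coordinates, also adapted to a complex structure\<close>

lemma coords_real: "coords 1 (\<lambda>_. 1 :: real) (\<lambda>_ x. x)"
  by (simp add: coords_def)

lemma coords_prod:
  assumes "coords n b c" "coords n' b' c'"
  shows "coords (n + n') (\<lambda>i. if i < n then (b i, 0) else (0, b' (i - n)))
    (\<lambda>i z. if i < n then c i (fst z) else c' (i - n) (snd z))"
proof -
  interpret X: coords n b c by fact
  interpret Y: coords n' b' c' by fact
  have z: "c i 0 = 0" if "i < n" for i using X.bl[OF that] by (simp add: linear_simps)
  have z': "c' i 0 = 0" if "i < n'" for i using Y.bl[OF that] by (simp add: linear_simps)
  have split: "(\<Sum>i<n + n'. g i) = (\<Sum>i<n. g i) + (\<Sum>i<n'. g (n + i))" for g :: "nat \<Rightarrow> 'c::ab_group_add"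
    by (induction n') (auto simp: add.assoc)
  show ?thesis
  proof (rule coords.intro)
    fix i assume i: "i < n + n'"
    show "bounded_linear (\<lambda>z. if i < n then c i (fst z) else c' (i - n) (snd z))"
    proof (cases "i < n")
      case True
      then show ?thesis using bounded_linear_compose[OF X.bl bounded_linear_fst] by simp
    next
      case False
      then have "i - n < n'" using i by simp
      then show ?thesis using bounded_linear_compose[OF Y.bl bounded_linear_snd] False by simp
    qed
  next
    fix z :: "'a \<times> 'b"
    have "(\<Sum>i<n. c i (fst z) *\<^sub>R (b i, 0)) + (\<Sum>i<n'. c' i (snd z) *\<^sub>R (0, b' i)) = z"
      using X.expand[of "fst z"] Y.expand[of "snd z"]
      by (simp add: prod_eq_iff fst_sum snd_sum)
    then show "(\<Sum>i<n + n'. (if i < n then c i (fst z) else c' (i - n) (snd z)) *\<^sub>R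
        (if i < n then (b i, 0) else (0, b' (i - n)))) = z"
      by (simp add: split)
  next
    fix i j assume "i < n + n'" "j < n + n'"
    then show "(if i < n then c i (fst (if j < n then (b j, 0) else (0, b' (j - n))))
        else c' (i - n) (snd (if j < n then (b j, 0) else (0, b' (j - n))))) = (if i = j then 1 else 0)"
      using X.dual Y.dual z z' by auto
  qed
qed

text \<open>Induction on the basis: the span of the smaller basis is closed because its coordinates
  are controlled by the norm, so a new basis vector has positive distance from it.\<close>

lemma finite_independent_coeff_bound:
  fixes B :: "'a::real_normed_vector set"
  assumes "finite B" "independent B"
  shows "\<exists>C\<ge>0. \<forall>u. (\<Sum>b\<in>B. \<bar>u b\<bar>) \<le> C * norm (\<Sum>b\<in>B. u b *\<^sub>R b)"
  using assms
proof (induction B rule: finite_induct)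
  case empty
  then show ?case by auto
next
  case (insert a B)
  have a: "a \<notin> span B" and B: "independent B"
    using insert.prems insert.hyps by (auto simp: independent_insert)
  then obtain C where C: "C \<ge> 0" "\<And>u. (\<Sum>b\<in>B. \<bar>u b\<bar>) \<le> C * norm (\<Sum>b\<in>B. u b *\<^sub>R b)"
    using insert.IH by blast
  have span: "\<exists>u. x = (\<Sum>b\<in>B. u b *\<^sub>R b)" if "x \<in> span B" for x
    using that by (auto simp: span_finite[OF insert.hyps(1)])
  have "closed (span B)"
    unfolding closed_sequential_limits
  proof (intro allI impI, elim conjE)
    fix f l assume f: "\<forall>n. f n \<in> span B" "f \<longlonglongrightarrow> l"
    then have "\<forall>n. \<exists>u. f n = (\<Sum>b\<in>B. u b *\<^sub>R b)" using span by blast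
    then obtain u where u: "\<And>n. f n = (\<Sum>b\<in>B. u n b *\<^sub>R b)" by metis
    have "convergent (\<lambda>n. u n b)" if b: "b \<in> B" for b
    proof (rule Cauchy_convergent, rule metric_CauchyI)
      fix e :: real assume e: "e > 0"
      have "Cauchy f" using f(2) by (simp add: LIMSEQ_imp_Cauchy)
      then obtain N where N: "\<And>m n. m \<ge> N \<Longrightarrow> n \<ge> N \<Longrightarrow> dist (f m) (f n) < e / (C + 1)"
        using e C(1) by (metis metric_CauchyD add_nonneg_pos divide_pos_pos zero_less_one)
      have "dist (u m b) (u n b) < e" if "m \<ge> N" "n \<ge> N" for m n
      proof -
        have "\<bar>u m b - u n b\<bar> \<le> (\<Sum>b\<in>B. \<bar>u m b - u n b\<bar>)"
          using b insert.hyps(1) by (intro member_le_sum) auto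
        also have "\<dots> \<le> C * norm (\<Sum>b\<in>B. (u m b - u n b) *\<^sub>R b)" by (rule C(2))
        also have "(\<Sum>b\<in>B. (u m b - u n b) *\<^sub>R b) = f m - f n"
          by (simp add: u scaleR_left_diff_distrib sum_subtractf)
        also have "C * norm (f m - f n) \<le> C * (e / (C + 1))"
          using N[OF that] C(1) by (intro mult_left_mono) (auto simp: dist_norm)
        also have "\<dots> < e" using e C(1) by (simp add: field_simps)
        finally show ?thesis by (simp add: dist_real_def)
      qed
      then show "\<exists>M. \<forall>m\<ge>M. \<forall>n\<ge>M. dist (u m b) (u n b) < e" by blast
    qed
    then have "\<forall>b\<in>B. \<exists>x. (\<lambda>n. u n b) \<longlonglongrightarrow> x" by (simp add: convergent_def)
    then obtain U where U: "\<And>b. b \<in> B \<Longrightarrow> (\<lambda>n. u n b) \<longlonglongrightarrow> U b" by metis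
    have "(\<lambda>n. \<Sum>b\<in>B. u n b *\<^sub>R b) \<longlonglongrightarrow> (\<Sum>b\<in>B. U b *\<^sub>R b)"
      by (intro tendsto_sum tendsto_scaleR U tendsto_const)
    then have "l = (\<Sum>b\<in>B. U b *\<^sub>R b)"
      using f(2) by (simp add: u[symmetric] LIMSEQ_unique)
    then show "l \<in> span B" by (simp add: span_sum span_scale span_base)
  qed
  then have d: "infdist a (span B) > 0"
    using a span_zero[of B] by (intro infdist_pos_not_in_closed) auto
  define d where "d = infdist a (span B)"
  have a_bound: "\<bar>r\<bar> * d \<le> norm (r *\<^sub>R a + y)" if "y \<in> span B" for r y
  proof (cases "r = 0")
    case False
    have "d \<le> dist a (- (inverse r *\<^sub>R y))"
      unfolding d_def using that by (intro infdist_le) (auto simp: span_neg span_scale)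
    then have "\<bar>r\<bar> * d \<le> \<bar>r\<bar> * norm (a + inverse r *\<^sub>R y)"
      by (intro mult_left_mono) (auto simp: dist_norm)
    also have "\<dots> = norm (r *\<^sub>R (a + inverse r *\<^sub>R y))" by simp
    also have "r *\<^sub>R (a + inverse r *\<^sub>R y) = r *\<^sub>R a + y" using False by (simp add: scaleR_add_right)
    finally show ?thesis .
  qed simp
  have dpos: "d > 0" using d by (simp add: d_def)
  \<comment> \<open>The term \<open>1 / d\<close> bounds the coefficient of \<open>a\<close>. The
    other coefficients are at most \<open>C\<close> times the norm of \<open>?y\<close>, and
    \<open>?y\<close> differs from the whole vector by the \<open>a\<close>-term, whose norm is at
    most \<open>norm a / d\<close> times that of the vector.\<close>
  let ?C = "1 / d + C * (1 + norm a / d)"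
  show ?case
  proof (intro exI[of _ ?C] conjI allI)
    show "?C \<ge> 0" using dpos C(1) by simp
    fix u :: "'a \<Rightarrow> real"
    let ?y = "\<Sum>b\<in>B. u b *\<^sub>R b"
    let ?x = "u a *\<^sub>R a + ?y"
    have y: "?y \<in> span B" by (simp add: span_sum span_scale span_base)
    have ua: "\<bar>u a\<bar> \<le> norm ?x / d" using a_bound[OF y, of "u a"] dpos by (simp add: field_simps)
    have "norm ?y \<le> norm ?x + \<bar>u a\<bar> * norm a"
      using norm_triangle_ineq4[of ?x "u a *\<^sub>R a"] by simp
    also have "\<dots> \<le> norm ?x + norm ?x / d * norm a"
      using ua by (intro add_left_mono mult_right_mono) auto
    finally have "C * norm ?y \<le> C * (norm ?x * (1 + norm a / d))"
      using C(1) by (intro mult_left_mono) (simp_all add: algebra_simps)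
    then have "\<bar>u a\<bar> + (\<Sum>b\<in>B. \<bar>u b\<bar>) \<le> norm ?x / d + C * (norm ?x * (1 + norm a / d))"
      using ua C(2)[of u] by linarith
    also have "\<dots> = ?C * norm ?x" by (simp add: algebra_simps)
    finally show "(\<Sum>b\<in>insert a B. \<bar>u b\<bar>) \<le> ?C * norm (\<Sum>b\<in>insert a B. u b *\<^sub>R b)"
      using insert.hyps by simp
  qed
qed

lemma basis_coords:
  fixes b :: "nat \<Rightarrow> 'a::real_normed_vector"
  assumes inj: "inj_on b {..<n}" and ind: "independent (b ` {..<n})" and span: "span (b ` {..<n}) = UNIV"
  obtains c where "coords n b c"
proof
  let ?B = "b ` {..<n}"
  define c where "c i x = representation ?B x (b i)" for i x
  have lin: "linear (c i)" for i
    unfolding c_def using ind span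
    by (intro linearI) (simp_all add: representation_add representation_scale)
  have expand: "(\<Sum>i<n. c i x *\<^sub>R b i) = x" for x
  proof -
    have "(\<Sum>v\<in>?B. representation ?B x v *\<^sub>R v) = x"
      using ind span by (intro sum_representation_eq) auto
    then show ?thesis by (simp add: sum.reindex[OF inj] c_def)
  qed
  obtain C where C: "C \<ge> 0" "\<And>u. (\<Sum>v\<in>?B. \<bar>u v\<bar>) \<le> C * norm (\<Sum>v\<in>?B. u v *\<^sub>R v)"
    using finite_independent_coeff_bound[OF _ ind] by blast
  show "coords n b c"
  proof (rule coords.intro)
    fix i assume i: "i < n"
    have "norm (c i x) \<le> norm x * C" for x
    proof -
      have "\<bar>c i x\<bar> \<le> (\<Sum>v\<in>?B. \<bar>representation ?B x v\<bar>)"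
        unfolding c_def using i by (intro member_le_sum) auto
      also have "\<dots> \<le> C * norm (\<Sum>v\<in>?B. representation ?B x v *\<^sub>R v)" by (rule C(2))
      also have "(\<Sum>v\<in>?B. representation ?B x v *\<^sub>R v) = x"
        using ind span by (intro sum_representation_eq) auto
      finally show ?thesis by (simp add: mult.commute)
    qed
    then show "bounded_linear (c i)"
      using lin[of i] by (intro bounded_linear_intro[where K = C]) (auto simp: linear_add linear_scale)
  next
    fix i j assume i: "i < n" and j: "j < n"
    show "c i (b j) = (if i = j then 1 else 0)"
      unfolding c_def using i j ind inj by (auto simp: representation_basis inj_on_eq_iff)
  qed (rule expand)
qed

lemma exists_coords:
  fixes B :: "'a::real_normed_vector set"
  assumes "finite B" "span B = UNIV"
  obtains n and b :: "nat \<Rightarrow> 'a" and c where "coords n b c"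
proof -
  obtain B' where B': "B' \<subseteq> B" "independent B'" "B \<subseteq> span B'"
    using maximal_independent_subset[of B] by blast
  have "finite B'" using B'(1) assms(1) finite_subset by blast
  then obtain b where b: "bij_betw b {..<card B'} B'"
    using ex_bij_betw_nat_finite by (metis atLeast0LessThan)
  then have im: "b ` {..<card B'} = B'" by (simp add: bij_betw_def)
  have "span B' = UNIV"
    using B'(3) assms(2) by (metis span_minimal subspace_span top.extremum_uniqueI)
  then show thesis
    using basis_coords[of b "card B'"] b B'(2) im that by (metis bij_betw_def)
qed

text \<open>A maximal family whose union with its image under \<open>I\<close> is independent spans everything,
  because \<open>I v = r v + s\<close> modulo an \<open>I\<close>-stable subspace would give \<open>(1 + r\<^sup>2) v = 0\<close> there.\<close>

lemma exists_complex_coords: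
  fixes I :: "'a::real_normed_vector \<Rightarrow> 'a"
  assumes fin: "finite B" "span B = (UNIV :: 'a set)"
    and I: "linear I" "\<And>v. I (I v) = - v"
  obtains m b c where "coords (2 * m) b c"
    "\<And>i. i < m \<Longrightarrow> I (b i) = b (m + i)" "\<And>i. i < m \<Longrightarrow> I (b (m + i)) = - b i"
proof -
  define good where "good m b \<longleftrightarrow> inj_on b {..<2*m} \<and> independent (b ` {..<2*m}) \<and>
    (\<forall>i<m. b (m + i) = I (b i))" for m and b :: "nat \<Rightarrow> 'a"
  have le: "m \<le> card B" if "good m b" for m b
  proof -
    have "card (b ` {..<2*m}) \<le> card B"
      using that fin unfolding good_def by (intro independent_span_bound[THEN conjunct2]) auto
    moreover have "card (b ` {..<2*m}) = 2 * m"
      using that unfolding good_def by (simp add: card_image)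
    ultimately show ?thesis by simp
  qed
  have "good 0 b" for b by (simp add: good_def independent_empty)
  then have "\<exists>b. good 0 b" by blast
  \<comment> \<open>A greatest length exists because independent sets have at most
    \<open>card B\<close> elements.\<close>
  then obtain m where m: "\<exists>b. good m b" "\<And>m'. \<exists>b. good m' b \<Longrightarrow> m' \<le> m"
    using ex_has_greatest_nat[of "\<lambda>m. \<exists>b. good m b" 0 id "Suc (card B)"] le
    by (auto simp: less_Suc_eq_le)
  then obtain b where b: "good m b" by blast
  let ?S = "span (b ` {..<2*m})"
  have bI: "I (b i) \<in> ?S" if "i < 2 * m" for i
  proof (cases "i < m")
    case True
    then have "I (b i) = b (m + i)" using b by (simp add: good_def)
    then show ?thesis using True by (simp add: span_base)
  next
    case False
    then have "b i = I (b (i - m))" using b that unfolding good_def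
      by (metis add.commute le_add_diff_inverse2 less_diff_conv2 linorder_not_less mult_2)
    then have "I (b i) = - b (i - m)" by (simp add: I)
    moreover have "b (i - m) \<in> ?S" using that by (intro span_base) auto
    ultimately show ?thesis by (simp add: span_neg)
  qed
  have stable: "I x \<in> ?S" if "x \<in> ?S" for x
  proof -
    have "I ` ?S = span (I ` b ` {..<2*m})" by (simp add: I(1) linear_span_image)
    also have "\<dots> \<subseteq> ?S" using bI by (intro span_minimal) auto
    finally show ?thesis using that by blast
  qed
  have "?S = UNIV"
  proof (rule ccontr)
    assume "?S \<noteq> UNIV"
    then obtain v where v: "v \<notin> ?S" by blast
    have Iv: "I v \<notin> span (insert v (b ` {..<2*m}))"
    proof
      assume "I v \<in> span (insert v (b ` {..<2*m}))"
      then obtain r where r: "I v - r *\<^sub>R v \<in> ?S" by (auto simp: span_breakdown_eq)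
      have "I (I v - r *\<^sub>R v) + r *\<^sub>R (I v - r *\<^sub>R v) \<in> ?S"
        using stable[OF r] r by (intro span_add span_scale) auto
      also have "I (I v - r *\<^sub>R v) + r *\<^sub>R (I v - r *\<^sub>R v) = (- (1 + r * r)) *\<^sub>R v"
        by (simp add: I linear_diff linear_scale algebra_simps)
      finally have "(- (1 + r * r)) *\<^sub>R v \<in> ?S" .
      then have "inverse (- (1 + r * r)) *\<^sub>R (- (1 + r * r)) *\<^sub>R v \<in> ?S" by (rule span_scale)
      moreover have "- (1 + r * r) \<noteq> 0" by (smt (verit) zero_le_square)
      ultimately have "v \<in> ?S" by simp
      then show False using v by blast
    qed
    \<comment> \<open>The images \<open>I (b i)\<close> occupy the second half, so one more vector
      shifts them by one place: \<open>v\<close> goes to index \<open>m\<close> and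
      \<open>I v\<close> to the end.\<close>
    define b' where "b' i = (if i < m then b i else if i = m then v else if i \<le> 2 * m then b (i - 1) else I v)" for i
    have im: "b' ` {..<2 * Suc m} = insert (I v) (insert v (b ` {..<2*m}))"
    proof -
      have 1: "{..<2 * Suc m} = {..<m} \<union> {m} \<union> Suc ` {m..<2*m} \<union> {Suc (2*m)}"
        by (auto simp: image_iff Bex_def)
      have 2: "b' ` Suc ` {m..<2*m} = b ` {m..<2*m}"
        unfolding image_image by (rule image_cong) (auto simp: b'_def)
      have 3: "b' ` {..<m} = b ` {..<m}"
        by (rule image_cong) (auto simp: b'_def)
      have 4: "{..<2*m} = {..<m} \<union> {m..<2*m}" by auto
      have 5: "b' ` {m} = {v}" "b' ` {Suc (2 * m)} = {I v}" by (auto simp: b'_def)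
      show ?thesis unfolding 1 4 image_Un 2 3 5 by blast
    qed
    have ind: "independent (b' ` {..<2 * Suc m})"
      unfolding im using b Iv v by (intro independent_insertI) (auto simp: good_def)
    have "card (b' ` {..<2 * Suc m}) = card {..<2 * Suc m}"
    proof -
      have "I v \<notin> insert v (b ` {..<2*m})" using Iv by (metis span_base)
      moreover have "v \<notin> b ` {..<2*m}" using v by (metis span_base)
      moreover have "card (b ` {..<2*m}) = 2 * m" using b by (simp add: good_def card_image)
      ultimately show ?thesis unfolding im by simp
    qed
    then have "inj_on b' {..<2 * Suc m}" by (rule eq_card_imp_inj_on[OF finite_lessThan])
    moreover have "b' (Suc m + i) = I (b' i)" if "i < Suc m" for i
      using b that by (auto simp: b'_def good_def less_Suc_eq mult_2)
    ultimately have "good (Suc m) b'" using ind by (simp add: good_def)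
    then show False using m(2)[of "Suc m"] by auto
  qed
  then obtain c where "coords (2 * m) b c"
    using basis_coords[of b "2 * m"] b by (auto simp: good_def)
  then show thesis
    using b I(2) by (intro that[of m b c]) (auto simp: good_def)
qed

section \<open>Compact boxes and bump functions\<close>

context coords
begin

lemma norm_le_co: "norm x \<le> (\<Sum>i<n. \<bar>co i x\<bar> * norm (bas i))"
proof -
  have "norm x = norm (\<Sum>i<n. co i x *\<^sub>R bas i)" by (simp add: expand)
  also have "\<dots> \<le> (\<Sum>i<n. norm (co i x *\<^sub>R bas i))" by (rule norm_sum)
  finally show ?thesis by simp
qed

text \<open>A box is a sum of finitely many segments, each a continuous image of a compact interval,
  and sums of compact sets are compact.\<close>

lemma compact_coords_box: "compact {x. \<forall>i<n. \<bar>co i x\<bar> \<le> r}"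
proof -
  have "compact {\<Sum>i<m. u i *\<^sub>R bas i | u. \<forall>i<m. \<bar>u i\<bar> \<le> r}" for m
  proof (induction m)
    case 0
    have "{\<Sum>i<0::nat. u i *\<^sub>R bas i | u. \<forall>i<0::nat. \<bar>u i\<bar> \<le> r} = {0}" by auto
    then show ?case by simp
  next
    case (Suc m)
    have "compact ((\<lambda>t. t *\<^sub>R bas m) ` {-r..r})"
      by (intro compact_continuous_image continuous_intros) simp
    from compact_sums[OF Suc this]
    have "compact {x + y |x y. x \<in> {\<Sum>i<m. u i *\<^sub>R bas i | u. \<forall>i<m. \<bar>u i\<bar> \<le> r} \<and> y \<in> (\<lambda>t. t *\<^sub>R bas m) ` {-r..r}}" .
    also have "{x + y |x y. x \<in> {\<Sum>i<m. u i *\<^sub>R bas i | u. \<forall>i<m. \<bar>u i\<bar> \<le> r} \<and> y \<in> (\<lambda>t. t *\<^sub>R bas m) ` {-r..r}} =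
      {\<Sum>i<Suc m. u i *\<^sub>R bas i | u. \<forall>i<Suc m. \<bar>u i\<bar> \<le> r}" (is "?l = ?r")
    proof (intro equalityI subsetI)
      fix z assume "z \<in> ?l"
      then obtain u t where "z = (\<Sum>i<m. u i *\<^sub>R bas i) + t *\<^sub>R bas m" "\<forall>i<m. \<bar>u i\<bar> \<le> r" "\<bar>t\<bar> \<le> r"
        by (auto simp: abs_le_iff)
      then have "z = (\<Sum>i<Suc m. (u(m := t)) i *\<^sub>R bas i)" "\<forall>i<Suc m. \<bar>(u(m := t)) i\<bar> \<le> r"
        by (auto simp: less_Suc_eq)
      then show "z \<in> ?r" by blast
    next
      fix z assume "z \<in> ?r"
      then obtain u where "z = (\<Sum>i<m. u i *\<^sub>R bas i) + u m *\<^sub>R bas m" "\<forall>i<Suc m. \<bar>u i\<bar> \<le> r"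
        by auto
      then show "z \<in> ?l" by (force simp: abs_le_iff)
    qed
    finally show ?case .
  qed
  moreover have "{x. \<forall>i<n. \<bar>co i x\<bar> \<le> r} = {\<Sum>i<n. u i *\<^sub>R bas i | u. \<forall>i<n. \<bar>u i\<bar> \<le> r}"
  proof (intro equalityI subsetI)
    fix x assume "x \<in> {x. \<forall>i<n. \<bar>co i x\<bar> \<le> r}"
    then show "x \<in> {\<Sum>i<n. u i *\<^sub>R bas i | u. \<forall>i<n. \<bar>u i\<bar> \<le> r}"
      using expand[of x] by (auto intro!: exI[of _ "\<lambda>i. co i x"])
  next
    fix x assume "x \<in> {\<Sum>i<n. u i *\<^sub>R bas i | u. \<forall>i<n. \<bar>u i\<bar> \<le> r}"
    then obtain u where u: "x = (\<Sum>i<n. u i *\<^sub>R bas i)" "\<forall>i<n. \<bar>u i\<bar> \<le> r" by blast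
    have "co i x = u i" if i: "i < n" for i
    proof -
      have "co i x = (\<Sum>j<n. u j * co i (bas j))"
        unfolding u(1) using bl[OF i]
        by (simp add: linear_sum bounded_linear.linear linear_scale)
      also have "\<dots> = (\<Sum>j<n. if i = j then u j else 0)"
        using i by (intro sum.cong) (auto simp: dual)
      finally show ?thesis using i by simp
    qed
    then show "x \<in> {x. \<forall>i<n. \<bar>co i x\<bar> \<le> r}" using u(2) by simp
  qed
  ultimately show ?thesis by simp
qed

lemma smooth_step:
  assumes "k > (0::real)"
  obtains h :: "real \<Rightarrow> real" where "smooth_on UNIV h" "\<And>u. u \<le> k \<Longrightarrow> h u = 1" "\<And>u. u \<ge> 2 * k \<Longrightarrow> h u = 0"
proof
  interpret R: coords 1 "\<lambda>_. 1 :: real" "\<lambda>_ x. x" by (rule coords_real)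
  \<comment> \<open>\<open>?a\<close> vanishes from \<open>2 * k\<close> on and \<open>?b\<close> up
    to \<open>k\<close>, and they never vanish together; hence the quotient of \<open>?a\<close> by
    \<open>?a + ?b\<close> is smooth.\<close>
  let ?a = "\<lambda>u. flat 0 (2 * k - u)" and ?b = "\<lambda>u. flat 0 (u - k)"
  have fl: "smooth_on UNIV (flat 0)" by (simp add: smooth_on_def Ck_on_flat)
  have aff: "smooth_on UNIV (\<lambda>u. c + d * u)" for c d :: real
    by (intro smooth_on_add smooth_on_const smooth_on_mult smooth_on_linear) auto
  have a: "smooth_on UNIV ?a" using R.smooth_on_compose[OF _ _ _ aff[of "2 * k" "-1"] fl] by simp
  have b: "smooth_on UNIV ?b" using R.smooth_on_compose[OF _ _ _ aff[of "- k" 1] fl] by simp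
  have pos: "?a u + ?b u > 0" for u using assms by (auto simp: flat_def add_pos_nonneg add_nonneg_pos)
  have "smooth_on UNIV (\<lambda>u. inverse (?a u + ?b u))"
  proof (rule R.smooth_on_compose[where f = "\<lambda>u. ?a u + ?b u" and g = inverse and T = "- {0}"])
    show "smooth_on UNIV (\<lambda>u. ?a u + ?b u)" by (intro smooth_on_add a b open_UNIV)
    show "smooth_on (- {0}) (inverse :: real \<Rightarrow> real)" by (simp add: smooth_on_def Ck_on_inverse)
    show "range (\<lambda>u. ?a u + ?b u) \<subseteq> - {0}" using pos by (force simp: less_le)
  qed auto
  then show "smooth_on UNIV (\<lambda>u. ?a u * inverse (?a u + ?b u))"
    by (intro smooth_on_mult a open_UNIV)
  show "?a u * inverse (?a u + ?b u) = 1" if "u \<le> k" for u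
    using that pos[of u] by (auto simp: flat_def)
  show "?a u * inverse (?a u + ?b u) = 0" if "u \<ge> 2 * k" for u
    using that by (simp add: flat_def)
qed

lemma exists_bump:
  assumes "r > 0"
  obtains \<beta> :: "'a \<Rightarrow> real" and K V where "smooth_on UNIV \<beta>" "compact K" "K \<subseteq> ball x0 r"
    "\<And>x. x \<notin> K \<Longrightarrow> \<beta> x = 0" "open V" "x0 \<in> V" "\<And>x. x \<in> V \<Longrightarrow> \<beta> x = 1"
proof -
  interpret R: coords 1 "\<lambda>_. 1 :: real" "\<lambda>_ x. x" by (rule coords_real)
  \<comment> \<open>The norm may fail to be smooth, whereas the sum of the squared coordinates is
    smooth.\<close>
  define Q where "Q x = (\<Sum>i<n. co i (x - x0) * co i (x - x0))" for x
  define S where "S = 1 + (\<Sum>i<n. norm (bas i))"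
  have S: "S > 0" unfolding S_def by (smt (verit) norm_ge_zero sum_nonneg)
  \<comment> \<open>\<open>Q x \<le> 2 * k\<close> bounds each coordinate of \<open>x - x0\<close>
    by \<open>r / (2 * S)\<close>, hence its norm by \<open>r / 2\<close>, as \<open>S\<close>
    exceeds the sum of the norms of the basis vectors.\<close>
  define k where "k = (r / (2 * S))\<^sup>2 / 2"
  have k: "k > 0" using S assms by (simp add: k_def)
  have co_le: "\<bar>co i (x - x0)\<bar> \<le> r / (2 * S)" if "Q x \<le> 2 * k" "i < n" for x i
  proof -
    have "co i (x - x0) * co i (x - x0) \<le> Q x"
      unfolding Q_def using that(2) by (intro member_le_sum) auto
    then have "(co i (x - x0))\<^sup>2 \<le> (r / (2 * S))\<^sup>2"
      using that(1) by (simp add: k_def power2_eq_square)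
    then show ?thesis using S assms by (simp add: abs_le_square_iff[symmetric])
  qed
  have sQ: "smooth_on UNIV Q"
  proof -
    have "smooth_on UNIV (\<lambda>x. co i (x - x0))" if "i < n" for i
      using smooth_on_bounded_linear[OF open_UNIV bl[OF that] smooth_on_diff[OF open_UNIV smooth_on_linear[OF open_UNIV bounded_linear_ident] smooth_on_const[OF open_UNIV]]] .
    then show ?thesis unfolding Q_def by (intro smooth_on_sum smooth_on_mult) auto
  qed
  then have cQ: "continuous_on UNIV Q" by (rule smooth_on_continuous)
  obtain h where h: "smooth_on UNIV h" "\<And>u. u \<le> k \<Longrightarrow> h u = 1" "\<And>u. u \<ge> 2 * k \<Longrightarrow> h u = (0::real)"
    using smooth_step[OF k] by metis
  let ?K = "{x. Q x \<le> 2 * k}"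
  show thesis
  proof
    show "smooth_on UNIV (\<lambda>x. h (Q x))" using R.smooth_on_compose[OF _ _ _ sQ h(1)] by simp
    let ?T = "(+) x0 ` {x. \<forall>i<n. \<bar>co i x\<bar> \<le> r / (2 * S)}"
    have "closed ?K" using cQ by (intro closed_Collect_le) auto
    moreover have "compact ?T" using compact_coords_box by (rule compact_translation)
    moreover have "x \<in> ?T" if "x \<in> ?K" for x
      using co_le that by (intro image_eqI[where x = "x - x0"]) auto
    then have "?T \<inter> ?K = ?K" by blast
    ultimately show "compact ?K" using compact_Int_closed[of ?T ?K] by simp
    show "?K \<subseteq> ball x0 r"
    proof
      fix x assume x: "x \<in> ?K"
      have "norm (x - x0) \<le> (\<Sum>i<n. \<bar>co i (x - x0)\<bar> * norm (bas i))" by (rule norm_le_co)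
      also have "\<dots> \<le> (\<Sum>i<n. r / (2 * S) * norm (bas i))"
        using x co_le by (intro sum_mono mult_right_mono) auto
      also have "\<dots> = r / (2 * S) * (\<Sum>i<n. norm (bas i))" by (simp add: sum_distrib_left)
      also have "\<dots> \<le> r / (2 * S) * S" using S assms by (intro mult_left_mono) (auto simp: S_def)
      also have "\<dots> < r" using S assms by simp
      finally show "x \<in> ball x0 r" by (simp add: dist_norm norm_minus_commute)
    qed
    show "h (Q x) = 0" if "x \<notin> ?K" for x using that h(3) by simp
    show "open {x. Q x < k}" using cQ by (intro open_Collect_less) auto
    show "x0 \<in> {x. Q x < k}" using k by (simp add: Q_def bl linear_0 bounded_linear.linear)
    show "h (Q x) = 1" if "x \<in> {x. Q x < k}" for x using that h(2) by simp
  qed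
qed

end

section \<open>Smooth functions and tangent vectors on manifolds\<close>

text \<open>Charts that need not belong to the atlas and may have another model space; for a fiber bundle
  they allow charts adapted to the projection.\<close>

definition compatible ::
  "('p::topological_space, 'e::real_normed_vector) atlas \<Rightarrow> 'p set \<Rightarrow> ('p \<Rightarrow> 'x::real_normed_vector) \<Rightarrow> bool"
  where "compatible A W \<kappa> \<longleftrightarrow> open W \<and> inj_on \<kappa> W \<and> continuous_on W \<kappa> \<and>
    (\<forall>V. open V \<longrightarrow> V \<subseteq> W \<longrightarrow> open (\<kappa> ` V)) \<and>
    (\<forall>(U, \<phi>)\<in>A. smooth_on (\<phi> ` (U \<inter> W)) (\<kappa> \<circ> inv_into U \<phi>) \<and>
      smooth_on (\<kappa> ` (U \<inter> W)) (\<phi> \<circ> inv_into W \<kappa>))"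

lemma compatibleD:
  assumes "compatible A W \<kappa>" "(U, \<phi>) \<in> A"
  shows "smooth_on (\<phi> ` (U \<inter> W)) (\<kappa> \<circ> inv_into U \<phi>)"
    and "smooth_on (\<kappa> ` (U \<inter> W)) (\<phi> \<circ> inv_into W \<kappa>)"
  using assms unfolding compatible_def by auto

lemma smooth_fun_on_subset: "smooth_fun_on A W f \<Longrightarrow> V \<subseteq> W \<Longrightarrow> smooth_fun_on A V f"
  unfolding smooth_fun_on_def by (fast intro: smooth_on_subset)

locale mfd =
  fixes A :: "('p::{t2_space, second_countable_topology}, 'e::real_normed_vector) atlas"
  assumes mfd: "smooth_manifold A"
begin

abbreviation C where "C \<equiv> smooth_funs A"

lemma
  assumes U: "(U, \<phi>) \<in> A"
  shows chart_open: "open U" and chart_inj: "inj_on \<phi> U"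
    and chart_hom: "homeomorphism U (\<phi> ` U) \<phi> (inv_into U \<phi>)"
    and chart_image: "open (\<phi> ` U)"
proof -
  have "\<forall>(U, \<phi>)\<in>A. open U \<and> open (\<phi> ` U) \<and> inj_on \<phi> U \<and>
      homeomorphism U (\<phi> ` U) \<phi> (inv_into U \<phi>)"
    using mfd unfolding smooth_manifold_def by (elim conjE)
  from bspec[OF this U]
  show "open U" "inj_on \<phi> U" "homeomorphism U (\<phi> ` U) \<phi> (inv_into U \<phi>)" "open (\<phi> ` U)"
    by simp_all
qed

lemma chart_trans:
  assumes "(U, \<phi>) \<in> A" "(V, \<psi>) \<in> A"
  shows "smooth_on (\<phi> ` (U \<inter> V)) (\<psi> \<circ> inv_into U \<phi>)"
proof -
  have "\<forall>(U, \<phi>)\<in>A. \<forall>(V, \<psi>)\<in>A. smooth_on (\<phi> ` (U \<inter> V)) (\<psi> \<circ> inv_into U \<phi>)"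
    using mfd unfolding smooth_manifold_def by (elim conjE)
  from bspec[OF this assms(1)] assms(2) show ?thesis by auto
qed

lemma chart_at: obtains U \<phi> where "(U, \<phi>) \<in> A" "p \<in> U"
proof -
  have "p \<in> (\<Union>(U, \<phi>)\<in>A. U)"
    using mfd unfolding smooth_manifold_def by (elim conjE) simp
  then show thesis using that by auto
qed

lemma model_coords: obtains n and b :: "nat \<Rightarrow> 'e" and c where "coords n b c"
  using mfd exists_coords unfolding smooth_manifold_def by metis

lemma chart_open_image:
  assumes "(U, \<phi>) \<in> A" "open V" "V \<subseteq> U"
  shows "open (\<phi> ` V)"
proof -
  have "openin (top_of_set U) V" using assms chart_open by (simp add: openin_open_eq)
  then have "openin (top_of_set (\<phi> ` U)) (\<phi> ` V)"
    by (rule homeomorphism_imp_open_map[OF chart_hom[OF assms(1)]])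
  then show ?thesis using chart_image[OF assms(1)] by (simp add: openin_open_eq)
qed

lemma chart_compatible: "(U, \<phi>) \<in> A \<Longrightarrow> compatible A U \<phi>"
  unfolding compatible_def
  using chart_open chart_inj chart_hom chart_open_image chart_trans
  by (fastforce simp: homeomorphism_def Int_commute)

lemma smooth_fun_on_cong:
  assumes "open W" "\<And>q. q \<in> W \<Longrightarrow> f q = g q" "smooth_fun_on A W f"
  shows "smooth_fun_on A W g"
  unfolding smooth_fun_on_def
proof clarify
  fix U \<phi> assume U: "(U, \<phi>) \<in> A"
  have "smooth_on (\<phi> ` (U \<inter> W)) (f \<circ> inv_into U \<phi>)"
    using assms(3) U unfolding smooth_fun_on_def by fast
  moreover have "(f \<circ> inv_into U \<phi>) x = (g \<circ> inv_into U \<phi>) x" if "x \<in> \<phi> ` (U \<inter> W)" for x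
    using that chart_inj[OF U] assms(2) by (auto simp: inv_into_f_f)
  ultimately show "smooth_on (\<phi> ` (U \<inter> W)) (g \<circ> inv_into U \<phi>)"
    using smooth_on_cong[OF chart_open_image[OF U]] assms(1) chart_open[OF U]
    by (metis (no_types, lifting) inf.cobounded1 open_Int)
qed

lemma smooth_fun_on_local:
  assumes "\<And>p. p \<in> W \<Longrightarrow> \<exists>V. open V \<and> p \<in> V \<and> smooth_fun_on A V f"
  shows "smooth_fun_on A W f"
  unfolding smooth_fun_on_def
proof clarify
  fix U \<phi> assume U: "(U, \<phi>) \<in> A"
  show "smooth_on (\<phi> ` (U \<inter> W)) (f \<circ> inv_into U \<phi>)"
  proof (rule smooth_on_local)
    fix x assume "x \<in> \<phi> ` (U \<inter> W)"
    then obtain p where p: "p \<in> U" "p \<in> W" "x = \<phi> p" by auto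
    obtain V where V: "open V" "p \<in> V" "smooth_fun_on A V f" using assms[OF p(2)] by blast
    have "open (\<phi> ` (U \<inter> V))" using chart_open_image[OF U] chart_open[OF U] V(1) by auto
    then show "\<exists>T. open T \<and> x \<in> T \<and> smooth_on T (f \<circ> inv_into U \<phi>)"
      using V p U unfolding smooth_fun_on_def by fast
  qed
qed

text \<open>Both directions compose with a transition map between \<open>\<kappa>\<close> and an
  atlas chart, which is smooth by compatibility. One compatible chart can then replace the
  atlas.\<close>

lemma compatible_smooth_fun_on:
  fixes \<kappa> :: "'p \<Rightarrow> 'x::real_normed_vector"
  assumes \<kappa>: "compatible A W \<kappa>" and co: "coords n bas (co :: nat \<Rightarrow> 'x \<Rightarrow> real)"
    and V: "open V" "V \<subseteq> W"
  shows "smooth_fun_on A V f \<longleftrightarrow> smooth_on (\<kappa> ` V) (f \<circ> inv_into W \<kappa>)"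
proof
  have inj: "inj_on \<kappa> W" using \<kappa> by (simp add: compatible_def)
  have opn: "open (\<kappa> ` T)" if "open T" "T \<subseteq> W" for T using \<kappa> that by (simp add: compatible_def)
  have W: "open W" using \<kappa> by (simp add: compatible_def)
  {
    assume f: "smooth_fun_on A V f"
    obtain n' b' c' where "coords n' (b' :: nat \<Rightarrow> 'e) c'" by (rule model_coords)
    then interpret E: coords n' b' c' .
    show "smooth_on (\<kappa> ` V) (f \<circ> inv_into W \<kappa>)"
    proof (rule smooth_on_local)
      fix x assume "x \<in> \<kappa> ` V"
      then obtain q where q: "q \<in> V" "x = \<kappa> q" by auto
      obtain U \<phi> where U: "(U, \<phi>) \<in> A" "q \<in> U" by (rule chart_at)
      let ?T = "\<kappa> ` (U \<inter> V)"
      have T: "open ?T" using V chart_open[OF U(1)] by (intro opn) auto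
      have "smooth_on ?T (\<lambda>y. (f \<circ> inv_into U \<phi>) ((\<phi> \<circ> inv_into W \<kappa>) y))"
      proof (rule E.smooth_on_compose[OF T, where T = "\<phi> ` (U \<inter> V)"])
        show "open (\<phi> ` (U \<inter> V))"
          using V chart_open[OF U(1)] by (intro chart_open_image[OF U(1)]) auto
        show "(\<phi> \<circ> inv_into W \<kappa>) ` ?T \<subseteq> \<phi> ` (U \<inter> V)"
          using V inj by (auto simp: inv_into_f_f subset_iff)
        show "smooth_on ?T (\<phi> \<circ> inv_into W \<kappa>)"
          by (rule smooth_on_subset[OF compatibleD(2)[OF \<kappa> U(1)]]) (use V(2) in auto)
        show "smooth_on (\<phi> ` (U \<inter> V)) (f \<circ> inv_into U \<phi>)"
          using f U(1) unfolding smooth_fun_on_def by auto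
      qed
      moreover have "(f \<circ> inv_into U \<phi>) ((\<phi> \<circ> inv_into W \<kappa>) y) = (f \<circ> inv_into W \<kappa>) y"
        if "y \<in> ?T" for y
        using that V(2) inj chart_inj[OF U(1)] by (auto simp: inv_into_f_f subset_iff)
      ultimately have "smooth_on ?T (f \<circ> inv_into W \<kappa>)" using smooth_on_cong[OF T] by metis
      then show "\<exists>T. open T \<and> x \<in> T \<and> smooth_on T (f \<circ> inv_into W \<kappa>)" using T q U(2) by blast
    qed
  }
  {
    assume f: "smooth_on (\<kappa> ` V) (f \<circ> inv_into W \<kappa>)"
    interpret X: coords n bas co by (rule co)
    show "smooth_fun_on A V f"
      unfolding smooth_fun_on_def
    proof clarify
      fix U \<phi> assume U: "(U, \<phi>) \<in> A"
      have T: "open (\<phi> ` (U \<inter> V))"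
        using V chart_open[OF U] by (intro chart_open_image[OF U]) auto
      have "smooth_on (\<phi> ` (U \<inter> V)) (\<lambda>y. (f \<circ> inv_into W \<kappa>) ((\<kappa> \<circ> inv_into U \<phi>) y))"
      proof (rule X.smooth_on_compose[OF T opn[OF V]])
        show "(\<kappa> \<circ> inv_into U \<phi>) ` \<phi> ` (U \<inter> V) \<subseteq> \<kappa> ` V"
          using chart_inj[OF U] by (auto simp: inv_into_f_f)
        show "smooth_on (\<phi> ` (U \<inter> V)) (\<kappa> \<circ> inv_into U \<phi>)"
          by (rule smooth_on_subset[OF compatibleD(1)[OF \<kappa> U]]) (use V(2) in auto)
      qed (rule f)
      moreover have "(f \<circ> inv_into W \<kappa>) ((\<kappa> \<circ> inv_into U \<phi>) y) = (f \<circ> inv_into U \<phi>) y"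
        if "y \<in> \<phi> ` (U \<inter> V)" for y
        using that V(2) inj chart_inj[OF U] by (auto simp: inv_into_f_f subset_iff)
      ultimately show "smooth_on (\<phi> ` (U \<inter> V)) (f \<circ> inv_into U \<phi>)" using smooth_on_cong[OF T] by metis
    qed
  }
qed

lemma smooth_fun_on_compose_chart:
  fixes \<kappa> :: "'p \<Rightarrow> 'x::real_normed_vector"
  assumes \<kappa>: "compatible A W \<kappa>" and co: "coords n bas (co :: nat \<Rightarrow> 'x \<Rightarrow> real)"
    and h: "smooth_on UNIV h"
  shows "smooth_fun_on A W (\<lambda>q. h (\<kappa> q))"
proof -
  have W: "open W" "inj_on \<kappa> W" "open (\<kappa> ` W)" using \<kappa> by (auto simp: compatible_def)
  have "smooth_on (\<kappa> ` W) h" using h smooth_on_subset by blast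
  moreover have "h x = ((\<lambda>q. h (\<kappa> q)) \<circ> inv_into W \<kappa>) x" if "x \<in> \<kappa> ` W" for x
    using that by (simp add: f_inv_into_f)
  ultimately have "smooth_on (\<kappa> ` W) ((\<lambda>q. h (\<kappa> q)) \<circ> inv_into W \<kappa>)"
    using smooth_on_cong[OF W(3)] by metis
  then show ?thesis by (simp add: compatible_smooth_fun_on[OF \<kappa> co W(1)])
qed

lemma smooth_fun_on_derivative:
  fixes \<kappa> :: "'p \<Rightarrow> 'x::real_normed_vector"
  assumes \<kappa>: "compatible A W \<kappa>" and co: "coords n bas (co :: nat \<Rightarrow> 'x \<Rightarrow> real)"
    and f: "smooth_fun_on A W f"
  shows "smooth_fun_on A W (\<lambda>q. frechet_derivative (f \<circ> inv_into W \<kappa>) (at (\<kappa> q)) v)"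
proof -
  have W: "open W" "inj_on \<kappa> W" "open (\<kappa> ` W)" using \<kappa> by (auto simp: compatible_def)
  have "smooth_on (\<kappa> ` W) (\<lambda>x. frechet_derivative (f \<circ> inv_into W \<kappa>) (at x) v)"
    using f by (intro smooth_on_derivative) (simp add: compatible_smooth_fun_on[OF \<kappa> co W(1)])
  moreover have "frechet_derivative (f \<circ> inv_into W \<kappa>) (at x) v =
      ((\<lambda>q. frechet_derivative (f \<circ> inv_into W \<kappa>) (at (\<kappa> q)) v) \<circ> inv_into W \<kappa>) x" if "x \<in> \<kappa> ` W" for x
    using that by (simp add: f_inv_into_f)
  ultimately have "smooth_on (\<kappa> ` W) ((\<lambda>q. frechet_derivative (f \<circ> inv_into W \<kappa>) (at (\<kappa> q)) v) \<circ> inv_into W \<kappa>)"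
    using smooth_on_cong[OF W(3)] by (metis (no_types, lifting))
  then show ?thesis by (simp add: compatible_smooth_fun_on[OF \<kappa> co W(1)])
qed

lemma open_chart_Int: "(U, \<phi>) \<in> A \<Longrightarrow> open W \<Longrightarrow> open (\<phi> ` (U \<inter> W))"
  using chart_open by (intro chart_open_image) auto

lemma smooth_fun_onD:
  "smooth_fun_on A W f \<Longrightarrow> (U, \<phi>) \<in> A \<Longrightarrow> smooth_on (\<phi> ` (U \<inter> W)) (\<lambda>x. f (inv_into U \<phi> x))"
  unfolding smooth_fun_on_def o_def by auto

lemma smooth_fun_onI:
  "(\<And>U \<phi>. (U, \<phi>) \<in> A \<Longrightarrow> smooth_on (\<phi> ` (U \<inter> W)) (\<lambda>x. f (inv_into U \<phi> x))) \<Longrightarrow> smooth_fun_on A W f"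
  unfolding smooth_fun_on_def o_def by auto

lemma smooth_fun_on_const: "open W \<Longrightarrow> smooth_fun_on A W (\<lambda>_. c)"
  by (rule smooth_fun_onI, rule smooth_on_const, rule open_chart_Int)

lemma smooth_fun_on_add:
  "open W \<Longrightarrow> smooth_fun_on A W f \<Longrightarrow> smooth_fun_on A W g \<Longrightarrow> smooth_fun_on A W (\<lambda>q. f q + g q)"
  by (rule smooth_fun_onI, rule smooth_on_add) (auto intro: open_chart_Int smooth_fun_onD)

lemma smooth_fun_on_mult:
  "open W \<Longrightarrow> smooth_fun_on A W f \<Longrightarrow> smooth_fun_on A W g \<Longrightarrow> smooth_fun_on A W (\<lambda>q. f q * g q)"
  by (rule smooth_fun_onI, rule smooth_on_mult) (auto intro: open_chart_Int smooth_fun_onD)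

lemma C_iff: "f \<in> C \<longleftrightarrow> smooth_fun_on A UNIV f"
  by (simp add: smooth_funs_def)

lemma C_smooth_fun_on: "f \<in> C \<Longrightarrow> smooth_fun_on A W f"
  unfolding C_iff by (erule smooth_fun_on_subset) simp

lemma C_const [simp]: "(\<lambda>_. c) \<in> C"
  by (simp add: C_iff smooth_fun_on_const)

lemma C_add [simp]: "f \<in> C \<Longrightarrow> g \<in> C \<Longrightarrow> (\<lambda>q. f q + g q) \<in> C"
  by (simp add: C_iff smooth_fun_on_add)

lemma C_mult [simp]: "f \<in> C \<Longrightarrow> g \<in> C \<Longrightarrow> (\<lambda>q. f q * g q) \<in> C"
  by (simp add: C_iff smooth_fun_on_mult)

lemma C_diff [simp]: "f \<in> C \<Longrightarrow> g \<in> C \<Longrightarrow> (\<lambda>q. f q - g q) \<in> C"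
  using C_add[of f "\<lambda>q. (-1) * g q"] C_mult[of "\<lambda>_. -1" g] by simp

lemma C_minus [simp]: "f \<in> C \<Longrightarrow> (\<lambda>q. - f q) \<in> C"
  using C_mult[of "\<lambda>_. -1" f] by simp

lemma C_sum [simp]: "(\<And>i. i \<in> I \<Longrightarrow> f i \<in> C) \<Longrightarrow> (\<lambda>q. \<Sum>i\<in>I. f i q) \<in> C"
  by (induction I rule: infinite_finite_induct) auto

lemma C_local_open:
  assumes "\<And>p. \<exists>V. open V \<and> p \<in> V \<and> smooth_fun_on A V f"
  shows "f \<in> C"
  unfolding C_iff by (rule smooth_fun_on_local) (rule assms)

text \<open>Extension by 0 is smooth because \<open>b\<close> vanishes off a closed set inside
  \<open>W\<close>: the open sets \<open>V \<inter> W\<close> and \<open>- K\<close> cover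
  \<open>V\<close>, and the function is a product on the first and 0 on the second.\<close>

lemma cutoff_on:
  assumes "open V" "open W" "smooth_fun_on A (V \<inter> W) f" "b \<in> C" "closed K" "K \<subseteq> W" "\<And>q. q \<notin> K \<Longrightarrow> b q = 0"
  shows "smooth_fun_on A V (\<lambda>q. if q \<in> W then b q * f q else 0)"
proof (rule smooth_fun_on_local)
  fix p assume p: "p \<in> V"
  let ?f = "\<lambda>q. if q \<in> W then b q * f q else 0"
  show "\<exists>V. open V \<and> p \<in> V \<and> smooth_fun_on A V ?f"
  proof (cases "p \<in> W")
    case True
    have o: "open (V \<inter> W)" using assms by blast
    have "smooth_fun_on A (V \<inter> W) (\<lambda>q. b q * f q)"
      by (intro smooth_fun_on_mult o assms C_smooth_fun_on)
    then have "smooth_fun_on A (V \<inter> W) ?f" by (rule smooth_fun_on_cong[OF o, rotated]) simp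
    then show ?thesis using True o p by blast
  next
    case False
    have "open (- K)" using assms(5) by (simp add: open_Compl)
    moreover have "smooth_fun_on A (- K) ?f"
      by (rule smooth_fun_on_cong[OF \<open>open (- K)\<close> _ smooth_fun_on_const[OF \<open>open (- K)\<close>, of 0]])
        (simp add: assms(7))
    moreover have "p \<in> - K" using False assms(6) by blast
    ultimately show ?thesis by blast
  qed
qed

lemma cutoff:
  assumes "open W" "smooth_fun_on A W f" "b \<in> C" "closed K" "K \<subseteq> W" "\<And>q. q \<notin> K \<Longrightarrow> b q = 0"
  shows "(\<lambda>q. if q \<in> W then b q * f q else 0) \<in> C"
  unfolding C_iff using assms by (intro cutoff_on[OF open_UNIV]) auto

lemma bump:
  assumes "open W" "p \<in> W"
  obtains b K where "b \<in> C" "closed K" "K \<subseteq> W" "\<And>q. q \<notin> K \<Longrightarrow> b q = 0"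
    "\<forall>\<^sub>F q in nhds p. b q = 1"
proof -
  obtain U \<phi> where U: "(U, \<phi>) \<in> A" "p \<in> U" by (rule chart_at)
  obtain n b' c' where co: "coords n (b' :: nat \<Rightarrow> 'e) c'" by (rule model_coords)
  then interpret E: coords n b' c' .
  have inj: "inj_on \<phi> U" and hom: "homeomorphism U (\<phi> ` U) \<phi> (inv_into U \<phi>)"
    using chart_inj chart_hom U(1) by auto
  have "open (\<phi> ` (U \<inter> W))" by (rule open_chart_Int[OF U(1) assms(1)])
  then obtain r where r: "r > 0" "ball (\<phi> p) r \<subseteq> \<phi> ` (U \<inter> W)"
    using assms(2) U(2) open_contains_ball by blast
  obtain \<beta> K V where \<beta>: "smooth_on UNIV \<beta>" "compact K" "K \<subseteq> ball (\<phi> p) r"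
    "\<And>x. x \<notin> K \<Longrightarrow> \<beta> x = 0" "open V" "\<phi> p \<in> V" "\<And>x. x \<in> V \<Longrightarrow> \<beta> x = (1::real)"
    by (rule E.exists_bump[OF r(1), of "\<phi> p"]) blast
  let ?K = "inv_into U \<phi> ` K"
  let ?b = "\<lambda>q. if q \<in> U then \<beta> (\<phi> q) else 0"
  have KU: "K \<subseteq> \<phi> ` (U \<inter> W)" using \<beta>(3) r(2) by blast
  \<comment> \<open>Compactness is what survives the passage from the chart to the manifold: a
    compact image is closed in the whole Hausdorff space, and not just in \<open>U\<close>.\<close>
  have "compact ?K"
    using hom KU \<beta>(2) unfolding homeomorphism_def
    by (intro compact_continuous_image) (auto intro: continuous_on_subset)
  then have cl: "closed ?K" by (rule compact_imp_closed)
  have KW: "?K \<subseteq> U \<inter> W" using KU inj by (auto simp: inv_into_f_f subset_iff image_iff)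
  have zero: "?b q = 0" if "q \<notin> ?K" for q
    using that \<beta>(4)[of "\<phi> q"] inj by (auto simp: image_iff inv_into_f_f) (metis inv_into_f_f)
  have "?b \<in> C"
  proof (rule C_local_open)
    fix q
    have s: "smooth_fun_on A U (\<lambda>q. \<beta> (\<phi> q))"
      by (rule smooth_fun_on_compose_chart[OF chart_compatible[OF U(1)] co \<beta>(1)])
    have sU: "smooth_fun_on A U ?b"
      by (rule smooth_fun_on_cong[OF chart_open[OF U(1)] _ s]) simp
    have ok: "open (- ?K)" using cl by (simp add: open_Compl)
    have sK: "smooth_fun_on A (- ?K) ?b"
      by (rule smooth_fun_on_cong[OF ok _ smooth_fun_on_const[OF ok, of 0]])
        (simp only: zero Compl_iff not_False_eq_True)
    show "\<exists>V. open V \<and> q \<in> V \<and> smooth_fun_on A V ?b"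
    proof (cases "q \<in> U")
      case True
      then show ?thesis using sU chart_open[OF U(1)] by blast
    next
      case False
      then have "q \<in> - ?K" using KW by blast
      then show ?thesis using sK ok by blast
    qed
  qed
  moreover have "\<forall>\<^sub>F q in nhds p. ?b q = 1"
  proof -
    have "open (\<phi> -` V \<inter> U)"
      using hom \<beta>(5) chart_open[OF U(1)] unfolding homeomorphism_def
      by (metis continuous_on_open_vimage)
    then show ?thesis
      using U(2) \<beta>(6,7) unfolding eventually_nhds by (intro exI[of _ "\<phi> -` V \<inter> U"]) auto
  qed
  ultimately show thesis using that[of ?b ?K] cl KW zero by blast
qed

text \<open>Tangent vectors are tested on global functions; this replaces a local function by a
  global one with the same germ.\<close>

lemma germ_extension:
  assumes "open W" "p \<in> W" "smooth_fun_on A W f"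
  obtains g where "g \<in> C" "\<forall>\<^sub>F q in nhds p. g q = f q"
proof -
  obtain b K where b: "b \<in> C" "closed K" "K \<subseteq> W" "\<And>q. q \<notin> K \<Longrightarrow> b q = 0"
    "\<forall>\<^sub>F q in nhds p. b q = 1" by (rule bump[OF assms(1,2)]) blast
  show thesis
  proof
    show "(\<lambda>q. if q \<in> W then b q * f q else 0) \<in> C"
      by (rule cutoff[OF assms(1,3) b(1-4)])
    show "\<forall>\<^sub>F q in nhds p. (if q \<in> W then b q * f q else 0) = f q"
      using b(5) eventually_nhds_in_open[OF assms(1,2)] by eventually_elim simp
  qed
qed

section \<open>Tangent vectors and their expansion in coordinates\<close>

lemma tangent_add: "X \<in> tangent_space A p \<Longrightarrow> f \<in> C \<Longrightarrow> g \<in> C \<Longrightarrow> X (\<lambda>q. f q + g q) = X f + X g"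
  and tangent_scale: "X \<in> tangent_space A p \<Longrightarrow> f \<in> C \<Longrightarrow> X (\<lambda>q. c * f q) = c * X f"
  and tangent_mult: "X \<in> tangent_space A p \<Longrightarrow> f \<in> C \<Longrightarrow> g \<in> C \<Longrightarrow> X (\<lambda>q. f q * g q) = X f * g p + f p * X g"
  and tangent_outside: "X \<in> tangent_space A p \<Longrightarrow> f \<notin> C \<Longrightarrow> X f = 0"
  unfolding tangent_space_def Hom_def lin_on_def
  by (auto simp: plus_fun_def scaleR_fun_def)

lemma tangent_const: "X \<in> tangent_space A p \<Longrightarrow> X (\<lambda>_. c) = 0"
  using tangent_mult[of X p "\<lambda>_. 1" "\<lambda>_. 1"] tangent_scale[of X p "\<lambda>_. 1" c] by simp

lemma tangent_diff: "X \<in> tangent_space A p \<Longrightarrow> f \<in> C \<Longrightarrow> g \<in> C \<Longrightarrow> X (\<lambda>q. f q - g q) = X f - X g"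
  using tangent_add[of X p f "\<lambda>q. (-1) * g q"] tangent_scale[of X p g "-1"] C_mult[of "\<lambda>_. -1" g] by simp

lemma tangent_sum:
  "X \<in> tangent_space A p \<Longrightarrow> (\<And>i. i \<in> I \<Longrightarrow> f i \<in> C) \<Longrightarrow> X (\<lambda>q. \<Sum>i\<in>I. f i q) = (\<Sum>i\<in>I. X (f i))"
proof (induction I rule: infinite_finite_induct)
  case (insert i I)
  then show ?case using tangent_add[of X p "f i" "\<lambda>q. \<Sum>i\<in>I. f i q"] by simp
qed (simp_all add: tangent_const)

text \<open>If b is 1 at p and vanishes off a set where f = g, then f - g = (1 - b)(f - g). In the
  Leibniz rule for this product both terms contain a factor that vanishes at p.\<close>

lemma tangent_local:
  assumes X: "X \<in> tangent_space A p" and fg: "f \<in> C" "g \<in> C" "\<forall>\<^sub>F q in nhds p. f q = g q"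
  shows "X f = X g"
proof -
  obtain W where W: "open W" "p \<in> W" "\<And>q. q \<in> W \<Longrightarrow> f q = g q"
    using fg(3) unfolding eventually_nhds by blast
  obtain b K where b: "b \<in> C" "closed K" "K \<subseteq> W" "\<And>q. q \<notin> K \<Longrightarrow> b q = 0"
    "\<forall>\<^sub>F q in nhds p. b q = 1" by (rule bump[OF W(1,2)]) blast
  have "b p = 1" using b(5) by (rule eventually_nhds_x_imp_x)
  have "(\<lambda>q. f q - g q) = (\<lambda>q. (1 - b q) * (f q - g q))"
    using W(3) b(3,4) by (auto simp: fun_eq_iff)
  then have "X (\<lambda>q. f q - g q) = X (\<lambda>q. (1 - b q) * (f q - g q))" by simp
  also have "\<dots> = X (\<lambda>q. 1 - b q) * (f p - g p) + (1 - b p) * X (\<lambda>q. f q - g q)"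
    using tangent_mult[OF X, of "\<lambda>q. 1 - b q" "\<lambda>q. f q - g q"] fg b(1) by simp
  also have "\<dots> = 0" using \<open>b p = 1\<close> W(2,3) by simp
  finally show ?thesis using tangent_diff[OF X fg(1,2)] by simp
qed

text \<open>Hadamard's lemma writes \<open>f\<close> near \<open>p\<close> as \<open>f p\<close>
  plus products whose first factors vanish at \<open>p\<close>. By the Leibniz rule \<open>X\<close>
  differentiates only these first factors, so it is determined by its values on the coordinates. The
  \<open>y i\<close> are global functions with the germs of the coordinates.\<close>

lemma tangent_expand:
  fixes \<kappa> :: "'p \<Rightarrow> 'x::real_normed_vector"
  assumes \<kappa>: "compatible A W \<kappa>" and co: "coords n bas (co :: nat \<Rightarrow> 'x \<Rightarrow> real)" and p: "p \<in> W"
    and X: "X \<in> tangent_space A p" and f: "f \<in> C"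
    and y: "\<And>i. i < n \<Longrightarrow> y i \<in> C" "\<And>i. i < n \<Longrightarrow> \<forall>\<^sub>F q in nhds p. y i q = co i (\<kappa> q)"
  shows "X f = (\<Sum>i<n. X (y i) * frechet_derivative (f \<circ> inv_into W \<kappa>) (at (\<kappa> p)) (bas i))"
proof -
  interpret X: coords n bas co by (rule co)
  have W: "open W" "inj_on \<kappa> W" "open (\<kappa> ` W)" "continuous_on W \<kappa>" using \<kappa> by (auto simp: compatible_def)
  let ?F = "f \<circ> inv_into W \<kappa>"
  obtain r where r: "r > 0" "ball (\<kappa> p) r \<subseteq> \<kappa> ` W"
    using W(3) p open_contains_ball by blast
  have "smooth_on (\<kappa> ` W) ?F"
    using C_smooth_fun_on[OF f] compatible_smooth_fun_on[OF \<kappa> co W(1)] by blast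
  then have "smooth_on (ball (\<kappa> p) r) ?F" using r(2) smooth_on_subset by blast
  then obtain H where H: "\<And>i. smooth_on (ball (\<kappa> p) r) (H i)"
    "\<And>i. H i (\<kappa> p) = frechet_derivative ?F (at (\<kappa> p)) (bas i)"
    "\<And>x. x \<in> ball (\<kappa> p) r \<Longrightarrow> ?F x = ?F (\<kappa> p) + (\<Sum>i<n. (co i x - co i (\<kappa> p)) * H i x)"
    by (rule X.hadamard) blast
  let ?V = "\<kappa> -` ball (\<kappa> p) r \<inter> W"
  have V: "open ?V" "?V \<subseteq> W" "p \<in> ?V"
    using W(1,4) p r(1) by (auto intro: continuous_on_open_vimage[THEN iffD1, rule_format])
  have img: "\<kappa> ` ?V = ball (\<kappa> p) r" using r(2) by auto
  have "smooth_fun_on A ?V (\<lambda>q. H i (\<kappa> q))" for i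
  proof -
    have "H i x = ((\<lambda>q. H i (\<kappa> q)) \<circ> inv_into W \<kappa>) x" if "x \<in> ball (\<kappa> p) r" for x
      using that r(2) by (auto simp: f_inv_into_f)
    then have "smooth_on (\<kappa> ` ?V) ((\<lambda>q. H i (\<kappa> q)) \<circ> inv_into W \<kappa>)"
      unfolding img using H(1) smooth_on_cong[OF open_ball] by (metis (no_types, lifting))
    then show ?thesis by (simp only: compatible_smooth_fun_on[OF \<kappa> co V(1,2)])
  qed
  then have "\<exists>g. g \<in> C \<and> (\<forall>\<^sub>F q in nhds p. g q = H i (\<kappa> q))" for i
    using germ_extension[OF V(1,3)] by metis
  then obtain G where G: "\<And>i. G i \<in> C" "\<And>i. \<forall>\<^sub>F q in nhds p. G i q = H i (\<kappa> q)" by metis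
  have yp: "y i p = co i (\<kappa> p)" if "i < n" for i
    using y(2)[OF that] by (rule eventually_nhds_x_imp_x)
  have Gp: "G i p = frechet_derivative ?F (at (\<kappa> p)) (bas i)" for i
    using eventually_nhds_x_imp_x[OF G(2)[of i]] H(2) by simp
  let ?S = "\<lambda>q. \<Sum>i<n. (y i q - y i p) * G i q"
  have SC: "?S \<in> C" by (intro C_sum C_mult C_diff C_const) (use y G in auto)
  have "\<forall>\<^sub>F q in nhds p. f q = f p + ?S q"
  proof -
    have "\<forall>\<^sub>F q in nhds p. \<forall>i\<in>{..<n}. y i q = co i (\<kappa> q) \<and> G i q = H i (\<kappa> q)"
      using y(2) G(2) by (intro eventually_ball_finite) (auto intro: eventually_conj)
    moreover have "\<forall>\<^sub>F q in nhds p. q \<in> ?V" by (rule eventually_nhds_in_open[OF V(1,3)])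
    ultimately show ?thesis
    proof eventually_elim
      case (elim q)
      have "f q = ?F (\<kappa> q)" using elim W(2) by simp
      also have "\<dots> = ?F (\<kappa> p) + (\<Sum>i<n. (co i (\<kappa> q) - co i (\<kappa> p)) * H i (\<kappa> q))"
        using elim by (intro H(3)) auto
      also have "?F (\<kappa> p) = f p" using W(2) p by simp
      finally show ?case using elim yp by simp
    qed
  qed
  then have "X f = X (\<lambda>q. f p + ?S q)"
    using f SC by (intro tangent_local[OF X]) auto
  also have "\<dots> = X ?S" using tangent_add[OF X _ SC, of "\<lambda>_. f p"] tangent_const[OF X] by simp
  also have "\<dots> = (\<Sum>i<n. X (\<lambda>q. (y i q - y i p) * G i q))"
    using y(1) G(1) by (intro tangent_sum[OF X]) simp
  also have "\<dots> = (\<Sum>i<n. X (y i) * G i p)"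
  proof (rule sum.cong[OF refl])
    fix i assume "i \<in> {..<n}"
    then have i: "i < n" by simp
    show "X (\<lambda>q. (y i q - y i p) * G i q) = X (y i) * G i p"
      using tangent_mult[OF X, of "\<lambda>q. y i q - y i p" "G i"] tangent_diff[OF X y(1)[OF i], of "\<lambda>_. y i p"]
        tangent_const[OF X] y(1)[OF i] G(1) by simp
  qed
  finally show ?thesis by (simp add: Gp)
qed

definition PD :: "'p set \<Rightarrow> ('p \<Rightarrow> 'x::real_normed_vector) \<Rightarrow> 'x \<Rightarrow> ('p \<Rightarrow> real) \<Rightarrow> 'p \<Rightarrow> real"
  where "PD W \<kappa> v f q = frechet_derivative (f \<circ> inv_into W \<kappa>) (at (\<kappa> q)) v"

context
  fixes \<kappa> :: "'p \<Rightarrow> 'x::real_normed_vector" and W n bas and co :: "nat \<Rightarrow> 'x \<Rightarrow> real"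
  assumes \<kappa>: "compatible A W \<kappa>" and co: "coords n bas co"
begin

lemma compatible_facts: "open W" "inj_on \<kappa> W" "open (\<kappa> ` W)"
  using \<kappa> by (auto simp: compatible_def)

lemma PD_has_derivative:
  assumes "smooth_fun_on A W f" "q \<in> W"
  shows "((f \<circ> inv_into W \<kappa>) has_derivative (\<lambda>v. PD W \<kappa> v f q)) (at (\<kappa> q))"
proof -
  have "smooth_on (\<kappa> ` W) (f \<circ> inv_into W \<kappa>)"
    using assms(1) by (simp add: compatible_smooth_fun_on[OF \<kappa> co compatible_facts(1)])
  from smooth_on_has_derivative[OF this imageI[OF assms(2)]] show ?thesis by (simp add: PD_def)
qed

lemma PD_unique:
  "((f \<circ> inv_into W \<kappa>) has_derivative f') (at (\<kappa> q)) \<Longrightarrow> PD W \<kappa> v f q = f' v"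
  unfolding PD_def by (metis frechet_derivative_at)

lemma PD_cong:
  assumes "open V" "q \<in> V" "V \<subseteq> W" "\<And>q. q \<in> V \<Longrightarrow> f q = g q"
  shows "PD W \<kappa> v f q = PD W \<kappa> v g q"
proof -
  have "open (\<kappa> ` V)" using \<kappa> assms(1,3) by (auto simp: compatible_def)
  then have "frechet_derivative (f \<circ> inv_into W \<kappa>) (at (\<kappa> q)) = frechet_derivative (g \<circ> inv_into W \<kappa>) (at (\<kappa> q))"
    using assms compatible_facts(2)
    by (intro frechet_derivative_cong_open[of "\<kappa> ` V"]) (auto simp: inv_into_f_f subset_iff)
  then show ?thesis by (simp add: PD_def)
qed

lemma PD_add:
  assumes "smooth_fun_on A W f" "smooth_fun_on A W g" "q \<in> W"
  shows "PD W \<kappa> v (\<lambda>q. f q + g q) q = PD W \<kappa> v f q + PD W \<kappa> v g q"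
  by (rule PD_unique)
    (use has_derivative_add[OF PD_has_derivative[OF assms(1,3)] PD_has_derivative[OF assms(2,3)]] in \<open>simp add: o_def\<close>)

lemma PD_mult:
  assumes "smooth_fun_on A W f" "smooth_fun_on A W g" "q \<in> W"
  shows "PD W \<kappa> v (\<lambda>q. f q * g q) q = PD W \<kappa> v f q * g q + f q * PD W \<kappa> v g q"
  by (rule PD_unique)
    (use has_derivative_mult[OF PD_has_derivative[OF assms(1,3)] PD_has_derivative[OF assms(2,3)]]
      compatible_facts(2) assms(3) in \<open>simp add: o_def add.commute inv_into_f_f\<close>)

lemma PD_const: "PD W \<kappa> v (\<lambda>_. c) q = 0"
  by (simp add: PD_def o_def)

lemma PD_smooth: "smooth_fun_on A W f \<Longrightarrow> smooth_fun_on A W (\<lambda>q. PD W \<kappa> v f q)"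
  unfolding PD_def by (rule smooth_fun_on_derivative[OF \<kappa> co])

lemma PD_linear:
  assumes "bounded_linear h" "q \<in> W"
  shows "PD W \<kappa> v (\<lambda>q. h (\<kappa> q)) q = h v"
proof (rule PD_unique)
  have "(h has_derivative h) (at (\<kappa> q))" using assms(1) by (rule bounded_linear_imp_has_derivative)
  then show "((\<lambda>q. h (\<kappa> q)) \<circ> inv_into W \<kappa> has_derivative h) (at (\<kappa> q))"
    by (rule has_derivative_transform_within_open[OF _ compatible_facts(3)])
      (use assms(2) in \<open>auto simp: f_inv_into_f\<close>)
qed

lemma tangent_PD:
  assumes "q \<in> W"
  shows "(\<lambda>f. if f \<in> C then c * PD W \<kappa> v f q else 0) \<in> tangent_space A q"
  unfolding tangent_space_def Hom_def lin_on_def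
  using PD_add[OF C_smooth_fun_on C_smooth_fun_on assms] PD_mult[OF C_smooth_fun_on C_smooth_fun_on assms]
    PD_mult[OF C_smooth_fun_on C_smooth_fun_on assms, of "\<lambda>_. a" for a] PD_const
  by (auto simp: plus_fun_def scaleR_fun_def algebra_simps)

end

end

section \<open>Derivations and jets of a line bundle\<close>

sublocale line_bundle \<subseteq> mfd A
  by unfold_locales (rule manifold)

lemma scaleR_fun_apply [simp]: "(c *\<^sub>R f) x = c *\<^sub>R f x"
  by (simp add: scaleR_fun_def)

lemma lin_onD:
  assumes "lin_on S T h"
  shows "x \<in> S \<Longrightarrow> h x \<in> T" "x \<in> S \<Longrightarrow> y \<in> S \<Longrightarrow> h (x + y) = h x + h y" "x \<in> S \<Longrightarrow> h (a *\<^sub>R x) = a *\<^sub>R h x"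
  using assms unfolding lin_on_def by blast+

lemma (in mfd) tangentI:
  assumes "\<And>f g. f \<in> C \<Longrightarrow> g \<in> C \<Longrightarrow> X (\<lambda>q. f q + g q) = X f + X g"
    and "\<And>f c. f \<in> C \<Longrightarrow> X (\<lambda>q. c * f q) = c * X f"
    and "\<And>f g. f \<in> C \<Longrightarrow> g \<in> C \<Longrightarrow> X (\<lambda>q. f q * g q) = X f * g p + f p * X g"
    and "\<And>f. f \<notin> C \<Longrightarrow> X f = 0"
  shows "X \<in> tangent_space A p"
  unfolding tangent_space_def Hom_def lin_on_def using assms by (auto simp: plus_fun_def scaleR_fun_def)

context line_bundle
begin

lemma E_add: "v \<in> E p \<Longrightarrow> w \<in> E p \<Longrightarrow> v + w \<in> E p"
  and E_scale: "v \<in> E p \<Longrightarrow> c *\<^sub>R v \<in> E p"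
  and E_zero: "0 \<in> E p"
  and E_diff: "v \<in> E p \<Longrightarrow> w \<in> E p \<Longrightarrow> v - w \<in> E p"
  using fiber(1) by (auto intro: subspace_add subspace_scale subspace_0 subspace_diff)

lemma E_line:
  assumes "s \<in> E p" "s \<noteq> 0" "v \<in> E p"
  shows "\<exists>c. v = c *\<^sub>R s"
proof -
  obtain B where B: "B \<subseteq> E p" "independent B" "E p \<subseteq> span B" "card B = dim (E p)"
    using basis_exists by blast
  then obtain b where b: "B = {b}" using fiber(2) card_1_singletonE by metis
  then have "s \<in> range (\<lambda>k. k *\<^sub>R b)" "v \<in> range (\<lambda>k. k *\<^sub>R b)"
    using B(3) assms(1,3) unfolding b span_singleton by auto
  then obtain a c where ac: "s = a *\<^sub>R b" "v = c *\<^sub>R b" by auto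
  then have "a \<noteq> 0" using assms by auto
  then have "v = (c / a) *\<^sub>R s" using ac by simp
  then show ?thesis by blast
qed

definition coef :: "('p \<Rightarrow> 'v) \<Rightarrow> ('p \<Rightarrow> 'v) \<Rightarrow> 'p \<Rightarrow> real"
  where "coef s l q = (SOME c. l q = c *\<^sub>R s q)"

lemma coef_eq: "s q \<in> E q \<Longrightarrow> s q \<noteq> 0 \<Longrightarrow> l q \<in> E q \<Longrightarrow> coef s l q *\<^sub>R s q = l q"
  unfolding coef_def using someI_ex[OF E_line, of "s q" q "l q"] by simp

lemma coef_unique: "s q \<noteq> 0 \<Longrightarrow> l q = c *\<^sub>R s q \<Longrightarrow> coef s l q = c"
  unfolding coef_def by (rule some_equality) auto

lemma sec_iff: "l \<in> sec \<longleftrightarrow> (\<forall>p. l p \<in> E p) \<and> (\<forall>U s. (U, s) \<in> Fr \<longrightarrow> smooth_fun_on A U (coef s l))"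
proof
  assume l: "l \<in> sec"
  have "smooth_fun_on A U (coef s l)" if U: "(U, s) \<in> Fr" for U s
  proof -
    obtain f where f: "smooth_fun_on A U f" "\<forall>p\<in>U. l p = f p *\<^sub>R s p"
      using l U unfolding sec_def by blast
    then have "f q = coef s l q" if "q \<in> U" for q
      using coef_unique[of s q l "f q"] frame(2)[OF U that] that by simp
    then show ?thesis using smooth_fun_on_cong[OF frame(1)[OF U] _ f(1)] by blast
  qed
  then show "(\<forall>p. l p \<in> E p) \<and> (\<forall>U s. (U, s) \<in> Fr \<longrightarrow> smooth_fun_on A U (coef s l))"
    using l unfolding sec_def by blast
next
  assume *: "(\<forall>p. l p \<in> E p) \<and> (\<forall>U s. (U, s) \<in> Fr \<longrightarrow> smooth_fun_on A U (coef s l))"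
  have "\<exists>f. smooth_fun_on A U f \<and> (\<forall>p\<in>U. l p = f p *\<^sub>R s p)" if U: "(U, s) \<in> Fr" for U s
  proof (intro exI conjI ballI)
    show "smooth_fun_on A U (coef s l)" using * U by blast
    show "l p = coef s l p *\<^sub>R s p" if "p \<in> U" for p
      using coef_eq[of s p l] frame(2)[OF U that] * by simp
  qed
  then show "l \<in> sec" using * unfolding sec_def by blast
qed

lemma sec_E: "l \<in> sec \<Longrightarrow> l p \<in> E p"
  by (simp add: sec_iff)

lemma sec_local:
  assumes "\<And>p. \<exists>m\<in>sec. \<forall>\<^sub>F q in nhds p. l q = m q"
  shows "l \<in> sec"
  unfolding sec_iff
proof (intro conjI allI impI)
  fix p
  obtain m where m: "m \<in> sec" "\<forall>\<^sub>F q in nhds p. l q = m q" using assms by blast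
  show "l p \<in> E p" using sec_E[OF m(1)] eventually_nhds_x_imp_x[OF m(2)] by simp
next
  fix U s assume U: "(U, s) \<in> Fr"
  show "smooth_fun_on A U (coef s l)"
  proof (rule smooth_fun_on_local)
    fix p assume p: "p \<in> U"
    obtain m where m: "m \<in> sec" "\<forall>\<^sub>F q in nhds p. l q = m q" using assms by blast
    then obtain V where V: "open V" "p \<in> V" "\<And>q. q \<in> V \<Longrightarrow> l q = m q"
      unfolding eventually_nhds by blast
    have o: "open (U \<inter> V)" using V frame(1)[OF U] by blast
    have "smooth_fun_on A U (coef s m)" using m(1) U by (simp add: sec_iff)
    then have "smooth_fun_on A (U \<inter> V) (coef s m)" by (rule smooth_fun_on_subset) blast
    then have "smooth_fun_on A (U \<inter> V) (coef s l)"
      by (rule smooth_fun_on_cong[OF o, rotated]) (simp add: coef_def V(3))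
    then show "\<exists>V. open V \<and> p \<in> V \<and> smooth_fun_on A V (coef s l)" using o p V(2) by blast
  qed
qed

lemma sec_add: "l \<in> sec \<Longrightarrow> m \<in> sec \<Longrightarrow> (\<lambda>q. l q + m q) \<in> sec"
  unfolding sec_iff
proof (intro conjI allI impI)
  fix U s assume U: "(U, s) \<in> Fr"
    and l: "(\<forall>p. l p \<in> E p) \<and> (\<forall>U s. (U, s) \<in> Fr \<longrightarrow> smooth_fun_on A U (coef s l))"
    and m: "(\<forall>p. m p \<in> E p) \<and> (\<forall>U s. (U, s) \<in> Fr \<longrightarrow> smooth_fun_on A U (coef s m))"
  have 1: "smooth_fun_on A U (\<lambda>q. coef s l q + coef s m q)"
    using l m U frame(1) by (intro smooth_fun_on_add) auto
  have 2: "coef s l q + coef s m q = coef s (\<lambda>q. l q + m q) q" if "q \<in> U" for q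
    using coef_unique[of s q "\<lambda>q. l q + m q" "coef s l q + coef s m q"] coef_eq[of s q l] coef_eq[of s q m]
      frame(2)[OF U that] l m by (simp add: scaleR_add_left)
  show "smooth_fun_on A U (coef s (\<lambda>q. l q + m q))"
    by (rule smooth_fun_on_cong[OF frame(1)[OF U] 2 1])
qed (simp add: E_add)

lemma sec_scale: "f \<in> C \<Longrightarrow> l \<in> sec \<Longrightarrow> (\<lambda>q. f q *\<^sub>R l q) \<in> sec"
  unfolding sec_iff
proof (intro conjI allI impI)
  fix U s assume U: "(U, s) \<in> Fr" and f: "f \<in> C"
    and l: "(\<forall>p. l p \<in> E p) \<and> (\<forall>U s. (U, s) \<in> Fr \<longrightarrow> smooth_fun_on A U (coef s l))"
  have 1: "smooth_fun_on A U (\<lambda>q. f q * coef s l q)"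
    using l U frame(1) C_smooth_fun_on[OF f] by (intro smooth_fun_on_mult) auto
  have 2: "f q * coef s l q = coef s (\<lambda>q. f q *\<^sub>R l q) q" if "q \<in> U" for q
    using coef_unique[of s q "\<lambda>q. f q *\<^sub>R l q" "f q * coef s l q"] coef_eq[of s q l]
      frame(2)[OF U that] l by (simp flip: scaleR_scaleR)
  show "smooth_fun_on A U (coef s (\<lambda>q. f q *\<^sub>R l q))"
    by (rule smooth_fun_on_cong[OF frame(1)[OF U] 2 1])
qed (simp add: E_scale)

text \<open>The frame is a global section because point derivations act on global sections
  only.\<close>

definition frame_on :: "'p set \<Rightarrow> ('p \<Rightarrow> 'v) \<Rightarrow> bool"
  where "frame_on W s \<longleftrightarrow> open W \<and> s \<in> sec \<and> (\<forall>q\<in>W. s q \<noteq> 0) \<and> (\<forall>l\<in>sec. smooth_fun_on A W (coef s l))"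

lemma frame_on_subset: "frame_on W s \<Longrightarrow> open V \<Longrightarrow> V \<subseteq> W \<Longrightarrow> frame_on V s"
  unfolding frame_on_def by (auto intro: smooth_fun_on_subset)

lemma frame_on_coef: "frame_on W s \<Longrightarrow> q \<in> W \<Longrightarrow> l q \<in> E q \<Longrightarrow> coef s l q *\<^sub>R s q = l q"
  unfolding frame_on_def by (simp add: coef_eq sec_E)

text \<open>A frame of \<open>Fr\<close> times a bump function is a global section, smooth in the
  other frames by the transition functions; where the bump function is 1 the frame is
  unchanged.\<close>

lemma exists_frame: obtains W s where "p \<in> W" "frame_on W s"
proof -
  obtain U t where U: "(U, t) \<in> Fr" "p \<in> U" using frame_cover[unfolded set_eq_iff, rule_format, of p] by auto
  obtain b K where b: "b \<in> C" "closed K" "K \<subseteq> U" "\<And>q. q \<notin> K \<Longrightarrow> b q = 0" "\<forall>\<^sub>F q in nhds p. b q = 1"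
    by (rule bump[OF frame(1)[OF U(1)] U(2)]) blast
  let ?s = "\<lambda>q. if q \<in> U then b q *\<^sub>R t q else 0"
  have "?s \<in> sec" unfolding sec_iff
  proof (intro conjI allI impI)
    show "?s q \<in> E q" for q using frame(2)[OF U(1)] by (simp add: E_scale E_zero)
    fix V t' assume V: "(V, t') \<in> Fr"
    obtain g where g: "smooth_fun_on A (V \<inter> U) g" "\<forall>p\<in>V \<inter> U. t p = g p *\<^sub>R t' p"
      using transition[OF V U(1)] by blast
    have "smooth_fun_on A V (\<lambda>q. if q \<in> U then b q * g q else 0)"
      by (rule cutoff_on[OF frame(1)[OF V] frame(1)[OF U(1)] g(1) b(1-4)])
    moreover have "(if q \<in> U then b q * g q else 0) = coef t' ?s q" if "q \<in> V" for q
      using coef_unique[of t' q ?s "if q \<in> U then b q * g q else 0"] g(2) frame(2)[OF V that] that by auto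
    ultimately show "smooth_fun_on A V (coef t' ?s)"
      by (rule smooth_fun_on_cong[OF frame(1)[OF V], rotated])
  qed
  obtain T where T: "open T" "p \<in> T" "\<And>q. q \<in> T \<Longrightarrow> b q = 1"
    using b(5) unfolding eventually_nhds by blast
  have o: "open (U \<inter> T)" using T frame(1)[OF U(1)] by blast
  have "smooth_fun_on A (U \<inter> T) (coef ?s l)" if "l \<in> sec" for l
  proof -
    have "smooth_fun_on A U (coef t l)" using that U(1) by (simp add: sec_iff)
    then have "smooth_fun_on A (U \<inter> T) (coef t l)" by (rule smooth_fun_on_subset) blast
    then show ?thesis by (rule smooth_fun_on_cong[OF o, rotated]) (simp add: coef_def T(3))
  qed
  then have "frame_on (U \<inter> T) ?s"
    unfolding frame_on_def using o \<open>?s \<in> sec\<close> T(3) frame(2)[OF U(1)] by auto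
  then show thesis using that U(2) T(2) by blast
qed

lemma exists_nonzero_section: obtains s where "s \<in> sec" "s p \<noteq> 0"
proof -
  obtain W s where "p \<in> W" "frame_on W s" by (rule exists_frame)
  then show thesis using that[of s] by (auto simp: frame_on_def)
qed

lemma frame_on_germ:
  assumes "frame_on W s" "p \<in> W" "l \<in> sec"
  obtains c where "c \<in> C" "\<forall>\<^sub>F q in nhds p. l q = c q *\<^sub>R s q"
proof -
  have W: "open W" "smooth_fun_on A W (coef s l)" using assms by (auto simp: frame_on_def)
  obtain c where c: "c \<in> C" "\<forall>\<^sub>F q in nhds p. c q = coef s l q"
    by (rule germ_extension[OF W(1) assms(2) W(2)])
  have "\<forall>\<^sub>F q in nhds p. l q = c q *\<^sub>R s q"
    using c(2) eventually_nhds_in_open[OF W(1) assms(2)]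
    by eventually_elim (simp add: frame_on_coef[OF assms(1)] sec_E[OF assms(3)])
  then show thesis using that c(1) by blast
qed

text \<open>The function is recovered as the coefficient of its product with a local frame.
  Smoothness of symbols follows from this, since the Leibniz rule shows them only in such
  products.\<close>

lemma C_from_sec:
  assumes "\<And>s. s \<in> sec \<Longrightarrow> (\<lambda>q. f q *\<^sub>R s q) \<in> sec"
  shows "f \<in> C"
proof (rule C_local_open)
  fix p
  obtain W s where W: "p \<in> W" "frame_on W s" by (rule exists_frame)
  have "smooth_fun_on A W (coef s (\<lambda>q. f q *\<^sub>R s q))" using W(2) assms by (auto simp: frame_on_def)
  then have "smooth_fun_on A W f"
    by (rule smooth_fun_on_cong[rotated -1]) (use W(2) in \<open>auto simp: frame_on_def intro!: coef_unique\<close>)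
  then show "\<exists>V. open V \<and> p \<in> V \<and> smooth_fun_on A V f" using W by (auto simp: frame_on_def)
qed

lemma sec_zero: "(\<lambda>_. 0) \<in> sec"
proof -
  obtain s where "s \<in> sec" by (rule exists_nonzero_section)
  then show ?thesis using sec_scale[of "\<lambda>_. 0" s] by simp
qed

lemma sec_cscale: "l \<in> sec \<Longrightarrow> (\<lambda>q. c *\<^sub>R l q) \<in> sec"
  using sec_scale[of "\<lambda>_. c" l] by simp

lemma sec_uminus: "l \<in> sec \<Longrightarrow> (\<lambda>q. - l q) \<in> sec"
  using sec_cscale[of l "-1"] by simp

lemma sec_diff: "l \<in> sec \<Longrightarrow> m \<in> sec \<Longrightarrow> (\<lambda>q. l q - m q) \<in> sec"
  using sec_add[of l "\<lambda>q. - m q"] sec_uminus[of m] by simp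

subsection \<open>Point derivations\<close>

lemma D_E: "\<delta> \<in> D p \<Longrightarrow> l \<in> sec \<Longrightarrow> \<delta> l \<in> E p"
  and D_add: "\<delta> \<in> D p \<Longrightarrow> l \<in> sec \<Longrightarrow> m \<in> sec \<Longrightarrow> \<delta> (\<lambda>q. l q + m q) = \<delta> l + \<delta> m"
  and D_cscale: "\<delta> \<in> D p \<Longrightarrow> l \<in> sec \<Longrightarrow> \<delta> (\<lambda>q. c *\<^sub>R l q) = c *\<^sub>R \<delta> l"
  and D_outside: "\<delta> \<in> D p \<Longrightarrow> l \<notin> sec \<Longrightarrow> \<delta> l = 0"
  unfolding D_def Hom_def lin_on_def by (auto simp: plus_fun_def scaleR_fun_def)

lemma D_diff: "\<delta> \<in> D p \<Longrightarrow> l \<in> sec \<Longrightarrow> m \<in> sec \<Longrightarrow> \<delta> (\<lambda>q. l q - m q) = \<delta> l - \<delta> m"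
  using D_add[of \<delta> p l "\<lambda>q. (-1) *\<^sub>R m q"] D_cscale[of \<delta> p m "-1"] sec_cscale[of m "-1"] by simp

lemma D_zero_section: "\<delta> \<in> D p \<Longrightarrow> \<delta> (\<lambda>_. 0) = 0"
  using D_cscale[of \<delta> p "\<lambda>_. 0" 0] sec_zero by simp

lemma DI:
  assumes "\<And>l. l \<in> sec \<Longrightarrow> \<delta> l \<in> E p"
    and "\<And>l m. l \<in> sec \<Longrightarrow> m \<in> sec \<Longrightarrow> \<delta> (\<lambda>q. l q + m q) = \<delta> l + \<delta> m"
    and "\<And>l c. l \<in> sec \<Longrightarrow> \<delta> (\<lambda>q. c *\<^sub>R l q) = c *\<^sub>R \<delta> l"
    and "\<And>l. l \<notin> sec \<Longrightarrow> \<delta> l = 0" and "has_symbol p \<delta> X"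
  shows "\<delta> \<in> D p"
  unfolding D_def Hom_def lin_on_def using assms by (auto simp: plus_fun_def scaleR_fun_def)

text \<open>Evaluation on a section that does not vanish at \<open>p\<close> isolates the symbol in
  the Leibniz rule.\<close>

lemma has_symbol_unique:
  assumes "has_symbol p \<delta> X" "has_symbol p \<delta> Y"
  shows "X = Y"
proof
  fix f
  obtain s where s: "s \<in> sec" "s p \<noteq> 0" by (rule exists_nonzero_section)
  show "X f = Y f"
  proof (cases "f \<in> C")
    case True
    then have "\<delta> (\<lambda>q. f q *\<^sub>R s q) = Z f *\<^sub>R s p + f p *\<^sub>R \<delta> s" if "has_symbol p \<delta> Z" for Z
      using that s(1) by (simp add: has_symbol_def)
    from this[OF assms(1)] this[OF assms(2)] have "X f *\<^sub>R s p = Y f *\<^sub>R s p"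
      by (simp del: scaleR_cancel_right)
    then show ?thesis using s(2) by simp
  next
    case False
    then show ?thesis
      using assms tangent_outside[of X p f] tangent_outside[of Y p f] by (simp add: has_symbol_def)
  qed
qed

definition symbol :: "'p \<Rightarrow> ('p, 'v) der \<Rightarrow> ('p \<Rightarrow> real) \<Rightarrow> real"
  where "symbol p \<delta> = (THE X. has_symbol p \<delta> X)"

lemma symbol_eq: "has_symbol p \<delta> X \<Longrightarrow> symbol p \<delta> = X"
  unfolding symbol_def using has_symbol_unique by (blast intro: the_equality)

lemma symbol: "\<delta> \<in> D p \<Longrightarrow> has_symbol p \<delta> (symbol p \<delta>)"
  using symbol_eq unfolding D_def by auto

lemma symbol_tangent: "\<delta> \<in> D p \<Longrightarrow> symbol p \<delta> \<in> tangent_space A p"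
  using symbol unfolding has_symbol_def by blast

lemma D_leibniz:
  "\<delta> \<in> D p \<Longrightarrow> f \<in> C \<Longrightarrow> l \<in> sec \<Longrightarrow> \<delta> (\<lambda>q. f q *\<^sub>R l q) = symbol p \<delta> f *\<^sub>R l p + f p *\<^sub>R \<delta> l"
  using symbol unfolding has_symbol_def by blast

text \<open>The argument of \<open>tangent_local\<close>, with the Leibniz rule of
  \<open>\<delta>\<close> in place of that of a tangent vector.\<close>

lemma D_local:
  assumes \<delta>: "\<delta> \<in> D p" and lm: "l \<in> sec" "m \<in> sec" "\<forall>\<^sub>F q in nhds p. l q = m q"
  shows "\<delta> l = \<delta> m"
proof -
  obtain W where W: "open W" "p \<in> W" "\<And>q. q \<in> W \<Longrightarrow> l q = m q"
    using lm(3) unfolding eventually_nhds by blast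
  obtain b K where b: "b \<in> C" "closed K" "K \<subseteq> W" "\<And>q. q \<notin> K \<Longrightarrow> b q = 0" "\<forall>\<^sub>F q in nhds p. b q = 1"
    by (rule bump[OF W(1,2)]) blast
  have "b p = 1" using b(5) by (rule eventually_nhds_x_imp_x)
  have lms: "(\<lambda>q. l q - m q) \<in> sec" using lm by (simp add: sec_diff)
  have "(\<lambda>q. l q - m q) = (\<lambda>q. (1 - b q) *\<^sub>R (l q - m q))"
  proof
    fix q
    have "q \<in> W \<or> b q = 0" using b(3,4) by blast
    then show "l q - m q = (1 - b q) *\<^sub>R (l q - m q)" using W(3) by auto
  qed
  then have "\<delta> (\<lambda>q. l q - m q) = \<delta> (\<lambda>q. (1 - b q) *\<^sub>R (l q - m q))" by simp
  also have "\<dots> = symbol p \<delta> (\<lambda>q. 1 - b q) *\<^sub>R (l p - m p) + (1 - b p) *\<^sub>R \<delta> (\<lambda>q. l q - m q)"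
    using D_leibniz[OF \<delta> _ lms, of "\<lambda>q. 1 - b q"] b(1) by simp
  also have "\<dots> = 0" using \<open>b p = 1\<close> W(2,3) by simp
  finally show ?thesis using D_diff[OF \<delta> lm(1,2)] by simp
qed

lemma has_symbol_add:
  assumes "\<delta> \<in> D p" "\<epsilon> \<in> D p"
  shows "has_symbol p (\<delta> + \<epsilon>) (symbol p \<delta> + symbol p \<epsilon>)"
  using symbol[OF assms(1)] symbol[OF assms(2)]
  unfolding has_symbol_def tangent_space_def Hom_def lin_on_def
  by (auto simp: algebra_simps plus_fun_def)

lemma has_symbol_scaleR:
  assumes "\<delta> \<in> D p"
  shows "has_symbol p (c *\<^sub>R \<delta>) (c *\<^sub>R symbol p \<delta>)"
  using symbol[OF assms]
  unfolding has_symbol_def tangent_space_def Hom_def lin_on_def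
  by (auto simp: algebra_simps scaleR_fun_def)

lemma D_plus: "\<delta> \<in> D p \<Longrightarrow> \<epsilon> \<in> D p \<Longrightarrow> \<delta> + \<epsilon> \<in> D p"
  by (rule DI[OF _ _ _ _ has_symbol_add])
    (auto simp: plus_fun_apply D_E E_add D_add D_cscale D_outside scaleR_add_right)

lemma D_scaleR: "\<delta> \<in> D p \<Longrightarrow> c *\<^sub>R \<delta> \<in> D p"
  by (rule DI[OF _ _ _ _ has_symbol_scaleR])
    (auto simp: D_E E_scale D_add D_cscale D_outside scaleR_add_right)

lemma symbol_add: "\<delta> \<in> D p \<Longrightarrow> \<epsilon> \<in> D p \<Longrightarrow> symbol p (\<delta> + \<epsilon>) f = symbol p \<delta> f + symbol p \<epsilon> f"
  by (simp only: symbol_eq[OF has_symbol_add] plus_fun_apply)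

lemma symbol_scaleR: "\<delta> \<in> D p \<Longrightarrow> symbol p (c *\<^sub>R \<delta>) f = c * symbol p \<delta> f"
  by (simp only: symbol_eq[OF has_symbol_scaleR] scaleR_fun_apply real_scaleR_def)

text \<open>The identity derivation 1 of L at \<open>p\<close>, which spans the kernel of the
  symbol. The value 0 outside \<open>sec\<close> is the convention of \<open>Hom\<close>.\<close>

definition idd :: "'p \<Rightarrow> ('p, 'v) der"
  where "idd p = (\<lambda>l. if l \<in> sec then l p else 0)"

lemma has_symbol_idd: "has_symbol p (idd p) (\<lambda>_. 0)"
  unfolding has_symbol_def tangent_space_def Hom_def lin_on_def idd_def by (auto simp: sec_scale)

lemma idd_D: "idd p \<in> D p"
  by (rule DI[OF _ _ _ _ has_symbol_idd]) (auto simp: idd_def sec_E sec_add sec_cscale)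

lemma symbol_idd: "symbol p (idd p) f = 0"
  by (simp add: symbol_eq[OF has_symbol_idd])

lemma D_zero: "0 \<in> D p"
  using D_scaleR[OF idd_D, of 0] by simp

lemma D_minus: "\<delta> \<in> D p \<Longrightarrow> - \<delta> \<in> D p"
  using D_scaleR[of \<delta> p "-1"] by simp

lemma D_minus2: "\<delta> \<in> D p \<Longrightarrow> \<epsilon> \<in> D p \<Longrightarrow> \<delta> - \<epsilon> \<in> D p"
  using D_plus[of \<delta> p "- \<epsilon>"] D_minus by simp

lemma symbol_diff: "\<delta> \<in> D p \<Longrightarrow> \<epsilon> \<in> D p \<Longrightarrow> symbol p (\<delta> - \<epsilon>) f = symbol p \<delta> f - symbol p \<epsilon> f"
  using symbol_add[of \<delta> p "(-1) *\<^sub>R \<epsilon>" f] symbol_scaleR[of \<epsilon> p "-1" f] D_scaleR[of \<epsilon> p "-1"] by simp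

lemma symbol_zero: "symbol p 0 f = 0"
  using symbol_scaleR[OF idd_D, of p 0 f] by simp

lemma D_sum: "(\<And>i. i \<in> I \<Longrightarrow> \<delta> i \<in> D p) \<Longrightarrow> (\<Sum>i\<in>I. \<delta> i) \<in> D p"
  by (induction I rule: infinite_finite_induct) (auto simp: D_zero D_plus)

lemma symbol_sum: "(\<And>i. i \<in> I \<Longrightarrow> \<delta> i \<in> D p) \<Longrightarrow> symbol p (\<Sum>i\<in>I. \<delta> i) f = (\<Sum>i\<in>I. symbol p (\<delta> i) f)"
  by (induction I rule: infinite_finite_induct) (auto simp: symbol_zero symbol_add D_sum)

text \<open>Near \<open>p\<close> each section is a function times the frame, so the Leibniz rule
  computes a derivation from its symbol and its value on the frame.\<close>

lemma D_eqI:
  assumes "\<delta> \<in> D p" "\<epsilon> \<in> D p" "frame_on W s" "p \<in> W" "\<delta> s = \<epsilon> s"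
    and "\<And>f. f \<in> C \<Longrightarrow> symbol p \<delta> f = symbol p \<epsilon> f"
  shows "\<delta> = \<epsilon>"
proof
  fix l
  show "\<delta> l = \<epsilon> l"
  proof (cases "l \<in> sec")
    case True
    obtain c where c: "c \<in> C" "\<forall>\<^sub>F q in nhds p. l q = c q *\<^sub>R s q"
      by (rule frame_on_germ[OF assms(3,4) True])
    have s: "s \<in> sec" using assms(3) by (simp add: frame_on_def)
    have "\<delta> l = \<delta> (\<lambda>q. c q *\<^sub>R s q)" "\<epsilon> l = \<epsilon> (\<lambda>q. c q *\<^sub>R s q)"
      using D_local[OF _ True sec_scale[OF c(1) s] c(2)] assms(1,2) by auto
    then show ?thesis
      using D_leibniz[OF assms(1) c(1) s] D_leibniz[OF assms(2) c(1) s] assms(5,6) c(1) by simp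
  qed (simp add: assms D_outside[of _ p])
qed

subsection \<open>Sections\<close>

lemma dsecI: "(\<And>p. \<Delta> p \<in> D p) \<Longrightarrow> (\<And>l. l \<in> sec \<Longrightarrow> (\<lambda>p. \<Delta> p l) \<in> sec) \<Longrightarrow> \<Delta> \<in> dsec"
  by (simp add: dsec_def act_def)

lemma dsec_D: "\<Delta> \<in> dsec \<Longrightarrow> \<Delta> p \<in> D p"
  by (simp add: dsec_def)

lemma dsec_sec: "\<Delta> \<in> dsec \<Longrightarrow> l \<in> sec \<Longrightarrow> (\<lambda>p. \<Delta> p l) \<in> sec"
  by (simp add: dsec_def act_def)

lemma dsec_local:
  assumes "\<And>p. \<exists>\<Delta>'\<in>dsec. \<forall>\<^sub>F q in nhds p. \<Delta> q = \<Delta>' q"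
  shows "\<Delta> \<in> dsec"
proof (rule dsecI)
  fix p
  obtain \<Delta>' where \<Delta>': "\<Delta>' \<in> dsec" "\<forall>\<^sub>F q in nhds p. \<Delta> q = \<Delta>' q" using assms by blast
  show "\<Delta> p \<in> D p"
    using eventually_nhds_x_imp_x[OF \<Delta>'(2)] dsec_D[OF \<Delta>'(1)] by simp
next
  fix l assume l: "l \<in> sec"
  show "(\<lambda>p. \<Delta> p l) \<in> sec"
  proof (rule sec_local)
    fix p
    obtain \<Delta>' where "\<Delta>' \<in> dsec" "\<forall>\<^sub>F q in nhds p. \<Delta> q = \<Delta>' q" using assms by blast
    then show "\<exists>m\<in>sec. \<forall>\<^sub>F q in nhds p. \<Delta> q l = m q"
      using dsec_sec[OF _ l] by (intro bexI[of _ "\<lambda>p. \<Delta>' p l"]) (auto elim: eventually_mono)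
  qed
qed

lemma dsec_add: "\<Delta> \<in> dsec \<Longrightarrow> \<Delta>' \<in> dsec \<Longrightarrow> (\<lambda>p. \<Delta> p + \<Delta>' p) \<in> dsec"
  by (rule dsecI) (auto simp: dsec_D D_plus plus_fun_apply sec_add dsec_sec)

lemma dsec_scale: "f \<in> C \<Longrightarrow> \<Delta> \<in> dsec \<Longrightarrow> (\<lambda>p. f p *\<^sub>R \<Delta> p) \<in> dsec"
  by (rule dsecI) (auto simp: dsec_D D_scaleR sec_scale dsec_sec)

lemma idd_dsec: "idd \<in> dsec"
  by (rule dsecI, rule idd_D) (simp add: idd_def)

lemma dsec_zero: "(\<lambda>_. 0) \<in> dsec"
  using dsec_scale[OF _ idd_dsec, of "\<lambda>_. 0"] by simp

lemma dsec_cscale: "\<Delta> \<in> dsec \<Longrightarrow> (\<lambda>p. c *\<^sub>R \<Delta> p) \<in> dsec"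
  using dsec_scale[of "\<lambda>_. c"] by simp

lemma dsec_uminus: "\<Delta> \<in> dsec \<Longrightarrow> (\<lambda>p. - \<Delta> p) \<in> dsec"
  using dsec_cscale[of \<Delta> "-1"] by simp

lemma dsec_diff: "\<Delta> \<in> dsec \<Longrightarrow> \<Delta>' \<in> dsec \<Longrightarrow> (\<lambda>p. \<Delta> p - \<Delta>' p) \<in> dsec"
  using dsec_add[of \<Delta> "\<lambda>p. - \<Delta>' p"] dsec_uminus by simp

lemma dsec_sum: "(\<And>i. i \<in> I \<Longrightarrow> \<Delta> i \<in> dsec) \<Longrightarrow> (\<lambda>p. \<Sum>i\<in>I. \<Delta> i p) \<in> dsec"
  by (induction I rule: infinite_finite_induct) (auto simp: dsec_zero dsec_add)

lemma symbol_C: "\<Delta> \<in> dsec \<Longrightarrow> f \<in> C \<Longrightarrow> (\<lambda>q. symbol q (\<Delta> q) f) \<in> C"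
proof (rule C_from_sec)
  fix s assume \<Delta>: "\<Delta> \<in> dsec" and f: "f \<in> C" and s: "s \<in> sec"
  have "(\<lambda>q. symbol q (\<Delta> q) f *\<^sub>R s q) = (\<lambda>q. \<Delta> q (\<lambda>q. f q *\<^sub>R s q) - f q *\<^sub>R \<Delta> q s)"
    using D_leibniz[OF dsec_D[OF \<Delta>] f s] by (simp add: fun_eq_iff)
  also have "\<dots> \<in> sec"
    by (rule sec_diff[OF dsec_sec[OF \<Delta> sec_scale[OF f s]] sec_scale[OF f dsec_sec[OF \<Delta> s]]])
  finally show "(\<lambda>q. symbol q (\<Delta> q) f *\<^sub>R s q) \<in> sec" .
qed

lemma dbracket_apply: "dbracket \<Delta> \<Delta>' p l = \<Delta> p (\<lambda>q. \<Delta>' q l) - \<Delta>' p (\<lambda>q. \<Delta> q l)"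
  by (simp add: dbracket_def act_def)

lemma has_symbol_dbracket:
  assumes \<Delta>: "\<Delta> \<in> dsec" "\<Delta>' \<in> dsec"
  shows "has_symbol p (dbracket \<Delta> \<Delta>' p)
    (\<lambda>f. symbol p (\<Delta> p) (\<lambda>q. symbol q (\<Delta>' q) f) - symbol p (\<Delta>' p) (\<lambda>q. symbol q (\<Delta> q) f))"
proof -
  let ?X = "\<lambda>q. symbol q (\<Delta> q)" and ?Y = "\<lambda>q. symbol q (\<Delta>' q)"
  have T: "?X q \<in> tangent_space A q" "?Y q \<in> tangent_space A q" for q
    using symbol_tangent dsec_D \<Delta> by auto
  have [simp]: "(\<lambda>q. ?X q f) \<in> C" "(\<lambda>q. ?Y q f) \<in> C" if "f \<in> C" for f
    using symbol_C \<Delta> that by auto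
  let ?Z = "\<lambda>f. ?X p (\<lambda>q. ?Y q f) - ?Y p (\<lambda>q. ?X q f)"
  have Z: "?Z \<in> tangent_space A p"
  proof (rule tangentI)
    fix f g assume fg: "f \<in> C" "g \<in> C"
    show "?Z (\<lambda>x. f x + g x) = ?Z f + ?Z g"
      using fg by (simp add: T[THEN tangent_add])
    show "?Z (\<lambda>x. f x * g x) = ?Z f * g p + f p * ?Z g"
      using fg by (simp add: T[THEN tangent_add] T[THEN tangent_mult] algebra_simps)
  next
    fix f :: "'p \<Rightarrow> real" and c :: real assume f: "f \<in> C"
    show "?Z (\<lambda>x. c * f x) = c * ?Z f"
      using f by (simp add: T[THEN tangent_scale] algebra_simps)
  next
    fix f :: "'p \<Rightarrow> real" assume f: "f \<notin> C"
    then show "?Z f = 0"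
      using T[THEN tangent_outside] T[THEN tangent_const] by simp
  qed
  moreover have "dbracket \<Delta> \<Delta>' p (\<lambda>q. f q *\<^sub>R l q) = ?Z f *\<^sub>R l p + f p *\<^sub>R dbracket \<Delta> \<Delta>' p l"
    if f: "f \<in> C" and l: "l \<in> sec" for f l
  proof -
    have [simp]: "(\<lambda>q. \<Delta> q l) \<in> sec" "(\<lambda>q. \<Delta>' q l) \<in> sec" using \<Delta> l dsec_sec by auto
    have D: "\<Delta> q \<in> D q" "\<Delta>' q \<in> D q" for q using \<Delta> dsec_D by auto
    show ?thesis
      using f l by (simp add: dbracket_apply D[THEN D_leibniz] D[THEN D_add] sec_scale algebra_simps)
  qed
  ultimately show ?thesis unfolding has_symbol_def by blast
qed

lemma dbracket_dsec:
  assumes "\<Delta> \<in> dsec" "\<Delta>' \<in> dsec"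
  shows "dbracket \<Delta> \<Delta>' \<in> dsec"
proof (rule dsecI)
  have D: "\<Delta> q \<in> D q" "\<Delta>' q \<in> D q" for q using assms dsec_D by auto
  have [simp]: "(\<lambda>q. \<Delta> q l) \<in> sec" "(\<lambda>q. \<Delta>' q l) \<in> sec" if "l \<in> sec" for l using assms that dsec_sec by auto
  show "dbracket \<Delta> \<Delta>' p \<in> D p" for p
    by (rule DI[OF _ _ _ _ has_symbol_dbracket[OF assms]])
      (auto simp: dbracket_apply D[THEN D_E] E_diff D[THEN D_add] D[THEN D_cscale] D[THEN D_outside]
        D[THEN D_zero_section] algebra_simps)
  fix l assume l: "l \<in> sec"
  show "(\<lambda>p. dbracket \<Delta> \<Delta>' p l) \<in> sec"
    unfolding dbracket_apply
    by (rule sec_diff[OF dsec_sec[OF assms(1) dsec_sec[OF assms(2) l]] dsec_sec[OF assms(2) dsec_sec[OF assms(1) l]]])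
qed

lemma symbol_dbracket:
  "\<Delta> \<in> dsec \<Longrightarrow> \<Delta>' \<in> dsec \<Longrightarrow> symbol p (dbracket \<Delta> \<Delta>' p) f =
    symbol p (\<Delta> p) (\<lambda>q. symbol q (\<Delta>' q) f) - symbol p (\<Delta>' p) (\<lambda>q. symbol q (\<Delta> q) f)"
  by (simp add: symbol_eq[OF has_symbol_dbracket])

lemma dbracket_antisym: "dbracket \<Delta> \<Delta>' p = - dbracket \<Delta>' \<Delta> p"
  by (simp add: dbracket_def fun_eq_iff)

lemma dbracket_outside: "\<Delta> \<in> dsec \<Longrightarrow> \<Delta>' \<in> dsec \<Longrightarrow> l \<notin> sec \<Longrightarrow> dbracket \<Delta> \<Delta>' p l = 0"
  by (rule D_outside[OF dsec_D[OF dbracket_dsec]])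

lemma dbracket_add:
  assumes "\<Delta> \<in> dsec" "\<Delta>1 \<in> dsec" "\<Delta>2 \<in> dsec"
  shows "dbracket \<Delta> (\<lambda>q. \<Delta>1 q + \<Delta>2 q) p = dbracket \<Delta> \<Delta>1 p + dbracket \<Delta> \<Delta>2 p"
proof
  fix l
  show "dbracket \<Delta> (\<lambda>q. \<Delta>1 q + \<Delta>2 q) p l = (dbracket \<Delta> \<Delta>1 p + dbracket \<Delta> \<Delta>2 p) l"
  proof (cases "l \<in> sec")
    case True
    then show ?thesis using assms D_add[OF dsec_D[OF assms(1)]] dsec_sec
      by (simp add: dbracket_apply plus_fun_apply)
  next
    case False
    then show ?thesis
      using assms dsec_add[OF assms(2,3)] by (simp add: dbracket_outside)
  qed
qed

lemma dbracket_scale: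
  assumes "\<Delta> \<in> dsec" "\<Delta>' \<in> dsec" "f \<in> C"
  shows "dbracket \<Delta> (\<lambda>q. f q *\<^sub>R \<Delta>' q) p = symbol p (\<Delta> p) f *\<^sub>R \<Delta>' p + f p *\<^sub>R dbracket \<Delta> \<Delta>' p"
proof
  fix l
  show "dbracket \<Delta> (\<lambda>q. f q *\<^sub>R \<Delta>' q) p l = (symbol p (\<Delta> p) f *\<^sub>R \<Delta>' p + f p *\<^sub>R dbracket \<Delta> \<Delta>' p) l"
  proof (cases "l \<in> sec")
    case True
    then show ?thesis using assms D_leibniz[OF dsec_D[OF assms(1)]] dsec_sec
      by (simp add: dbracket_apply plus_fun_apply algebra_simps)
  next
    case False
    then show ?thesis
      using assms dsec_scale[OF assms(3,2)] D_outside[OF dsec_D[OF assms(2)] False]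
      by (simp add: dbracket_outside)
  qed
qed

lemma dbracket_jacobi:
  assumes "\<Delta>0 \<in> dsec" "\<Delta>1 \<in> dsec" "\<Delta>2 \<in> dsec"
  shows "dbracket (dbracket \<Delta>0 \<Delta>1) \<Delta>2 p - dbracket (dbracket \<Delta>0 \<Delta>2) \<Delta>1 p + dbracket (dbracket \<Delta>1 \<Delta>2) \<Delta>0 p = 0"
proof
  fix l
  show "(dbracket (dbracket \<Delta>0 \<Delta>1) \<Delta>2 p - dbracket (dbracket \<Delta>0 \<Delta>2) \<Delta>1 p + dbracket (dbracket \<Delta>1 \<Delta>2) \<Delta>0 p) l = 0 l"
  proof (cases "l \<in> sec")
    case True
    have S: "(\<lambda>q. \<Delta>0 q m) \<in> sec" "(\<lambda>q. \<Delta>1 q m) \<in> sec" "(\<lambda>q. \<Delta>2 q m) \<in> sec" if "m \<in> sec" for m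
      using assms that dsec_sec by auto
    note d = D_diff[OF dsec_D[OF assms(1)]] D_diff[OF dsec_D[OF assms(2)]] D_diff[OF dsec_D[OF assms(3)]]
    show ?thesis using True by (simp add: dbracket_apply d S)
  next
    case False
    then show ?thesis
      using assms by (simp add: dbracket_outside dbracket_dsec)
  qed
qed

section \<open>Jets and their sections\<close>

lemma J1_E: "\<alpha> \<in> J1 p \<Longrightarrow> \<delta> \<in> D p \<Longrightarrow> \<alpha> \<delta> \<in> E p"
  and J1_add: "\<alpha> \<in> J1 p \<Longrightarrow> \<delta> \<in> D p \<Longrightarrow> \<epsilon> \<in> D p \<Longrightarrow> \<alpha> (\<delta> + \<epsilon>) = \<alpha> \<delta> + \<alpha> \<epsilon>"
  and J1_scaleR: "\<alpha> \<in> J1 p \<Longrightarrow> \<delta> \<in> D p \<Longrightarrow> \<alpha> (c *\<^sub>R \<delta>) = c *\<^sub>R \<alpha> \<delta>"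
  and J1_outside: "\<alpha> \<in> J1 p \<Longrightarrow> \<delta> \<notin> D p \<Longrightarrow> \<alpha> \<delta> = 0"
  unfolding J1_def Hom_def lin_on_def by auto

lemma J1_zero: "\<alpha> \<in> J1 p \<Longrightarrow> \<alpha> 0 = 0"
  using J1_scaleR[OF _ idd_D, of \<alpha> p 0] by simp

lemma J1_uminus: "\<alpha> \<in> J1 p \<Longrightarrow> \<delta> \<in> D p \<Longrightarrow> \<alpha> (- \<delta>) = - \<alpha> \<delta>"
  using J1_scaleR[of \<alpha> p \<delta> "-1"] by simp

lemma J1_diff: "\<alpha> \<in> J1 p \<Longrightarrow> \<delta> \<in> D p \<Longrightarrow> \<epsilon> \<in> D p \<Longrightarrow> \<alpha> (\<delta> - \<epsilon>) = \<alpha> \<delta> - \<alpha> \<epsilon>"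
  using J1_add[of \<alpha> p \<delta> "- \<epsilon>"] J1_uminus[of \<alpha> p \<epsilon>] D_minus by simp

lemma J1_sum: "\<alpha> \<in> J1 p \<Longrightarrow> (\<And>i. i \<in> I \<Longrightarrow> \<delta> i \<in> D p) \<Longrightarrow> \<alpha> (\<Sum>i\<in>I. \<delta> i) = (\<Sum>i\<in>I. \<alpha> (\<delta> i))"
  by (induction I rule: infinite_finite_induct) (auto simp: J1_zero J1_add D_sum)

lemma J1I:
  assumes "\<And>\<delta>. \<delta> \<in> D p \<Longrightarrow> \<alpha> \<delta> \<in> E p"
    and "\<And>\<delta> \<epsilon>. \<delta> \<in> D p \<Longrightarrow> \<epsilon> \<in> D p \<Longrightarrow> \<alpha> (\<delta> + \<epsilon>) = \<alpha> \<delta> + \<alpha> \<epsilon>"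
    and "\<And>\<delta> c. \<delta> \<in> D p \<Longrightarrow> \<alpha> (c *\<^sub>R \<delta>) = c *\<^sub>R \<alpha> \<delta>"
    and "\<And>\<delta>. \<delta> \<notin> D p \<Longrightarrow> \<alpha> \<delta> = 0"
  shows "\<alpha> \<in> J1 p"
  unfolding J1_def Hom_def lin_on_def using assms by auto

lemma J1_eqI: "\<alpha> \<in> J1 p \<Longrightarrow> \<beta> \<in> J1 p \<Longrightarrow> (\<And>\<delta>. \<delta> \<in> D p \<Longrightarrow> \<alpha> \<delta> = \<beta> \<delta>) \<Longrightarrow> \<alpha> = \<beta>"
  using J1_outside by (metis ext)

lemma J1_plus: "\<alpha> \<in> J1 p \<Longrightarrow> \<beta> \<in> J1 p \<Longrightarrow> \<alpha> + \<beta> \<in> J1 p"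
  by (rule J1I) (auto simp: plus_fun_apply J1_E E_add J1_add J1_scaleR J1_outside scaleR_add_right)

lemma J1_scale: "\<alpha> \<in> J1 p \<Longrightarrow> c *\<^sub>R \<alpha> \<in> J1 p"
  by (rule J1I) (auto simp: J1_E E_scale J1_add J1_scaleR J1_outside scaleR_add_right)

lemma J1_zero_mem: "0 \<in> J1 p"
  by (rule J1I) (auto simp: E_zero)

lemma J1_neg: "\<alpha> \<in> J1 p \<Longrightarrow> - \<alpha> \<in> J1 p"
  using J1_scale[of \<alpha> p "-1"] by simp

lemma J1_minus: "\<alpha> \<in> J1 p \<Longrightarrow> \<beta> \<in> J1 p \<Longrightarrow> \<alpha> - \<beta> \<in> J1 p"
  using J1_plus[of \<alpha> p "- \<beta>"] J1_neg by simp

lemma J1_sum_mem: "(\<And>i. i \<in> I \<Longrightarrow> \<alpha> i \<in> J1 p) \<Longrightarrow> (\<Sum>i\<in>I. \<alpha> i) \<in> J1 p"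
  by (induction I rule: infinite_finite_induct) (auto simp: J1_zero_mem J1_plus)

lemma jsecI: "(\<And>p. \<psi> p \<in> J1 p) \<Longrightarrow> (\<And>\<Delta>. \<Delta> \<in> dsec \<Longrightarrow> (\<lambda>p. \<psi> p (\<Delta> p)) \<in> sec) \<Longrightarrow> \<psi> \<in> jsec"
  by (simp add: jsec_def)

lemma jsec_J1: "\<psi> \<in> jsec \<Longrightarrow> \<psi> p \<in> J1 p"
  by (simp add: jsec_def)

lemma jsec_sec: "\<psi> \<in> jsec \<Longrightarrow> \<Delta> \<in> dsec \<Longrightarrow> (\<lambda>p. \<psi> p (\<Delta> p)) \<in> sec"
  by (simp add: jsec_def)

lemma jsec_local:
  assumes "\<And>p. \<exists>\<psi>'\<in>jsec. \<forall>\<^sub>F q in nhds p. \<psi> q = \<psi>' q"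
  shows "\<psi> \<in> jsec"
proof (rule jsecI)
  fix p
  obtain \<psi>' where \<psi>': "\<psi>' \<in> jsec" "\<forall>\<^sub>F q in nhds p. \<psi> q = \<psi>' q" using assms by blast
  show "\<psi> p \<in> J1 p"
    using eventually_nhds_x_imp_x[OF \<psi>'(2)] jsec_J1[OF \<psi>'(1)] by simp
next
  fix \<Delta> assume \<Delta>: "\<Delta> \<in> dsec"
  show "(\<lambda>p. \<psi> p (\<Delta> p)) \<in> sec"
  proof (rule sec_local)
    fix p
    obtain \<psi>' where "\<psi>' \<in> jsec" "\<forall>\<^sub>F q in nhds p. \<psi> q = \<psi>' q" using assms by blast
    then show "\<exists>m\<in>sec. \<forall>\<^sub>F q in nhds p. \<psi> q (\<Delta> q) = m q"
      using jsec_sec[OF _ \<Delta>] by (intro bexI[of _ "\<lambda>p. \<psi>' p (\<Delta> p)"]) (auto elim: eventually_mono)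
  qed
qed

lemma jsec_add: "\<psi> \<in> jsec \<Longrightarrow> \<psi>' \<in> jsec \<Longrightarrow> (\<lambda>p. \<psi> p + \<psi>' p) \<in> jsec"
  by (rule jsecI) (auto simp: jsec_J1 J1_plus plus_fun_apply sec_add jsec_sec)

lemma jsec_scale: "f \<in> C \<Longrightarrow> \<psi> \<in> jsec \<Longrightarrow> (\<lambda>p. f p *\<^sub>R \<psi> p) \<in> jsec"
  by (rule jsecI) (auto simp: jsec_J1 J1_scale sec_scale jsec_sec)

lemma jsec_zero: "(\<lambda>_. 0) \<in> jsec"
  by (rule jsecI) (auto simp: J1_zero_mem sec_zero)

lemma jsec_cscale: "\<psi> \<in> jsec \<Longrightarrow> (\<lambda>p. c *\<^sub>R \<psi> p) \<in> jsec"
  using jsec_scale[of "\<lambda>_. c"] by simp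

lemma jsec_uminus: "\<psi> \<in> jsec \<Longrightarrow> (\<lambda>p. - \<psi> p) \<in> jsec"
  using jsec_cscale[of \<psi> "-1"] by simp

lemma jsec_diff: "\<psi> \<in> jsec \<Longrightarrow> \<psi>' \<in> jsec \<Longrightarrow> (\<lambda>p. \<psi> p - \<psi>' p) \<in> jsec"
  using jsec_add[of \<psi> "\<lambda>p. - \<psi>' p"] jsec_uminus by simp

lemma jsec_sum: "(\<And>i. i \<in> I \<Longrightarrow> \<psi> i \<in> jsec) \<Longrightarrow> (\<lambda>p. \<Sum>i\<in>I. \<psi> i p) \<in> jsec"
  by (induction I rule: infinite_finite_induct) (auto simp: jsec_zero jsec_add)

lemma j1_jsec: "l \<in> sec \<Longrightarrow> j1 l \<in> jsec"
proof (rule jsecI)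
  assume l: "l \<in> sec"
  show "j1 l p \<in> J1 p" for p
  proof (rule J1I)
    fix \<delta> assume d: "\<delta> \<in> D p"
    show "j1 l p \<delta> \<in> E p" using d D_E[OF d l] by (simp add: j1_def)
    show "j1 l p (\<delta> + \<epsilon>) = j1 l p \<delta> + j1 l p \<epsilon>" if "\<epsilon> \<in> D p" for \<epsilon>
      using d that D_plus[OF d that] by (simp add: j1_def)
    show "j1 l p (c *\<^sub>R \<delta>) = c *\<^sub>R j1 l p \<delta>" for c
      using d D_scaleR[OF d, of c] by (simp add: j1_def)
  qed (simp add: j1_def)
  show "(\<lambda>p. j1 l p (\<Delta> p)) \<in> sec" if "\<Delta> \<in> dsec" for \<Delta>
    using that by (simp add: j1_def dsec_D dsec_sec[OF _ l])
qed

lemma j1_apply: "\<delta> \<in> D p \<Longrightarrow> j1 l p \<delta> = \<delta> l"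
  by (simp add: j1_def)

end

section \<open>Frames adapted to a fiber bundle over a complex manifold\<close>

lemma compatibleI:
  assumes "open W" "inj_on \<kappa> W" "continuous_on W \<kappa>" "\<And>T. open T \<Longrightarrow> T \<subseteq> W \<Longrightarrow> open (\<kappa> ` T)"
    and "\<And>U \<phi>. (U, \<phi>) \<in> A \<Longrightarrow> smooth_on (\<phi> ` (U \<inter> W)) (\<kappa> \<circ> inv_into U \<phi>) \<and>
      smooth_on (\<kappa> ` (U \<inter> W)) (\<phi> \<circ> inv_into W \<kappa>)"
  shows "compatible A W \<kappa>"
  unfolding compatible_def using assms by auto

lemma (in mfd) compatible_subset:
  fixes \<kappa> :: "'p \<Rightarrow> 'x::real_normed_vector"
  assumes \<kappa>: "compatible A W \<kappa>" and V: "open V" "V \<subseteq> W"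
  shows "compatible A V \<kappa>"
proof -
  have inj: "inj_on \<kappa> W" "inj_on \<kappa> V" using \<kappa> V unfolding compatible_def by (auto intro: inj_on_subset)
  have "smooth_on (\<phi> ` (U \<inter> V)) (\<kappa> \<circ> inv_into U \<phi>) \<and> smooth_on (\<kappa> ` (U \<inter> V)) (\<phi> \<circ> inv_into V \<kappa>)"
    if U: "(U, \<phi>) \<in> A" for U \<phi>
  proof
    show "smooth_on (\<phi> ` (U \<inter> V)) (\<kappa> \<circ> inv_into U \<phi>)"
      by (rule smooth_on_subset[OF compatibleD(1)[OF \<kappa> U]]) (use V(2) in auto)
    have "smooth_on (\<kappa> ` (U \<inter> V)) (\<phi> \<circ> inv_into W \<kappa>)"
      by (rule smooth_on_subset[OF compatibleD(2)[OF \<kappa> U]]) (use V(2) in auto)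
    moreover have "open (\<kappa> ` (U \<inter> V))"
      using \<kappa> V chart_open[OF U] unfolding compatible_def by (meson open_Int inf.cobounded2 order_trans)
    moreover have "(\<phi> \<circ> inv_into W \<kappa>) x = (\<phi> \<circ> inv_into V \<kappa>) x" if "x \<in> \<kappa> ` (U \<inter> V)" for x
      using that V(2) inj by (auto simp: inv_into_f_f subset_iff)
    ultimately show "smooth_on (\<kappa> ` (U \<inter> V)) (\<phi> \<circ> inv_into V \<kappa>)"
      using smooth_on_cong[of "\<kappa> ` (U \<inter> V)" "\<phi> \<circ> inv_into W \<kappa>" "\<phi> \<circ> inv_into V \<kappa>"] by simp
  qed
  note smooth = this
  have cont: "continuous_on V \<kappa>"
    using \<kappa> V(2) unfolding compatible_def by (auto intro: continuous_on_subset)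
  have "open (\<kappa> ` T)" if "open T" "T \<subseteq> V" for T
    using \<kappa> V(2) that unfolding compatible_def by (meson order_trans)
  then show ?thesis by (intro compatibleI V(1) inj(2) cont smooth)
qed

lemma open_map_prod_image:
  assumes "\<And>S. open S \<Longrightarrow> S \<subseteq> V \<Longrightarrow> open (f ` S)" "\<And>S. open S \<Longrightarrow> S \<subseteq> V' \<Longrightarrow> open (g ` S)"
    and "open V" "open V'" "open T" "T \<subseteq> V \<times> V'"
  shows "open (map_prod f g ` T)"
  unfolding open_prod_def
proof
  fix x assume "x \<in> map_prod f g ` T"
  then obtain a b where ab: "(a, b) \<in> T" "x = (f a, g b)" by auto
  obtain S S' where S: "open S" "open S'" "(a, b) \<in> S \<times> S'" "S \<times> S' \<subseteq> T"
    using open_prod_elim[OF assms(5) ab(1)] by metis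
  have "open (f ` (S \<inter> V))" "open (g ` (S' \<inter> V'))"
    using S(1,2) assms(3,4) by (auto intro!: assms(1,2))
  moreover have "x \<in> f ` (S \<inter> V) \<times> g ` (S' \<inter> V')" using S(3) ab assms(6) by auto
  moreover have "f ` (S \<inter> V) \<times> g ` (S' \<inter> V') \<subseteq> map_prod f g ` T" using S(4) by auto
  ultimately show "\<exists>A B. open A \<and> open B \<and> x \<in> A \<times> B \<and> A \<times> B \<subseteq> map_prod f g ` T" by blast
qed

context line_bundle
begin

text \<open>The flat connection for which the frame \<open>s\<close> is parallel, in the direction
  of the constant vector \<open>v\<close> of the chart. The cutoff \<open>b\<close> makes it a
  global section of DL.\<close>

definition nabla :: "'p set \<Rightarrow> ('p \<Rightarrow> 'x::real_normed_vector) \<Rightarrow> ('p \<Rightarrow> 'v) \<Rightarrow> ('p \<Rightarrow> real) \<Rightarrow> 'x \<Rightarrow> 'p \<Rightarrow> ('p, 'v) der"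
  where "nabla W \<kappa> s b v q =
    (\<lambda>l. if l \<in> sec \<and> q \<in> W then (b q * PD W \<kappa> v (coef s l) q) *\<^sub>R s q else 0)"

context
  fixes \<kappa> :: "'p \<Rightarrow> 'x::real_normed_vector" and W n bas and co :: "nat \<Rightarrow> 'x \<Rightarrow> real" and s b K
  assumes \<kappa>: "compatible A W \<kappa>" and co: "coords n bas co" and s: "frame_on W s"
    and b: "b \<in> C" "closed K" "K \<subseteq> W" "\<And>q. q \<notin> K \<Longrightarrow> b q = 0"
begin

lemma coef_PD:
  assumes "q \<in> W"
  shows "l \<in> sec \<Longrightarrow> m \<in> sec \<Longrightarrow> PD W \<kappa> v (coef s (\<lambda>q. l q + m q)) q = PD W \<kappa> v (coef s l) q + PD W \<kappa> v (coef s m) q"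
    and "f \<in> C \<Longrightarrow> l \<in> sec \<Longrightarrow> PD W \<kappa> v (coef s (\<lambda>q. f q *\<^sub>R l q)) q =
      PD W \<kappa> v f q * coef s l q + f q * PD W \<kappa> v (coef s l) q"
    and "PD W \<kappa> v (coef s s) q = 0"
proof -
  have W: "open W" using s by (simp add: frame_on_def)
  have ne: "s q \<noteq> 0" if "q \<in> W" for q using s that by (simp add: frame_on_def)
  have sm: "smooth_fun_on A W (coef s l)" if "l \<in> sec" for l using s that by (simp add: frame_on_def)
  have e: "coef s l q *\<^sub>R s q = l q" if "l \<in> sec" "q \<in> W" for l q
    using frame_on_coef[OF s that(2), of l] sec_E[OF that(1)] by simp
  {
    assume lm: "l \<in> sec" "m \<in> sec"
    have "PD W \<kappa> v (coef s (\<lambda>q. l q + m q)) q = PD W \<kappa> v (\<lambda>q. coef s l q + coef s m q) q"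
      by (rule PD_cong[OF \<kappa> co W assms order_refl])
        (auto intro!: coef_unique simp: ne scaleR_add_left e lm)
    then show "PD W \<kappa> v (coef s (\<lambda>q. l q + m q)) q = PD W \<kappa> v (coef s l) q + PD W \<kappa> v (coef s m) q"
      using PD_add[OF \<kappa> co sm[OF lm(1)] sm[OF lm(2)] assms] by simp
  }
  {
    assume fl: "f \<in> C" "l \<in> sec"
    have "PD W \<kappa> v (coef s (\<lambda>q. f q *\<^sub>R l q)) q = PD W \<kappa> v (\<lambda>q. f q * coef s l q) q"
      by (rule PD_cong[OF \<kappa> co W assms order_refl])
        (auto intro!: coef_unique simp: ne e fl simp flip: scaleR_scaleR)
    then show "PD W \<kappa> v (coef s (\<lambda>q. f q *\<^sub>R l q)) q =
        PD W \<kappa> v f q * coef s l q + f q * PD W \<kappa> v (coef s l) q"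
      using PD_mult[OF \<kappa> co C_smooth_fun_on[OF fl(1)] sm[OF fl(2)] assms] by simp
  }
  have "PD W \<kappa> v (coef s s) q = PD W \<kappa> v (\<lambda>_. 1) q"
    by (rule PD_cong[OF \<kappa> co W assms order_refl]) (auto intro!: coef_unique simp: ne)
  then show "PD W \<kappa> v (coef s s) q = 0" by (simp add: PD_const[OF \<kappa> co])
qed

lemma has_symbol_nabla:
  "has_symbol q (nabla W \<kappa> s b v q) (\<lambda>f. if f \<in> C \<and> q \<in> W then b q * PD W \<kappa> v f q else 0)"
  unfolding has_symbol_def
proof (intro conjI ballI)
  show "(\<lambda>f. if f \<in> C \<and> q \<in> W then b q * PD W \<kappa> v f q else 0) \<in> tangent_space A q"
  proof (cases "q \<in> W")
    case True
    then show ?thesis using tangent_PD[OF \<kappa> co True, of "b q" v] by simp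
  next
    case False
    then show ?thesis by (intro tangentI) auto
  qed
  fix f l assume fl: "f \<in> C" "l \<in> sec"
  show "nabla W \<kappa> s b v q (\<lambda>q. f q *\<^sub>R l q) =
      (if f \<in> C \<and> q \<in> W then b q * PD W \<kappa> v f q else 0) *\<^sub>R l q + f q *\<^sub>R nabla W \<kappa> s b v q l"
  proof (cases "q \<in> W")
    case True
    have "coef s l q *\<^sub>R s q = l q" using frame_on_coef[OF s True, of l] sec_E[OF fl(2)] by simp
    then have "(b q * (PD W \<kappa> v f q * coef s l q)) *\<^sub>R s q = (b q * PD W \<kappa> v f q) *\<^sub>R l q"
      by (simp flip: scaleR_scaleR)
    then show ?thesis
      using True fl sec_scale[OF fl] by (simp add: nabla_def coef_PD(2)[OF True fl] algebra_simps)
  next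
    case False
    then show ?thesis by (simp add: nabla_def)
  qed
qed

lemma nabla_D: "nabla W \<kappa> s b v q \<in> D q"
proof (rule DI[OF _ _ _ _ has_symbol_nabla])
  have "s q \<in> E q" using s by (simp add: frame_on_def sec_E)
  then show "nabla W \<kappa> s b v q l \<in> E q" for l by (simp add: nabla_def E_scale E_zero)
  show "nabla W \<kappa> s b v q (\<lambda>q. l q + m q) = nabla W \<kappa> s b v q l + nabla W \<kappa> s b v q m"
    if "l \<in> sec" "m \<in> sec" for l m
    using that sec_add[OF that] by (simp add: nabla_def coef_PD(1) algebra_simps)
  show "nabla W \<kappa> s b v q (\<lambda>q. c *\<^sub>R l q) = c *\<^sub>R nabla W \<kappa> s b v q l" if "l \<in> sec" for l c
    using that sec_cscale[OF that, of c] coef_PD(2)[of q "\<lambda>_. c" l v] by (simp add: nabla_def PD_const[OF \<kappa> co])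
qed (simp add: nabla_def)

lemma symbol_nabla: "symbol q (nabla W \<kappa> s b v q) f = (if f \<in> C \<and> q \<in> W then b q * PD W \<kappa> v f q else 0)"
  by (simp add: symbol_eq[OF has_symbol_nabla])

lemma nabla_frame: "nabla W \<kappa> s b v q s = 0"
  by (simp add: nabla_def coef_PD(3))

lemma nabla_dsec: "nabla W \<kappa> s b v \<in> dsec"
proof (rule dsecI[OF nabla_D])
  fix l assume l: "l \<in> sec"
  have W: "open W" "s \<in> sec" "smooth_fun_on A W (coef s l)" using s l by (auto simp: frame_on_def)
  have "(\<lambda>q. if q \<in> W then b q * PD W \<kappa> v (coef s l) q else 0) \<in> C"
    by (rule cutoff[OF W(1) PD_smooth[OF \<kappa> co W(3)] b])
  from sec_scale[OF this W(2)]
  show "(\<lambda>q. nabla W \<kappa> s b v q l) \<in> sec"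
    by (rule back_subst[of "\<lambda>x. x \<in> sec"]) (auto simp: nabla_def l)
qed

end

end

section \<open>Charts adapted to the projection\<close>

locale fibered = line_bundle A E Fr
  for A :: "('p::{t2_space, second_countable_topology}, 'e::real_normed_vector) atlas"
    and E :: "'p \<Rightarrow> 'v::real_vector set" and Fr +
  fixes B :: "('m::{t2_space, second_countable_topology}, 'c::real_normed_vector) atlas"
    and F :: "('f::{t2_space, second_countable_topology}, 'd::real_normed_vector) atlas"
    and \<pi> :: "'p \<Rightarrow> 'm" and I :: "'c \<Rightarrow> 'c"
  assumes cplx: "complex_manifold I B" and fbundle: "fiber_bundle A B F \<pi>"
begin

sublocale base: mfd B
  using cplx by unfold_locales (simp add: complex_manifold_def)

sublocale fib: mfd F
  using fbundle by unfold_locales (simp add: fiber_bundle_def)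

lemma I_linear: "linear I" and I_I: "I (I v) = - v"
  using cplx by (auto simp: complex_manifold_def)

lemma continuous_pi: "continuous_on UNIV \<pi>"
  using fbundle unfolding fiber_bundle_def smooth_map_on_def by blast

text \<open>The chart is a local trivialization followed by a chart of the base times a chart of the
  fiber, so its model space is a product.\<close>

lemma adapted_chart:
  obtains W V \<psi> and \<kappa> :: "'p \<Rightarrow> 'c \<times> 'd" where "p \<in> W" "compatible A W \<kappa>" "(V, \<psi>) \<in> B"
    "\<And>q. q \<in> W \<Longrightarrow> \<pi> q \<in> V" "\<And>q. q \<in> W \<Longrightarrow> fst (\<kappa> q) = \<psi> (\<pi> q)"
proof -
  obtain U h k where U: "open U" "\<pi> p \<in> U" and hom: "homeomorphism (\<pi> -` U) (U \<times> UNIV) h k"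
    and sh: "smooth_map_on A (prod_atlas B F) (\<pi> -` U) h"
    and sk: "smooth_map_on (prod_atlas B F) A (U \<times> UNIV) k"
    and fh: "\<forall>q\<in>\<pi> -` U. fst (h q) = \<pi> q"
    using fbundle unfolding fiber_bundle_def by meson
  obtain V \<psi> where V: "(V, \<psi>) \<in> B" "\<pi> p \<in> V" by (rule base.chart_at)
  obtain V' \<psi>' where V': "(V', \<psi>') \<in> F" "snd (h p) \<in> V'" by (rule fib.chart_at)
  let ?\<Psi> = "map_prod \<psi> \<psi>'" and ?W = "h -` (V \<times> V') \<inter> \<pi> -` U"
  have prod: "(V \<times> V', ?\<Psi>) \<in> prod_atlas B F" unfolding prod_atlas_def using V(1) V'(1) by blast
  have ov: "open (V \<times> V')" using base.chart_open[OF V(1)] fib.chart_open[OF V'(1)] by (rule open_Times)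
  have oU: "open (\<pi> -` U)" using continuous_pi U(1) by (simp add: continuous_on_open_vimage open_vimage)
  have h: "continuous_on (\<pi> -` U) h" "h ` (\<pi> -` U) = U \<times> UNIV" "\<And>q. q \<in> \<pi> -` U \<Longrightarrow> k (h q) = q"
    and k: "continuous_on (U \<times> UNIV) k" "k ` (U \<times> UNIV) = \<pi> -` U" "\<And>z. z \<in> U \<times> UNIV \<Longrightarrow> h (k z) = z"
    using hom by (auto simp: homeomorphism_def)
  have oW: "open ?W" using h(1) oU ov by (metis continuous_on_open_vimage)
  have inj\<Psi>: "inj_on ?\<Psi> (V \<times> V')"
    by (rule map_prod_inj_on[OF base.chart_inj[OF V(1)] fib.chart_inj[OF V'(1)]])
  have injh: "inj_on h (\<pi> -` U)" using h(3) by (rule inj_on_inverseI)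
  let ?\<kappa> = "?\<Psi> \<circ> h"
  have inj: "inj_on ?\<kappa> ?W"
  proof (rule comp_inj_on)
    show "inj_on h ?W" by (rule inj_on_subset[OF injh]) blast
    show "inj_on ?\<Psi> (h ` ?W)" by (rule inj_on_subset[OF inj\<Psi>]) auto
  qed
  have cont: "continuous_on ?W ?\<kappa>"
  proof (rule continuous_on_compose)
    show "continuous_on ?W h" by (rule continuous_on_subset[OF h(1)]) blast
    have c: "continuous_on V \<psi>" "continuous_on V' \<psi>'"
      using base.chart_hom[OF V(1)] fib.chart_hom[OF V'(1)] by (auto simp: homeomorphism_def)
    have "continuous_on (V \<times> V') (\<lambda>z. \<psi> (fst z))"
      by (rule continuous_on_compose2[OF c(1) continuous_on_fst[OF continuous_on_id]]) auto
    moreover have "continuous_on (V \<times> V') (\<lambda>z. \<psi>' (snd z))"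
      by (rule continuous_on_compose2[OF c(2) continuous_on_snd[OF continuous_on_id]]) auto
    ultimately have "continuous_on (V \<times> V') (\<lambda>z. (\<psi> (fst z), \<psi>' (snd z)))"
      by (rule continuous_on_Pair)
    then have "continuous_on (V \<times> V') ?\<Psi>" by (simp add: map_prod_def case_prod_unfold)
    then show "continuous_on (h ` ?W) ?\<Psi>" by (rule continuous_on_subset) auto
  qed
  \<comment> \<open>Images under \<open>h\<close> are preimages under its inverse \<open>k\<close>,
    so their openness follows from continuity of \<open>k\<close>.\<close>
  have himg: "h ` T = k -` T \<inter> (U \<times> UNIV)" if "T \<subseteq> \<pi> -` U" for T
  proof (intro equalityI subsetI)
    fix z assume "z \<in> h ` T"
    then show "z \<in> k -` T \<inter> (U \<times> UNIV)" using that h(2,3) by auto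
  next
    fix z assume "z \<in> k -` T \<inter> (U \<times> UNIV)"
    then show "z \<in> h ` T" using k(3)[of z] by (intro image_eqI[of _ _ "k z"]) auto
  qed
  have opn: "open (?\<kappa> ` T)" if "open T" "T \<subseteq> ?W" for T
  proof -
    have "open (U \<times> (UNIV :: 'f set))" using U(1) by (simp add: open_Times)
    then have oT: "open (h ` T)"
      using that k(1) himg[of T] by (metis continuous_on_open_vimage inf.boundedE)
    have "open (?\<Psi> ` h ` T)"
      by (rule open_map_prod_image[OF base.chart_open_image[OF V(1)] fib.chart_open_image[OF V'(1)]
            base.chart_open[OF V(1)] fib.chart_open[OF V'(1)] oT]) (use that in auto)
    then show ?thesis by (simp add: image_comp)
  qed
  have "smooth_on (\<phi> ` (U' \<inter> ?W)) (?\<kappa> \<circ> inv_into U' \<phi>) \<and> smooth_on (?\<kappa> ` (U' \<inter> ?W)) (\<phi> \<circ> inv_into ?W ?\<kappa>)"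
    if U': "(U', \<phi>) \<in> A" for U' \<phi>
  proof
    have "smooth_on (\<phi> ` (U' \<inter> \<pi> -` U \<inter> h -` (V \<times> V'))) (?\<Psi> \<circ> h \<circ> inv_into U' \<phi>)"
      using sh U' prod unfolding smooth_map_on_def by blast
    then show "smooth_on (\<phi> ` (U' \<inter> ?W)) (?\<kappa> \<circ> inv_into U' \<phi>)" by (simp add: Int_ac)
    have "h ` (U' \<inter> ?W) = V \<times> V' \<inter> (U \<times> UNIV) \<inter> k -` U'"
    proof (intro equalityI subsetI)
      fix z assume "z \<in> h ` (U' \<inter> ?W)"
      then obtain q where q: "q \<in> U'" "q \<in> ?W" "z = h q" by blast
      then have "k z = q" using h(3) by simp
      then show "z \<in> V \<times> V' \<inter> (U \<times> UNIV) \<inter> k -` U'" using q h(2) by auto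
    next
      fix z assume z: "z \<in> V \<times> V' \<inter> (U \<times> UNIV) \<inter> k -` U'"
      then have "k z \<in> \<pi> -` U" using k(2) by blast
      then show "z \<in> h ` (U' \<inter> ?W)" using z k(3)[of z] by (intro image_eqI[of _ _ "k z"]) auto
    qed
    then have im: "?\<kappa> ` (U' \<inter> ?W) = ?\<Psi> ` (V \<times> V' \<inter> (U \<times> UNIV) \<inter> k -` U')" by (metis image_comp)
    have "smooth_on (?\<kappa> ` (U' \<inter> ?W)) (\<phi> \<circ> k \<circ> inv_into (V \<times> V') ?\<Psi>)"
      unfolding im using sk U' prod unfolding smooth_map_on_def by blast
    moreover have "open (?\<kappa> ` (U' \<inter> ?W))" using chart_open[OF U'] oW by (intro opn) auto
    moreover have "(\<phi> \<circ> k \<circ> inv_into (V \<times> V') ?\<Psi>) x = (\<phi> \<circ> inv_into ?W ?\<kappa>) x" if "x \<in> ?\<kappa> ` (U' \<inter> ?W)" for x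
    proof -
      from that obtain q where q: "q \<in> U'" "q \<in> ?W" "x = ?\<kappa> q" by blast
      have "inv_into (V \<times> V') ?\<Psi> (?\<Psi> (h q)) = h q" using q(2) by (intro inv_into_f_f[OF inj\<Psi>]) auto
      moreover have "inv_into ?W ?\<kappa> (?\<kappa> q) = q" by (rule inv_into_f_f[OF inj q(2)])
      ultimately show ?thesis using q h(3) by simp
    qed
    ultimately show "smooth_on (?\<kappa> ` (U' \<inter> ?W)) (\<phi> \<circ> inv_into ?W ?\<kappa>)"
      using smooth_on_cong[of "?\<kappa> ` (U' \<inter> ?W)" "\<phi> \<circ> k \<circ> inv_into (V \<times> V') ?\<Psi>" "\<phi> \<circ> inv_into ?W ?\<kappa>"] by simp
  qed
  then have comp: "compatible A ?W ?\<kappa>" by (intro compatibleI oW inj cont opn)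
  have p: "p \<in> ?W" using U(2) V(2) V'(2) fh by (auto simp: mem_Times_iff)
  have "\<pi> q \<in> V" "fst (?\<kappa> q) = \<psi> (\<pi> q)" if "q \<in> ?W" for q
    using that fh by (auto simp: mem_Times_iff fst_map_prod)
  then show thesis by (rule that[OF p comp V(1)])
qed

lemma pullback_C: "g \<in> base.C \<Longrightarrow> g \<circ> \<pi> \<in> C"
proof (rule C_local_open)
  fix p assume g: "g \<in> base.C"
  obtain V \<psi> where V: "(V, \<psi>) \<in> B" "\<pi> p \<in> V" by (rule base.chart_at)
  have oV: "open (\<pi> -` V)"
    using continuous_pi base.chart_open[OF V(1)] by (simp add: continuous_on_open_vimage open_vimage)
  obtain n b c where "coords n (b :: nat \<Rightarrow> 'c) c" by (rule base.model_coords)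
  then interpret X: coords n b c .
  have "smooth_fun_on A (\<pi> -` V) (g \<circ> \<pi>)"
  proof (rule smooth_fun_onI)
    fix U \<phi> assume U: "(U, \<phi>) \<in> A"
    let ?T = "\<phi> ` (U \<inter> \<pi> -` V)"
    have "smooth_on (\<phi> ` (U \<inter> UNIV \<inter> \<pi> -` V)) (\<psi> \<circ> \<pi> \<circ> inv_into U \<phi>)"
      using fbundle U V(1) unfolding fiber_bundle_def smooth_map_on_def by blast
    then have s: "smooth_on ?T (\<psi> \<circ> \<pi> \<circ> inv_into U \<phi>)" by simp
    have T: "open ?T" by (rule open_chart_Int[OF U oV])
    have sg: "smooth_on (\<psi> ` V) (\<lambda>x. g (inv_into V \<psi> x))"
      using base.smooth_fun_onD[OF base.C_smooth_fun_on[OF g, of UNIV] V(1)] by simp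
    have "smooth_on ?T (\<lambda>x. g (inv_into V \<psi> ((\<psi> \<circ> \<pi> \<circ> inv_into U \<phi>) x)))"
      by (rule X.smooth_on_compose[OF T base.chart_image[OF V(1)] _ s sg])
        (use chart_inj[OF U] in auto)
    moreover have "g (inv_into V \<psi> ((\<psi> \<circ> \<pi> \<circ> inv_into U \<phi>) x)) = (g \<circ> \<pi>) (inv_into U \<phi> x)" if "x \<in> ?T" for x
      using that chart_inj[OF U] base.chart_inj[OF V(1)] by auto
    ultimately show "smooth_on ?T (\<lambda>x. (g \<circ> \<pi>) (inv_into U \<phi> x))"
      using smooth_on_cong[OF T, of "\<lambda>x. g (inv_into V \<psi> ((\<psi> \<circ> \<pi> \<circ> inv_into U \<phi>) x))"
          "\<lambda>x. (g \<circ> \<pi>) (inv_into U \<phi> x)"] by simp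
  qed
  then show "\<exists>V. open V \<and> p \<in> V \<and> smooth_fun_on A V (g \<circ> \<pi>)" using oV V(2) by blast
qed

text \<open>In an adapted chart \<open>g \<circ> \<pi>\<close> is the coordinate expression of
  \<open>g\<close> after \<open>fst\<close>, so only the base component of the direction
  counts.\<close>

lemma PD_pullback:
  fixes \<kappa> :: "'p \<Rightarrow> 'c \<times> 'd"
  assumes \<kappa>: "compatible A W \<kappa>" and co: "coords n bas (co :: nat \<Rightarrow> 'c \<times> 'd \<Rightarrow> real)"
    and V: "(V, \<psi>) \<in> B" "\<And>q. q \<in> W \<Longrightarrow> \<pi> q \<in> V" "\<And>q. q \<in> W \<Longrightarrow> fst (\<kappa> q) = \<psi> (\<pi> q)"
    and g: "g \<in> base.C" and q: "q \<in> W"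
  shows "PD W \<kappa> v (g \<circ> \<pi>) q = base.PD V \<psi> (fst v) g (\<pi> q)"
proof (rule PD_unique[OF \<kappa> co])
  obtain n' b' c' where co': "coords n' (b' :: nat \<Rightarrow> 'c) c'" by (rule base.model_coords)
  have d: "(g \<circ> inv_into V \<psi> has_derivative (\<lambda>v. base.PD V \<psi> v g (\<pi> q))) (at (fst (\<kappa> q)))"
    unfolding V(3)[OF q]
    by (rule base.PD_has_derivative[OF base.chart_compatible[OF V(1)] co' base.C_smooth_fun_on[OF g] V(2)[OF q]])
  have f: "(fst has_derivative fst) (at (\<kappa> q))" by (rule bounded_linear_imp_has_derivative[OF bounded_linear_fst])
  have o: "open (\<kappa> ` W)" "inj_on \<kappa> W" using compatible_facts[OF \<kappa> co] by auto
  have eq: "(g \<circ> inv_into V \<psi>) (fst x) = ((g \<circ> \<pi>) \<circ> inv_into W \<kappa>) x" if "x \<in> \<kappa> ` W" for x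
    using that o(2) V(2,3) base.chart_inj[OF V(1)] by (auto simp: inv_into_f_f)
  show "((g \<circ> \<pi>) \<circ> inv_into W \<kappa> has_derivative (\<lambda>v. base.PD V \<psi> (fst v) g (\<pi> q))) (at (\<kappa> q))"
    by (rule has_derivative_transform_within_open[OF has_derivative_compose[OF f d] o(1) imageI[OF q] eq])
qed

lemma VerL_iff: "\<delta> \<in> VerL B \<pi> p \<longleftrightarrow> \<delta> \<in> D p \<and> (\<forall>g\<in>base.C. symbol p \<delta> (g \<circ> \<pi>) = 0)"
proof -
  have "tangent_map B \<pi> X = 0 \<longleftrightarrow> (\<forall>g\<in>base.C. X (g \<circ> \<pi>) = 0)" for X
    by (auto simp: tangent_map_def fun_eq_iff)
  moreover have "(\<exists>X\<in>Ver A B \<pi> p. has_symbol p \<delta> X) \<longleftrightarrow> symbol p \<delta> \<in> Ver A B \<pi> p" if "\<delta> \<in> D p"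
    using symbol[OF that] symbol_eq by metis
  ultimately show ?thesis
    unfolding VerL_def Ver_def using symbol_tangent by auto
qed

end

section \<open>Derivations that project to type (0,1)\<close>

context fibered
begin

text \<open>Pairs \<open>(f, g)\<close> for which \<open>g + \<i> f\<close> is holomorphic near a point, that is
  \<open>dg = df \<circ> I\<close>. They cut out the complex derivations that project to type (0,1).\<close>

definition CR :: "'m \<Rightarrow> (('m \<Rightarrow> real) \<times> ('m \<Rightarrow> real)) set"
  where "CR x = {(f, g). f \<in> base.C \<and> g \<in> base.C \<and>
    (\<forall>\<^sub>F x' in nhds x. \<forall>V \<psi>. (V, \<psi>) \<in> B \<longrightarrow> x' \<in> V \<longrightarrow>
      (\<forall>v. base.PD V \<psi> v g x' = base.PD V \<psi> (I v) f x'))}"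

text \<open>With F and G the pullbacks of f and g, only the real part of (\<delta>1 + i \<delta>2)(G
  + i F) = 0 is imposed. The imaginary part is, up to sign, the real part for i (G + i F), and
  \<open>CR\<close> is stable under this multiplication by \<open>CR_rotate\<close>.\<close>

definition T01 :: "'p \<Rightarrow> (('p, 'v) der \<times> ('p, 'v) der) set"
  where "T01 p = {(\<delta>1, \<delta>2). \<delta>1 \<in> D p \<and> \<delta>2 \<in> D p \<and>
    (\<forall>(f, g)\<in>CR (\<pi> p). symbol p \<delta>1 (g \<circ> \<pi>) = symbol p \<delta>2 (f \<circ> \<pi>))}"

lemma base_PD_linear:
  assumes "(V, \<psi>) \<in> B" "x \<in> V" "g \<in> base.C"
  shows "linear (\<lambda>v. base.PD V \<psi> v g x)"
proof -
  obtain n' b' c' where co': "coords n' (b' :: nat \<Rightarrow> 'c) c'" by (rule base.model_coords)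
  show ?thesis
    by (rule has_derivative_linear[OF base.PD_has_derivative[OF base.chart_compatible[OF assms(1)] co'
            base.C_smooth_fun_on[OF assms(3)] assms(2)]])
qed

lemma CR_C: "(f, g) \<in> CR x \<Longrightarrow> f \<in> base.C \<and> g \<in> base.C"
  by (simp add: CR_def)

text \<open>\<open>CR\<close> asks for its equation near the point and not only at it, because
  involutivity of \<open>T01\<close> differentiates the equation.\<close>

lemma CR_eventually: "(f, g) \<in> CR x \<Longrightarrow> \<forall>\<^sub>F x' in nhds x. (f, g) \<in> CR x'"
  by (simp add: CR_def eventually_eventually)

lemma CR_PD:
  assumes "(f, g) \<in> CR x" "(V, \<psi>) \<in> B" "x \<in> V"
  shows "base.PD V \<psi> v g x = base.PD V \<psi> (I v) f x"
proof -
  have "\<forall>\<^sub>F x' in nhds x. \<forall>V \<psi>. (V, \<psi>) \<in> B \<longrightarrow> x' \<in> V \<longrightarrow>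
      (\<forall>v. base.PD V \<psi> v g x' = base.PD V \<psi> (I v) f x')"
    using assms(1) by (simp add: CR_def)
  from eventually_nhds_x_imp_x[OF this] show ?thesis using assms(2,3) by blast
qed

text \<open>The new pair stands for - f + i g = i (g + i f).\<close>

lemma CR_rotate:
  assumes "(f, g) \<in> CR x"
  shows "(g, \<lambda>q. - f q) \<in> CR x"
proof -
  have C: "f \<in> base.C" "g \<in> base.C" using CR_C[OF assms] by auto
  have ev: "\<forall>\<^sub>F x' in nhds x. (f, g) \<in> CR x'" by (rule CR_eventually[OF assms])
  have "base.PD V \<psi> v (\<lambda>q. - f q) x' = base.PD V \<psi> (I v) g x'"
    if "(f, g) \<in> CR x'" "(V, \<psi>) \<in> B" "x' \<in> V" for x' V \<psi> v
  proof -
    obtain n' b' c' where co': "coords n' (b' :: nat \<Rightarrow> 'c) c'" by (rule base.model_coords)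
    note cc = base.chart_compatible[OF that(2)]
    have "base.PD V \<psi> (I v) g x' = base.PD V \<psi> (- v) f x'"
      using CR_PD[OF that] by (simp add: I_I)
    also have "\<dots> = - base.PD V \<psi> v f x'"
      using base_PD_linear[OF that(2,3) C(1)] by (rule linear_neg)
    also have "\<dots> = base.PD V \<psi> v (\<lambda>q. (-1) * f q) x'"
      using base.PD_mult[OF cc co' base.smooth_fun_on_const[OF base.chart_open[OF that(2)]] base.C_smooth_fun_on[OF C(1)] that(3), of v "-1"]
        base.PD_const[OF cc co', of v "-1" x'] by simp
    finally show ?thesis by simp
  qed
  with ev show ?thesis using C by (simp add: CR_def eventually_mono)
qed

text \<open>By \<open>b v = a (I v)\<close> the function b + i a is complex linear. It satisfies the
  equation in every chart because the derivatives of the transition maps commute with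
  \<open>I\<close>.\<close>

lemma CR_linear:
  assumes V: "(V0, \<psi>0) \<in> B" "x \<in> V0" and ab: "bounded_linear a" "bounded_linear b" "\<And>v. b v = a (I v)"
    and fg: "f \<in> base.C" "g \<in> base.C" "\<forall>\<^sub>F x' in nhds x. f x' = a (\<psi>0 x')" "\<forall>\<^sub>F x' in nhds x. g x' = b (\<psi>0 x')"
  shows "(f, g) \<in> CR x"
proof -
  obtain n' b' c' where co': "coords n' (b' :: nat \<Rightarrow> 'c) c'" by (rule base.model_coords)
  have "\<forall>\<^sub>F x' in nhds x. f x' = a (\<psi>0 x') \<and> g x' = b (\<psi>0 x') \<and> x' \<in> V0"
    using fg(3,4) eventually_nhds_in_open[OF base.chart_open[OF V(1)] V(2)] by eventually_elim simp
  then obtain S where S: "open S" "x \<in> S" "\<And>x'. x' \<in> S \<Longrightarrow> f x' = a (\<psi>0 x') \<and> g x' = b (\<psi>0 x') \<and> x' \<in> V0"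
    unfolding eventually_nhds by blast
  have "base.PD V \<psi> v g x' = base.PD V \<psi> (I v) f x'"
    if x': "x' \<in> S" "(V, \<psi>) \<in> B" "x' \<in> V" for x' V \<psi> v
  proof -
    note cc = base.chart_compatible[OF x'(2)]
    let ?\<tau> = "frechet_derivative (\<psi>0 \<circ> inv_into V \<psi>) (at (\<psi> x'))"
    have mem: "\<psi> x' \<in> \<psi> ` (V \<inter> V0)" using x' S(3) by blast
    have \<tau>: "(\<psi>0 \<circ> inv_into V \<psi> has_derivative ?\<tau>) (at (\<psi> x'))"
      by (rule smooth_on_has_derivative[OF base.chart_trans[OF x'(2) V(1)] mem])
    have pd: "base.PD V \<psi> w h x' = c (?\<tau> w)"
      if c: "bounded_linear c" "\<And>z. z \<in> S \<Longrightarrow> h z = c (\<psi>0 z)" for c h w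
    proof -
      have "base.PD V \<psi> w h x' = base.PD V \<psi> w (\<lambda>z. c (\<psi>0 z)) x'"
        by (rule base.PD_cong[OF cc co', of "S \<inter> V"])
          (use S(1) base.chart_open[OF x'(2)] x' c(2) in auto)
      also have "\<dots> = c (?\<tau> w)"
        using bounded_linear.has_derivative[OF c(1) \<tau>] by (intro base.PD_unique[OF cc co']) (simp add: o_def)
      finally show ?thesis .
    qed
    have "?\<tau> (I v) = I (?\<tau> v)"
      using cplx x'(2) V(1) mem unfolding complex_manifold_def by blast
    then show ?thesis using pd[OF ab(1), of f] pd[OF ab(2), of g] S(3) ab(3) by simp
  qed
  then show ?thesis unfolding CR_def using fg(1,2) S(1,2) by (auto simp: eventually_nhds)
qed

text \<open>If \<open>F = f \<circ> \<pi>\<close> and \<open>G = g \<circ> \<pi>\<close>, membership in \<open>T01\<close> says that \<open>\<delta>\<^sub>1 + \<i> \<delta>\<^sub>2\<close> annihilates \<open>G + \<i> F\<close>.\<close>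

lemma T01_involutive:
  assumes \<Delta>: "\<Delta>1 \<in> dsec" "\<Delta>2 \<in> dsec" "\<And>q. (\<Delta>1 q, \<Delta>2 q) \<in> T01 q"
    and \<Gamma>: "\<Gamma>1 \<in> dsec" "\<Gamma>2 \<in> dsec" "\<And>q. (\<Gamma>1 q, \<Gamma>2 q) \<in> T01 q"
  shows "(dbracket \<Delta>1 \<Gamma>1 p - dbracket \<Delta>2 \<Gamma>2 p, dbracket \<Delta>1 \<Gamma>2 p + dbracket \<Delta>2 \<Gamma>1 p) \<in> T01 p"
proof -
  have br: "dbracket \<Delta>1 \<Gamma>1 p \<in> D p" "dbracket \<Delta>2 \<Gamma>2 p \<in> D p" "dbracket \<Delta>1 \<Gamma>2 p \<in> D p" "dbracket \<Delta>2 \<Gamma>1 p \<in> D p"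
    using \<Delta> \<Gamma> dbracket_dsec dsec_D by auto
  have "symbol p (dbracket \<Delta>1 \<Gamma>1 p - dbracket \<Delta>2 \<Gamma>2 p) (g \<circ> \<pi>) =
      symbol p (dbracket \<Delta>1 \<Gamma>2 p + dbracket \<Delta>2 \<Gamma>1 p) (f \<circ> \<pi>)" if fg: "(f, g) \<in> CR (\<pi> p)" for f g
  proof -
    let ?F = "f \<circ> \<pi>" and ?G = "g \<circ> \<pi>"
    have C: "?F \<in> C" "?G \<in> C" using CR_C[OF fg] pullback_C by auto
    have ev: "\<forall>\<^sub>F q in nhds p. (f, g) \<in> CR (\<pi> q)"
    proof -
      obtain S where S: "open S" "\<pi> p \<in> S" "\<And>x. x \<in> S \<Longrightarrow> (f, g) \<in> CR x"
        using CR_eventually[OF fg] unfolding eventually_nhds by auto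
      have "open (\<pi> -` S)" using continuous_pi S(1) by (simp add: continuous_on_open_vimage open_vimage)
      then show ?thesis unfolding eventually_nhds using S(2,3) by (intro exI[of _ "\<pi> -` S"]) auto
    qed
    \<comment> \<open>The second equation is the first one for the rotated pair.\<close>
    have rel: "symbol q \<delta>1 ?G = symbol q \<delta>2 ?F \<and> symbol q \<delta>2 ?G = - symbol q \<delta>1 ?F"
      if "(\<delta>1, \<delta>2) \<in> T01 q" "(f, g) \<in> CR (\<pi> q)" for \<delta>1 \<delta>2 q
    proof
      have d: "\<delta>1 \<in> D q" using that(1) by (simp add: T01_def)
      show "symbol q \<delta>1 ?G = symbol q \<delta>2 ?F" using that by (auto simp: T01_def)
      have "symbol q \<delta>1 ((\<lambda>q. - f q) \<circ> \<pi>) = symbol q \<delta>2 ?G"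
        using that(1) CR_rotate[OF that(2)] by (auto simp: T01_def)
      moreover have "symbol q \<delta>1 ((\<lambda>q. - f q) \<circ> \<pi>) = - symbol q \<delta>1 ?F"
        using tangent_scale[OF symbol_tangent[OF d] C(1), of "-1"] by (simp add: o_def)
      ultimately show "symbol q \<delta>2 ?G = - symbol q \<delta>1 ?F" by simp
    qed
    \<comment> \<open>The relations hold in a whole neighbourhood of \<open>p\<close>, so a
      derivation at \<open>p\<close> may be applied to them once more.\<close>
    have eqs: "symbol p \<delta> (\<lambda>q. symbol q (\<Theta>1 q) ?G) = symbol p \<delta> (\<lambda>q. symbol q (\<Theta>2 q) ?F)"
      "symbol p \<delta> (\<lambda>q. symbol q (\<Theta>2 q) ?G) = - symbol p \<delta> (\<lambda>q. symbol q (\<Theta>1 q) ?F)"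
      if \<delta>: "\<delta> \<in> D p" and \<Theta>: "\<Theta>1 \<in> dsec" "\<Theta>2 \<in> dsec" "\<And>q. (\<Theta>1 q, \<Theta>2 q) \<in> T01 q" for \<delta> \<Theta>1 \<Theta>2
    proof -
      note T = symbol_tangent[OF \<delta>]
      show "symbol p \<delta> (\<lambda>q. symbol q (\<Theta>1 q) ?G) = symbol p \<delta> (\<lambda>q. symbol q (\<Theta>2 q) ?F)"
        by (rule tangent_local[OF T symbol_C[OF \<Theta>(1) C(2)] symbol_C[OF \<Theta>(2) C(1)] eventually_mono[OF ev]])
          (simp add: rel[OF \<Theta>(3)])
      have "symbol p \<delta> (\<lambda>q. symbol q (\<Theta>2 q) ?G) = symbol p \<delta> (\<lambda>q. (-1) * symbol q (\<Theta>1 q) ?F)"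
        by (rule tangent_local[OF T symbol_C[OF \<Theta>(2) C(2)] C_mult[OF C_const symbol_C[OF \<Theta>(1) C(1)]] eventually_mono[OF ev]])
          (simp add: rel[OF \<Theta>(3)])
      then show "symbol p \<delta> (\<lambda>q. symbol q (\<Theta>2 q) ?G) = - symbol p \<delta> (\<lambda>q. symbol q (\<Theta>1 q) ?F)"
        using tangent_scale[OF T symbol_C[OF \<Theta>(1) C(1)], of "-1"] by simp
    qed
    note e = eqs[OF dsec_D[OF \<Delta>(1)] \<Gamma>] eqs[OF dsec_D[OF \<Delta>(2)] \<Gamma>]
      eqs[OF dsec_D[OF \<Gamma>(1)] \<Delta>] eqs[OF dsec_D[OF \<Gamma>(2)] \<Delta>]
    show ?thesis
      by (simp only: symbol_diff[OF br(1,2)] symbol_add[OF br(3,4)] symbol_dbracket \<Delta>(1,2) \<Gamma>(1,2) e)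
  qed
  then show ?thesis unfolding T01_def using br by (auto simp: D_minus2 D_plus)
qed

end

section \<open>Adapted frames of DL\<close>

locale fibered_coords = fibered A E Fr B F \<pi> I
  for A :: "('p::{t2_space, second_countable_topology}, 'e::real_normed_vector) atlas"
    and E :: "'p \<Rightarrow> 'v::real_vector set" and Fr
    and B :: "('m::{t2_space, second_countable_topology}, 'c::real_normed_vector) atlas"
    and F :: "('f::{t2_space, second_countable_topology}, 'd::real_normed_vector) atlas"
    and \<pi> :: "'p \<Rightarrow> 'm" and I :: "'c \<Rightarrow> 'c" +
  fixes m :: nat and bc :: "nat \<Rightarrow> 'c" and cc and k :: nat and bd :: "nat \<Rightarrow> 'd" and cd
  assumes base_coords: "coords (2 * m) bc cc"
    and I_bc: "i < m \<Longrightarrow> I (bc i) = bc (m + i)" "i < m \<Longrightarrow> I (bc (m + i)) = - bc i"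
    and fib_coords: "coords k bd cd"
begin

sublocale bco: coords "2 * m" bc cc by (rule base_coords)

definition N where "N = 2 * m + k"

definition bas :: "nat \<Rightarrow> 'c \<times> 'd"
  where "bas i = (if i < 2 * m then (bc i, 0) else (0, bd (i - 2 * m)))"

definition co :: "nat \<Rightarrow> 'c \<times> 'd \<Rightarrow> real"
  where "co i z = (if i < 2 * m then cc i (fst z) else cd (i - 2 * m) (snd z))"

lemma coords_bas: "coords N bas co"
  using coords_prod[OF base_coords fib_coords] unfolding N_def bas_def[abs_def] co_def[abs_def] .

text \<open>\<open>idd\<close> and the \<open>nab i\<close> form a frame of DL over
  \<open>W\<close>, dual to evaluation on \<open>s\<close> and to the differentials of the
  \<open>y i\<close>; they are global objects, the duality holds over \<open>W\<close>. The first
  \<open>2 * m\<close> functions are meant as real and imaginary parts of holomorphic coordinates z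
  = y i + i y (m + i) of the base: the last conjunct says that \<delta>1 + i \<delta>2 annihilates
  all z.\<close>

definition adapted :: "'p set \<Rightarrow> ('p \<Rightarrow> 'v) \<Rightarrow> (nat \<Rightarrow> 'p \<Rightarrow> real) \<Rightarrow> (nat \<Rightarrow> 'p \<Rightarrow> ('p, 'v) der) \<Rightarrow> bool"
  where "adapted W s y nab \<longleftrightarrow> frame_on W s \<and>
    (\<forall>i<N. y i \<in> C \<and> nab i \<in> dsec) \<and>
    (\<forall>q\<in>W. \<forall>i<N. nab i q s = 0 \<and> (\<forall>j<N. symbol q (nab i q) (y j) = (if i = j then 1 else 0))) \<and>
    (\<forall>q\<in>W. \<forall>\<delta>\<in>D q. \<delta> s = 0 \<longrightarrow> (\<forall>i<N. symbol q \<delta> (y i) = 0) \<longrightarrow> \<delta> = 0) \<and>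
    (\<forall>i<N. 2 * m \<le> i \<longrightarrow> (\<forall>q. nab i q \<in> VerL B \<pi> q)) \<and>
    (\<forall>q\<in>W. \<forall>\<delta>\<in>D q. \<delta> \<in> VerL B \<pi> q \<longleftrightarrow> (\<forall>i<2 * m. symbol q \<delta> (y i) = 0)) \<and>
    (\<forall>q\<in>W. \<forall>\<delta>1\<in>D q. \<forall>\<delta>2\<in>D q. (\<delta>1, \<delta>2) \<in> T01 q \<longleftrightarrow>
      (\<forall>i<m. symbol q \<delta>2 (y (m + i)) = symbol q \<delta>1 (y i) \<and> symbol q \<delta>2 (y i) = - symbol q \<delta>1 (y (m + i))))"

text \<open>These are the real and imaginary parts of complex linearity of \<open>cc i\<close> + i
  \<open>cc (m + i)\<close>.\<close>

lemma cc_I: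
  assumes "i < m"
  shows "cc i (I v) = - cc (m + i) v" "cc (m + i) (I v) = cc i v"
proof -
  have lin: "linear (\<lambda>v. cc j (I v))" if "j < 2 * m" for j
    using linear_compose[OF I_linear bounded_linear.linear[OF bco.bl[OF that]]] by (simp add: o_def)
  have I_b: "I (bc j) = (if j < m then bc (m + j) else - bc (j - m))" if "j < 2 * m" for j
    using I_bc(1)[of j] I_bc(2)[of "j - m"] that by (cases "j < m") auto
  have neg: "cc j (- v) = - cc j v" if "j < 2 * m" for j v
    using bounded_linear.linear[OF bco.bl[OF that]] by (rule linear_neg)
  have "cc i (I v) = (\<Sum>j<2*m. cc j v *\<^sub>R cc i (I (bc j)))"
    using assms by (intro bco.linear_expand lin) auto
  also have "\<dots> = (\<Sum>j<2*m. if j = m + i then - cc j v else 0)"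
    using assms by (intro sum.cong) (auto simp: I_b neg bco.dual)
  finally show "cc i (I v) = - cc (m + i) v" using assms by simp
  have "cc (m + i) (I v) = (\<Sum>j<2*m. cc j v *\<^sub>R cc (m + i) (I (bc j)))"
    using assms by (intro bco.linear_expand lin) auto
  also have "\<dots> = (\<Sum>j<2*m. if j = i then cc j v else 0)"
    using assms by (intro sum.cong) (auto simp: I_b neg bco.dual)
  finally show "cc (m + i) (I v) = cc i v" using assms by simp
qed

lemma exists_adapted: obtains W s y nab where "p \<in> W" "adapted W s y nab"
proof -
  obtain W0 V \<psi> and \<kappa> :: "'p \<Rightarrow> 'c \<times> 'd" where W0: "p \<in> W0" "compatible A W0 \<kappa>" "(V, \<psi>) \<in> B"
    "\<And>q. q \<in> W0 \<Longrightarrow> \<pi> q \<in> V" "\<And>q. q \<in> W0 \<Longrightarrow> fst (\<kappa> q) = \<psi> (\<pi> q)"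
    by (rule adapted_chart) blast
  obtain Ws s where Ws: "p \<in> Ws" "frame_on Ws s" by (rule exists_frame)
  define W where "W = W0 \<inter> Ws"
  have W: "open W" "p \<in> W" using W0(1,2) Ws by (auto simp: W_def compatible_def frame_on_def)
  have \<kappa>: "compatible A W \<kappa>" by (rule compatible_subset[OF W0(2) W(1)]) (simp add: W_def)
  have s: "frame_on W s" by (rule frame_on_subset[OF Ws(2) W(1)]) (simp add: W_def)
  have \<pi>W: "\<pi> q \<in> V" "fst (\<kappa> q) = \<psi> (\<pi> q)" if "q \<in> W" for q using that W0(4,5) by (auto simp: W_def)
  obtain b K where b: "b \<in> C" "closed K" "K \<subseteq> W" "\<And>q. q \<notin> K \<Longrightarrow> b q = 0" "\<forall>\<^sub>F q in nhds p. b q = 1"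
    by (rule bump[OF W]) blast
  note co = coords_bas
  interpret X: coords N bas co by (rule co)
  have "\<exists>u. u \<in> base.C \<and> (\<forall>\<^sub>F x in nhds (\<pi> p). u x = cc i (\<psi> x))" if "i < 2 * m" for i
  proof -
    have "smooth_fun_on B V (\<lambda>x. cc i (\<psi> x))"
      by (rule base.smooth_fun_on_compose_chart[OF base.chart_compatible[OF W0(3)] base_coords])
        (rule smooth_on_linear[OF open_UNIV bco.bl[OF that]])
    from base.germ_extension[OF base.chart_open[OF W0(3)] \<pi>W(1)[OF W(2)] this]
    show ?thesis by blast
  qed
  then obtain u where u: "\<And>i. i < 2 * m \<Longrightarrow> u i \<in> base.C" "\<And>i. i < 2 * m \<Longrightarrow> \<forall>\<^sub>F x in nhds (\<pi> p). u i x = cc i (\<psi> x)"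
    by metis
  have "\<exists>w. w \<in> C \<and> (\<forall>\<^sub>F q in nhds p. w q = co i (\<kappa> q))" if "i < N" for i
  proof -
    have "smooth_fun_on A W (\<lambda>q. co i (\<kappa> q))"
      by (rule smooth_fun_on_compose_chart[OF \<kappa> co]) (rule smooth_on_linear[OF open_UNIV X.bl[OF that]])
    from germ_extension[OF W this] show ?thesis by blast
  qed
  then obtain w where w: "\<And>i. i < N \<Longrightarrow> w i \<in> C" "\<And>i. i < N \<Longrightarrow> \<forall>\<^sub>F q in nhds p. w i q = co i (\<kappa> q)"
    by metis
  \<comment> \<open>The first \<open>2 * m\<close> functions are pulled back from global functions
    on the base, so that membership in \<open>VerL\<close> and \<open>T01\<close> can be tested on
    them.\<close>
  define y where "y i = (if i < 2 * m then u i \<circ> \<pi> else w i)" for i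
  have yC: "y i \<in> C" if "i < N" for i using that u(1) w(1) pullback_C by (auto simp: y_def)
  have u_ev: "\<forall>\<^sub>F x in nhds (\<pi> p). \<forall>i\<in>{..<2*m}. u i x = cc i (\<psi> x)"
    using u(2) by (intro eventually_ball_finite) auto
  then obtain V1 where V1: "open V1" "\<pi> p \<in> V1" "\<And>x i. x \<in> V1 \<Longrightarrow> i < 2 * m \<Longrightarrow> u i x = cc i (\<psi> x)"
    unfolding eventually_nhds by blast
  have w_ev: "\<forall>\<^sub>F q in nhds p. \<forall>i\<in>{..<N}. w i q = co i (\<kappa> q)"
    using w(2) by (intro eventually_ball_finite) auto
  with b(5) have "\<forall>\<^sub>F q in nhds p. b q = 1 \<and> (\<forall>i\<in>{..<N}. w i q = co i (\<kappa> q))" by (rule eventually_conj)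
  then obtain W1 where W1: "open W1" "p \<in> W1" "\<And>q. q \<in> W1 \<Longrightarrow> b q = 1" "\<And>q i. q \<in> W1 \<Longrightarrow> i < N \<Longrightarrow> w i q = co i (\<kappa> q)"
    unfolding eventually_nhds by blast
  \<comment> \<open>On \<open>W2\<close> the bump function is 1 and all \<open>u i\<close> and
    \<open>w i\<close> agree with the coordinates.\<close>
  define W2 where "W2 = W \<inter> W1 \<inter> \<pi> -` V1"
  have oV1: "open (\<pi> -` V1)" using continuous_pi V1(1) by (simp add: continuous_on_open_vimage open_vimage)
  have W2: "open W2" "p \<in> W2" "W2 \<subseteq> W" using W W1(1,2) V1(2) oV1 by (auto simp: W2_def)
  have y_eq: "y i q = co i (\<kappa> q)" if "q \<in> W2" "i < N" for q i
    using that W1(4) V1(3) \<pi>W(2) by (auto simp: y_def W2_def co_def)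
  have y_ev: "\<forall>\<^sub>F q' in nhds q. y i q' = co i (\<kappa> q')" if "q \<in> W2" "i < N" for q i
    using that y_eq W2(1) unfolding eventually_nhds by blast
  let ?n = "\<lambda>v. nabla W \<kappa> s b v"
  define nab where "nab i = ?n (bas i)" for i
  note nb = \<kappa> co s b(1-4)
  have sym: "symbol q (?n v q) f = b q * PD W \<kappa> v f q" if "f \<in> C" "q \<in> W" for f q v
    using symbol_nabla[OF nb, of q v f] that by simp
  have PDy: "PD W \<kappa> v (y i) q = co i v" if "q \<in> W2" "i < N" for q i v
  proof -
    have "PD W \<kappa> v (y i) q = PD W \<kappa> v (\<lambda>q. co i (\<kappa> q)) q"
      by (rule PD_cong[OF \<kappa> co W2(1) that(1) W2(3)]) (use y_eq that(2) in blast)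
    also have "\<dots> = co i v" using that W2(3) by (intro PD_linear[OF \<kappa> co X.bl]) auto
    finally show ?thesis .
  qed
  have expand: "symbol q \<delta> f = (\<Sum>i<N. symbol q \<delta> (y i) * PD W \<kappa> (bas i) f q)"
    if "q \<in> W2" "\<delta> \<in> D q" "f \<in> C" for q \<delta> f
    unfolding PD_def using that W2(3) y_ev yC
    by (intro tangent_expand[OF \<kappa> co _ symbol_tangent]) auto
  have pull: "PD W \<kappa> v (g \<circ> \<pi>) q = base.PD V \<psi> (fst v) g (\<pi> q)" if "g \<in> base.C" "q \<in> W" for g q v
    by (rule PD_pullback[OF \<kappa> co W0(3) \<pi>W that])
  have lin: "linear (\<lambda>v. base.PD V \<psi> v g (\<pi> q))" if "g \<in> base.C" "q \<in> W" for g q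
    by (rule base_PD_linear[OF W0(3) \<pi>W(1)[OF that(2)] that(1)])
  have expand_base: "symbol q \<delta> (g \<circ> \<pi>) = (\<Sum>i<2*m. symbol q \<delta> (y i) * base.PD V \<psi> (bc i) g (\<pi> q))"
    if q: "q \<in> W2" and \<delta>: "\<delta> \<in> D q" and g: "g \<in> base.C" for q \<delta> g
  proof -
    have qW: "q \<in> W" using q W2(3) by blast
    have "symbol q \<delta> (g \<circ> \<pi>) = (\<Sum>i<N. symbol q \<delta> (y i) * base.PD V \<psi> (fst (bas i)) g (\<pi> q))"
      using expand[OF q \<delta> pullback_C[OF g]] pull[OF g qW] by simp
    \<comment> \<open>The fiber directions have base component 0, so pullbacks from the base have
      derivative 0 along them.\<close>
    also have "\<dots> = (\<Sum>i<2*m. symbol q \<delta> (y i) * base.PD V \<psi> (fst (bas i)) g (\<pi> q))"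
      by (rule sum.mono_neutral_right)
        (use linear_0[OF lin[OF g qW]] in \<open>auto simp: N_def bas_def\<close>)
    also have "\<dots> = (\<Sum>i<2*m. symbol q \<delta> (y i) * base.PD V \<psi> (bc i) g (\<pi> q))"
      by (rule sum.cong) (auto simp: bas_def)
    finally show ?thesis .
  qed
  have ver: "\<delta> \<in> VerL B \<pi> q \<longleftrightarrow> (\<forall>i<2*m. symbol q \<delta> (y i) = 0)" if "q \<in> W2" "\<delta> \<in> D q" for q \<delta>
  proof
    assume "\<delta> \<in> VerL B \<pi> q"
    then show "\<forall>i<2*m. symbol q \<delta> (y i) = 0" using u(1) by (simp add: VerL_iff y_def)
  next
    assume "\<forall>i<2*m. symbol q \<delta> (y i) = 0"
    then show "\<delta> \<in> VerL B \<pi> q" using expand_base[OF that] that(2) by (simp add: VerL_iff)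
  qed
  have t01: "(\<delta>1, \<delta>2) \<in> T01 q \<longleftrightarrow> (\<forall>i<m. symbol q \<delta>2 (y (m + i)) = symbol q \<delta>1 (y i) \<and>
      symbol q \<delta>2 (y i) = - symbol q \<delta>1 (y (m + i)))"
    if q: "q \<in> W2" and \<delta>: "\<delta>1 \<in> D q" "\<delta>2 \<in> D q" for q \<delta>1 \<delta>2
  proof
    assume T: "(\<delta>1, \<delta>2) \<in> T01 q"
    have qV: "\<pi> q \<in> V" "\<pi> q \<in> V1" using q \<pi>W(1) by (auto simp: W2_def)
    have ev: "\<forall>\<^sub>F x in nhds (\<pi> q). u i x = cc i (\<psi> x)" if "i < 2 * m" for i
      using V1(1,3) qV(2) that unfolding eventually_nhds by blast
    show "\<forall>i<m. symbol q \<delta>2 (y (m + i)) = symbol q \<delta>1 (y i) \<and>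
      symbol q \<delta>2 (y i) = - symbol q \<delta>1 (y (m + i))"
    proof (intro allI impI)
      fix i assume i: "i < m"
      \<comment> \<open>Near this point, g + i f is the holomorphic coordinate \<open>cc i\<close> +
        i \<open>cc (m + i)\<close> of the chart \<open>\<psi>\<close>.\<close>
      have "(u (m + i), u i) \<in> CR (\<pi> q)"
        by (rule CR_linear[OF W0(3) qV(1), of "cc (m + i)" "cc i"])
          (use i in \<open>auto intro!: bco.bl u(1) ev simp: cc_I\<close>)
      then have 1: "symbol q \<delta>1 (u i \<circ> \<pi>) = symbol q \<delta>2 (u (m + i) \<circ> \<pi>)"
        and 2: "symbol q \<delta>1 ((\<lambda>x. - u (m + i) x) \<circ> \<pi>) = symbol q \<delta>2 (u i \<circ> \<pi>)"
        using T CR_rotate[of "u (m + i)" "u i" "\<pi> q"] by (auto simp: T01_def)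
      have "symbol q \<delta>1 ((\<lambda>x. - u (m + i) x) \<circ> \<pi>) = - symbol q \<delta>1 (u (m + i) \<circ> \<pi>)"
        using tangent_scale[OF symbol_tangent[OF \<delta>(1)] pullback_C[OF u(1)], of "m + i" "-1"] i
        by (simp add: o_def)
      then show "symbol q \<delta>2 (y (m + i)) = symbol q \<delta>1 (y i) \<and>
          symbol q \<delta>2 (y i) = - symbol q \<delta>1 (y (m + i))"
        using 1 2 i by (simp add: y_def)
    qed
  next
    assume R: "\<forall>i<m. symbol q \<delta>2 (y (m + i)) = symbol q \<delta>1 (y i) \<and>
      symbol q \<delta>2 (y i) = - symbol q \<delta>1 (y (m + i))"
    have qW: "q \<in> W" using q W2(3) by blast
    have "symbol q \<delta>1 (g \<circ> \<pi>) = symbol q \<delta>2 (f \<circ> \<pi>)" if fg: "(f, g) \<in> CR (\<pi> q)" for f g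
    proof -
      have C: "f \<in> base.C" "g \<in> base.C" using CR_C[OF fg] by auto
      have split: "(\<Sum>i<2*m. h i) = (\<Sum>i<m. h i + h (m + i))" for h :: "nat \<Rightarrow> real"
        using sum.nat_group[of h m 2] by (simp add: mult_2 sum.distrib lessThan_atLeast0 sum.atLeastLessThan_concat[of 0 m "m + m", symmetric] sum.shift_bounds_nat_ivl[of h 0 m m, simplified] add.commute)
      let ?g = "\<lambda>v. base.PD V \<psi> v g (\<pi> q)" and ?f = "\<lambda>v. base.PD V \<psi> v f (\<pi> q)"
      have gf: "?g v = ?f (I v)" for v by (rule CR_PD[OF fg W0(3) \<pi>W(1)[OF qW]])
      have "symbol q \<delta>1 (g \<circ> \<pi>) = (\<Sum>i<m. symbol q \<delta>1 (y i) * ?f (I (bc i)) + symbol q \<delta>1 (y (m + i)) * ?f (I (bc (m + i))))"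
        using expand_base[OF q \<delta>(1) C(2)] by (simp add: split gf)
      also have "\<dots> = (\<Sum>i<m. symbol q \<delta>2 (y i) * ?f (bc i) + symbol q \<delta>2 (y (m + i)) * ?f (bc (m + i)))"
        by (rule sum.cong) (use R in \<open>auto simp: I_bc linear_neg[OF lin[OF C(1) qW]]\<close>)
      also have "\<dots> = symbol q \<delta>2 (f \<circ> \<pi>)"
        using expand_base[OF q \<delta>(2) C(1)] by (simp add: split)
      finally show ?thesis .
    qed
    then show "(\<delta>1, \<delta>2) \<in> T01 q" using \<delta> by (auto simp: T01_def)
  qed
  have fiber_vert: "nab i q \<in> VerL B \<pi> q" if "i < N" "2 * m \<le> i" for i q
    unfolding VerL_iff nab_def
  proof (intro conjI ballI)
    show "?n (bas i) q \<in> D q" by (rule nabla_D[OF nb])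
    fix g assume g: "g \<in> base.C"
    have "symbol q (?n (bas i) q) (g \<circ> \<pi>) = 0" if "q \<in> W"
      using sym[OF pullback_C[OF g] that] pull[OF g that, of "bas i"] linear_0[OF lin[OF g that]] \<open>2 * m \<le> i\<close>
      by (simp add: bas_def)
    then show "symbol q (?n (bas i) q) (g \<circ> \<pi>) = 0"
      using symbol_nabla[OF nb, of q "bas i" "g \<circ> \<pi>"] by (cases "q \<in> W") auto
  qed
  have "adapted W2 s y nab"
    unfolding adapted_def
  proof (intro conjI allI impI ballI)
    show "frame_on W2 s" by (rule frame_on_subset[OF s W2(1,3)])
    show "y i \<in> C" if "i < N" for i by (rule yC[OF that])
    show "nab i \<in> dsec" for i unfolding nab_def by (rule nabla_dsec[OF nb])
    show "nab i q s = 0" for i q unfolding nab_def by (rule nabla_frame[OF nb])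
    show "symbol q (nab i q) (y j) = (if i = j then 1 else 0)" if "q \<in> W2" "i < N" "j < N" for i j q
      unfolding nab_def using that W2(3) W1(3) sym[OF yC[OF that(3)], of q "bas i"] PDy[OF that(1,3)]
        X.dual[OF that(3,2)] by (auto simp: W2_def)
    show "\<delta> = 0" if "q \<in> W2" "\<delta> \<in> D q" "\<delta> s = 0" "\<forall>i<N. symbol q \<delta> (y i) = 0" for q \<delta>
    proof (rule D_eqI[OF that(2) D_zero s])
      show "q \<in> W" using that(1) W2(3) by blast
      show "symbol q \<delta> f = symbol q 0 f" if "f \<in> C" for f
        using expand[OF \<open>q \<in> W2\<close> \<open>\<delta> \<in> D q\<close> that] \<open>\<forall>i<N. symbol q \<delta> (y i) = 0\<close> by (simp add: symbol_zero)
    qed (simp add: that(3))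
  qed (use ver t01 fiber_vert in auto)
  then show thesis using that W2(2) by blast
qed

end

section \<open>Tensoriality of the Chevalley--Eilenberg formula\<close>

lemma sum_fun_apply: "(\<Sum>i\<in>I. f i) x = (\<Sum>i\<in>I. f i x :: 'a::comm_monoid_add)"
  by (induction I rule: infinite_finite_induct) auto

context line_bundle
begin

text \<open>The formula of \<open>d1\<close> with the extensions as arguments. By
  \<open>CE_tensorial\<close> the result depends only on their values at the point, which removes
  the choice made by \<open>ext\<close>.\<close>

definition CE :: "('p \<Rightarrow> ('p, 'v) jet) \<Rightarrow> ('p \<Rightarrow> ('p, 'v) der) \<Rightarrow> ('p \<Rightarrow> ('p, 'v) der) \<Rightarrow> 'p \<Rightarrow> 'v"
  where "CE \<psi> \<Delta>1 \<Delta>2 p =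
    \<Delta>1 p (\<lambda>q. \<psi> q (\<Delta>2 q)) - \<Delta>2 p (\<lambda>q. \<psi> q (\<Delta>1 q)) - \<psi> p (dbracket \<Delta>1 \<Delta>2 p)"

context
  fixes \<psi> assumes \<psi>: "\<psi> \<in> jsec"
begin

lemma CE_antisym:
  assumes "\<Delta>1 \<in> dsec" "\<Delta>2 \<in> dsec"
  shows "CE \<psi> \<Delta>2 \<Delta>1 p = - CE \<psi> \<Delta>1 \<Delta>2 p"
  using J1_uminus[OF jsec_J1[OF \<psi>] dsec_D[OF dbracket_dsec[OF assms]], of p]
  by (simp add: CE_def dbracket_antisym[of \<Delta>2 \<Delta>1])

lemma CE_add:
  assumes "\<Delta> \<in> dsec" "\<Delta>1 \<in> dsec" "\<Delta>2 \<in> dsec"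
  shows "CE \<psi> \<Delta> (\<lambda>q. \<Delta>1 q + \<Delta>2 q) p = CE \<psi> \<Delta> \<Delta>1 p + CE \<psi> \<Delta> \<Delta>2 p"
proof -
  have "(\<lambda>q. \<psi> q (\<Delta>1 q + \<Delta>2 q)) = (\<lambda>q. \<psi> q (\<Delta>1 q) + \<psi> q (\<Delta>2 q))"
    using assms by (simp add: J1_add[OF jsec_J1[OF \<psi>]] dsec_D)
  moreover have "\<psi> p (dbracket \<Delta> \<Delta>1 p + dbracket \<Delta> \<Delta>2 p) = \<psi> p (dbracket \<Delta> \<Delta>1 p) + \<psi> p (dbracket \<Delta> \<Delta>2 p)"
    using assms by (intro J1_add[OF jsec_J1[OF \<psi>]] dsec_D dbracket_dsec)
  ultimately show ?thesis
    using D_add[OF dsec_D[OF assms(1)] jsec_sec[OF \<psi> assms(2)] jsec_sec[OF \<psi> assms(3)], of p]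
    by (simp add: CE_def dbracket_add[OF assms])
qed

text \<open>The Leibniz term of \<open>\<Delta>\<close> on f \<psi>(\<Delta>') equals the one that
  the bracket contributes, and the two enter with opposite signs.\<close>

lemma CE_scale:
  assumes "\<Delta> \<in> dsec" "\<Delta>' \<in> dsec" "f \<in> C"
  shows "CE \<psi> \<Delta> (\<lambda>q. f q *\<^sub>R \<Delta>' q) p = f p *\<^sub>R CE \<psi> \<Delta> \<Delta>' p"
proof -
  have "(\<lambda>q. \<psi> q (f q *\<^sub>R \<Delta>' q)) = (\<lambda>q. f q *\<^sub>R \<psi> q (\<Delta>' q))"
    using assms by (simp add: J1_scaleR[OF jsec_J1[OF \<psi>]] dsec_D)
  moreover have "\<psi> p (symbol p (\<Delta> p) f *\<^sub>R \<Delta>' p + f p *\<^sub>R dbracket \<Delta> \<Delta>' p) =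
      symbol p (\<Delta> p) f *\<^sub>R \<psi> p (\<Delta>' p) + f p *\<^sub>R \<psi> p (dbracket \<Delta> \<Delta>' p)"
    using dsec_D[OF assms(2), of p] dsec_D[OF dbracket_dsec[OF assms(1,2)], of p]
    by (simp add: J1_add[OF jsec_J1[OF \<psi>]] J1_scaleR[OF jsec_J1[OF \<psi>]] D_scaleR)
  ultimately show ?thesis
    using D_leibniz[OF dsec_D[OF assms(1)] assms(3) jsec_sec[OF \<psi> assms(2)], of p]
    by (simp add: CE_def dbracket_scale[OF assms] algebra_simps)
qed

lemma CE_sum:
  assumes "\<Delta> \<in> dsec"
  shows "(\<And>i. i \<in> I \<Longrightarrow> \<Theta> i \<in> dsec) \<Longrightarrow> CE \<psi> \<Delta> (\<lambda>q. \<Sum>i\<in>I. \<Theta> i q) p = (\<Sum>i\<in>I. CE \<psi> \<Delta> (\<Theta> i) p)"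
proof (induction I rule: infinite_finite_induct)
  case (insert i I)
  have \<Theta>: "\<Theta> i \<in> dsec" "(\<lambda>q. \<Sum>i\<in>I. \<Theta> i q) \<in> dsec"
    using insert.prems dsec_sum[of I \<Theta>] by auto
  show ?case
    unfolding sum.insert[OF insert.hyps] CE_add[OF assms \<Theta>] using insert by simp
qed (use CE_scale[OF assms idd_dsec, of "\<lambda>_. 0" p] in simp_all)

lemma CE_local:
  assumes "\<Delta> \<in> dsec" "\<Delta>1 \<in> dsec" "\<Delta>2 \<in> dsec" "\<forall>\<^sub>F q in nhds p. \<Delta>1 q = \<Delta>2 q"
  shows "CE \<psi> \<Delta> \<Delta>1 p = CE \<psi> \<Delta> \<Delta>2 p"
proof -
  have p: "\<Delta>1 p = \<Delta>2 p" using eventually_nhds_x_imp_x[OF assms(4)] .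
  have "\<Delta> p (\<lambda>q. \<psi> q (\<Delta>1 q)) = \<Delta> p (\<lambda>q. \<psi> q (\<Delta>2 q))"
    by (rule D_local[OF dsec_D[OF assms(1)] jsec_sec[OF \<psi> assms(2)] jsec_sec[OF \<psi> assms(3)] eventually_mono[OF assms(4)]]) simp
  moreover have "dbracket \<Delta> \<Delta>1 p = dbracket \<Delta> \<Delta>2 p"
  proof
    fix l
    show "dbracket \<Delta> \<Delta>1 p l = dbracket \<Delta> \<Delta>2 p l"
    proof (cases "l \<in> sec")
      case True
      have "\<Delta> p (\<lambda>q. \<Delta>1 q l) = \<Delta> p (\<lambda>q. \<Delta>2 q l)"
        by (rule D_local[OF dsec_D[OF assms(1)] dsec_sec[OF assms(2) True] dsec_sec[OF assms(3) True] eventually_mono[OF assms(4)]]) simp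
      then show ?thesis by (simp add: dbracket_apply p)
    qed (simp add: dbracket_outside assms)
  qed
  ultimately show ?thesis by (simp add: CE_def p)
qed

end

end

context fibered_coords
begin

text \<open>The jet df \<otimes> s, which on a derivation gives the symbol applied to
  \<open>f\<close>, times \<open>s\<close>.\<close>

definition eta :: "('p \<Rightarrow> 'v) \<Rightarrow> ('p \<Rightarrow> real) \<Rightarrow> 'p \<Rightarrow> ('p, 'v) jet"
  where "eta s f q = j1 (\<lambda>q. f q *\<^sub>R s q) q - f q *\<^sub>R j1 s q"

lemma eta_jsec: "f \<in> C \<Longrightarrow> s \<in> sec \<Longrightarrow> eta s f \<in> jsec"
  unfolding eta_def[abs_def] by (rule jsec_diff[OF j1_jsec[OF sec_scale] jsec_scale[OF _ j1_jsec]])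

lemma eta_apply: "f \<in> C \<Longrightarrow> s \<in> sec \<Longrightarrow> \<delta> \<in> D q \<Longrightarrow> eta s f q \<delta> = symbol q \<delta> f *\<^sub>R s q"
  by (simp add: eta_def j1_apply D_leibniz)

context
  fixes W s y nab
  assumes ad: "adapted W s y nab"
begin

lemma adapted_frame: "frame_on W s" "open W" "s \<in> sec" "q \<in> W \<Longrightarrow> s q \<noteq> 0"
  using ad by (auto simp: adapted_def frame_on_def)

lemma adapted_y: "i < N \<Longrightarrow> y i \<in> C"
  and adapted_nab: "i < N \<Longrightarrow> nab i \<in> dsec"
  and adapted_nab_s: "q \<in> W \<Longrightarrow> i < N \<Longrightarrow> nab i q s = 0"
  and adapted_nab_y: "q \<in> W \<Longrightarrow> i < N \<Longrightarrow> j < N \<Longrightarrow> symbol q (nab i q) (y j) = (if i = j then 1 else 0)"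
  and adapted_zero: "q \<in> W \<Longrightarrow> \<delta> \<in> D q \<Longrightarrow> \<delta> s = 0 \<Longrightarrow> (\<And>i. i < N \<Longrightarrow> symbol q \<delta> (y i) = 0) \<Longrightarrow> \<delta> = 0"
  and adapted_vert: "i < N \<Longrightarrow> 2 * m \<le> i \<Longrightarrow> nab i q \<in> VerL B \<pi> q"
  and adapted_VerL: "q \<in> W \<Longrightarrow> \<delta> \<in> D q \<Longrightarrow> \<delta> \<in> VerL B \<pi> q \<longleftrightarrow> (\<forall>i<2 * m. symbol q \<delta> (y i) = 0)"
  and adapted_T01: "q \<in> W \<Longrightarrow> \<delta>1 \<in> D q \<Longrightarrow> \<delta>2 \<in> D q \<Longrightarrow> (\<delta>1, \<delta>2) \<in> T01 q \<longleftrightarrow>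
      (\<forall>i<m. symbol q \<delta>2 (y (m + i)) = symbol q \<delta>1 (y i) \<and> symbol q \<delta>2 (y i) = - symbol q \<delta>1 (y (m + i)))"
  using ad unfolding adapted_def by simp_all

definition cmb :: "real \<Rightarrow> (nat \<Rightarrow> real) \<Rightarrow> 'p \<Rightarrow> ('p, 'v) der"
  where "cmb a d q = a *\<^sub>R idd q + (\<Sum>i<N. d i *\<^sub>R nab i q)"

lemma cmb_D: "cmb a d q \<in> D q"
  unfolding cmb_def by (intro D_plus D_scaleR D_sum idd_D dsec_D[OF adapted_nab]) simp

lemma cmb_s: "q \<in> W \<Longrightarrow> cmb a d q s = a *\<^sub>R s q"
  by (simp add: cmb_def sum_fun_apply adapted_nab_s idd_def adapted_frame(3))

lemma cmb_symbol:
  assumes "q \<in> W" "j < N"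
  shows "symbol q (cmb a d q) (y j) = d j"
proof -
  have nd: "nab i q \<in> D q" if "i < N" for i using adapted_nab[OF that] by (rule dsec_D)
  have "symbol q (cmb a d q) (y j) = symbol q (\<Sum>i<N. d i *\<^sub>R nab i q) (y j)"
    unfolding cmb_def using nd
    by (subst symbol_add) (auto intro!: D_scaleR idd_D D_sum simp: symbol_scaleR[OF idd_D] symbol_idd)
  also have "\<dots> = (\<Sum>i<N. symbol q (d i *\<^sub>R nab i q) (y j))"
    using nd by (intro symbol_sum D_scaleR) auto
  also have "\<dots> = (\<Sum>i<N. if i = j then d i else 0)"
    using nd assms by (intro sum.cong) (auto simp: symbol_scaleR adapted_nab_y)
  also have "\<dots> = d j" using assms by simp
  finally show ?thesis .
qed

lemma cmb_unique:
  assumes "q \<in> W" "\<delta> \<in> D q" "\<delta> s = a *\<^sub>R s q" "\<And>i. i < N \<Longrightarrow> symbol q \<delta> (y i) = d i"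
  shows "\<delta> = cmb a d q"
proof -
  have "\<delta> - cmb a d q = 0"
  proof (rule adapted_zero[OF assms(1) D_minus2[OF assms(2) cmb_D]])
    show "(\<delta> - cmb a d q) s = 0" using assms(1,3) by (simp add: cmb_s)
    show "symbol q (\<delta> - cmb a d q) (y i) = 0" if "i < N" for i
      using assms(1,2,4) that by (simp add: symbol_diff cmb_D cmb_symbol)
  qed
  then show ?thesis by simp
qed

lemma cmb_expand:
  assumes "q \<in> W" "\<delta> \<in> D q"
  shows "\<delta> = cmb (coef s (\<lambda>_. \<delta> s) q) (\<lambda>i. symbol q \<delta> (y i)) q"
proof (rule cmb_unique[OF assms])
  show "\<delta> s = coef s (\<lambda>_. \<delta> s) q *\<^sub>R s q"
    using coef_eq[of s q "\<lambda>_. \<delta> s"] adapted_frame(3,4) assms D_E by (simp add: sec_E)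
qed simp

lemma J1_cmb:
  assumes "\<alpha> \<in> J1 q"
  shows "\<alpha> (cmb a d q) = a *\<^sub>R \<alpha> (idd q) + (\<Sum>i<N. d i *\<^sub>R \<alpha> (nab i q))"
proof -
  have nd: "nab i q \<in> D q" if "i < N" for i using adapted_nab[OF that] by (rule dsec_D)
  have "\<alpha> (cmb a d q) = \<alpha> (a *\<^sub>R idd q) + \<alpha> (\<Sum>i<N. d i *\<^sub>R nab i q)"
    unfolding cmb_def using nd by (intro J1_add[OF assms] D_scaleR idd_D D_sum) auto
  also have "\<alpha> (\<Sum>i<N. d i *\<^sub>R nab i q) = (\<Sum>i<N. \<alpha> (d i *\<^sub>R nab i q))"
    using nd by (intro J1_sum[OF assms] D_scaleR) auto
  also have "\<dots> = (\<Sum>i<N. d i *\<^sub>R \<alpha> (nab i q))"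
    using nd by (intro sum.cong) (auto simp: J1_scaleR[OF assms])
  finally show ?thesis by (simp only: J1_scaleR[OF assms idd_D])
qed

definition jcmb :: "real \<Rightarrow> (nat \<Rightarrow> real) \<Rightarrow> 'p \<Rightarrow> ('p, 'v) jet"
  where "jcmb a d q = a *\<^sub>R j1 s q + (\<Sum>i<N. d i *\<^sub>R eta s (y i) q)"

lemma jcmb_jsec: "jcmb a d \<in> jsec"
  unfolding jcmb_def[abs_def]
  by (intro jsec_add jsec_cscale jsec_sum j1_jsec eta_jsec adapted_frame(3) adapted_y) simp

lemma jcmb_apply:
  "\<delta> \<in> D q \<Longrightarrow> jcmb a d q \<delta> = a *\<^sub>R \<delta> s + (\<Sum>i<N. d i *\<^sub>R symbol q \<delta> (y i) *\<^sub>R s q)"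
  by (simp add: jcmb_def sum_fun_apply j1_apply eta_apply adapted_y adapted_frame(3))

lemma jcmb_unique:
  assumes "q \<in> W" "\<alpha> \<in> J1 q" "\<alpha> (idd q) = a *\<^sub>R s q" "\<And>i. i < N \<Longrightarrow> \<alpha> (nab i q) = d i *\<^sub>R s q"
  shows "\<alpha> = jcmb a d q"
proof (rule J1_eqI[OF assms(2) jsec_J1[OF jcmb_jsec]])
  fix \<delta> assume \<delta>: "\<delta> \<in> D q"
  obtain a' d' where e: "\<delta> = cmb a' d' q" using cmb_expand[OF assms(1) \<delta>] by blast
  have "jcmb a d q \<delta> = a *\<^sub>R a' *\<^sub>R s q + (\<Sum>i<N. d i *\<^sub>R d' i *\<^sub>R s q)"
    unfolding jcmb_apply[OF \<delta>] by (simp add: e cmb_s cmb_symbol assms(1))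
  moreover have "\<alpha> \<delta> = a' *\<^sub>R a *\<^sub>R s q + (\<Sum>i<N. d' i *\<^sub>R d i *\<^sub>R s q)"
    unfolding e J1_cmb[OF assms(2)] using assms(3,4) by simp
  ultimately show "\<alpha> \<delta> = jcmb a d q \<delta>" by (simp add: mult.commute)
qed

lemma jcmb_expand:
  assumes "q \<in> W" "\<alpha> \<in> J1 q"
  obtains a d where "\<alpha> = jcmb a d q"
proof -
  have *: "\<alpha> \<delta> = coef s (\<lambda>_. \<alpha> \<delta>) q *\<^sub>R s q" if "\<delta> \<in> D q" for \<delta>
    using coef_eq[of s q "\<lambda>_. \<alpha> \<delta>"] adapted_frame(3,4) assms J1_E that by (simp add: sec_E)
  show thesis
    by (rule that, rule jcmb_unique[OF assms]) (rule *, simp add: idd_D dsec_D adapted_nab)+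
qed

lemma dsec_germ:
  assumes "q \<in> W" "\<Delta> \<in> dsec"
  obtains a where "a \<in> C" "\<forall>\<^sub>F x in nhds q. \<Delta> x = cmb (a x) (\<lambda>i. symbol x (\<Delta> x) (y i)) x"
proof -
  obtain a where a: "a \<in> C" "\<forall>\<^sub>F x in nhds q. \<Delta> x s = a x *\<^sub>R s x"
    by (rule frame_on_germ[OF adapted_frame(1) assms(1) dsec_sec[OF assms(2) adapted_frame(3)]])
  have "\<forall>\<^sub>F x in nhds q. \<Delta> x = cmb (a x) (\<lambda>i. symbol x (\<Delta> x) (y i)) x"
    using a(2) eventually_nhds_in_open[OF adapted_frame(2) assms(1)]
    by eventually_elim (rule cmb_unique, auto intro: dsec_D[OF assms(2)])
  then show thesis using that a(1) by blast
qed

text \<open>Near \<open>q\<close> the coefficients of \<open>\<Delta>'\<close> in the frame are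
  smooth functions that vanish at \<open>q\<close>. Since \<open>CE\<close> is local and linear over
  functions, they come out as factors 0.\<close>

lemma CE_vanish:
  assumes "\<psi> \<in> jsec" "\<Delta> \<in> dsec" "\<Delta>' \<in> dsec" "\<Delta>' q = 0" "q \<in> W"
  shows "CE \<psi> \<Delta> \<Delta>' q = 0"
proof -
  obtain a where a: "a \<in> C" "\<forall>\<^sub>F x in nhds q. \<Delta>' x = cmb (a x) (\<lambda>i. symbol x (\<Delta>' x) (y i)) x"
    by (rule dsec_germ[OF assms(5,3)])
  have sC: "(\<lambda>x. symbol x (\<Delta>' x) (y i)) \<in> C" if "i < N" for i
    by (rule symbol_C[OF assms(3) adapted_y[OF that]])
  have t: "(\<lambda>x. symbol x (\<Delta>' x) (y i) *\<^sub>R nab i x) \<in> dsec" if "i < N" for i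
    by (rule dsec_scale[OF sC[OF that] adapted_nab[OF that]])
  have d: "(\<lambda>x. a x *\<^sub>R idd x) \<in> dsec" "(\<lambda>x. \<Sum>i<N. symbol x (\<Delta>' x) (y i) *\<^sub>R nab i x) \<in> dsec"
    using dsec_scale[OF a(1) idd_dsec] t by (auto intro!: dsec_sum)
  have "\<Delta>' q s = a q *\<^sub>R s q"
    using eventually_nhds_x_imp_x[OF a(2)] cmb_s[OF assms(5), of "a q"] by metis
  then have aq: "a q = 0" using assms(4,5) adapted_frame(4) by simp
  have "CE \<psi> \<Delta> \<Delta>' q = CE \<psi> \<Delta> (\<lambda>x. a x *\<^sub>R idd x + (\<Sum>i<N. symbol x (\<Delta>' x) (y i) *\<^sub>R nab i x)) q"
    by (rule CE_local[OF assms(1,2,3) dsec_add[OF d]]) (use a(2) in \<open>simp add: cmb_def\<close>)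
  also have "\<dots> = a q *\<^sub>R CE \<psi> \<Delta> idd q + (\<Sum>i<N. CE \<psi> \<Delta> (\<lambda>x. symbol x (\<Delta>' x) (y i) *\<^sub>R nab i x) q)"
    using CE_add[OF assms(1,2) d] CE_scale[OF assms(1,2) idd_dsec a(1)] CE_sum[OF assms(1,2), of "{..<N}"] t by simp
  also have "\<dots> = 0"
    using CE_scale[OF assms(1,2) adapted_nab sC, of _ _ q] by (simp add: aq assms(4) symbol_zero)
  finally show ?thesis .
qed

end

text \<open>Constant coefficients in an adapted frame give the extension, because the frame consists
  of global sections.\<close>

lemma D_extend: assumes "\<delta> \<in> D p" obtains \<Delta> where "\<Delta> \<in> dsec" "\<Delta> p = \<delta>"
proof -
  obtain W s y nab where W: "p \<in> W" "adapted W s y nab" by (rule exists_adapted)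
  obtain a d where e: "\<delta> = cmb nab a d p" using cmb_expand[OF W(2,1) assms] by blast
  have "cmb nab a d \<in> dsec"
    unfolding cmb_def[OF W(2), abs_def]
    by (intro dsec_add dsec_cscale dsec_sum idd_dsec adapted_nab[OF W(2)]) simp
  then show thesis using that e by blast
qed

lemma J1_extend: assumes "\<alpha> \<in> J1 p" obtains \<psi> where "\<psi> \<in> jsec" "\<psi> p = \<alpha>"
proof -
  obtain W s y nab where W: "p \<in> W" "adapted W s y nab" by (rule exists_adapted)
  obtain a d where "\<alpha> = jcmb s y a d p" by (rule jcmb_expand[OF W(2,1) assms])
  then show thesis using that jcmb_jsec[OF W(2), of a d] by blast
qed

lemma D_separate:
  assumes "\<delta> \<in> D p" "\<epsilon> \<in> D p" "\<And>\<alpha>. \<alpha> \<in> J1 p \<Longrightarrow> \<alpha> \<delta> = \<alpha> \<epsilon>"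
  shows "\<delta> = \<epsilon>"
proof -
  have "j1 l p \<delta> = j1 l p \<epsilon>" if "l \<in> sec" for l using assms(3) jsec_J1[OF j1_jsec[OF that]] by blast
  then have "\<delta> l = \<epsilon> l" for l 
    using assms(1,2) D_outside[of \<delta> p l] D_outside[of \<epsilon> p l] by (cases "l \<in> sec") (auto simp: j1_apply)
  then show ?thesis by blast
qed

lemma CE_tensorial:
  assumes "\<psi> \<in> jsec" "\<Delta>1 \<in> dsec" "\<Delta>2 \<in> dsec" "\<Delta>1' \<in> dsec" "\<Delta>2' \<in> dsec" "\<Delta>1 p = \<Delta>1' p" "\<Delta>2 p = \<Delta>2' p"
  shows "CE \<psi> \<Delta>1 \<Delta>2 p = CE \<psi> \<Delta>1' \<Delta>2' p"
proof -
  obtain W s y nab where W: "p \<in> W" "adapted W s y nab" by (rule exists_adapted)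
  have one: "CE \<psi> \<Delta> \<Gamma> p = CE \<psi> \<Delta> \<Gamma>' p"
    if "\<Delta> \<in> dsec" "\<Gamma> \<in> dsec" "\<Gamma>' \<in> dsec" "\<Gamma> p = \<Gamma>' p" for \<Delta> \<Gamma> \<Gamma>'
    using CE_vanish[OF W(2) assms(1) that(1) dsec_diff[OF that(2,3)] _ W(1)] that(4)
      CE_add[OF assms(1) that(1) dsec_diff[OF that(2,3)] that(3), of p] by simp
  have "CE \<psi> \<Delta>1 \<Delta>2 p = CE \<psi> \<Delta>1 \<Delta>2' p" using assms by (intro one)
  also have "\<dots> = - CE \<psi> \<Delta>2' \<Delta>1 p" by (rule CE_antisym) (use assms in auto)
  also have "CE \<psi> \<Delta>2' \<Delta>1 p = CE \<psi> \<Delta>2' \<Delta>1' p" using assms by (intro one)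
  also have "- CE \<psi> \<Delta>2' \<Delta>1' p = CE \<psi> \<Delta>1' \<Delta>2' p" using CE_antisym[OF assms(1,4,5)] by simp
  finally show ?thesis .
qed

lemma assumes "\<delta> \<in> D p" shows ext_dsec: "ext p \<delta> \<in> dsec" and ext_at: "ext p \<delta> p = \<delta>"
proof -
  obtain \<Delta> where "\<Delta> \<in> dsec \<and> \<Delta> p = \<delta>" using D_extend[OF assms] by metis
  then have "ext p \<delta> \<in> dsec \<and> ext p \<delta> p = \<delta>"
    unfolding ext_def by (rule someI[of "\<lambda>\<Delta>. \<Delta> \<in> dsec \<and> \<Delta> p = \<delta>"])
  then show "ext p \<delta> \<in> dsec" "ext p \<delta> p = \<delta>" by auto
qed

context
  fixes \<psi> assumes \<psi>: "\<psi> \<in> jsec"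
begin

lemma d1_eq: "\<Delta>1 \<in> dsec \<Longrightarrow> \<Delta>2 \<in> dsec \<Longrightarrow> d1 \<psi> p (\<Delta>1 p) (\<Delta>2 p) = CE \<psi> \<Delta>1 \<Delta>2 p"
  using CE_tensorial[OF \<psi> ext_dsec ext_dsec, of "\<Delta>1 p" p "\<Delta>2 p" p \<Delta>1 \<Delta>2]
  by (simp add: d1_def dsec_D ext_at Let_def CE_def)

lemma d1_outside: "\<delta> \<notin> D p \<or> \<epsilon> \<notin> D p \<Longrightarrow> d1 \<psi> p \<delta> \<epsilon> = 0"
  by (auto simp: d1_def)

lemma d1_sec: "\<Delta>1 \<in> dsec \<Longrightarrow> \<Delta>2 \<in> dsec \<Longrightarrow> (\<lambda>p. d1 \<psi> p (\<Delta>1 p) (\<Delta>2 p)) \<in> sec"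
proof -
  assume \<Delta>: "\<Delta>1 \<in> dsec" "\<Delta>2 \<in> dsec"
  have "(\<lambda>p. CE \<psi> \<Delta>1 \<Delta>2 p) \<in> sec"
    unfolding CE_def
    by (rule sec_diff[OF sec_diff[OF dsec_sec[OF \<Delta>(1) jsec_sec[OF \<psi> \<Delta>(2)]] dsec_sec[OF \<Delta>(2) jsec_sec[OF \<psi> \<Delta>(1)]]]
          jsec_sec[OF \<psi> dbracket_dsec[OF \<Delta>]]])
  then show ?thesis by (simp add: d1_eq[OF \<Delta>])
qed

lemma d1_antisym: "d1 \<psi> p \<epsilon> \<delta> = - d1 \<psi> p \<delta> \<epsilon>"
proof (cases "\<delta> \<in> D p \<and> \<epsilon> \<in> D p")
  case True
  then obtain \<Delta>1 \<Delta>2 where "\<Delta>1 \<in> dsec" "\<Delta>1 p = \<delta>" "\<Delta>2 \<in> dsec" "\<Delta>2 p = \<epsilon>" using D_extend by metis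
  then show ?thesis using d1_eq[of \<Delta>1 \<Delta>2 p] d1_eq[of \<Delta>2 \<Delta>1 p] CE_antisym[OF \<psi>, of \<Delta>1 \<Delta>2 p] by simp
next
  case False
  then show ?thesis using d1_outside by auto
qed

lemma d1_J1: "d1 \<psi> p \<delta> \<in> J1 p"
proof (cases "\<delta> \<in> D p")
  case True
  obtain \<Delta> where \<Delta>: "\<Delta> \<in> dsec" "\<Delta> p = \<delta>" by (rule D_extend[OF True])
  show ?thesis
  proof (rule J1I)
    fix \<epsilon> assume e: "\<epsilon> \<in> D p"
    obtain \<Theta> where \<Theta>: "\<Theta> \<in> dsec" "\<Theta> p = \<epsilon>" by (rule D_extend[OF e])
    show "d1 \<psi> p \<delta> \<epsilon> \<in> E p" using sec_E[OF d1_sec[OF \<Delta>(1) \<Theta>(1)], of p] \<Delta>(2) \<Theta>(2) by simp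
    show "d1 \<psi> p \<delta> (\<epsilon> + \<epsilon>') = d1 \<psi> p \<delta> \<epsilon> + d1 \<psi> p \<delta> \<epsilon>'" if e': "\<epsilon>' \<in> D p" for \<epsilon>'
    proof -
      obtain \<Theta>' where \<Theta>': "\<Theta>' \<in> dsec" "\<Theta>' p = \<epsilon>'" by (rule D_extend[OF e'])
      show ?thesis
        using d1_eq[OF \<Delta>(1) dsec_add[OF \<Theta>(1) \<Theta>'(1)], of p] CE_add[OF \<psi> \<Delta>(1) \<Theta>(1) \<Theta>'(1), of p]
          d1_eq[OF \<Delta>(1) \<Theta>(1), of p] d1_eq[OF \<Delta>(1) \<Theta>'(1), of p] \<Delta>(2) \<Theta>(2) \<Theta>'(2) by simp
    qed
    show "d1 \<psi> p \<delta> (c *\<^sub>R \<epsilon>) = c *\<^sub>R d1 \<psi> p \<delta> \<epsilon>" for c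
      using d1_eq[OF \<Delta>(1) dsec_cscale[OF \<Theta>(1)], of p c] CE_scale[OF \<psi> \<Delta>(1) \<Theta>(1) C_const, of c p]
        d1_eq[OF \<Delta>(1) \<Theta>(1), of p] \<Delta>(2) \<Theta>(2) by simp
  qed (simp add: d1_outside)
next
  case False
  then have "d1 \<psi> p \<delta> = 0" using d1_outside by (simp add: fun_eq_iff)
  then show ?thesis by (simp add: J1_zero_mem)
qed

text \<open>Twofold derivatives combine into brackets, which cancel along with the mixed terms; the
  three terms with iterated brackets vanish by the Jacobi identity.\<close>

lemma d2_d1:
  assumes \<Delta>: "\<Delta>0 \<in> dsec" "\<Delta>1 \<in> dsec" "\<Delta>2 \<in> dsec"
  shows "d2 (d1 \<psi>) \<Delta>0 \<Delta>1 \<Delta>2 p = 0"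
proof -
  note br = dbracket_dsec
  have S: "(\<lambda>q. \<psi> q (\<Theta> q)) \<in> sec" if "\<Theta> \<in> dsec" for \<Theta> using jsec_sec[OF \<psi> that] .
  have DD: "\<Theta> p (\<lambda>q. CE \<psi> \<Theta>1 \<Theta>2 q) = \<Theta> p (\<lambda>q. \<Theta>1 q (\<lambda>x. \<psi> x (\<Theta>2 x))) -
      \<Theta> p (\<lambda>q. \<Theta>2 q (\<lambda>x. \<psi> x (\<Theta>1 x))) - \<Theta> p (\<lambda>q. \<psi> q (dbracket \<Theta>1 \<Theta>2 q))"
    if "\<Theta> \<in> dsec" "\<Theta>1 \<in> dsec" "\<Theta>2 \<in> dsec" for \<Theta> \<Theta>1 \<Theta>2
    unfolding CE_def
    by (simp only: D_diff[OF dsec_D[OF that(1)] sec_diff[OF dsec_sec[OF that(2) S[OF that(3)]] dsec_sec[OF that(3) S[OF that(2)]]] S[OF br[OF that(2,3)]]]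
        D_diff[OF dsec_D[OF that(1)] dsec_sec[OF that(2) S[OF that(3)]] dsec_sec[OF that(3) S[OF that(2)]]])
  have e: "d1 \<psi> q (\<Theta>1 q) (\<Theta>2 q) = CE \<psi> \<Theta>1 \<Theta>2 q" if "\<Theta>1 \<in> dsec" "\<Theta>2 \<in> dsec" for \<Theta>1 \<Theta>2 q
    by (rule d1_eq[OF that])
  have "\<psi> p (dbracket (dbracket \<Delta>0 \<Delta>1) \<Delta>2 p) - \<psi> p (dbracket (dbracket \<Delta>0 \<Delta>2) \<Delta>1 p) + \<psi> p (dbracket (dbracket \<Delta>1 \<Delta>2) \<Delta>0 p) =
    \<psi> p (dbracket (dbracket \<Delta>0 \<Delta>1) \<Delta>2 p - dbracket (dbracket \<Delta>0 \<Delta>2) \<Delta>1 p + dbracket (dbracket \<Delta>1 \<Delta>2) \<Delta>0 p)"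
    using \<Delta> by (simp add: J1_add[OF jsec_J1[OF \<psi>]] J1_diff[OF jsec_J1[OF \<psi>]] br dsec_D D_minus2)
  also have "\<dots> = 0" by (simp add: dbracket_jacobi[OF \<Delta>] J1_zero[OF jsec_J1[OF \<psi>]])
  finally have jac: "\<psi> p (dbracket (dbracket \<Delta>0 \<Delta>1) \<Delta>2 p) =
    \<psi> p (dbracket (dbracket \<Delta>0 \<Delta>2) \<Delta>1 p) - \<psi> p (dbracket (dbracket \<Delta>1 \<Delta>2) \<Delta>0 p)" by (simp add: algebra_simps)
  show ?thesis
    unfolding d2_def
    using e[OF br[OF \<Delta>(1,2)] \<Delta>(3), of p] e[OF br[OF \<Delta>(1,3)] \<Delta>(2), of p] e[OF br[OF \<Delta>(2,3)] \<Delta>(1), of p]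
    by (simp add: e \<Delta> DD) (simp add: CE_def dbracket_apply[of \<Delta>0 \<Delta>1] dbracket_apply[of \<Delta>0 \<Delta>2]
        dbracket_apply[of \<Delta>1 \<Delta>2] jac algebra_simps)
qed

end

end

section \<open>The generalized contact structure of a family of contact manifolds\<close>

lemma lin_on_sum:
  assumes "lin_on V T h" "0 \<in> V" "\<And>x y. x \<in> V \<Longrightarrow> y \<in> V \<Longrightarrow> x + y \<in> V"
  shows "(\<And>i. i \<in> I \<Longrightarrow> f i \<in> V) \<Longrightarrow> h (\<Sum>i\<in>I. f i) = (\<Sum>i\<in>I. h (f i)) \<and> (\<Sum>i\<in>I. f i) \<in> V"
proof (induction I rule: infinite_finite_induct)
  case (insert i I)
  then show ?case using lin_onD(2)[OF assms(1), of "f i" "\<Sum>i\<in>I. f i"] assms(3) by simp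
qed (use lin_onD(3)[OF assms(1,2), of 0] assms(2) in auto)

text \<open>With \<open>f k = 1\<close> on \<open>V k\<close>, the products \<open>f n * (\<Prod>k<n. 1 - f k)\<close> vanish on \<open>V k\<close> for \<open>n > k\<close>, so
  that the partition of unity they form is locally finite without a refinement of the cover.\<close>

lemma (in mfd) countable_bumps:
  assumes "\<And>p. open (U p)" "\<And>p. p \<in> U p"
  obtains P :: "nat \<Rightarrow> 'p" and V b where "\<forall>n. open (V n)" "(\<Union>n. V n) = UNIV" "\<forall>n. b n \<in> C"
    "\<forall>n q. q \<in> V n \<longrightarrow> b n q = 1" "\<forall>n q. q \<notin> U (P n) \<longrightarrow> b n q = 0"
proof -
  have "\<exists>b V. b \<in> C \<and> open V \<and> p \<in> V \<and> (\<forall>q\<in>V. b q = 1) \<and> (\<forall>q. q \<notin> U p \<longrightarrow> b q = 0)" for p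
  proof -
    obtain b K where b: "b \<in> C" "closed K" "K \<subseteq> U p" "\<And>q. q \<notin> K \<Longrightarrow> b q = 0" "\<forall>\<^sub>F q in nhds p. b q = 1"
      by (rule bump[OF assms]) blast
    then obtain V where "open V" "p \<in> V" "\<forall>q\<in>V. b q = 1" unfolding eventually_nhds by blast
    then show ?thesis using b by blast
  qed
  then obtain b V where bV: "\<And>p. b p \<in> C" "\<And>p. open (V p)" "\<And>p. p \<in> V p" "\<And>p q. q \<in> V p \<Longrightarrow> b p q = 1"
    "\<And>p q. q \<notin> U p \<Longrightarrow> b p q = 0" by metis
  obtain \<F> where \<F>: "\<F> \<subseteq> range V" "countable \<F>" "\<Union>\<F> = \<Union>(range V)"
    using Lindelof[of "range V"] bV(2) by blast
  have un: "\<Union>\<F> = UNIV" unfolding \<F>(3) using bV(3) by blast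
  then have ne: "\<F> \<noteq> {}" by auto
  have "\<exists>p. from_nat_into \<F> n = V p" for n using from_nat_into[OF ne, of n] \<F>(1) by blast
  then obtain P where P: "\<And>n. from_nat_into \<F> n = V (P n)" by metis
  have "(\<Union>n. V (P n)) = UNIV"
    using un range_from_nat_into[OF ne \<F>(2)] by (simp flip: P)
  then show thesis
    using bV by (intro that[of "\<lambda>n. V (P n)" "\<lambda>n. b (P n)" P]) simp_all
qed

section \<open>Linear algebra of vertical and type (0,1) derivations\<close>

context fibered_coords
begin

lemma VerL_D: "v \<in> VerL B \<pi> p \<Longrightarrow> v \<in> D p"
  by (simp add: VerL_iff)

lemma VerL_add: "v \<in> VerL B \<pi> p \<Longrightarrow> w \<in> VerL B \<pi> p \<Longrightarrow> v + w \<in> VerL B \<pi> p"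
  by (simp add: VerL_iff D_plus symbol_add)

lemma VerL_scaleR: "v \<in> VerL B \<pi> p \<Longrightarrow> c *\<^sub>R v \<in> VerL B \<pi> p"
  by (simp add: VerL_iff D_scaleR symbol_scaleR)

lemma VerL_zero: "0 \<in> VerL B \<pi> p"
  by (simp add: VerL_iff D_zero symbol_zero)

lemma idd_VerL: "idd p \<in> VerL B \<pi> p"
  by (simp add: VerL_iff idd_D symbol_idd)

lemma vsecI: "\<Delta> \<in> dsec \<Longrightarrow> (\<And>p. \<Delta> p \<in> VerL B \<pi> p) \<Longrightarrow> \<Delta> \<in> vsec B \<pi>"
  by (simp add: vsec_def)

lemma vsecD: "\<Delta> \<in> vsec B \<pi> \<Longrightarrow> \<Delta> \<in> dsec" "\<Delta> \<in> vsec B \<pi> \<Longrightarrow> \<Delta> p \<in> VerL B \<pi> p"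
  by (simp_all add: vsec_def)

lemma dbracket_vsec:
  assumes "\<Delta> \<in> vsec B \<pi>" "\<Delta>' \<in> vsec B \<pi>"
  shows "dbracket \<Delta> \<Delta>' \<in> vsec B \<pi>"
proof (rule vsecI)
  note d = vsecD(1)[OF assms(1)] vsecD(1)[OF assms(2)]
  show "dbracket \<Delta> \<Delta>' \<in> dsec" by (rule dbracket_dsec[OF d])
  have "symbol q (\<Delta> q) (g \<circ> \<pi>) = 0" "symbol q (\<Delta>' q) (g \<circ> \<pi>) = 0" if "g \<in> base.C" for g q
    using vsecD(2)[OF assms(1), of q] vsecD(2)[OF assms(2), of q] that by (auto simp: VerL_iff)
  then show "dbracket \<Delta> \<Delta>' p \<in> VerL B \<pi> p" for p
    using dsec_D[OF dbracket_dsec[OF d]] d tangent_const[OF symbol_tangent[OF dsec_D[OF d(1)]]]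
      tangent_const[OF symbol_tangent[OF dsec_D[OF d(2)]]]
    by (simp add: VerL_iff symbol_dbracket)
qed

lemma T01_iff: "(a, b) \<in> T01 p \<longleftrightarrow> a \<in> D p \<and> b \<in> D p \<and>
    (\<forall>f g. (f, g) \<in> CR (\<pi> p) \<longrightarrow> symbol p a (g \<circ> \<pi>) = symbol p b (f \<circ> \<pi>))"
  unfolding T01_def by auto

lemma T01_D: "(a, b) \<in> T01 p \<Longrightarrow> a \<in> D p \<and> b \<in> D p"
  by (simp add: T01_iff)

lemma T01_add: "(a, b) \<in> T01 p \<Longrightarrow> (a', b') \<in> T01 p \<Longrightarrow> (a + a', b + b') \<in> T01 p"
  by (simp add: T01_iff D_plus symbol_add)

lemma T01_scaleR: "(a, b) \<in> T01 p \<Longrightarrow> (c *\<^sub>R a, c *\<^sub>R b) \<in> T01 p"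
  by (simp add: T01_iff D_scaleR symbol_scaleR)

lemma T01_VerL: "v \<in> VerL B \<pi> p \<Longrightarrow> w \<in> VerL B \<pi> p \<Longrightarrow> (v, w) \<in> T01 p"
  by (auto simp: T01_iff VerL_iff dest!: CR_C)

text \<open>Multiplication by i sends a + i b to - b + i a.\<close>

lemma T01_rotate:
  assumes "(a, b) \<in> T01 p"
  shows "(- b, a) \<in> T01 p"
proof -
  have d: "a \<in> D p" "b \<in> D p" using T01_D[OF assms] by auto
  have "symbol p (- b) (g \<circ> \<pi>) = symbol p a (f \<circ> \<pi>)" if fg: "(f, g) \<in> CR (\<pi> p)" for f g
  proof -
    have "symbol p a ((\<lambda>q. - f q) \<circ> \<pi>) = symbol p b (g \<circ> \<pi>)"
      using assms CR_rotate[OF fg] by (simp add: T01_iff)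
    moreover have "symbol p a ((\<lambda>q. - f q) \<circ> \<pi>) = - symbol p a (f \<circ> \<pi>)"
      using tangent_scale[OF symbol_tangent[OF d(1)] pullback_C, of f "-1"] CR_C[OF fg] by (simp add: o_def)
    ultimately show ?thesis using symbol_scaleR[OF d(2), of "-1"] by simp
  qed
  then show ?thesis using d by (simp add: T01_iff D_minus)
qed

text \<open>If i b projects to type (0,1), then so does the real derivation b, and a real vector of
  type (0,1) is 0.\<close>

lemma T01_vertical:
  assumes "(0, b) \<in> T01 p"
  shows "b \<in> VerL B \<pi> p"
proof -
  obtain W s y nab where W: "p \<in> W" "adapted W s y nab" by (rule exists_adapted)
  have b: "b \<in> D p" using T01_D[OF assms] by blast
  have r: "\<forall>i<m. symbol p b (y (m + i)) = 0 \<and> symbol p b (y i) = 0"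
    using assms adapted_T01[OF W(2,1) D_zero b] by (simp add: symbol_zero)
  have "symbol p b (y i) = 0" if "i < 2 * m" for i
    using r[rule_format, of i] r[rule_format, of "i - m"] that by (cases "i < m") auto
  then show ?thesis using adapted_VerL[OF W(2,1) b] by blast
qed

end

section \<open>The map from jets to derivations given by the Jacobi tensor\<close>

locale contact_setting = fibered_coords A E Fr B F \<pi> I m bc cc k bd cd
  for A :: "('p::{t2_space, second_countable_topology}, 'e::real_normed_vector) atlas"
    and E :: "'p \<Rightarrow> 'v::real_vector set" and Fr
    and B :: "('m::{t2_space, second_countable_topology}, 'c::real_normed_vector) atlas"
    and F :: "('f::{t2_space, second_countable_topology}, 'd::real_normed_vector) atlas"
    and \<pi> :: "'p \<Rightarrow> 'm" and I :: "'c \<Rightarrow> 'c" and m bc cc k and bd :: "nat \<Rightarrow> 'd" and cd +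
  fixes J :: "'p \<Rightarrow> ('p, 'v) jet \<Rightarrow> ('p, 'v) jet \<Rightarrow> 'v"
  assumes jac: "jacobi_tensor J" and fam: "gives_contact_family B \<pi> J"
begin

abbreviation S where "S \<equiv> sharp J"

lemma J_right: "\<alpha> \<in> J1 p \<Longrightarrow> lin_on (J1 p) (E p) (J p \<alpha>)"
  and J_left: "\<alpha> \<in> J1 p \<Longrightarrow> lin_on (J1 p) (E p) (\<lambda>\<beta>. J p \<beta> \<alpha>)"
  and J_alt: "\<alpha> \<in> J1 p \<Longrightarrow> J p \<alpha> \<alpha> = 0"
  using jac unfolding jacobi_tensor_def alt_bilin_def by blast+

lemma J_sec: "\<alpha> \<in> jsec \<Longrightarrow> \<beta> \<in> jsec \<Longrightarrow> (\<lambda>p. J p (\<alpha> p) (\<beta> p)) \<in> sec"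
  using jac unfolding jacobi_tensor_def by blast

lemma J_antisym: "\<alpha> \<in> J1 p \<Longrightarrow> \<beta> \<in> J1 p \<Longrightarrow> J p \<alpha> \<beta> = - J p \<beta> \<alpha>"
  using J_alt[OF J1_plus, of \<alpha> p \<beta>] lin_onD(2)[OF J_right[OF J1_plus], of \<alpha> p \<beta> \<alpha> \<beta>]
    lin_onD(2)[OF J_left, of \<alpha> p \<alpha> \<beta>] lin_onD(2)[OF J_left, of \<beta> p \<alpha> \<beta>] J_alt[of \<alpha> p] J_alt[of \<beta> p]
  by (simp add: eq_neg_iff_add_eq_0 add.commute)

text \<open>\<open>sharp\<close> is a definite description, so existence is a claim of its own. It
  holds because DL has finite rank and L is a line: in an adapted frame the coefficients of the
  element are the values of \<open>J p \<alpha>\<close> on the dual frame of jets.\<close>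

lemma sharp_exists:
  assumes \<alpha>: "\<alpha> \<in> J1 p"
  shows "\<exists>\<delta>. \<delta> \<in> D p \<and> (\<forall>\<beta>\<in>J1 p. \<beta> \<delta> = J p \<alpha> \<beta>)"
proof -
  obtain W s y nab where W: "p \<in> W" "adapted W s y nab" by (rule exists_adapted)
  note s = adapted_frame[OF W(2)]
  have js: "j1 s p \<in> J1 p" by (rule jsec_J1[OF j1_jsec[OF s(3)]])
  have je: "eta s (y i) p \<in> J1 p" if "i < N" for i
    by (rule jsec_J1[OF eta_jsec[OF adapted_y[OF W(2) that] s(3)]])
  define cf where "cf \<beta> = coef s (\<lambda>_. J p \<alpha> \<beta>) p" for \<beta>
  have cf: "J p \<alpha> \<beta> = cf \<beta> *\<^sub>R s p" if "\<beta> \<in> J1 p" for \<beta>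
    using coef_eq[of s p "\<lambda>_. J p \<alpha> \<beta>"] lin_onD(1)[OF J_right[OF \<alpha>] that] sec_E[OF s(3)] s(4)[OF W(1)]
    by (simp add: cf_def)
  let ?\<delta> = "cmb nab (cf (j1 s p)) (\<lambda>i. cf (eta s (y i) p)) p"
  have "\<beta> ?\<delta> = J p \<alpha> \<beta>" if \<beta>: "\<beta> \<in> J1 p" for \<beta>
  proof -
    obtain a b where e: "\<beta> = jcmb s y a b p" by (rule jcmb_expand[OF W(2,1) \<beta>])
    have "\<beta> ?\<delta> = a *\<^sub>R cf (j1 s p) *\<^sub>R s p + (\<Sum>i<N. b i *\<^sub>R cf (eta s (y i) p) *\<^sub>R s p)"
      unfolding e jcmb_apply[OF W(2) cmb_D[OF W(2)]] by (simp add: cmb_s[OF W(2,1)] cmb_symbol[OF W(2,1)])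
    also have "\<dots> = a *\<^sub>R J p \<alpha> (j1 s p) + (\<Sum>i<N. J p \<alpha> (b i *\<^sub>R eta s (y i) p))"
    proof -
      have "J p \<alpha> (c *\<^sub>R eta s (y i) p) = c *\<^sub>R cf (eta s (y i) p) *\<^sub>R s p" if "i < N" for i c
        by (simp only: lin_onD(3)[OF J_right[OF \<alpha>] je[OF that]] cf[OF je[OF that]])
      then show ?thesis by (simp add: cf[OF js])
    qed
    also have "\<dots> = J p \<alpha> (a *\<^sub>R j1 s p) + J p \<alpha> (\<Sum>i<N. b i *\<^sub>R eta s (y i) p)"
      using lin_on_sum[OF J_right[OF \<alpha>] J1_zero_mem J1_plus, of "{..<N}" "\<lambda>i. b i *\<^sub>R eta s (y i) p"]
        lin_onD(3)[OF J_right[OF \<alpha>] js, of a] J1_scale[OF je] by simp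
    also have "\<dots> = J p \<alpha> \<beta>"
      unfolding e jcmb_def[OF W(2)]
      by (rule lin_onD(2)[OF J_right[OF \<alpha>], symmetric]) (auto intro!: J1_scale J1_sum_mem js je)
    finally show ?thesis .
  qed
  then show ?thesis using cmb_D[OF W(2)] by blast
qed

lemma sharp:
  assumes "\<alpha> \<in> J1 p"
  shows sharp_D: "S p \<alpha> \<in> D p" and sharp_apply: "\<beta> \<in> J1 p \<Longrightarrow> \<beta> (S p \<alpha>) = J p \<alpha> \<beta>"
proof -
  have "\<exists>!\<delta>. \<delta> \<in> D p \<and> (\<forall>\<beta>\<in>J1 p. \<beta> \<delta> = J p \<alpha> \<beta>)"
    using sharp_exists[OF assms] by (auto intro!: D_separate)
  from theI'[OF this] show "S p \<alpha> \<in> D p" "\<beta> \<in> J1 p \<Longrightarrow> \<beta> (S p \<alpha>) = J p \<alpha> \<beta>"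
    unfolding sharp_def by blast+
qed

lemma sharp_antisym: "\<alpha> \<in> J1 p \<Longrightarrow> \<beta> \<in> J1 p \<Longrightarrow> \<beta> (S p \<alpha>) = - \<alpha> (S p \<beta>)"
  by (simp add: sharp_apply J_antisym[of \<alpha>])

lemma sharp_add: "\<alpha> \<in> J1 p \<Longrightarrow> \<beta> \<in> J1 p \<Longrightarrow> S p (\<alpha> + \<beta>) = S p \<alpha> + S p \<beta>"
  by (rule D_separate[where p = p]) (auto simp: sharp_D D_plus J1_plus J1_add sharp_apply lin_onD(2)[OF J_left])

lemma sharp_scaleR: "\<alpha> \<in> J1 p \<Longrightarrow> S p (c *\<^sub>R \<alpha>) = c *\<^sub>R S p \<alpha>"
  by (rule D_separate[where p = p]) (auto simp: sharp_D D_scaleR J1_scale J1_scaleR sharp_apply lin_onD(3)[OF J_left])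

lemma sharp_minus: "\<alpha> \<in> J1 p \<Longrightarrow> S p (- \<alpha>) = - S p \<alpha>"
  using sharp_scaleR[of \<alpha> p "-1"] by simp

lemma sharp_diff: "\<alpha> \<in> J1 p \<Longrightarrow> \<beta> \<in> J1 p \<Longrightarrow> S p (\<alpha> - \<beta>) = S p \<alpha> - S p \<beta>"
  using sharp_add[of \<alpha> p "- \<beta>"] sharp_minus[of \<beta> p] J1_neg by simp

lemma sharp_zero: "S p 0 = 0"
  using sharp_scaleR[OF J1_zero_mem, of p 0] by simp

lemma sharp_dsec: "\<alpha> \<in> jsec \<Longrightarrow> (\<lambda>p. S p (\<alpha> p)) \<in> dsec"
proof (rule dsecI)
  assume \<alpha>: "\<alpha> \<in> jsec"
  show "S p (\<alpha> p) \<in> D p" for p by (rule sharp_D[OF jsec_J1[OF \<alpha>]])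
  fix l assume l: "l \<in> sec"
  have "S p (\<alpha> p) l = J p (\<alpha> p) (j1 l p)" for p
    using sharp_apply[OF jsec_J1[OF \<alpha>] jsec_J1[OF j1_jsec[OF l]], of p] j1_apply[OF sharp_D[OF jsec_J1[OF \<alpha>]]] by simp
  then show "(\<lambda>p. S p (\<alpha> p) l) \<in> sec" using J_sec[OF \<alpha> j1_jsec[OF l]] by simp
qed

lemma sharp_image: "S p ` J1 p = VerL B \<pi> p"
  using fam unfolding gives_contact_family_def by blast

lemma sharp_VerL: "\<alpha> \<in> J1 p \<Longrightarrow> S p \<alpha> \<in> VerL B \<pi> p"
  using sharp_image by blast

lemma VerL_sharp: assumes "v \<in> VerL B \<pi> p" obtains \<alpha> where "\<alpha> \<in> J1 p" "v = S p \<alpha>"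
  using assms sharp_image by blast

text \<open>By antisymmetry, a jet \<gamma> takes on \<open>S p \<alpha>\<close> minus the value of
  \<alpha> on \<open>S p \<gamma>\<close>, and the latter derivation is vertical.\<close>

lemma sharp_restrict:
  assumes "\<alpha> \<in> J1 p" "\<beta> \<in> J1 p" "\<And>v. v \<in> VerL B \<pi> p \<Longrightarrow> \<alpha> v = \<beta> v"
  shows "S p \<alpha> = S p \<beta>"
proof (rule D_separate[OF sharp_D[OF assms(1)] sharp_D[OF assms(2)]])
  fix \<gamma> assume g: "\<gamma> \<in> J1 p"
  show "\<gamma> (S p \<alpha>) = \<gamma> (S p \<beta>)"
    using sharp_antisym[OF assms(1) g] sharp_antisym[OF assms(2) g] assms(3)[OF sharp_VerL[OF g]] by simp
qed

text \<open>The image of a section of jets under \<open>S\<close> is a vertical section, so it is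
  enough to extend a jet.\<close>

lemma VerL_extend: assumes "v \<in> VerL B \<pi> p" obtains \<Delta> where "\<Delta> \<in> vsec B \<pi>" "\<Delta> p = v"
proof -
  obtain \<alpha> where \<alpha>: "\<alpha> \<in> J1 p" "v = S p \<alpha>" by (rule VerL_sharp[OF assms])
  obtain \<psi> where \<psi>: "\<psi> \<in> jsec" "\<psi> p = \<alpha>" by (rule J1_extend[OF \<alpha>(1)])
  have "(\<lambda>p. S p (\<psi> p)) \<in> vsec B \<pi>"
    by (rule vsecI[OF sharp_dsec[OF \<psi>(1)] sharp_VerL[OF jsec_J1[OF \<psi>(1)]]])
  then show thesis using that[of "\<lambda>p. S p (\<psi> p)"] \<alpha>(2) \<psi>(2) by simp
qed

subsection \<open>A closed extension of the vertical form\<close>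

definition omega :: "'p \<Rightarrow> ('p, 'v) der \<Rightarrow> ('p, 'v) der \<Rightarrow> 'v"
  where "omega = (SOME \<omega>. smooth_contact_family B \<pi> \<omega> \<and>
    (\<forall>p. \<forall>\<alpha>\<in>J1 p. \<forall>\<beta>\<in>J1 p. \<omega> p (S p \<alpha>) (S p \<beta>) = \<alpha> (S p \<beta>)))"

lemma omega: "smooth_contact_family B \<pi> omega"
  and omega_sharp: "\<alpha> \<in> J1 p \<Longrightarrow> \<beta> \<in> J1 p \<Longrightarrow> omega p (S p \<alpha>) (S p \<beta>) = \<alpha> (S p \<beta>)"
proof -
  have "\<exists>\<omega>. smooth_contact_family B \<pi> \<omega> \<and>
    (\<forall>p. \<forall>\<alpha>\<in>J1 p. \<forall>\<beta>\<in>J1 p. \<omega> p (S p \<alpha>) (S p \<beta>) = \<alpha> (S p \<beta>))"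
    using fam unfolding gives_contact_family_def by blast
  from someI_ex[OF this]
  show "smooth_contact_family B \<pi> omega" "\<alpha> \<in> J1 p \<Longrightarrow> \<beta> \<in> J1 p \<Longrightarrow> omega p (S p \<alpha>) (S p \<beta>) = \<alpha> (S p \<beta>)"
    unfolding omega_def[symmetric] by blast+
qed

lemma omega_right: "v \<in> VerL B \<pi> p \<Longrightarrow> lin_on (VerL B \<pi> p) (E p) (omega p v)"
  and omega_left: "v \<in> VerL B \<pi> p \<Longrightarrow> lin_on (VerL B \<pi> p) (E p) (\<lambda>w. omega p w v)"
  and omega_alt: "v \<in> VerL B \<pi> p \<Longrightarrow> omega p v v = 0"
  and omega_sec: "\<Delta> \<in> vsec B \<pi> \<Longrightarrow> \<Delta>' \<in> vsec B \<pi> \<Longrightarrow> (\<lambda>p. omega p (\<Delta> p) (\<Delta>' p)) \<in> sec"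
  and omega_closed: "\<Delta>0 \<in> vsec B \<pi> \<Longrightarrow> \<Delta>1 \<in> vsec B \<pi> \<Longrightarrow> \<Delta>2 \<in> vsec B \<pi> \<Longrightarrow> d2 omega \<Delta>0 \<Delta>1 \<Delta>2 = 0"
  using omega by (simp_all add: smooth_contact_family_def alt_bilin_def)

lemma omega_antisym: "v \<in> VerL B \<pi> p \<Longrightarrow> w \<in> VerL B \<pi> p \<Longrightarrow> omega p v w = - omega p w v"
  using omega_alt[OF VerL_add, of v p w] lin_onD(2)[OF omega_right[OF VerL_add], of v p w v w]
    lin_onD(2)[OF omega_left, of v p v w] lin_onD(2)[OF omega_left, of w p v w] omega_alt[of v p] omega_alt[of w p]
  by (simp add: eq_neg_iff_add_eq_0 add.commute)

text \<open>The contraction of \<open>omega\<close> with the identity derivation is prolonged by 0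
  to the horizontal members of an adapted frame.\<close>

lemma theta_local:
  "\<exists>U \<psi>. open U \<and> p \<in> U \<and> \<psi> \<in> jsec \<and> (\<forall>q\<in>U. \<forall>v\<in>VerL B \<pi> q. \<psi> q v = omega q (idd q) v)"
proof -
  obtain W s y nab where W: "p \<in> W" "adapted W s y nab" by (rule exists_adapted)
  note s = adapted_frame[OF W(2)]
  let ?R = "{2 * m..<N}"
  have iv: "idd \<in> vsec B \<pi>" by (rule vsecI[OF idd_dsec idd_VerL])
  have nv: "nab i \<in> vsec B \<pi>" if "i \<in> ?R" for i
    using that adapted_nab[OF W(2)] adapted_vert[OF W(2)] by (intro vsecI) auto
  have "\<forall>i. \<exists>c. i \<in> ?R \<longrightarrow> c \<in> C \<and> (\<forall>\<^sub>F q in nhds p. omega q (idd q) (nab i q) = c q *\<^sub>R s q)"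
    (is "\<forall>i. ?Q i")
  proof
    fix i
    show "?Q i"
    proof (cases "i \<in> ?R")
    case True
    obtain c where "c \<in> C" "\<forall>\<^sub>F q in nhds p. omega q (idd q) (nab i q) = c q *\<^sub>R s q"
      by (rule frame_on_germ[OF s(1) W(1) omega_sec[OF iv nv[OF True]]])
    then show ?thesis by blast
    next
      case False
      then show ?thesis by blast
    qed
  qed
  then obtain c where
    "\<forall>i. i \<in> ?R \<longrightarrow> c i \<in> C \<and> (\<forall>\<^sub>F q in nhds p. omega q (idd q) (nab i q) = c i q *\<^sub>R s q)"
    by (rule exE[OF choice])
  then have c: "c i \<in> C" "\<forall>\<^sub>F q in nhds p. omega q (idd q) (nab i q) = c i q *\<^sub>R s q" if "i \<in> ?R" for i
    using that by auto
  have "\<forall>\<^sub>F q in nhds p. \<forall>i\<in>?R. omega q (idd q) (nab i q) = c i q *\<^sub>R s q"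
    using c(2) by (intro eventually_ball_finite) auto
  then obtain U where U: "open U" "p \<in> U" "\<And>q i. q \<in> U \<Longrightarrow> i \<in> ?R \<Longrightarrow> omega q (idd q) (nab i q) = c i q *\<^sub>R s q"
    unfolding eventually_nhds by blast
  \<comment> \<open>A \<open>j1 s\<close> term is absent because \<open>omega\<close> vanishes on
    the pair of identity derivations; the horizontal \<open>eta\<close> terms are absent by
    choice.\<close>
  define \<psi> where "\<psi> q = (\<Sum>i\<in>?R. c i q *\<^sub>R eta s (y i) q)" for q
  have "\<psi> \<in> jsec"
    unfolding \<psi>_def[abs_def] using c(1) eta_jsec[OF adapted_y[OF W(2)] s(3)]
    by (intro jsec_sum jsec_scale) auto
  moreover have "\<psi> q v = omega q (idd q) v" if q: "q \<in> U \<inter> W" and v: "v \<in> VerL B \<pi> q" for q v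
  proof -
    have qW: "q \<in> W" and vD: "v \<in> D q" using q VerL_D[OF v] by auto
    let ?d = "\<lambda>i. symbol q v (y i)"
    obtain a where e: "v = cmb nab a ?d q" using cmb_expand[OF W(2) qW vD] by blast
    have d0: "?d i = 0" if "i < 2 * m" for i using adapted_VerL[OF W(2) qW vD] v that by blast
    have "(\<Sum>i<N. ?d i *\<^sub>R nab i q) = (\<Sum>i\<in>?R. ?d i *\<^sub>R nab i q)"
      by (rule sum.mono_neutral_right) (use d0 in auto)
    then have e2: "v = a *\<^sub>R idd q + (\<Sum>i\<in>?R. ?d i *\<^sub>R nab i q)" using e by (simp only: cmb_def[OF W(2)])
    have nV: "nab i q \<in> VerL B \<pi> q" if "i \<in> ?R" for i using vsecD(2)[OF nv[OF that]] .
    note lin = omega_right[OF idd_VerL[of q]]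
    have sm: "omega q (idd q) (\<Sum>i\<in>?R. ?d i *\<^sub>R nab i q) = (\<Sum>i\<in>?R. omega q (idd q) (?d i *\<^sub>R nab i q)) \<and>
        (\<Sum>i\<in>?R. ?d i *\<^sub>R nab i q) \<in> VerL B \<pi> q"
      using nV by (intro lin_on_sum[OF lin VerL_zero VerL_add] VerL_scaleR)
    have "omega q (idd q) v = omega q (idd q) (a *\<^sub>R idd q) + omega q (idd q) (\<Sum>i\<in>?R. ?d i *\<^sub>R nab i q)"
      by (subst e2, rule lin_onD(2)[OF lin VerL_scaleR[OF idd_VerL]]) (use sm in blast)
    also have "\<dots> = (\<Sum>i\<in>?R. omega q (idd q) (?d i *\<^sub>R nab i q))"
      using sm lin_onD(3)[OF lin idd_VerL, of a] omega_alt[OF idd_VerL, of q] by simp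
    also have "\<dots> = (\<Sum>i\<in>?R. ?d i *\<^sub>R c i q *\<^sub>R s q)"
      using nV q U(3) by (intro sum.cong) (auto simp: lin_onD(3)[OF lin])
    also have "\<dots> = \<psi> q v"
      unfolding \<psi>_def sum_fun_apply
      by (rule sum.cong) (auto simp: eta_apply adapted_y[OF W(2)] s(3) vD mult.commute)
    finally show ?thesis by simp
  qed
  ultimately show ?thesis using U(1,2) W(1) s(2) by (intro exI[of _ "U \<inter> W"] exI[of _ \<psi>]) auto
qed

text \<open>The prescription on \<open>VerL\<close> is affine in \<theta>, so it survives a
  combination of local solutions with coefficients of sum 1.\<close>

lemma theta_exists: "\<exists>\<theta>\<in>jsec. \<forall>p. \<forall>v\<in>VerL B \<pi> p. \<theta> p v = omega p (idd p) v"
proof -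
  obtain U \<psi> where U: "\<And>p. open (U p)" "\<And>p. p \<in> U p" "\<And>p. \<psi> p \<in> jsec"
    "\<And>p q v. q \<in> U p \<Longrightarrow> v \<in> VerL B \<pi> q \<Longrightarrow> \<psi> p q v = omega q (idd q) v"
    using theta_local by metis
  obtain P :: "nat \<Rightarrow> 'p" and V b where "\<forall>n. open (V n)" "(\<Union>n. V n) = UNIV" "\<forall>n. b n \<in> C"
    "\<forall>n q. q \<in> V n \<longrightarrow> b n q = 1" "\<forall>n q. q \<notin> U (P n) \<longrightarrow> b n q = 0"
    by (rule countable_bumps[of U, OF U(1,2)])
  then have V: "\<And>n. open (V n)" "(\<Union>n. V n) = UNIV" "\<And>n. b n \<in> C"
    "\<And>n q. q \<in> V n \<Longrightarrow> b n q = 1" "\<And>n q. q \<notin> U (P n) \<Longrightarrow> b n q = 0" by simp_all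
  define g where "g n q = b n q * (\<Prod>k<n. 1 - b k q)" for n q
  have prodC: "(\<lambda>q. \<Prod>k<n. 1 - b k q) \<in> C" for n by (induction n) (auto simp: V(3))
  have gC: "g n \<in> C" for n unfolding g_def[abs_def] using V(3) prodC by simp
  have sum_g: "(\<Sum>i<n. g i q) = 1 - (\<Prod>k<n. 1 - b k q)" for n q
    by (induction n) (auto simp: g_def algebra_simps)
  have prod0: "(\<Prod>k<n. 1 - b k q) = 0" if "q \<in> V k" "k < n" for q k n
    using that V(4) by (intro prod_zero) auto
  define T where "T n q = (\<Sum>i<n. g i q *\<^sub>R \<psi> (P i) q)" for n q
  have T_jsec: "T n \<in> jsec" for n
    unfolding T_def[abs_def] by (rule jsec_sum, rule jsec_scale[OF gC U(3)])
  have T_stable: "T n q = T (Suc k) q" if "q \<in> V k" "k < n" for n k q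
  proof -
    have "(\<Sum>i\<in>{..<n}. g i q *\<^sub>R \<psi> (P i) q) = (\<Sum>i\<in>{..<Suc k}. g i q *\<^sub>R \<psi> (P i) q)"
      by (rule sum.mono_neutral_right) (use that prod0 in \<open>auto simp: g_def\<close>)
    then show ?thesis by (simp only: T_def)
  qed
  \<comment> \<open>The sum is cut off after the first index whose \<open>V\<close> contains
    \<open>q\<close>. By \<open>T_stable\<close> any later cutoff gives the same value, so near each
    point \<theta> agrees with a single section \<open>T n\<close>.\<close>
  define L where "L q = (LEAST k. q \<in> V k)" for q
  have L: "q \<in> V (L q)" for q
  proof -
    have "q \<in> (\<Union>n. V n)" using V(2) by simp
    then show ?thesis unfolding L_def by (auto intro: LeastI)
  qed
  have L_le: "L q \<le> k" if "q \<in> V k" for q k unfolding L_def using that by (rule Least_le)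
  define \<theta> where "\<theta> q = T (Suc (L q)) q" for q
  have \<theta>_eq: "\<theta> q = T (Suc k) q" if "q \<in> V k" for q k
    unfolding \<theta>_def using T_stable[OF L, of q "Suc k"] L_le[OF that] by simp
  have "\<theta> \<in> jsec"
  proof (rule jsec_local)
    fix p
    show "\<exists>\<psi>'\<in>jsec. \<forall>\<^sub>F q in nhds p. \<theta> q = \<psi>' q"
      using T_jsec \<theta>_eq V(1) L unfolding eventually_nhds
      by (intro bexI[of _ "T (Suc (L p))"] exI[of _ "V (L p)"]) auto
  qed
  moreover have "\<theta> q v = omega q (idd q) v" if v: "v \<in> VerL B \<pi> q" for q v
  proof -
    have "\<theta> q v = (\<Sum>i<Suc (L q). g i q *\<^sub>R \<psi> (P i) q v)"
      by (simp only: \<theta>_def T_def sum_fun_apply scaleR_fun_apply)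
    also have "\<dots> = (\<Sum>i<Suc (L q). g i q *\<^sub>R omega q (idd q) v)"
    proof (rule sum.cong[OF refl])
      fix i
      show "g i q *\<^sub>R \<psi> (P i) q v = g i q *\<^sub>R omega q (idd q) v"
        using U(4)[OF _ v, of "P i"] V(5)[of q i] by (cases "q \<in> U (P i)") (auto simp: g_def)
    qed
    also have "\<dots> = (\<Sum>i<Suc (L q). g i q) *\<^sub>R omega q (idd q) v" by (simp only: scaleR_sum_left)
    also have "\<dots> = omega q (idd q) v" unfolding sum_g prod0[OF L lessI] by simp
    finally show ?thesis .
  qed
  ultimately show ?thesis by blast
qed

definition theta :: "'p \<Rightarrow> ('p, 'v) jet"
  where "theta = (SOME \<theta>. \<theta> \<in> jsec \<and> (\<forall>p. \<forall>v\<in>VerL B \<pi> p. \<theta> p v = omega p (idd p) v))"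

lemma theta_jsec: "theta \<in> jsec" and theta_VerL: "v \<in> VerL B \<pi> p \<Longrightarrow> theta p v = omega p (idd p) v"
proof -
  have "\<exists>\<theta>. \<theta> \<in> jsec \<and> (\<forall>p. \<forall>v\<in>VerL B \<pi> p. \<theta> p v = omega p (idd p) v)"
    using theta_exists by blast
  from someI_ex[OF this]
  show "theta \<in> jsec" "v \<in> VerL B \<pi> p \<Longrightarrow> theta p v = omega p (idd p) v"
    unfolding theta_def[symmetric] by blast+
qed

abbreviation Om where "Om \<equiv> d1 theta"

lemmas Om_J1 = d1_J1[OF theta_jsec]
lemmas Om_antisym = d1_antisym[OF theta_jsec]
lemmas Om_sec = d1_sec[OF theta_jsec]
lemmas Om_closed = d2_d1[OF theta_jsec]
lemmas Om_right_add = J1_add[OF Om_J1]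
lemmas Om_right_diff = J1_diff[OF Om_J1]
lemmas Om_right_scaleR = J1_scaleR[OF Om_J1]
lemmas Om_right_minus = J1_uminus[OF Om_J1]
lemmas Om_right_zero = J1_zero[OF Om_J1]

lemma Om_left_add: "\<delta> \<in> D p \<Longrightarrow> \<delta>' \<in> D p \<Longrightarrow> Om p (\<delta> + \<delta>') \<epsilon> = Om p \<delta> \<epsilon> + Om p \<delta>' \<epsilon>"
proof -
  assume d: "\<delta> \<in> D p" "\<delta>' \<in> D p"
  have "Om p (\<delta> + \<delta>') \<epsilon> = - (Om p \<epsilon> \<delta> + Om p \<epsilon> \<delta>')"
    by (simp only: Om_antisym[of p "\<delta> + \<delta>'" \<epsilon>] Om_right_add[OF d])
  then show ?thesis by (simp only: Om_antisym[of p \<delta> \<epsilon>] Om_antisym[of p \<delta>' \<epsilon>] minus_add_distrib)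
qed

lemma Om_left_scaleR: "\<delta> \<in> D p \<Longrightarrow> Om p (c *\<^sub>R \<delta>) \<epsilon> = c *\<^sub>R Om p \<delta> \<epsilon>"
  by (simp only: Om_antisym[of p "c *\<^sub>R \<delta>" \<epsilon>] Om_antisym[of p \<delta> \<epsilon>] Om_right_scaleR scaleR_minus_right)

lemma Om_left_minus: "\<delta> \<in> D p \<Longrightarrow> Om p (- \<delta>) \<epsilon> = - Om p \<delta> \<epsilon>"
  using Om_left_scaleR[of \<delta> p "-1"] by simp

lemma Om_left_diff: "\<delta> \<in> D p \<Longrightarrow> \<delta>' \<in> D p \<Longrightarrow> Om p (\<delta> - \<delta>') \<epsilon> = Om p \<delta> \<epsilon> - Om p \<delta>' \<epsilon>"
  using Om_left_add[of \<delta> p "- \<delta>'" \<epsilon>] Om_left_minus[of \<delta>' p \<epsilon>] D_minus by simp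

text \<open>Since the identity derivation \<open>1\<close> is central, closedness of \<open>\<omega>\<close> on \<open>(1, \<Delta>\<^sub>1, \<Delta>\<^sub>2)\<close> says that
  \<open>\<omega>\<close> is the differential of its contraction with \<open>1\<close>.\<close>

lemma Om_vertical:
  assumes "v \<in> VerL B \<pi> p" "w \<in> VerL B \<pi> p"
  shows "Om p v w = omega p v w"
proof -
  obtain \<Delta>1 where \<Delta>1: "\<Delta>1 \<in> vsec B \<pi>" "\<Delta>1 p = v" by (rule VerL_extend[OF assms(1)])
  obtain \<Delta>2 where \<Delta>2: "\<Delta>2 \<in> vsec B \<pi>" "\<Delta>2 p = w" by (rule VerL_extend[OF assms(2)])
  note d = vsecD(1)[OF \<Delta>1(1)] vsecD(1)[OF \<Delta>2(1)]
  have iv: "idd \<in> vsec B \<pi>" by (rule vsecI[OF idd_dsec idd_VerL])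
  have central: "dbracket idd \<Delta> p = 0" if \<Delta>: "\<Delta> \<in> dsec" for \<Delta>
  proof
    fix l
    show "dbracket idd \<Delta> p l = 0 l"
    proof (cases "l \<in> sec")
      case True
      then show ?thesis using dsec_sec[OF \<Delta> True] by (simp add: dbracket_apply idd_def)
    qed (simp add: dbracket_outside idd_dsec \<Delta>)
  qed
  have th: "(\<lambda>q. omega q (idd q) (\<Delta> q)) = (\<lambda>q. theta q (\<Delta> q))" if "\<Delta> \<in> vsec B \<pi>" for \<Delta>
    using theta_VerL[OF vsecD(2)[OF that]] by simp
  have bv: "dbracket \<Delta>1 \<Delta>2 p \<in> VerL B \<pi> p" using vsecD(2)[OF dbracket_vsec[OF \<Delta>1(1) \<Delta>2(1)]] .
  have z: "omega p 0 v = 0" "omega p 0 w = 0"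
    using lin_onD(3)[OF omega_left[OF assms(1)] VerL_zero, of 0] lin_onD(3)[OF omega_left[OF assms(2)] VerL_zero, of 0] by auto
  have "d2 omega idd \<Delta>1 \<Delta>2 p = 0" using omega_closed[OF iv \<Delta>1(1) \<Delta>2(1)] by simp
  then have "omega p v w - \<Delta>1 p (\<lambda>q. theta q (\<Delta>2 q)) + \<Delta>2 p (\<lambda>q. theta q (\<Delta>1 q)) - omega p (dbracket \<Delta>1 \<Delta>2 p) (idd p) = 0"
    using omega_sec[OF \<Delta>1(1) \<Delta>2(1)]
    by (simp add: d2_def central d th \<Delta>1 \<Delta>2 z) (simp add: idd_def \<Delta>1 \<Delta>2)
  moreover have "omega p (dbracket \<Delta>1 \<Delta>2 p) (idd p) = - theta p (dbracket \<Delta>1 \<Delta>2 p)"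
    using omega_antisym[OF bv idd_VerL] theta_VerL[OF bv] by simp
  ultimately have "omega p v w = CE theta \<Delta>1 \<Delta>2 p" by (simp add: CE_def algebra_simps)
  then show ?thesis using d1_eq[OF theta_jsec d, of p] \<Delta>1(2) \<Delta>2(2) by simp
qed

end

context contact_setting
begin

subsection \<open>The transverse complex structure\<close>

definition Pv :: "'p \<Rightarrow> ('p, 'v) der \<Rightarrow> ('p, 'v) der"
  where "Pv p \<delta> = S p (Om p \<delta>)"

lemma Pv_VerL: "Pv p \<delta> \<in> VerL B \<pi> p"
  unfolding Pv_def by (rule sharp_VerL[OF Om_J1])

lemma Pv_D: "Pv p \<delta> \<in> D p"
  by (rule VerL_D[OF Pv_VerL])

lemma Om_plus: "\<delta> \<in> D p \<Longrightarrow> \<delta>' \<in> D p \<Longrightarrow> Om p (\<delta> + \<delta>') = Om p \<delta> + Om p \<delta>'"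
  by (rule ext) (simp only: Om_left_add plus_fun_apply)

lemma Om_scale: "\<delta> \<in> D p \<Longrightarrow> Om p (c *\<^sub>R \<delta>) = c *\<^sub>R Om p \<delta>"
  by (rule ext) (simp only: Om_left_scaleR scaleR_fun_apply)

lemma Om_zero: "Om p 0 = 0"
  using Om_scale[OF idd_D, of p 0] by simp

lemma Pv_add: "\<delta> \<in> D p \<Longrightarrow> \<delta>' \<in> D p \<Longrightarrow> Pv p (\<delta> + \<delta>') = Pv p \<delta> + Pv p \<delta>'"
  by (simp only: Pv_def Om_plus sharp_add[OF Om_J1 Om_J1])

lemma Pv_scaleR: "\<delta> \<in> D p \<Longrightarrow> Pv p (c *\<^sub>R \<delta>) = c *\<^sub>R Pv p \<delta>"
  by (simp only: Pv_def Om_scale sharp_scaleR[OF Om_J1])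

lemma Pv_zero: "Pv p 0 = 0"
  by (simp only: Pv_def Om_zero sharp_zero)

lemma Pv_diff: "\<delta> \<in> D p \<Longrightarrow> \<delta>' \<in> D p \<Longrightarrow> Pv p (\<delta> - \<delta>') = Pv p \<delta> - Pv p \<delta>'"
  using Pv_add[of \<delta> p "(-1) *\<^sub>R \<delta>'"] Pv_scaleR[of \<delta>' p "-1"] D_scaleR[of \<delta>' p "-1"] by simp

lemma Om_sharp: "\<alpha> \<in> J1 p \<Longrightarrow> Om p (S p \<alpha>) \<epsilon> = \<alpha> (Pv p \<epsilon>)"
  by (simp only: Om_antisym[of p "S p \<alpha>" \<epsilon>] Pv_def sharp_antisym[OF Om_J1, of \<alpha> p \<epsilon>])

text \<open>On \<open>VerL\<close> the form \<open>Om\<close> is \<open>omega\<close>, the inverse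
  of \<open>J\<close>, and therefore \<open>S\<close> undoes it.\<close>

lemma Pv_vertical:
  assumes "v \<in> VerL B \<pi> p"
  shows "Pv p v = v"
proof -
  obtain \<alpha> where \<alpha>: "\<alpha> \<in> J1 p" "v = S p \<alpha>" by (rule VerL_sharp[OF assms])
  show ?thesis
  proof (rule D_separate[OF Pv_D VerL_D[OF assms]])
    fix \<gamma> assume g: "\<gamma> \<in> J1 p"
    have "\<gamma> (Pv p v) = - Om p v (S p \<gamma>)" unfolding Pv_def by (rule sharp_antisym[OF Om_J1 g])
    also have "\<dots> = - omega p (S p \<alpha>) (S p \<gamma>)" using Om_vertical[OF assms sharp_VerL[OF g]] \<alpha>(2) by simp
    also have "\<dots> = \<gamma> v" using omega_sharp[OF \<alpha>(1) g] sharp_antisym[OF \<alpha>(1) g] \<alpha>(2) by simp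
    finally show "\<gamma> (Pv p v) = \<gamma> v" .
  qed
qed

lemma Om_jsec: "\<Delta> \<in> dsec \<Longrightarrow> (\<lambda>p. Om p (\<Delta> p)) \<in> jsec"
  by (rule jsecI[OF Om_J1 Om_sec])

lemma Pv_dsec: "\<Delta> \<in> dsec \<Longrightarrow> (\<lambda>p. Pv p (\<Delta> p)) \<in> dsec"
  unfolding Pv_def by (rule sharp_dsec[OF Om_jsec])

text \<open>Membership of (\<delta>, - h) in \<open>T01\<close> says that \<delta> - i h projects to
  type (0,1), that is, h projects to -I applied to the projection of \<delta>. The condition on
  \<open>Pv\<close> puts h into the \<Omega>-orthogonal complement of \<open>VerL\<close> and so
  removes the vertical ambiguity.\<close>

definition phi :: "'p \<Rightarrow> ('p, 'v) der \<Rightarrow> ('p, 'v) der"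
  where "phi p \<delta> = (if \<delta> \<in> D p then (THE h. h \<in> D p \<and> Pv p h = 0 \<and> (\<delta>, - h) \<in> T01 p) else 0)"

lemma phi_eqI:
  assumes "\<delta> \<in> D p" "h \<in> D p" "Pv p h = 0" "(\<delta>, - h) \<in> T01 p"
  shows "phi p \<delta> = h"
proof -
  have uniq: "h' = h" if h': "h' \<in> D p" "Pv p h' = 0" "(\<delta>, - h') \<in> T01 p" for h'
  proof -
    \<comment> \<open>The difference of two candidates is vertical, hence fixed by
      \<open>Pv\<close>, which also annihilates it.\<close>
    have "(\<delta> + (-1) *\<^sub>R \<delta>, - h + (-1) *\<^sub>R - h') \<in> T01 p"
      by (rule T01_add[OF assms(4) T01_scaleR[OF h'(3)]])
    then have "(0, h' - h) \<in> T01 p" by simp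
    then have "Pv p (h' - h) = h' - h" by (rule Pv_vertical[OF T01_vertical])
    then show ?thesis using Pv_diff[OF h'(1) assms(2)] h'(2) assms(3) by simp
  qed
  have "(THE h. h \<in> D p \<and> Pv p h = 0 \<and> (\<delta>, - h) \<in> T01 p) = h"
  proof (rule the_equality)
    show "h \<in> D p \<and> Pv p h = 0 \<and> (\<delta>, - h) \<in> T01 p" by (intro conjI assms(2-4))
    show "h' = h" if "h' \<in> D p \<and> Pv p h' = 0 \<and> (\<delta>, - h') \<in> T01 p" for h'
      by (rule uniq[OF conjunct1[OF that] conjunct1[OF conjunct2[OF that]] conjunct2[OF conjunct2[OF that]]])
  qed
  then show ?thesis using assms(1) by (simp only: phi_def if_True)
qed

text \<open>The coordinates of -I applied to the projection of \<delta>, with all fiber coordinates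
  0.\<close>

definition rotc :: "(nat \<Rightarrow> 'p \<Rightarrow> real) \<Rightarrow> 'p \<Rightarrow> ('p, 'v) der \<Rightarrow> nat \<Rightarrow> real"
  where "rotc y q \<delta> j = (if j < m then symbol q \<delta> (y (m + j))
    else if j < 2 * m then - symbol q \<delta> (y (j - m)) else 0)"

text \<open>Any lift h of the rotated projection will do: subtracting \<open>Pv p h\<close> moves it
  into the complement, and a vertical change does not leave \<open>T01\<close>.\<close>

lemma phi_frame:
  assumes W: "adapted W s y nab" "p \<in> W" and \<delta>: "\<delta> \<in> D p"
  defines "h \<equiv> cmb nab 0 (rotc y p \<delta>) p"
  shows "phi p \<delta> = h - Pv p h" "h - Pv p h \<in> D p" "Pv p (h - Pv p h) = 0" "(\<delta>, - (h - Pv p h)) \<in> T01 p"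
proof -
  have hD: "h \<in> D p" unfolding h_def by (rule cmb_D[OF W(1)])
  show D: "h - Pv p h \<in> D p" by (rule D_minus2[OF hD Pv_D])
  show P: "Pv p (h - Pv p h) = 0"
    using Pv_diff[OF hD Pv_D] Pv_vertical[OF Pv_VerL] by simp
  have sy: "symbol p (- h) (y j) = - rotc y p \<delta> j" if "j < N" for j
    using symbol_scaleR[OF hD, of "-1"] cmb_symbol[OF W that] by (simp add: h_def)
  have "(\<delta>, - h) \<in> T01 p"
    unfolding adapted_T01[OF W \<delta> D_minus[OF hD]]
    using sy by (auto simp: N_def rotc_def)
  from T01_add[OF this T01_VerL[OF VerL_zero Pv_VerL]]
  show T: "(\<delta>, - (h - Pv p h)) \<in> T01 p" by simp
  show "phi p \<delta> = h - Pv p h" by (rule phi_eqI[OF \<delta> D P T])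
qed

lemma phi_outside: "\<delta> \<notin> D p \<Longrightarrow> phi p \<delta> = 0"
  by (simp add: phi_def)

lemma phi:
  assumes "\<delta> \<in> D p"
  shows "Pv p (phi p \<delta>) = 0" and phi_T01: "(\<delta>, - phi p \<delta>) \<in> T01 p"
proof -
  obtain W s y nab where W: "p \<in> W" "adapted W s y nab" by (rule exists_adapted)
  show "Pv p (phi p \<delta>) = 0" "(\<delta>, - phi p \<delta>) \<in> T01 p"
    using phi_frame[OF W(2,1) assms] by auto
qed

lemma phi_D: "phi p \<delta> \<in> D p"
proof (cases "\<delta> \<in> D p")
  case True
  then show ?thesis using T01_D[OF phi_T01[OF True]] D_minus[of "- phi p \<delta>" p] by simp
qed (simp add: phi_outside D_zero)

lemma Pv_phi: "Pv p (phi p \<delta>) = 0"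
  using phi(1) phi_outside Pv_zero by (cases "\<delta> \<in> D p") auto

lemma phi_add:
  assumes "\<delta> \<in> D p" "\<delta>' \<in> D p"
  shows "phi p (\<delta> + \<delta>') = phi p \<delta> + phi p \<delta>'"
proof (rule phi_eqI[OF D_plus[OF assms] D_plus[OF phi_D phi_D]])
  show "Pv p (phi p \<delta> + phi p \<delta>') = 0" by (simp only: Pv_add[OF phi_D phi_D] Pv_phi add_0)
  show "(\<delta> + \<delta>', - (phi p \<delta> + phi p \<delta>')) \<in> T01 p"
    using T01_add[OF phi_T01[OF assms(1)] phi_T01[OF assms(2)]] by simp
qed

lemma phi_scaleR:
  assumes "\<delta> \<in> D p"
  shows "phi p (c *\<^sub>R \<delta>) = c *\<^sub>R phi p \<delta>"
proof (rule phi_eqI[OF D_scaleR[OF assms] D_scaleR[OF phi_D]])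
  show "Pv p (c *\<^sub>R phi p \<delta>) = 0" by (simp only: Pv_scaleR[OF phi_D] Pv_phi scaleR_zero_right)
  show "(c *\<^sub>R \<delta>, - (c *\<^sub>R phi p \<delta>)) \<in> T01 p"
    using T01_scaleR[OF phi_T01[OF assms], of c] by simp
qed

lemma phi_minus: "\<delta> \<in> D p \<Longrightarrow> phi p (- \<delta>) = - phi p \<delta>"
  using phi_scaleR[of \<delta> p "-1"] by simp

lemma phi_vertical: "v \<in> VerL B \<pi> p \<Longrightarrow> phi p v = 0"
  by (rule phi_eqI) (auto simp: VerL_D D_zero Pv_zero T01_VerL VerL_zero)

text \<open>Multiplying the pair (\<delta>, - \<phi> \<delta>) by i gives (\<phi> \<delta>,
  \<delta>), so the second image is - \<delta> corrected by its vertical part.\<close>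

lemma phi_phi:
  assumes "\<delta> \<in> D p"
  shows "phi p (phi p \<delta>) = Pv p \<delta> - \<delta>"
proof (rule phi_eqI[OF phi_D D_minus2[OF Pv_D assms]])
  show "Pv p (Pv p \<delta> - \<delta>) = 0" using Pv_diff[OF Pv_D assms] Pv_vertical[OF Pv_VerL] by simp
  have "(phi p \<delta>, \<delta>) \<in> T01 p" using T01_rotate[OF phi_T01[OF assms]] by simp
  from T01_add[OF this T01_VerL[OF VerL_zero VerL_scaleR[OF Pv_VerL, of "-1"]]]
  show "(phi p \<delta>, - (Pv p \<delta> - \<delta>)) \<in> T01 p" by simp
qed

text \<open>Every element of \<open>T01\<close> is a - i \<phi>(a) plus i times a vertical
  derivation, which describes \<open>T01\<close> by free real data.\<close>

lemma T01_phi_iff: "(a, b) \<in> T01 p \<longleftrightarrow> a \<in> D p \<and> b \<in> D p \<and> b + phi p a \<in> VerL B \<pi> p"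
proof
  assume T: "(a, b) \<in> T01 p"
  then have d: "a \<in> D p" "b \<in> D p" using T01_D by auto
  have "(a + (-1) *\<^sub>R a, b + (-1) *\<^sub>R - phi p a) \<in> T01 p"
    by (rule T01_add[OF T T01_scaleR[OF phi_T01[OF d(1)]]])
  then have "(0, b + phi p a) \<in> T01 p" by simp
  then show "a \<in> D p \<and> b \<in> D p \<and> b + phi p a \<in> VerL B \<pi> p" using d T01_vertical by blast
next
  assume d: "a \<in> D p \<and> b \<in> D p \<and> b + phi p a \<in> VerL B \<pi> p"
  then have "(a + 0, - phi p a + (b + phi p a)) \<in> T01 p"
    by (intro T01_add phi_T01 T01_VerL VerL_zero) auto
  then show "(a, b) \<in> T01 p" by simp
qed

lemma phi_dsec:
  assumes \<Delta>: "\<Delta> \<in> dsec"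
  shows "(\<lambda>p. phi p (\<Delta> p)) \<in> dsec"
proof (rule dsec_local)
  fix p
  obtain W s y nab where W: "p \<in> W" "adapted W s y nab" by (rule exists_adapted)
  let ?h = "\<lambda>q. \<Sum>i<N. rotc y q (\<Delta> q) i *\<^sub>R nab i q"
  have "(\<lambda>q. rotc y q (\<Delta> q) i) \<in> C" if "i < N" for i
  proof -
    have y: "(\<lambda>q. symbol q (\<Delta> q) (y j)) \<in> C" if "j < N" for j by (rule symbol_C[OF \<Delta> adapted_y[OF W(2) that]])
    consider "i < m" | "\<not> i < m" "i < 2 * m" | "\<not> i < m" "\<not> i < 2 * m" by blast
    then show ?thesis using y[of "m + i"] y[of "i - m"] by cases (auto simp: rotc_def N_def)
  qed
  then have h: "?h \<in> dsec" using adapted_nab[OF W(2)] by (intro dsec_sum dsec_scale) auto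
  have "\<forall>\<^sub>F q in nhds p. phi q (\<Delta> q) = ?h q - Pv q (?h q)"
    using eventually_nhds_in_open[OF adapted_frame(2)[OF W(2)] W(1)]
  proof eventually_elim
    case (elim q)
    have "cmb nab 0 (rotc y q (\<Delta> q)) q = ?h q" by (simp add: cmb_def[OF W(2)])
    then show ?case using phi_frame(1)[OF W(2) elim dsec_D[OF \<Delta>]] by simp
  qed
  then show "\<exists>\<Delta>'\<in>dsec. \<forall>\<^sub>F q in nhds p. phi q (\<Delta> q) = \<Delta>' q"
    using dsec_diff[OF h Pv_dsec[OF h]] by (intro bexI[of _ "\<lambda>q. ?h q - Pv q (?h q)"])
qed

lemma Om_phi_sharp: "\<alpha> \<in> J1 p \<Longrightarrow> Om p (phi p \<delta>) (S p \<alpha>) = 0"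
  using Om_sharp[of \<alpha> p "phi p \<delta>"] Om_antisym[of p "phi p \<delta>" "S p \<alpha>"] by (simp add: Pv_phi J1_zero)

lemma Om_phi_vertical: "v \<in> VerL B \<pi> p \<Longrightarrow> Om p (phi p \<delta>) v = 0"
  using Om_phi_sharp VerL_sharp by metis

subsection \<open>The endomorphism\<close>

text \<open>The first term is, up to sign, inverse to \<open>S\<close> on \<open>VerL\<close>. Alone
  it would leave - \<Omega>(\<phi> \<delta>, \<epsilon>) + \<Omega>(\<delta>, \<phi> \<epsilon>) in
  the square of \<open>K0\<close>; the second term cancels this because \<phi> squares to
  \<open>Pv\<close> - 1.\<close>

definition sig :: "'p \<Rightarrow> ('p, 'v) der \<Rightarrow> ('p, 'v) jet"
  where "sig p \<delta> = - Om p \<delta> + (Om p (phi p \<delta>) \<circ> phi p)"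

definition K0 :: "'p \<Rightarrow> ('p, 'v) gen \<Rightarrow> ('p, 'v) gen"
  where "K0 p z = (phi p (fst z) + S p (snd z), sig p (fst z) - (snd z \<circ> phi p))"

lemma sig_apply: "sig p \<delta> \<epsilon> = - Om p \<delta> \<epsilon> + Om p (phi p \<delta>) (phi p \<epsilon>)"
  by (simp add: sig_def)

lemma comp_phi_J1:
  assumes "\<beta> \<in> J1 p"
  shows "\<beta> \<circ> phi p \<in> J1 p"
  by (rule J1I) (simp_all only: o_def J1_E[OF assms phi_D] phi_add J1_add[OF assms phi_D phi_D] phi_scaleR
      J1_scaleR[OF assms phi_D] phi_outside J1_zero[OF assms] not_False_eq_True)

lemma sig_J1: "sig p \<delta> \<in> J1 p"
  unfolding sig_def by (rule J1_plus[OF J1_neg[OF Om_J1] comp_phi_J1[OF Om_J1]])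

lemma sig_add: "\<delta> \<in> D p \<Longrightarrow> \<delta>' \<in> D p \<Longrightarrow> sig p (\<delta> + \<delta>') = sig p \<delta> + sig p \<delta>'"
  by (rule ext) (simp only: sig_apply plus_fun_apply phi_add Om_left_add phi_D, simp)

lemma sig_scaleR: "\<delta> \<in> D p \<Longrightarrow> sig p (c *\<^sub>R \<delta>) = c *\<^sub>R sig p \<delta>"
  by (rule ext) (simp only: sig_apply scaleR_fun_apply phi_scaleR Om_left_scaleR phi_D, simp add: algebra_simps)

lemma sig_vertical: "v \<in> VerL B \<pi> p \<Longrightarrow> sig p v = - Om p v"
  by (rule ext) (simp add: sig_apply phi_vertical Om_zero)

lemma gfib_iff: "z \<in> gfib p \<longleftrightarrow> fst z \<in> D p \<and> snd z \<in> J1 p"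
  by (simp add: gfib_def mem_Times_iff)

lemma gfib_zero: "0 \<in> gfib p"
  by (simp add: gfib_iff D_zero J1_zero_mem)

lemma gfib_add: "z \<in> gfib p \<Longrightarrow> w \<in> gfib p \<Longrightarrow> z + w \<in> gfib p"
  by (simp add: gfib_iff D_plus J1_plus)

lemma gfib_scaleR: "z \<in> gfib p \<Longrightarrow> c *\<^sub>R z \<in> gfib p"
  by (simp add: gfib_iff D_scaleR J1_scale)

lemma gfib_minus: "z \<in> gfib p \<Longrightarrow> - z \<in> gfib p"
  using gfib_scaleR[of z p "-1"] by simp

lemma K0_gfib: "z \<in> gfib p \<Longrightarrow> K0 p z \<in> gfib p"
  by (simp add: gfib_iff K0_def D_plus phi_D sharp_D J1_minus sig_J1 comp_phi_J1)

lemma K0_add: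
  assumes "z \<in> gfib p" "w \<in> gfib p"
  shows "K0 p (z + w) = K0 p z + K0 p w"
proof -
  have "(snd z + snd w) \<circ> phi p = (snd z \<circ> phi p) + (snd w \<circ> phi p)" by (rule ext) simp
  then show ?thesis
    using assms by (simp add: gfib_iff K0_def phi_add sharp_add sig_add)
qed

lemma K0_scaleR:
  assumes "z \<in> gfib p"
  shows "K0 p (c *\<^sub>R z) = c *\<^sub>R K0 p z"
proof -
  have "(c *\<^sub>R snd z) \<circ> phi p = c *\<^sub>R (snd z \<circ> phi p)" by (rule ext) simp
  then show ?thesis
    using assms by (simp add: gfib_iff K0_def phi_scaleR sharp_scaleR sig_scaleR scaleR_add_right scaleR_diff_right)
qed

lemma sharp_comp_phi:
  assumes "\<beta> \<in> J1 p"
  shows "S p (\<beta> \<circ> phi p) = 0"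
proof -
  have "S p (\<beta> \<circ> phi p) = S p 0"
    by (rule sharp_restrict[OF comp_phi_J1[OF assms] J1_zero_mem]) (simp add: phi_vertical J1_zero[OF assms])
  then show ?thesis by (simp add: sharp_zero)
qed

lemma K0_square:
  assumes "z \<in> gfib p"
  shows "K0 p (K0 p z) = - z"
proof -
  obtain \<delta> \<alpha> where z: "z = (\<delta>, \<alpha>)" "\<delta> \<in> D p" "\<alpha> \<in> J1 p" using assms by (cases z) (auto simp: gfib_iff)
  have S\<alpha>: "S p \<alpha> \<in> D p" "phi p (S p \<alpha>) = 0"
    using sharp_D[OF z(3)] phi_vertical[OF sharp_VerL[OF z(3)]] by auto
  let ?x = "phi p \<delta> + S p \<alpha>"
  have px: "phi p ?x = Pv p \<delta> - \<delta>" using phi_add[OF phi_D S\<alpha>(1)] phi_phi[OF z(2)] S\<alpha>(2) by simp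
  have "S p (sig p \<delta> - (\<alpha> \<circ> phi p)) = S p (sig p \<delta>) - S p (\<alpha> \<circ> phi p)"
    by (rule sharp_diff[OF sig_J1 comp_phi_J1[OF z(3)]])
  also have "S p (sig p \<delta>) = - Pv p \<delta>"
    unfolding sig_def using sharp_add[OF J1_neg[OF Om_J1] comp_phi_J1[OF Om_J1]]
    by (simp add: sharp_minus[OF Om_J1] sharp_comp_phi[OF Om_J1] Pv_def)
  finally have "S p (sig p \<delta> - (\<alpha> \<circ> phi p)) = - Pv p \<delta>"
    unfolding sharp_comp_phi[OF z(3)] by (simp only: diff_0_right)
  then have first: "phi p ?x + S p (sig p \<delta> - (\<alpha> \<circ> phi p)) = - \<delta>"
    unfolding px by simp
  have "sig p ?x \<epsilon> - (sig p \<delta> - (\<alpha> \<circ> phi p)) (phi p \<epsilon>) = - \<alpha> \<epsilon>" if e: "\<epsilon> \<in> D p" for \<epsilon>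
  proof -
    have 1: "Om p ?x \<epsilon> = Om p (phi p \<delta>) \<epsilon> + \<alpha> (Pv p \<epsilon>)"
      by (simp only: Om_left_add[OF phi_D S\<alpha>(1)] Om_sharp[OF z(3)])
    have "Om p (Pv p \<delta>) (phi p \<epsilon>) = 0"
      using Om_antisym[of p "Pv p \<delta>" "phi p \<epsilon>"] Om_phi_vertical[OF Pv_VerL, of p \<epsilon> \<delta>] by simp
    then have 2: "Om p (phi p ?x) (phi p \<epsilon>) = - Om p \<delta> (phi p \<epsilon>)"
      unfolding px using Om_left_diff[OF Pv_D z(2), of \<delta> "phi p \<epsilon>"] by simp
    have 3: "Om p (phi p \<delta>) (phi p (phi p \<epsilon>)) = - Om p (phi p \<delta>) \<epsilon>"
      unfolding phi_phi[OF e] using Om_right_diff[OF Pv_D e, of "phi p \<delta>" \<epsilon>] Om_phi_vertical[OF Pv_VerL, of p \<delta> \<epsilon>] by simp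
    have 4: "\<alpha> (phi p (phi p \<epsilon>)) = \<alpha> (Pv p \<epsilon>) - \<alpha> \<epsilon>"
      unfolding phi_phi[OF e] by (rule J1_diff[OF z(3) Pv_D e])
    show ?thesis by (simp add: sig_apply 1 2 3 4)
  qed
  then have second: "sig p ?x - ((sig p \<delta> - (\<alpha> \<circ> phi p)) \<circ> phi p) = - \<alpha>"
    by (intro J1_eqI[where p = p] J1_minus sig_J1 comp_phi_J1 J1_neg z(3)) auto
  show ?thesis using first second by (simp add: K0_def z(1))
qed

lemma K0_pairing:
  assumes "z \<in> gfib p" "w \<in> gfib p"
  shows "pairing (K0 p z) (K0 p w) = pairing z w"
proof -
  obtain \<delta> \<alpha> where z: "z = (\<delta>, \<alpha>)" "\<delta> \<in> D p" "\<alpha> \<in> J1 p" using assms(1) by (cases z) (auto simp: gfib_iff)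
  obtain \<epsilon> \<beta> where w: "w = (\<epsilon>, \<beta>)" "\<epsilon> \<in> D p" "\<beta> \<in> J1 p" using assms(2) by (cases w) (auto simp: gfib_iff)
  \<comment> \<open>One half of the pairing. In the sum of both halves the terms with
    \<open>Om\<close> cancel by antisymmetry and those with \<open>Pv\<close> cancel each other,
    which leaves \<alpha>(\<epsilon>) + \<beta>(\<delta>).\<close>
  have half: "(sig p \<delta> - (\<alpha> \<circ> phi p)) (phi p \<epsilon> + S p \<beta>) =
      - Om p \<delta> (phi p \<epsilon>) - Om p (phi p \<delta>) \<epsilon> + \<beta> (Pv p \<delta>) - \<alpha> (Pv p \<epsilon>) + \<alpha> \<epsilon>"
    if d: "\<delta> \<in> D p" "\<alpha> \<in> J1 p" "\<epsilon> \<in> D p" "\<beta> \<in> J1 p" for \<delta> \<alpha> \<epsilon> \<beta>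
  proof -
    have "(sig p \<delta> - (\<alpha> \<circ> phi p)) (phi p \<epsilon> + S p \<beta>) =
        (sig p \<delta> - (\<alpha> \<circ> phi p)) (phi p \<epsilon>) + (sig p \<delta> - (\<alpha> \<circ> phi p)) (S p \<beta>)"
      by (rule J1_add[OF J1_minus[OF sig_J1 comp_phi_J1[OF d(2)]] phi_D sharp_D[OF d(4)]])
    moreover have "phi p (S p \<beta>) = 0" by (rule phi_vertical[OF sharp_VerL[OF d(4)]])
    moreover have "Om p \<delta> (S p \<beta>) = - \<beta> (Pv p \<delta>)"
      using Om_antisym[of p \<delta> "S p \<beta>"] Om_sharp[OF d(4)] by simp
    moreover have "Om p (phi p \<delta>) (phi p (phi p \<epsilon>)) = - Om p (phi p \<delta>) \<epsilon>"
      unfolding phi_phi[OF d(3)] using Om_right_diff[OF Pv_D d(3), of "phi p \<delta>" \<epsilon>] Om_phi_vertical[OF Pv_VerL, of p \<delta> \<epsilon>] by simp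
    moreover have "\<alpha> (phi p (phi p \<epsilon>)) = \<alpha> (Pv p \<epsilon>) - \<alpha> \<epsilon>"
      unfolding phi_phi[OF d(3)] by (rule J1_diff[OF d(2) Pv_D d(3)])
    ultimately show ?thesis
      by (simp add: sig_apply Om_right_zero J1_zero[OF d(2)])
  qed
  show ?thesis
    using half[OF z(2,3) w(2,3)] half[OF w(2,3) z(2,3)] Om_antisym[of p \<epsilon> "phi p \<delta>"] Om_antisym[of p "phi p \<epsilon>" \<delta>]
    by (simp add: pairing_def K0_def z(1) w(1))
qed

lemma sig_jsec: "\<Delta> \<in> dsec \<Longrightarrow> (\<lambda>p. sig p (\<Delta> p)) \<in> jsec"
proof (rule jsecI[OF sig_J1])
  fix \<Theta> assume d: "\<Delta> \<in> dsec" "\<Theta> \<in> dsec"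
  show "(\<lambda>p. sig p (\<Delta> p) (\<Theta> p)) \<in> sec"
    unfolding sig_apply
    by (rule sec_add[OF sec_uminus[OF Om_sec[OF d]] Om_sec[OF phi_dsec[OF d(1)] phi_dsec[OF d(2)]]])
qed

lemma comp_phi_jsec: "\<psi> \<in> jsec \<Longrightarrow> (\<lambda>p. \<psi> p \<circ> phi p) \<in> jsec"
proof (rule jsecI)
  assume \<psi>: "\<psi> \<in> jsec"
  show "\<psi> p \<circ> phi p \<in> J1 p" for p by (rule comp_phi_J1[OF jsec_J1[OF \<psi>]])
  show "(\<lambda>p. (\<psi> p \<circ> phi p) (\<Delta> p)) \<in> sec" if "\<Delta> \<in> dsec" for \<Delta>
    using jsec_sec[OF \<psi> phi_dsec[OF that]] by simp
qed

lemma K0_gsec: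
  assumes "z \<in> gsec"
  shows "(\<lambda>p. K0 p (z p)) \<in> gsec"
proof -
  have d: "(\<lambda>p. fst (z p)) \<in> dsec" "(\<lambda>p. snd (z p)) \<in> jsec" using assms by (simp_all add: gsec_def o_def)
  have "(\<lambda>p. phi p (fst (z p)) + S p (snd (z p))) \<in> dsec"
    by (rule dsec_add[OF phi_dsec[OF d(1)] sharp_dsec[OF d(2)]])
  moreover have "(\<lambda>p. sig p (fst (z p)) - (snd (z p) \<circ> phi p)) \<in> jsec"
    by (rule jsec_diff[OF sig_jsec[OF d(1)] comp_phi_jsec[OF d(2)]])
  ultimately show ?thesis by (simp add: gsec_def K0_def comp_def[of fst] comp_def[of snd])
qed

section \<open>Transformation by the closed form\<close>

definition eB :: "real \<Rightarrow> 'p \<Rightarrow> ('p, 'v) gen \<Rightarrow> ('p, 'v) gen"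
  where "eB c p z = (fst z, snd z + c *\<^sub>R Om p (fst z))"

lemma eB_gfib: "z \<in> gfib p \<Longrightarrow> eB c p z \<in> gfib p"
  by (simp add: gfib_iff eB_def J1_plus J1_scale Om_J1)

lemma eB_add: "z \<in> gfib p \<Longrightarrow> w \<in> gfib p \<Longrightarrow> eB c p (z + w) = eB c p z + eB c p w"
  by (simp add: gfib_iff eB_def Om_plus scaleR_add_right)

lemma eB_scaleR: "z \<in> gfib p \<Longrightarrow> eB c p (a *\<^sub>R z) = a *\<^sub>R eB c p z"
  by (simp add: gfib_iff eB_def Om_scale scaleR_add_right scaleR_left_commute)

lemma eB_minus: "z \<in> gfib p \<Longrightarrow> eB c p (- z) = - eB c p z"
  using eB_scaleR[of z p c "-1"] by simp

lemma eB_eB: "eB c p (eB d p z) = eB (c + d) p z"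
  by (simp add: eB_def scaleR_add_left)

lemma eB_0: "eB 0 p z = z"
  by (simp add: eB_def)

lemma eB_pairing: "pairing (eB c p z) (eB c p w) = pairing z w"
  using Om_antisym[of p "fst z" "fst w"] by (simp add: pairing_def eB_def scaleR_fun_apply)

lemma eB_gsec: "z \<in> gsec \<Longrightarrow> (\<lambda>p. eB c p (z p)) \<in> gsec"
proof -
  assume z: "z \<in> gsec"
  have d: "(\<lambda>p. fst (z p)) \<in> dsec" "(\<lambda>p. snd (z p)) \<in> jsec" using z by (simp_all add: gsec_def o_def)
  have "(\<lambda>p. snd (z p) + c *\<^sub>R Om p (fst (z p))) \<in> jsec"
    by (rule jsec_add[OF d(2) jsec_scale[OF C_const Om_jsec[OF d(1)]]])
  then show ?thesis using d(1) by (simp add: gsec_def eB_def comp_def[of fst] comp_def[of snd])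
qed

text \<open>Conjugation transports eigenbundles: that of \<open>K\<close> is the image of that of
  \<open>K0\<close> under \<open>eB 1\<close>, hence the graph for (1 + i) \<Omega> in place of i
  \<Omega>.\<close>

definition K :: "'p \<Rightarrow> ('p, 'v) gen \<Rightarrow> ('p, 'v) gen"
  where "K p z = eB 1 p (K0 p (eB (-1) p z))"

lemma K_gfib: "z \<in> gfib p \<Longrightarrow> K p z \<in> gfib p"
  by (simp add: K_def eB_gfib K0_gfib)

lemma K_add: "z \<in> gfib p \<Longrightarrow> w \<in> gfib p \<Longrightarrow> K p (z + w) = K p z + K p w"
  by (simp add: K_def eB_gfib K0_gfib eB_add K0_add)

lemma K_scaleR: "z \<in> gfib p \<Longrightarrow> K p (c *\<^sub>R z) = c *\<^sub>R K p z"
  by (simp add: K_def eB_gfib K0_gfib eB_scaleR K0_scaleR)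

lemma K_lin: "lin_on (gfib p) (gfib p) (K p)"
  unfolding lin_on_def using K_gfib K_add K_scaleR by blast

lemma K_minus: "z \<in> gfib p \<Longrightarrow> K p (- z) = - K p z"
  using K_scaleR[of z p "-1"] by simp

lemma K_square: "z \<in> gfib p \<Longrightarrow> K p (K p z) = - z"
  by (simp add: K_def eB_eB eB_0 eB_gfib K0_square eB_minus)

lemma K_pairing: "z \<in> gfib p \<Longrightarrow> w \<in> gfib p \<Longrightarrow> pairing (K p z) (K p w) = pairing z w"
  by (simp add: K_def eB_pairing K0_pairing eB_gfib)

lemma K_skew:
  assumes "z \<in> gfib p" "w \<in> gfib p"
  shows "pairing (K p z) w = - pairing z (K p w)"
proof -
  have "pairing (K p z) w = pairing (K p (K p z)) (K p w)" by (rule K_pairing[OF K_gfib[OF assms(1)] assms(2), symmetric])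
  also have "\<dots> = pairing (- z) (K p w)" by (simp only: K_square[OF assms(1)])
  also have "\<dots> = - pairing z (K p w)"
    using assms K_gfib[OF assms(2)] J1_uminus[of "snd (K p w)" p "fst z"] by (simp add: pairing_def gfib_iff)
  finally show ?thesis .
qed

lemma K_gsec: "z \<in> gsec \<Longrightarrow> (\<lambda>p. K p (z p)) \<in> gsec"
  unfolding K_def by (rule eB_gsec[OF K0_gsec[OF eB_gsec]])

section \<open>The eigenbundle\<close>

definition LL :: "'p \<Rightarrow> (('p, 'v) gen \<times> ('p, 'v) gen) set"
  where "LL p = {z \<in> gfib p \<times> gfib p. map_prod (K p) (K p) z = cscale \<i> z}"

text \<open>For a + i b the eigenvalue equation reads K a = - b and K b = a, and the second follows
  from the first. So \<open>LL\<close> is the graph of - \<open>K\<close> over the real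
  fiber.\<close>

lemma LL_iff: "z \<in> LL p \<longleftrightarrow> fst z \<in> gfib p \<and> snd z = - K p (fst z)"
proof
  assume "z \<in> LL p"
  then have "fst z \<in> gfib p" "K p (fst z) = - snd z"
    by (auto simp: LL_def cscale_def prod_eq_iff)
  then show "fst z \<in> gfib p \<and> snd z = - K p (fst z)" by simp
next
  assume *: "fst z \<in> gfib p \<and> snd z = - K p (fst z)"
  then have "K p (snd z) = fst z"
    using K_minus[OF K_gfib, of "fst z" p] K_square[of "fst z" p] by simp
  then show "z \<in> LL p" using * K_gfib gfib_minus
    by (auto simp: LL_def cscale_def mem_Times_iff map_prod_def case_prod_unfold)
qed

lemma LL_endomorphism: "gc_endomorphism LL K"
  unfolding gc_endomorphism_def using K_lin K_gsec K_square K_pairing by (auto simp: LL_def)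

lemma comp_Hom_J1:
  assumes "\<beta> \<in> J1 p" "h \<in> Hom (D p) (D p)"
  shows "\<beta> \<circ> h \<in> J1 p"
proof -
  have h: "\<And>\<delta>. \<delta> \<in> D p \<Longrightarrow> h \<delta> \<in> D p" "\<And>\<delta> \<delta>'. \<delta> \<in> D p \<Longrightarrow> \<delta>' \<in> D p \<Longrightarrow> h (\<delta> + \<delta>') = h \<delta> + h \<delta>'"
    "\<And>\<delta> c. \<delta> \<in> D p \<Longrightarrow> h (c *\<^sub>R \<delta>) = c *\<^sub>R h \<delta>" "\<And>\<delta>. \<delta> \<notin> D p \<Longrightarrow> h \<delta> = 0"
    using assms(2) by (auto simp: Hom_def lin_on_def)
  show ?thesis
    by (rule J1I) (simp_all add: h J1_E[OF assms(1)] J1_add[OF assms(1)] J1_scaleR[OF assms(1)] J1_zero[OF assms(1)])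
qed

lemma Om_outside: "\<delta> \<notin> D p \<Longrightarrow> Om p \<delta> = 0"
  by (rule ext) (rule trans[OF d1_outside[OF theta_jsec disjI1]], auto)

lemma Pv_outside: "\<delta> \<notin> D p \<Longrightarrow> Pv p \<delta> = 0"
  by (simp add: Pv_def Om_outside sharp_zero)

lemma phi_Pv_Hom: "(\<lambda>\<delta>. c *\<^sub>R phi p \<delta> - Pv p \<delta>) \<in> Hom (D p) (D p)"
  unfolding Hom_def lin_on_def
  by (simp add: phi_D Pv_D D_minus2 D_scaleR phi_add Pv_add phi_scaleR Pv_scaleR phi_outside Pv_outside algebra_simps)

lemma phi_Pv_inverse:
  assumes "\<delta> \<in> D p"
  shows "(-1) *\<^sub>R phi p (1 *\<^sub>R phi p \<delta> - Pv p \<delta>) - Pv p (1 *\<^sub>R phi p \<delta> - Pv p \<delta>) = \<delta>"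
proof -
  have "phi p (phi p \<delta> - Pv p \<delta>) = Pv p \<delta> - \<delta>"
    using phi_add[OF phi_D D_minus[OF Pv_D], of p \<delta> \<delta>] phi_minus[OF Pv_D, of p \<delta>]
    by (simp add: phi_phi[OF assms] phi_vertical[OF Pv_VerL])
  moreover have "Pv p (phi p \<delta> - Pv p \<delta>) = - Pv p \<delta>"
    using Pv_diff[OF phi_D Pv_D] by (simp add: Pv_phi Pv_vertical[OF Pv_VerL])
  ultimately show ?thesis by simp
qed

lemma LL_jacobi: "jacobi_structure_of LL J"
proof -
  define h where "h p = (\<lambda>\<delta>. 1 *\<^sub>R phi p \<delta> - Pv p \<delta>)" for p
  define r where "r p = (\<lambda>\<delta>. (-1) *\<^sub>R phi p \<delta> - Pv p \<delta>)" for p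
  \<comment> \<open>\<open>sg\<close> is the part of the second component of \<open>K\<close> that
    comes from \<delta>. It has to appear as \<tau>(\<delta>) composed with \<open>h\<close>, and
    therefore \<tau> composes it with the inverse \<open>r\<close> of \<open>h\<close>.\<close>
  define sg where "sg p \<delta> = sig p \<delta> + (Om p \<delta> \<circ> phi p) + Om p (phi p \<delta>) - Om p (Pv p \<delta>)" for p \<delta>
  define \<tau> where "\<tau> p = (\<lambda>\<delta>. if \<delta> \<in> D p then sg p \<delta> \<circ> r p else 0)" for p
  have h: "h p \<in> Hom (D p) (D p)" and r: "r p \<in> Hom (D p) (D p)" for p
    unfolding h_def r_def by (rule phi_Pv_Hom)+
  have rh: "r p (h p \<delta>) = \<delta>" if "\<delta> \<in> D p" for p \<delta>
    unfolding h_def r_def by (rule phi_Pv_inverse[OF that])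
  have sgJ: "sg p \<delta> \<in> J1 p" for p \<delta>
    unfolding sg_def by (intro J1_minus J1_plus sig_J1 comp_phi_J1 Om_J1)
  have sg_add: "sg p (\<delta> + \<delta>') = sg p \<delta> + sg p \<delta>'" if "\<delta> \<in> D p" "\<delta>' \<in> D p" for p \<delta> \<delta>'
    unfolding sg_def by (rule ext) (simp add: sig_add Om_plus phi_add Pv_add phi_D Pv_D that)
  have sg_scale: "sg p (c *\<^sub>R \<delta>) = c *\<^sub>R sg p \<delta>" if "\<delta> \<in> D p" for p c \<delta>
    unfolding sg_def
    by (rule ext) (simp add: sig_scaleR Om_scale phi_scaleR Pv_scaleR phi_D Pv_D that scaleR_fun_apply algebra_simps)
  have \<tau>: "\<tau> p \<in> Hom (D p) (J1 p)" for p
    unfolding Hom_def lin_on_def \<tau>_def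
    by (auto simp: D_plus D_scaleR comp_Hom_J1[OF sgJ r] sg_add sg_scale fun_eq_iff scaleR_fun_apply)
  have K: "K p (\<delta>, \<alpha>) = (h p \<delta> + S p \<alpha>, \<tau> p \<delta> - \<alpha> \<circ> h p)" if d: "\<delta> \<in> D p" "\<alpha> \<in> J1 p" for p \<delta> \<alpha>
  proof (rule prod_eqI)
    have Sm: "S p (\<alpha> - Om p \<delta>) = S p \<alpha> - Pv p \<delta>"
      unfolding Pv_def by (rule sharp_diff[OF d(2) Om_J1])
    have 1: "fst (K p (\<delta>, \<alpha>)) = phi p \<delta> + (S p \<alpha> - Pv p \<delta>)"
      by (simp add: K_def eB_def K0_def Sm)
    show "fst (K p (\<delta>, \<alpha>)) = fst (h p \<delta> + S p \<alpha>, \<tau> p \<delta> - \<alpha> \<circ> h p)"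
      unfolding 1 by (simp add: h_def)
    have "K p (\<delta>, \<alpha>) \<in> gfib p" by (rule K_gfib) (simp add: gfib_iff d)
    then have KJ: "snd (K p (\<delta>, \<alpha>)) \<in> J1 p" by (simp add: gfib_iff)
    have \<tau>J: "\<tau> p \<delta> - \<alpha> \<in> J1 p" using comp_Hom_J1[OF sgJ r] d by (simp add: \<tau>_def J1_minus)
    have "snd (K p (\<delta>, \<alpha>)) = (\<tau> p \<delta> - \<alpha>) \<circ> h p"
    proof (rule J1_eqI[OF KJ comp_Hom_J1[OF \<tau>J h]])
      fix \<epsilon> assume e: "\<epsilon> \<in> D p"
      have "Om p (phi p \<delta> + (S p \<alpha> - Pv p \<delta>)) \<epsilon> = Om p (phi p \<delta>) \<epsilon> + (\<alpha> (Pv p \<epsilon>) - Om p (Pv p \<delta>) \<epsilon>)"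
        by (simp only: Om_left_add[OF phi_D D_minus2[OF sharp_D[OF d(2)] Pv_D]] Om_left_diff[OF sharp_D[OF d(2)] Pv_D] Om_sharp[OF d(2)])
      then have "snd (K p (\<delta>, \<alpha>)) \<epsilon> = sig p \<delta> \<epsilon> - (\<alpha> (phi p \<epsilon>) - Om p \<delta> (phi p \<epsilon>)) +
          (Om p (phi p \<delta>) \<epsilon> + (\<alpha> (Pv p \<epsilon>) - Om p (Pv p \<delta>) \<epsilon>))"
        by (simp add: K_def eB_def K0_def Sm)
      moreover have "((\<tau> p \<delta> - \<alpha>) \<circ> h p) \<epsilon> = sg p \<delta> \<epsilon> - (\<alpha> (phi p \<epsilon>) - \<alpha> (Pv p \<epsilon>))"
        using rh[OF e] d(1) J1_diff[OF d(2) phi_D Pv_D, of \<epsilon> \<epsilon>] by (simp add: \<tau>_def) (simp add: h_def)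
      ultimately show "snd (K p (\<delta>, \<alpha>)) \<epsilon> = ((\<tau> p \<delta> - \<alpha>) \<circ> h p) \<epsilon>" by (simp add: sg_def)
    qed
    then show "snd (K p (\<delta>, \<alpha>)) = snd (h p \<delta> + S p \<alpha>, \<tau> p \<delta> - \<alpha> \<circ> h p)" by simp
  qed
  show ?thesis
    unfolding jacobi_structure_of_def
    by (intro conjI jac exI[of _ K] exI[of _ h] exI[of _ \<tau>] LL_endomorphism allI ballI h \<tau> K)
qed

lemma LL_csubspace: "csubspace (LL p)"
  unfolding csubspace_def
proof (intro conjI ballI allI)
  show "0 \<in> LL p" using K_scaleR[OF gfib_zero, of p 0] by (simp add: LL_iff gfib_zero)
  show "z + w \<in> LL p" if "z \<in> LL p" "w \<in> LL p" for z w
    using that by (simp add: LL_iff gfib_add K_add)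
  show "cscale c z \<in> LL p" if z: "z \<in> LL p" for c z
  proof -
    have x: "fst z \<in> gfib p" "snd z = - K p (fst z)" using z by (auto simp: LL_iff)
    have "K p (Re c *\<^sub>R fst z + Im c *\<^sub>R K p (fst z)) = Re c *\<^sub>R K p (fst z) - Im c *\<^sub>R fst z"
      using x(1) K_gfib[OF x(1)] by (simp add: K_add gfib_scaleR K_scaleR K_square)
    then show ?thesis using x K_gfib[OF x(1)] by (simp add: LL_iff cscale_def gfib_add gfib_scaleR)
  qed
qed

text \<open>A point of the graph of - \<open>K\<close> whose conjugate is on the graph too satisfies
  K x = - K x, and \<open>K\<close> is injective.\<close>

lemma LL_conj: "LL p \<inter> cconj ` LL p = {0}"
proof -
  have "z = 0" if "z \<in> LL p" "w \<in> LL p" "z = cconj w" for z w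
  proof -
    have w: "fst w \<in> gfib p" "snd w = - K p (fst w)" and z: "snd z = - K p (fst z)"
      using that by (auto simp: LL_iff)
    have "fst z = fst w" "snd z = - snd w" using that(3) by (auto simp: cconj_def)
    then have "- K p (fst w) = K p (fst w)" using w(2) z by simp
    then have "(2::real) *\<^sub>R K p (fst w) = 0" unfolding scaleR_2 by (metis add.right_inverse)
    then have k: "K p (fst w) = 0" by simp
    have "- fst w = K p (K p (fst w))" by (rule K_square[OF w(1), symmetric])
    also have "\<dots> = 0" unfolding k using K_scaleR[OF gfib_zero, of p 0] by simp
    finally have "fst w = 0" by simp
    then show "z = 0" using \<open>fst z = fst w\<close> \<open>snd z = - snd w\<close> w(2) k by (simp add: prod_eq_iff)
  qed
  moreover have "0 \<in> LL p" using LL_csubspace by (simp add: csubspace_def)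
  moreover have "0 = cconj 0" by (simp add: cconj_def prod_eq_iff)
  ultimately show ?thesis by blast
qed

lemma pairing_minus_right: "z \<in> gfib p \<Longrightarrow> w \<in> gfib p \<Longrightarrow> pairing z (- w) = - pairing z w"
  using J1_uminus[of "snd z" p "fst w"] by (simp add: pairing_def gfib_iff)

lemma pairing_minus_left: "z \<in> gfib p \<Longrightarrow> w \<in> gfib p \<Longrightarrow> pairing (- z) w = - pairing z w"
  using J1_uminus[of "snd w" p "fst z"] by (simp add: pairing_def gfib_iff)

lemma pairing_nondegenerate:
  assumes "z \<in> gfib p" "w \<in> gfib p" "\<And>x. x \<in> gfib p \<Longrightarrow> pairing z x = pairing w x"
  shows "z = w"
proof -
  have "fst z = fst w"
  proof (rule D_separate)
    show "fst z \<in> D p" "fst w \<in> D p" using assms by (auto simp: gfib_iff)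
    fix \<alpha> assume "\<alpha> \<in> J1 p"
    then have "(0, \<alpha>) \<in> gfib p" by (simp add: gfib_iff D_zero)
    from assms(3)[OF this] show "\<alpha> (fst z) = \<alpha> (fst w)"
      using assms(1,2) J1_zero[of "snd z" p] J1_zero[of "snd w" p] by (simp add: pairing_def gfib_iff)
  qed
  moreover have "snd z = snd w"
  proof (rule J1_eqI)
    show "snd z \<in> J1 p" "snd w \<in> J1 p" using assms by (auto simp: gfib_iff)
    fix \<delta> assume "\<delta> \<in> D p"
    then have "(\<delta>, 0) \<in> gfib p" by (simp add: gfib_iff J1_zero_mem)
    from assms(3)[OF this] show "snd z \<delta> = snd w \<delta>" by (simp add: pairing_def)
  qed
  ultimately show ?thesis by (simp add: prod_eq_iff)
qed

text \<open>Isotropy on \<open>LL\<close> is skewness of \<open>K\<close>. Maximality holds because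
  an element w that is isotropic to all (x, - K x) satisfies K (snd w) = fst w by nondegeneracy of
  the pairing, and this is the eigenvalue equation.\<close>

lemma LL_maximally_isotropic: "maximally_isotropic LL"
  unfolding maximally_isotropic_def
proof (intro allI conjI impI)
  fix p
  show "isotropic (LL p)"
    unfolding isotropic_def
  proof (intro ballI)
    fix z w assume zw: "z \<in> LL p" "w \<in> LL p"
    then have g: "fst z \<in> gfib p" "fst w \<in> gfib p" and s: "snd z = - K p (fst z)" "snd w = - K p (fst w)"
      by (auto simp: LL_iff)
    note k = K_gfib[OF g(1)] K_gfib[OF g(2)]
    have "pairing (snd z) (snd w) = pairing (fst z) (fst w)"
      by (simp only: s pairing_minus_left[OF k(1) gfib_minus[OF k(2)]] pairing_minus_right[OF k] minus_minus K_pairing[OF g])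
    moreover have "pairing (fst z) (snd w) + pairing (snd z) (fst w) = 0"
      by (simp only: s pairing_minus_right[OF g(1) k(2)] pairing_minus_left[OF k(1) g(2)] K_skew[OF g] minus_minus left_minus)
    ultimately show "cbilinear_ext pairing z w = 0" by (simp add: cbilinear_ext_def prod_eq_iff)
  qed
  fix W assume W: "csubspace W \<and> W \<subseteq> gfib p \<times> gfib p \<and> isotropic W \<and> LL p \<subseteq> W"
  have "w \<in> LL p" if w: "w \<in> W" for w
  proof -
    have "w \<in> gfib p \<times> gfib p" using W w by (elim conjE) (rule subsetD)
    then have g: "fst w \<in> gfib p" "snd w \<in> gfib p" by (simp_all add: mem_Times_iff)
    have "K p (snd w) = fst w"
    proof (rule pairing_nondegenerate[OF K_gfib[OF g(2)] g(1)])
      fix x assume x: "x \<in> gfib p"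
      have "(x, - K p x) \<in> LL p" using x by (simp add: LL_iff)
      then have "(x, - K p x) \<in> W" using W by (elim conjE) (rule subsetD)
      then have "cbilinear_ext pairing w (x, - K p x) = 0" using W w by (simp add: isotropic_def)
      then have "pairing (fst w) x - pairing (snd w) (- K p x) = 0"
        by (simp add: cbilinear_ext_def prod_eq_iff)
      then show "pairing (K p (snd w)) x = pairing (fst w) x"
        using pairing_minus_right[OF g(2) K_gfib[OF x]] K_skew[OF g(2) x]
        by (simp add: neg_eq_iff_add_eq_0 add.commute)
    qed
    then show ?thesis using g K_square[OF g(2)] by (simp add: LL_iff flip: \<open>K p (snd w) = fst w\<close>)
  qed
  then show "W = LL p" using W by blast
qed

end

lemma sum_neutral_shift:
  fixes f :: "nat \<Rightarrow> 'a::comm_monoid_add"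
  assumes "2 * m \<le> N" "\<And>i. i < N \<Longrightarrow> i < m \<or> 2 * m \<le> i \<Longrightarrow> f i = 0"
  shows "(\<Sum>i<N. f i) = (\<Sum>i<m. f (m + i))"
proof -
  have "(\<Sum>i<N. f i) = (\<Sum>i\<in>{0 + m..<m + m}. f i)"
    by (rule sum.mono_neutral_right) (use assms in \<open>auto simp: not_le not_less\<close>)
  also have "\<dots> = (\<Sum>i\<in>{0..<m}. f (i + m))" by (rule sum.shift_bounds_nat_ivl)
  finally show ?thesis by (simp add: add.commute atLeast0LessThan)
qed

context contact_setting
begin

subsection \<open>A complex frame\<close>

text \<open>Half of a real frame of the fiber, completed by its image under \<open>K0\<close>. Up to
  vertical parts and jets, \<open>K0\<close> turns \<open>nab i\<close> with i < m into -
  \<open>nab (m + i)\<close>; it turns \<open>eta\<close> of \<open>y i\<close> into minus that of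
  \<open>y (m + i)\<close>, and vertical derivations into jets that pair nondegenerately with
  \<open>VerL\<close>. Index \<open>N\<close> holds the identity derivation, so there are
  \<open>Suc N\<close> members.\<close>

definition xi :: "('p \<Rightarrow> 'v) \<Rightarrow> (nat \<Rightarrow> 'p \<Rightarrow> real) \<Rightarrow> (nat \<Rightarrow> 'p \<Rightarrow> ('p, 'v) der) \<Rightarrow> nat \<Rightarrow> 'p \<Rightarrow> ('p, 'v) gen"
  where "xi s y nab i q = (if i = N then (idd q, 0)
    else if i < m \<or> 2 * m \<le> i then (nab i q, 0) else (0, eta s (y (i - m)) q))"

context
  fixes W s y nab q
  assumes W: "adapted W s y nab" and q: "q \<in> W"
begin

lemma nab_D: "i < N \<Longrightarrow> nab i q \<in> D q"
  by (rule dsec_D[OF adapted_nab[OF W]])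

lemma eta_J1: "i < N \<Longrightarrow> eta s (y i) q \<in> J1 q"
  by (rule jsec_J1[OF eta_jsec[OF adapted_y[OF W] adapted_frame(3)[OF W]]])

lemma mN: "i < m \<Longrightarrow> i < N" "i < m \<Longrightarrow> m + i < N" "i < 2 * m \<Longrightarrow> i < N" "2 * m \<le> N"
  by (simp_all add: N_def)

lemma phi_symbol:
  assumes "\<delta> \<in> D q" "j < m"
  shows "symbol q (phi q \<delta>) (y j) = symbol q \<delta> (y (m + j))"
    and "symbol q (phi q \<delta>) (y (m + j)) = - symbol q \<delta> (y j)"
proof -
  have "symbol q (- phi q \<delta>) f = - symbol q (phi q \<delta>) f" for f
    using symbol_scaleR[OF phi_D, of q "-1" \<delta> f] by simp
  then show "symbol q (phi q \<delta>) (y j) = symbol q \<delta> (y (m + j))"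
    "symbol q (phi q \<delta>) (y (m + j)) = - symbol q \<delta> (y j)"
    using adapted_T01[OF W q assms(1) D_minus[OF phi_D], of \<delta>] phi_T01[OF assms(1)] assms(2) by auto
qed

definition "comb a = (cmb nab (a N) (\<lambda>i. if i < m \<or> 2 * m \<le> i then a i else 0) q,
  \<Sum>i<m. a (m + i) *\<^sub>R eta s (y i) q)"

lemma comb_gfib: "comb a \<in> gfib q"
  unfolding comb_def gfib_iff fst_conv snd_conv
  by (intro conjI cmb_D[OF W] J1_sum_mem J1_scale eta_J1 mN) simp

lemma xi_gfib: "i \<le> N \<Longrightarrow> xi s y nab i q \<in> gfib q"
  by (simp add: xi_def gfib_iff idd_D nab_D eta_J1 D_zero J1_zero_mem)

lemma sum_xi: "(\<Sum>i<Suc N. a i *\<^sub>R xi s y nab i q) = comb a"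
proof (rule prod_eqI)
  have "(\<Sum>i<N. fst (a i *\<^sub>R xi s y nab i q)) = (\<Sum>i<N. (if i < m \<or> 2 * m \<le> i then a i else 0) *\<^sub>R nab i q)"
    by (rule sum.cong) (simp_all add: xi_def)
  then show "fst (\<Sum>i<Suc N. a i *\<^sub>R xi s y nab i q) = fst (comb a)"
    by (simp only: fst_sum fst_add sum.lessThan_Suc comb_def fst_conv cmb_def[OF W]) (simp add: xi_def add.commute)
  have "(\<Sum>i<N. snd (a i *\<^sub>R xi s y nab i q)) = (\<Sum>i<m. snd (a (m + i) *\<^sub>R xi s y nab (m + i) q))"
    by (rule sum_neutral_shift[OF mN(4)]) (auto simp: xi_def)
  also have "\<dots> = (\<Sum>i<m. a (m + i) *\<^sub>R eta s (y i) q)"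
    by (rule sum.cong) (auto simp: xi_def N_def)
  finally show "snd (\<Sum>i<Suc N. a i *\<^sub>R xi s y nab i q) = snd (comb a)"
    by (simp only: snd_sum snd_add sum.lessThan_Suc comb_def snd_conv) (simp add: xi_def)
qed

lemma comb_fst_symbol:
  "j < m \<Longrightarrow> symbol q (fst (comb a)) (y j) = a j"
  "j < m \<Longrightarrow> symbol q (fst (comb a)) (y (m + j)) = 0"
  "2 * m \<le> j \<Longrightarrow> j < N \<Longrightarrow> symbol q (fst (comb a)) (y j) = a j"
  by (simp_all add: comb_def cmb_symbol[OF W q] mN)

lemma comb_snd_apply:
  assumes "\<delta> \<in> D q"
  shows "snd (comb a) \<delta> = (\<Sum>i<m. a (m + i) *\<^sub>R symbol q \<delta> (y i) *\<^sub>R s q)"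
  unfolding comb_def snd_conv sum_fun_apply
  by (rule sum.cong) (simp_all add: scaleR_fun_apply eta_apply adapted_y[OF W] adapted_frame(3)[OF W] assms mN)

lemma comb_snd_annihilates:
  assumes "\<delta> \<in> D q" "\<And>j. j < m \<Longrightarrow> symbol q \<delta> (y j) = 0"
  shows "snd (comb a) \<delta> = 0"
  by (simp add: comb_snd_apply[OF assms(1)] assms(2))

lemma comb_snd_vertical: "v \<in> VerL B \<pi> q \<Longrightarrow> snd (comb a) v = 0"
  using adapted_VerL[OF W q VerL_D] by (intro comb_snd_annihilates VerL_D) auto

text \<open>The jet part annihilates \<open>VerL\<close>, and by \<open>sharp_restrict\<close> such
  a jet has image 0 under \<open>S\<close>.\<close>

lemma K0_comb: "K0 q (comb a) = (phi q (fst (comb a)), sig q (fst (comb a)) - (snd (comb a) \<circ> phi q))"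
proof -
  have "S q (snd (comb a)) = S q 0"
    using comb_gfib[of a] by (intro sharp_restrict) (auto simp: gfib_iff J1_zero_mem comb_snd_vertical)
  then show ?thesis by (simp only: K0_def sharp_zero add_0_right)
qed

lemma comb_eq_0:
  assumes "comb a = 0" "i \<le> N"
  shows "a i = 0"
proof -
  have z: "fst (comb a) = 0" "snd (comb a) = 0" using assms(1) by auto
  have s0: "symbol q 0 f = 0" for f using symbol_scaleR[OF D_zero, of q 0 f] by simp
  consider "i < m" | "m \<le> i" "i < 2 * m" | "2 * m \<le> i" "i < N" | "i = N" using assms(2) by linarith
  then show ?thesis
  proof cases
    case 1
    then show ?thesis using comb_fst_symbol(1)[of i a] z s0 by simp
  next
    case 2
    then have i: "i - m < m" "i - m < N" by (auto simp: N_def)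
    have "0 = snd (comb a) (nab (i - m) q)" using z by simp
    also have "\<dots> = (\<Sum>j<m. if j = i - m then a i *\<^sub>R s q else 0)"
      unfolding comb_snd_apply[OF nab_D[OF i(2)]]
      by (rule sum.cong) (use i 2 in \<open>auto simp: adapted_nab_y[OF W q] mN\<close>)
    also have "\<dots> = a i *\<^sub>R s q" using i by simp
    finally show ?thesis using adapted_frame(4)[OF W q] by simp
  next
    case 3
    then show ?thesis using comb_fst_symbol(3)[of i a] z s0 by simp
  next
    case 4
    have "a N *\<^sub>R s q = fst (comb a) s" by (simp add: comb_def cmb_s[OF W q])
    then show ?thesis using z adapted_frame(4)[OF W q] 4 by simp
  qed
qed

text \<open>Real independence of the frame and its image under \<open>K0\<close>. The coordinates m
  + j of the first component force the second derivation to be vertical, and nondegeneracy on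
  \<open>VerL\<close> makes it 0. What remains is \<alpha> = \<alpha>' \<circ> \<phi>, where the two
  sides involve the \<open>eta\<close> of complementary base coordinates.\<close>

lemma comb_K0_kernel:
  assumes "comb a + K0 q (comb b) = 0"
  shows "comb a = 0 \<and> comb b = 0"
proof -
  let ?\<delta> = "fst (comb a)" and ?\<alpha> = "snd (comb a)" and ?\<delta>' = "fst (comb b)" and ?\<alpha>' = "snd (comb b)"
  have g: "?\<delta> \<in> D q" "?\<alpha> \<in> J1 q" "?\<delta>' \<in> D q" "?\<alpha>' \<in> J1 q" using comb_gfib by (auto simp: gfib_iff)
  have 1: "?\<delta> + phi q ?\<delta>' = 0" and 2: "?\<alpha> + (sig q ?\<delta>' - (?\<alpha>' \<circ> phi q)) = 0"
    using assms unfolding K0_comb by (auto simp: prod_eq_iff)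
  have s0: "symbol q 0 f = 0" for f using symbol_scaleR[OF D_zero, of q 0 f] by simp
  have b0: "symbol q ?\<delta>' (y j) = 0" if "j < m" for j
    using symbol_add[OF g(1) phi_D, of ?\<delta>' "y (m + j)"] phi_symbol(2)[OF g(3) that] comb_fst_symbol(2)[OF that, of a]
    unfolding 1 s0 by simp
  have "symbol q ?\<delta>' (y j) = 0" if "j < 2 * m" for j
    using b0[of j] comb_fst_symbol(2)[of "j - m" b] that by (cases "j < m") auto
  then have V: "?\<delta>' \<in> VerL B \<pi> q" using adapted_VerL[OF W q g(3)] by blast
  then have \<delta>0: "?\<delta> = 0" using 1 phi_vertical[OF V] by simp
  have 3: "?\<alpha> \<epsilon> = Om q ?\<delta>' \<epsilon> + ?\<alpha>' (phi q \<epsilon>)" for \<epsilon>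
    using fun_cong[OF eq_neg_iff_add_eq_0[THEN iffD2, OF 2], of \<epsilon>] unfolding sig_vertical[OF V]
    by (simp add: algebra_simps)
  have "S q (Om q ?\<delta>') = S q 0"
  proof (rule sharp_restrict[OF Om_J1 J1_zero_mem])
    fix v assume v: "v \<in> VerL B \<pi> q"
    show "Om q ?\<delta>' v = 0 v"
      using 3[of v] comb_snd_vertical[OF v, of a] phi_vertical[OF v] J1_zero[OF g(4)] by simp
  qed
  then have \<delta>'0: "?\<delta>' = 0" using Pv_vertical[OF V] by (simp add: Pv_def sharp_zero)
  have 4: "?\<alpha> \<epsilon> = ?\<alpha>' (phi q \<epsilon>)" for \<epsilon> using 3[of \<epsilon>] by (simp add: \<delta>'0 Om_zero)
  have \<alpha>0: "?\<alpha> = 0"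
  proof (rule J1_eqI[OF g(2) J1_zero_mem])
    fix \<epsilon> assume e: "\<epsilon> \<in> D q"
    have n: "?\<alpha> (nab i q) = 0" if "i < m" for i
      unfolding 4
      by (rule comb_snd_annihilates[OF phi_D])
        (use that in \<open>auto simp: phi_symbol(1)[OF nab_D] mN adapted_nab_y[OF W q]\<close>)
    have n': "?\<alpha> (nab i q) = 0" if "m \<le> i" "i < N" for i
      by (rule comb_snd_annihilates[OF nab_D[OF that(2)]]) (use that mN in \<open>auto simp: adapted_nab_y[OF W q]\<close>)
    have "\<forall>i<N. ?\<alpha> (nab i q) = 0" using n n' not_le by blast
    moreover have "?\<alpha> (idd q) = 0" by (rule comb_snd_vertical[OF idd_VerL])
    ultimately have "?\<alpha> (cmb nab c d q) = 0" for c d unfolding J1_cmb[OF W g(2)] by simp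
    then show "?\<alpha> \<epsilon> = 0 \<epsilon>" using cmb_expand[OF W q e] by (metis zero_fun_apply)
  qed
  have "?\<alpha>' = 0"
  proof (rule J1_eqI[OF g(4) J1_zero_mem])
    fix \<epsilon> assume e: "\<epsilon> \<in> D q"
    have "?\<alpha>' (phi q (phi q \<epsilon>)) = 0" using 4[of "phi q \<epsilon>"] \<alpha>0 by simp
    then show "?\<alpha>' \<epsilon> = 0 \<epsilon>"
      unfolding phi_phi[OF e] using J1_diff[OF g(4) Pv_D e, of \<epsilon>] comb_snd_vertical[OF Pv_VerL, of b \<epsilon>] by simp
  qed
  then show ?thesis using \<delta>0 \<alpha>0 \<delta>'0 by (simp add: prod_eq_iff)
qed

lemma comb_surj:
  assumes "\<delta> \<in> D q" "\<And>j. j < m \<Longrightarrow> symbol q \<delta> (y (m + j)) = 0"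
  shows "\<exists>a. comb a = (\<delta>, \<Sum>i<m. t i *\<^sub>R eta s (y i) q)"
proof -
  define a where "a i = (if i = N then coef s (\<lambda>_. \<delta> s) q
    else if i < m \<or> 2 * m \<le> i then symbol q \<delta> (y i) else t (i - m))" for i
  have "fst (comb a) = \<delta>"
  proof -
    have "(if i < m \<or> 2 * m \<le> i then a i else 0) = symbol q \<delta> (y i)" if "i < N" for i
      using assms(2)[of "i - m"] that by (auto simp: a_def)
    then have "fst (comb a) = cmb nab (a N) (\<lambda>i. symbol q \<delta> (y i)) q"
      unfolding comb_def fst_conv cmb_def[OF W] by (intro arg_cong2[where f = "(+)"] sum.cong) auto
    then show ?thesis using cmb_expand[OF W q assms(1)] by (simp add: a_def)
  qed
  moreover have "snd (comb a) = (\<Sum>i<m. t i *\<^sub>R eta s (y i) q)"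
    unfolding comb_def snd_conv by (rule sum.cong) (auto simp: a_def N_def)
  ultimately show ?thesis by (intro exI[of _ a] prod_eqI) simp_all
qed

lemma gfib_decompose:
  assumes "z \<in> gfib q"
  shows "\<exists>a b. z = comb a + K0 q (comb b)"
proof -
  obtain \<delta> \<alpha> where z: "z = (\<delta>, \<alpha>)" "\<delta> \<in> D q" "\<alpha> \<in> J1 q" using assms by (cases z) (auto simp: gfib_iff)
  \<comment> \<open>The image of \<open>\<delta>0\<close> under \<phi> has the same coordinates m +
    j as \<delta>, so the difference lies in the range of \<open>comb\<close>.\<close>
  define \<delta>0 where "\<delta>0 = cmb nab 0 (\<lambda>j. if j < m then - symbol q \<delta> (y (m + j)) else 0) q"
  have \<delta>0: "\<delta>0 \<in> D q" unfolding \<delta>0_def by (rule cmb_D[OF W])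
  have \<delta>0_sym: "symbol q \<delta>0 (y j) = (if j < m then - symbol q \<delta> (y (m + j)) else 0)" if "j < N" for j
    unfolding \<delta>0_def by (rule cmb_symbol[OF W q that])
  define \<alpha>0 where "\<alpha>0 = \<alpha> - sig q \<delta>0"
  have \<alpha>0: "\<alpha>0 \<in> J1 q" unfolding \<alpha>0_def by (rule J1_minus[OF z(3) sig_J1])
  \<comment> \<open>This vertical correction leaves \<phi> unchanged and makes the remaining jet
    \<open>\<alpha>1\<close> vanish on \<open>VerL\<close>, so that \<open>\<alpha>1\<close> is a
    combination of the \<open>eta s (y i)\<close> with i < 2 m.\<close>
  define v where "v = - S q \<alpha>0"
  have v: "v \<in> VerL B \<pi> q" using VerL_scaleR[OF sharp_VerL[OF \<alpha>0], of "-1"] by (simp add: v_def)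
  note vD = VerL_D[OF v]
  define \<delta>' where "\<delta>' = \<delta>0 + v"
  have \<delta>': "\<delta>' \<in> D q" unfolding \<delta>'_def by (rule D_plus[OF \<delta>0 vD])
  have ph: "phi q \<delta>' = phi q \<delta>0" unfolding \<delta>'_def by (simp add: phi_add[OF \<delta>0 vD] phi_vertical[OF v])
  define \<alpha>1 where "\<alpha>1 = \<alpha> - sig q \<delta>'"
  have \<alpha>1: "\<alpha>1 \<in> J1 q" unfolding \<alpha>1_def by (rule J1_minus[OF z(3) sig_J1])
  have \<alpha>1_eq: "\<alpha>1 = \<alpha>0 + Om q v"
    unfolding \<alpha>1_def \<alpha>0_def \<delta>'_def sig_add[OF \<delta>0 vD] sig_vertical[OF v] by simp
  have kill: "\<alpha>1 w = 0" if w: "w \<in> VerL B \<pi> q" for w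
    using Om_sharp[OF \<alpha>0, of w] Om_left_minus[OF sharp_D[OF \<alpha>0], of w] Pv_vertical[OF w]
    unfolding \<alpha>1_eq v_def by simp
  obtain c t where t: "\<alpha>1 = jcmb s y c t q" by (rule jcmb_expand[OF W q \<alpha>1])
  have c: "c = 0"
    using kill[OF idd_VerL] jcmb_apply[OF W idd_D, of c t] adapted_frame(3,4)[OF W] q symbol_idd
    unfolding t by (simp add: idd_def)
  have tv: "t i = 0" if i: "2 * m \<le> i" "i < N" for i
  proof -
    have "0 = jcmb s y c t q (nab i q)" using kill[OF adapted_vert[OF W i(2,1)]] unfolding t by simp
    also have "\<dots> = (\<Sum>j<N. if j = i then t i *\<^sub>R s q else 0)"
      unfolding jcmb_apply[OF W nab_D[OF i(2)]] c scaleR_zero_left add_0_left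
      by (rule sum.cong) (simp_all add: adapted_nab_y[OF W q i(2)])
    also have "\<dots> = t i *\<^sub>R s q" using i by simp
    finally show ?thesis using adapted_frame(4)[OF W q] by simp
  qed
  have s1: "symbol q (\<delta> - phi q \<delta>') (y (m + j)) = 0" if "j < m" for j
    unfolding ph symbol_diff[OF z(2) phi_D] phi_symbol(2)[OF \<delta>0 that] \<delta>0_sym[OF mN(1)[OF that]] using that by simp
  have s2: "symbol q \<delta>' (y (m + j)) = 0" if "j < m" for j
    unfolding \<delta>'_def symbol_add[OF \<delta>0 vD] \<delta>0_sym[OF mN(2)[OF that]]
    using adapted_VerL[OF W q vD] v that by simp
  obtain a where a: "comb a = (\<delta> - phi q \<delta>', \<Sum>i<m. t i *\<^sub>R eta s (y i) q)"
    using comb_surj[OF D_minus2[OF z(2) phi_D] s1] by blast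
  obtain b where b: "comb b = (\<delta>', \<Sum>i<m. (- t (m + i)) *\<^sub>R eta s (y i) q)"
    using comb_surj[OF \<delta>' s2, of "\<lambda>i. - t (m + i)"] by blast
  have "\<alpha>1 = snd (comb a) - (snd (comb b) \<circ> phi q)"
  proof (rule J1_eqI[OF \<alpha>1])
    show "snd (comb a) - (snd (comb b) \<circ> phi q) \<in> J1 q"
      using comb_gfib by (intro J1_minus comp_phi_J1) (auto simp: gfib_iff)
    fix \<epsilon> assume e: "\<epsilon> \<in> D q"
    have ap: "eta s (y i) q \<epsilon>' = symbol q \<epsilon>' (y i) *\<^sub>R s q" if "i < m" "\<epsilon>' \<in> D q" for i \<epsilon>'
      by (rule eta_apply[OF adapted_y[OF W mN(1)[OF that(1)]] adapted_frame(3)[OF W] that(2)])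
    let ?f = "\<lambda>i. t i *\<^sub>R symbol q \<epsilon> (y i) *\<^sub>R s q"
    have "\<alpha>1 \<epsilon> = (\<Sum>i<N. ?f i)" unfolding t c jcmb_apply[OF W e] by simp
    also have "\<dots> = (\<Sum>i\<in>{..<m + m}. ?f i)"
      by (rule sum.mono_neutral_right) (use tv mN in auto)
    also have "\<dots> = (\<Sum>i<m. ?f i) + (\<Sum>i\<in>{m..<m + m}. ?f i)"
      by (simp only: lessThan_atLeast0 sum.atLeastLessThan_concat le_add1 zero_le)
    also have "(\<Sum>i\<in>{m..<m + m}. ?f i) = (\<Sum>i<m. ?f (m + i))"
      using sum.shift_bounds_nat_ivl[of ?f 0 m m] by (simp add: add.commute atLeast0LessThan)
    finally have "\<alpha>1 \<epsilon> = (\<Sum>i<m. ?f i) + (\<Sum>i<m. ?f (m + i))" .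
    moreover have "snd (comb a) \<epsilon> = (\<Sum>i<m. ?f i)"
      unfolding a snd_conv sum_fun_apply by (rule sum.cong) (simp_all add: scaleR_fun_apply ap e)
    moreover have "snd (comb b) (phi q \<epsilon>) = - (\<Sum>i<m. ?f (m + i))"
      unfolding b snd_conv sum_fun_apply sum_negf[symmetric]
      by (rule sum.cong) (simp_all add: scaleR_fun_apply ap phi_D phi_symbol(1) e)
    ultimately show "\<alpha>1 \<epsilon> = (snd (comb a) - (snd (comb b) \<circ> phi q)) \<epsilon>" by simp
  qed
  then have "z = comb a + K0 q (comb b)"
    unfolding K0_comb z(1) by (intro prod_eqI) (simp_all add: a b \<alpha>1_def algebra_simps)
  then show ?thesis by blast
qed

lemma K0_lin: "lin_on (gfib q) (gfib q) (K0 q)"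
  unfolding lin_on_def using K0_gfib K0_add K0_scaleR by blast

lemma eB_lin: "lin_on (gfib q) (gfib q) (eB c q)"
  unfolding lin_on_def using eB_gfib eB_add eB_scaleR by blast

lemma K_eB: "z \<in> gfib q \<Longrightarrow> K q (eB 1 q z) = eB 1 q (K0 q z)"
  by (simp add: K_def eB_eB eB_0)

lemma sum_frame:
  "(\<Sum>i<Suc N. Re (c i) *\<^sub>R eB 1 q (xi s y nab i q) + Im (c i) *\<^sub>R K q (eB 1 q (xi s y nab i q))) =
    eB 1 q (comb (\<lambda>i. Re (c i)) + K0 q (comb (\<lambda>i. Im (c i))))"
proof -
  let ?x = "\<lambda>i. xi s y nab i q"
  have x: "?x i \<in> gfib q" if "i < Suc N" for i using xi_gfib that by simp
  have K0x: "K0 q (comb (\<lambda>i. Im (c i))) = (\<Sum>i<Suc N. Im (c i) *\<^sub>R K0 q (?x i))"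
  proof -
    have "K0 q (\<Sum>i<Suc N. Im (c i) *\<^sub>R ?x i) = (\<Sum>i<Suc N. K0 q (Im (c i) *\<^sub>R ?x i))"
      by (rule conjunct1[OF lin_on_sum[OF K0_lin gfib_zero gfib_add]]) (simp_all add: gfib_scaleR x)
    also have "\<dots> = (\<Sum>i<Suc N. Im (c i) *\<^sub>R K0 q (?x i))"
      by (rule sum.cong) (simp_all add: K0_scaleR x)
    finally show ?thesis by (simp only: sum_xi)
  qed
  have A: "comb (\<lambda>i. Re (c i)) + K0 q (comb (\<lambda>i. Im (c i))) =
      (\<Sum>i<Suc N. Re (c i) *\<^sub>R ?x i + Im (c i) *\<^sub>R K0 q (?x i))"
    unfolding K0x unfolding sum_xi[symmetric] by (rule sum.distrib[symmetric])
  have "eB 1 q (\<Sum>i<Suc N. Re (c i) *\<^sub>R ?x i + Im (c i) *\<^sub>R K0 q (?x i)) =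
      (\<Sum>i<Suc N. eB 1 q (Re (c i) *\<^sub>R ?x i + Im (c i) *\<^sub>R K0 q (?x i)))"
    by (rule conjunct1[OF lin_on_sum[OF eB_lin gfib_zero gfib_add]]) (simp_all add: gfib_add gfib_scaleR K0_gfib x)
  also have "\<dots> = (\<Sum>i<Suc N. Re (c i) *\<^sub>R eB 1 q (?x i) + Im (c i) *\<^sub>R K q (eB 1 q (?x i)))"
    by (rule sum.cong) (simp_all add: eB_add gfib_scaleR K0_gfib x eB_scaleR K_eB)
  finally show ?thesis unfolding A ..
qed

text \<open>The first component identifies \<open>LL\<close> with the real fiber, where
  multiplication by c acts as Re c + Im c K. Bijectivity then says that the transformed
  \<open>xi\<close> and their images under \<open>K\<close> form a real basis.\<close>

lemma frame_bij:
  fixes e :: "nat \<Rightarrow> ('p, 'v) gen \<times> ('p, 'v) gen"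
  defines "e \<equiv> \<lambda>i. (eB 1 q (xi s y nab i q), - K q (eB 1 q (xi s y nab i q)))"
  shows "bij_betw (\<lambda>c. \<Sum>i<Suc N. cscale (c i) (e i)) ({..<Suc N} \<rightarrow>\<^sub>E (UNIV :: complex set)) (LL q)"
proof -
  let ?f = "\<lambda>c. \<Sum>i<Suc N. cscale (c i) (e i)"
  have e: "e i \<in> LL q" if "i < Suc N" for i using xi_gfib that by (simp add: e_def LL_iff eB_gfib)
  have f_LL: "?f c \<in> LL q" for c
  proof -
    have "(\<Sum>i\<in>I. cscale (c i) (e i)) \<in> LL q" if "I \<subseteq> {..<Suc N}" for I
      using finite_subset[OF that finite_lessThan] that
    proof (induction I rule: finite_induct)
      case empty
      then show ?case using LL_csubspace by (simp add: csubspace_def)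
    next
      case (insert i I)
      then show ?case using LL_csubspace e by (simp add: csubspace_def)
    qed
    from this[OF subset_refl] show ?thesis .
  qed
  have fst_f: "fst (?f c) = eB 1 q (comb (\<lambda>i. Re (c i)) + K0 q (comb (\<lambda>i. Im (c i))))" for c
    unfolding sum_frame[symmetric] fst_sum by (rule sum.cong) (simp_all add: cscale_def e_def)
  have inj: "inj_on ?f ({..<Suc N} \<rightarrow>\<^sub>E UNIV)"
  proof (rule inj_onI)
    fix c d :: "nat \<Rightarrow> complex"
    assume cd: "c \<in> {..<Suc N} \<rightarrow>\<^sub>E UNIV" "d \<in> {..<Suc N} \<rightarrow>\<^sub>E UNIV" and eq: "?f c = ?f d"
    have "0 = fst (?f c) - fst (?f d)" using eq by simp
    also have "\<dots> = fst (?f (\<lambda>i. c i - d i))"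
      unfolding fst_sum sum_subtractf[symmetric]
      by (rule sum.cong) (simp_all add: cscale_def algebra_simps)
    also have "\<dots> = eB 1 q (comb (\<lambda>i. Re (c i - d i)) + K0 q (comb (\<lambda>i. Im (c i - d i))))" by (rule fst_f)
    finally have "eB (-1) q (eB 1 q (comb (\<lambda>i. Re (c i - d i)) + K0 q (comb (\<lambda>i. Im (c i - d i))))) = eB (-1) q 0"
      by simp
    then have "comb (\<lambda>i. Re (c i - d i)) + K0 q (comb (\<lambda>i. Im (c i - d i))) = 0"
      unfolding eB_eB by (simp add: eB_0) (simp add: eB_def Om_zero prod_eq_iff)
    then have z: "comb (\<lambda>i. Re (c i - d i)) = 0" "comb (\<lambda>i. Im (c i - d i)) = 0"
      using comb_K0_kernel by blast+
    have "c i = d i" if "i \<le> N" for i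
      using comb_eq_0[OF z(1) that] comb_eq_0[OF z(2) that] by (simp add: complex_eq_iff)
    then show "c = d" using cd by (intro PiE_ext[OF cd]) auto
  qed
  have "z \<in> ?f ` ({..<Suc N} \<rightarrow>\<^sub>E UNIV)" if z: "z \<in> LL q" for z
  proof -
    have "fst z \<in> gfib q" using z by (simp add: LL_iff)
    then obtain a b where ab: "eB (-1) q (fst z) = comb a + K0 q (comb b)"
      using gfib_decompose[OF eB_gfib] by blast
    define c where "c = restrict (\<lambda>i. Complex (a i) (b i)) {..<Suc N}"
    have "comb (\<lambda>i. Re (c i)) = comb a" "comb (\<lambda>i. Im (c i)) = comb b"
      unfolding sum_xi[symmetric] by (auto simp: c_def intro!: sum.cong)
    then have "fst (?f c) = eB 1 q (eB (-1) q (fst z))" unfolding fst_f ab by simp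
    then have "fst (?f c) = fst z" by (simp add: eB_eB eB_0)
    then have "z = ?f c" using f_LL[of c] z unfolding LL_iff by (intro prod_eqI) simp_all
    moreover have "c \<in> {..<Suc N} \<rightarrow>\<^sub>E UNIV" by (simp add: c_def)
    ultimately show ?thesis by blast
  qed
  then have "?f ` ({..<Suc N} \<rightarrow>\<^sub>E UNIV) = LL q" using f_LL by blast
  with inj show ?thesis by (simp only: bij_betw_def)
qed

end

lemma xi_gsec: "adapted W s y nab \<Longrightarrow> i < Suc N \<Longrightarrow> xi s y nab i \<in> gsec"
proof -
  assume W: "adapted W s y nab" and i: "i < Suc N"
  consider "i = N" | "i < m \<or> 2 * m \<le> i" "i < N" | "\<not> (i < m \<or> 2 * m \<le> i)" "i < N" "i - m < N"
    using i by linarith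
  then show ?thesis
  proof cases
    case 1
    then show ?thesis using idd_dsec jsec_zero by (simp add: gsec_def xi_def[abs_def] comp_def)
  next
    case 2
    then show ?thesis using adapted_nab[OF W 2(2)] jsec_zero by (auto simp: gsec_def xi_def[abs_def] comp_def)
  next
    case 3
    then show ?thesis using eta_jsec[OF adapted_y[OF W 3(3)] adapted_frame(3)[OF W]] dsec_zero
      by (auto simp: gsec_def xi_def[abs_def] comp_def)
  qed
qed

lemma gsec_uminus: "z \<in> gsec \<Longrightarrow> (\<lambda>p. - z p) \<in> gsec"
proof -
  assume "z \<in> gsec"
  then have d: "(\<lambda>p. fst (z p)) \<in> dsec" "(\<lambda>p. snd (z p)) \<in> jsec" by (simp_all add: gsec_def comp_def)
  have "(\<lambda>p. (-1) *\<^sub>R fst (z p)) \<in> dsec" by (rule dsec_cscale[OF d(1)])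
  then show ?thesis using jsec_uminus[OF d(2)] by (simp add: gsec_def comp_def[of fst] comp_def[of snd])
qed

lemma LL_subbundle: "complex_subbundle LL"
  unfolding complex_subbundle_def
proof (intro conjI allI)
  show "csubspace (LL p)" "LL p \<subseteq> gfib p \<times> gfib p" for p
    by (rule LL_csubspace) (auto simp: LL_def)
  have "\<exists>U e. open U \<and> p \<in> U \<and> (\<forall>i<Suc N. e i \<in> cgsec) \<and>
      (\<forall>q\<in>U. bij_betw (\<lambda>c. \<Sum>i<Suc N. cscale (c i) (e i q)) ({..<Suc N} \<rightarrow>\<^sub>E (UNIV :: complex set)) (LL q))" for p
  proof -
    obtain W s y nab where W: "p \<in> W" "adapted W s y nab" by (rule exists_adapted)
    define e where "e i q = (eB 1 q (xi s y nab i q), - K q (eB 1 q (xi s y nab i q)))" for i q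
    have "e i \<in> cgsec" if "i < Suc N" for i
    proof -
      have x: "(\<lambda>q. eB 1 q (xi s y nab i q)) \<in> gsec" by (rule eB_gsec[OF xi_gsec[OF W(2) that]])
      show ?thesis using x gsec_uminus[OF K_gsec[OF x]] by (simp add: cgsec_def e_def comp_def[of fst] comp_def[of snd])
    qed
    then show ?thesis
      using W(1) adapted_frame(2)[OF W(2)] frame_bij[OF W(2)]
      by (intro exI[of _ W] exI[of _ e]) (simp add: e_def)
  qed
  then show "\<exists>k::nat. \<forall>p. \<exists>U e. open U \<and> p \<in> U \<and> (\<forall>i<k. e i \<in> cgsec) \<and>
      (\<forall>q\<in>U. bij_betw (\<lambda>c. \<Sum>i<k. cscale (c i) (e i q)) ({..<k} \<rightarrow>\<^sub>E (UNIV :: complex set)) (LL q))"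
    by blast
qed

end

context line_bundle
begin

text \<open>A pointwise identity of sections may be differentiated. The shape is that of the
  imaginary part of (1 + i) \<Omega> on two complex derivations, as in \<open>ImOm\<close>;
  \<open>D_minus_relation\<close> has the shape of the real part.\<close>

lemma D_plus_relation:
  assumes "\<delta> \<in> D p" "l1 \<in> sec" "l2 \<in> sec" "m1 \<in> sec" "m2 \<in> sec" "m3 \<in> sec" "m4 \<in> sec"
    "\<And>q. l1 q + l2 q = m1 q - m2 q + (m3 q + m4 q)"
  shows "\<delta> l1 + \<delta> l2 = \<delta> m1 - \<delta> m2 + (\<delta> m3 + \<delta> m4)"
proof -
  have "\<delta> l1 + \<delta> l2 = \<delta> (\<lambda>q. m1 q - m2 q + (m3 q + m4 q))"
    using D_add[OF assms(1-3)] assms(8) by simp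
  then show ?thesis
    by (simp only: D_add[OF assms(1) sec_diff[OF assms(4,5)] sec_add[OF assms(6,7)]]
        D_diff[OF assms(1,4,5)] D_add[OF assms(1,6,7)])
qed

lemma D_minus_relation:
  assumes "\<delta> \<in> D p" "l1 \<in> sec" "l2 \<in> sec" "m1 \<in> sec" "m2 \<in> sec" "m3 \<in> sec" "m4 \<in> sec"
    "\<And>q. l1 q - l2 q = m1 q - m2 q - (m3 q + m4 q)"
  shows "\<delta> l1 - \<delta> l2 = \<delta> m1 - \<delta> m2 - (\<delta> m3 + \<delta> m4)"
proof -
  have "\<delta> l1 - \<delta> l2 = \<delta> (\<lambda>q. m1 q - m2 q - (m3 q + m4 q))"
    using D_diff[OF assms(1-3)] assms(8) by simp
  then show ?thesis
    by (simp only: D_diff[OF assms(1) sec_diff[OF assms(4,5)] sec_add[OF assms(6,7)]]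
        D_diff[OF assms(1,4,5)] D_add[OF assms(1,6,7)])
qed

end

context contact_setting
begin

subsection \<open>Involutivity\<close>

text \<open>With \<open>\<delta> = \<delta>1 + \<i> \<delta>2\<close> and \<open>\<Gamma> = \<Gamma>1 + \<i> \<Gamma>2\<close>, this is the imaginary part of \<open>(1 + \<i>) \<Omega>(\<delta>, \<Gamma>)\<close>.\<close>

definition ImOm :: "'p \<Rightarrow> ('p, 'v) der \<Rightarrow> ('p, 'v) der \<Rightarrow> ('p, 'v) der \<Rightarrow> ('p, 'v) der \<Rightarrow> 'v"
  where "ImOm p \<delta>1 \<delta>2 \<Gamma>1 \<Gamma>2 =
    Om p \<delta>1 \<Gamma>1 - Om p \<delta>2 \<Gamma>2 + (Om p \<delta>1 \<Gamma>2 + Om p \<delta>2 \<Gamma>1)"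

text \<open>\<open>LL\<close> is the graph of (1 + i) \<Omega> over \<open>T01\<close>, tested on
  \<open>T01\<close>. The imaginary part of the relation contains the real one, because
  \<open>T01\<close> is stable under multiplication by i.\<close>

lemma LL_pairing_T01:
  assumes "((\<delta>1, \<alpha>1), (\<delta>2, \<alpha>2)) \<in> LL p"
  shows "(\<delta>1, \<delta>2) \<in> T01 p"
    and "(\<Gamma>1, \<Gamma>2) \<in> T01 p \<Longrightarrow> \<alpha>1 \<Gamma>2 + \<alpha>2 \<Gamma>1 = ImOm p \<delta>1 \<delta>2 \<Gamma>1 \<Gamma>2"
proof -
  have d: "\<delta>1 \<in> D p" "\<alpha>1 \<in> J1 p" and e: "(\<delta>2, \<alpha>2) = - K p (\<delta>1, \<alpha>1)"
    using assms by (simp_all add: LL_iff gfib_iff)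
  define \<beta> where "\<beta> = \<alpha>1 - Om p \<delta>1"
  have \<beta>: "\<beta> \<in> J1 p" unfolding \<beta>_def by (rule J1_minus[OF d(2) Om_J1])
  have Sb: "S p \<beta> \<in> D p" "S p \<beta> \<in> VerL B \<pi> p" by (rule sharp_D[OF \<beta>] sharp_VerL[OF \<beta>])+
  have e1: "\<delta>2 = - (phi p \<delta>1 + S p \<beta>)"
    and e2: "\<alpha>2 = - (sig p \<delta>1 - (\<beta> \<circ> phi p) + Om p (phi p \<delta>1 + S p \<beta>))"
    using e by (simp_all add: K_def K0_def eB_def \<beta>_def)
  have sum_D: "phi p \<delta>1 + S p \<beta> \<in> D p" by (rule D_plus[OF phi_D Sb(1)])
  have "\<delta>2 + phi p \<delta>1 \<in> VerL B \<pi> p" using VerL_scaleR[OF Sb(2), of "-1"] unfolding e1 by simp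
  moreover have d2: "\<delta>2 \<in> D p" unfolding e1 by (rule D_minus[OF sum_D])
  ultimately show T: "(\<delta>1, \<delta>2) \<in> T01 p" using d(1) by (simp add: T01_phi_iff)
  assume G: "(\<Gamma>1, \<Gamma>2) \<in> T01 p"
  define v where "v = \<Gamma>2 + phi p \<Gamma>1"
  have v: "v \<in> VerL B \<pi> p" and G1: "\<Gamma>1 \<in> D p" using G by (auto simp: T01_phi_iff v_def)
  note vD = VerL_D[OF v]
  have G2: "\<Gamma>2 = v - phi p \<Gamma>1" by (simp add: v_def)
  have a: "\<alpha>1 x = \<beta> x + Om p \<delta>1 x" for x by (simp add: \<beta>_def)
  have o2: "Om p \<delta>2 x = - (Om p (phi p \<delta>1) x + \<beta> (Pv p x))" for x
    unfolding e1 by (simp only: Om_left_minus[OF sum_D] Om_left_add[OF phi_D Sb(1)] Om_sharp[OF \<beta>])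
  have o2': "Om p (phi p \<delta>1 + S p \<beta>) x = - Om p \<delta>2 x" for x
    unfolding e1 by (simp only: Om_left_minus[OF sum_D] minus_minus)
  have "Pv p \<Gamma>2 = v" unfolding G2 Pv_diff[OF vD phi_D] Pv_phi Pv_vertical[OF v] by simp
  then have X: "Om p \<delta>2 \<Gamma>2 = Om p (phi p \<delta>1) (phi p \<Gamma>1) - \<beta> v"
    unfolding o2 by (simp add: G2 Om_right_diff[OF vD phi_D] Om_phi_vertical[OF v])
  have b2: "\<beta> \<Gamma>2 = \<beta> v - \<beta> (phi p \<Gamma>1)" unfolding G2 by (rule J1_diff[OF \<beta> vD phi_D])
  have a2: "\<alpha>2 \<Gamma>1 = Om p \<delta>1 \<Gamma>1 - Om p (phi p \<delta>1) (phi p \<Gamma>1) + \<beta> (phi p \<Gamma>1) + Om p \<delta>2 \<Gamma>1"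
  proof -
    have "\<alpha>2 \<Gamma>1 = - (sig p \<delta>1 \<Gamma>1 - \<beta> (phi p \<Gamma>1) + - Om p \<delta>2 \<Gamma>1)" by (simp add: e2 o2')
    then show ?thesis by (simp add: sig_apply algebra_simps)
  qed
  show "\<alpha>1 \<Gamma>2 + \<alpha>2 \<Gamma>1 = ImOm p \<delta>1 \<delta>2 \<Gamma>1 \<Gamma>2"
    unfolding ImOm_def X a[of \<Gamma>2] b2 a2 by (simp add: algebra_simps)
qed

text \<open>The candidate is compared with the element of \<open>LL\<close> over the same real part.
  The second derivations differ by a vertical u; testing on (0, v) with vertical v gives u = 0 by
  nondegeneracy, and testing on (x, - \<phi> x) then identifies the jets.\<close>

lemma LL_T01I:
  assumes z: "(\<delta>1, \<alpha>1) \<in> gfib p" "(\<delta>2, \<alpha>2) \<in> gfib p" and T: "(\<delta>1, \<delta>2) \<in> T01 p"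
    and cond: "\<And>\<Gamma>1 \<Gamma>2. (\<Gamma>1, \<Gamma>2) \<in> T01 p \<Longrightarrow> \<alpha>1 \<Gamma>2 + \<alpha>2 \<Gamma>1 = ImOm p \<delta>1 \<delta>2 \<Gamma>1 \<Gamma>2"
  shows "((\<delta>1, \<alpha>1), (\<delta>2, \<alpha>2)) \<in> LL p"
proof -
  obtain \<epsilon> \<gamma> where w: "- K p (\<delta>1, \<alpha>1) = (\<epsilon>, \<gamma>)" by (cases "- K p (\<delta>1, \<alpha>1)")
  have mem: "((\<delta>1, \<alpha>1), (\<epsilon>, \<gamma>)) \<in> LL p" using z(1) w by (simp add: LL_iff)
  have "(\<epsilon>, \<gamma>) \<in> gfib p" unfolding w[symmetric] by (rule gfib_minus[OF K_gfib[OF z(1)]])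
  then have g: "\<epsilon> \<in> D p" "\<gamma> \<in> J1 p" "\<delta>2 \<in> D p" "\<alpha>2 \<in> J1 p" using z(2) by (auto simp: gfib_iff)
  note L = LL_pairing_T01[OF mem]
  define u where "u = \<delta>2 - \<epsilon>"
  have uD: "u \<in> D p" unfolding u_def by (rule D_minus2[OF g(3,1)])
  have "(\<delta>1 + (-1) *\<^sub>R \<delta>1, \<delta>2 + (-1) *\<^sub>R \<epsilon>) \<in> T01 p" by (rule T01_add[OF T T01_scaleR[OF L(1)]])
  then have u: "u \<in> VerL B \<pi> p" using T01_vertical by (simp add: u_def)
  have Omu: "Om p u x = Om p \<delta>2 x - Om p \<epsilon> x" for x unfolding u_def by (rule Om_left_diff[OF g(3,1)])
  have diff: "\<alpha>2 \<Gamma>1 - \<gamma> \<Gamma>1 = Om p u \<Gamma>1 - Om p u \<Gamma>2" if "(\<Gamma>1, \<Gamma>2) \<in> T01 p" for \<Gamma>1 \<Gamma>2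
  proof -
    have "\<alpha>2 \<Gamma>1 - \<gamma> \<Gamma>1 = (\<alpha>1 \<Gamma>2 + \<alpha>2 \<Gamma>1) - (\<alpha>1 \<Gamma>2 + \<gamma> \<Gamma>1)" by simp
    then show ?thesis unfolding cond[OF that] L(2)[OF that] Omu ImOm_def by (simp add: algebra_simps)
  qed
  have "S p (Om p u) = S p 0"
  proof (rule sharp_restrict[OF Om_J1 J1_zero_mem])
    fix v assume v: "v \<in> VerL B \<pi> p"
    show "Om p u v = 0 v"
      using diff[OF T01_VerL[OF VerL_zero v]] J1_zero[OF g(2)] J1_zero[OF g(4)] by (simp add: Om_right_zero)
  qed
  then have u0: "u = 0" using Pv_vertical[OF u] by (simp add: Pv_def sharp_zero)
  have "\<alpha>2 = \<gamma>"
  proof (rule J1_eqI[OF g(4,2)])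
    fix x assume "x \<in> D p"
    from diff[OF phi_T01[OF this]] show "\<alpha>2 x = \<gamma> x" by (simp add: u0 Om_zero)
  qed
  with u0 mem show ?thesis by (simp add: u_def)
qed

text \<open>By \<open>T01_phi_iff\<close> the second component is a vertical part minus \<phi> of
  the first, and both data extend to sections.\<close>

lemma T01_extend:
  assumes "(\<Gamma>1, \<Gamma>2) \<in> T01 p"
  obtains G1 G2 where "G1 \<in> dsec" "G2 \<in> dsec" "G1 p = \<Gamma>1" "G2 p = \<Gamma>2" "\<forall>q. (G1 q, G2 q) \<in> T01 q"
proof -
  have d: "\<Gamma>1 \<in> D p" "\<Gamma>2 + phi p \<Gamma>1 \<in> VerL B \<pi> p" using assms by (simp_all add: T01_phi_iff)
  obtain G where G: "G \<in> dsec" "G p = \<Gamma>1" by (rule D_extend[OF d(1)])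
  obtain V where V: "V \<in> vsec B \<pi>" "V p = \<Gamma>2 + phi p \<Gamma>1" by (rule VerL_extend[OF d(2)])
  have G2: "(\<lambda>q. V q - phi q (G q)) \<in> dsec" by (rule dsec_diff[OF vsecD(1)[OF V(1)] phi_dsec[OF G(1)]])
  have T: "\<forall>q. (G q, V q - phi q (G q)) \<in> T01 q"
  proof
    fix q
    show "(G q, V q - phi q (G q)) \<in> T01 q"
      unfolding T01_phi_iff using dsec_D[OF G(1), of q] dsec_D[OF G2, of q] vsecD(2)[OF V(1), of q] by simp
  qed
  show thesis by (rule that[OF G(1) G2 G(2) _ T]) (simp add: V(2) G(2))
qed

text \<open>In the Lie derivative the term \<Gamma>(\<beta>(\<Delta>)) of \<open>d1\<close> cancels
  against the one from \<open>j1\<close>, which leaves five terms.\<close>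

lemma gbracket_apply:
  assumes "\<Delta> \<in> dsec" "\<alpha> \<in> jsec" "\<Theta> \<in> dsec" "\<beta> \<in> jsec" "\<Gamma> \<in> dsec"
  shows "snd (gbracket (\<lambda>q. (\<Delta> q, \<alpha> q)) (\<lambda>q. (\<Theta> q, \<beta> q)) p) (\<Gamma> p) =
    \<Delta> p (\<lambda>q. \<beta> q (\<Gamma> q)) - \<beta> p (dbracket \<Delta> \<Gamma> p) - \<Theta> p (\<lambda>q. \<alpha> q (\<Gamma> q))
    + \<Gamma> p (\<lambda>q. \<alpha> q (\<Theta> q)) + \<alpha> p (dbracket \<Theta> \<Gamma> p)"
  by (simp add: gbracket_def comp_def lieD_def CE_def j1_apply dsec_D[OF assms(5)]
      d1_eq[OF assms(4,1,5)] d1_eq[OF assms(2,3,5)] algebra_simps)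

lemma gbracket_gfib:
  assumes "z \<in> gsec" "w \<in> gsec"
  shows "gbracket z w p \<in> gfib p"
proof -
  have d: "fst \<circ> z \<in> dsec" "snd \<circ> z \<in> jsec" "fst \<circ> w \<in> dsec" "snd \<circ> w \<in> jsec"
    using assms by (simp_all add: gsec_def)
  have "snd (gbracket z w p) = d1 (snd \<circ> w) p (fst (z p)) + j1 (\<lambda>q. snd (w q) (fst (z q))) p - d1 (snd \<circ> z) p (fst (w p))"
    by (rule ext) (simp add: gbracket_def lieD_def)
  moreover have "\<dots> \<in> J1 p"
    using jsec_sec[OF d(4,1)] by (intro J1_minus J1_plus d1_J1 d jsec_J1[OF j1_jsec]) simp
  moreover have "fst (gbracket z w p) \<in> D p"
    using dsec_D[OF dbracket_dsec[OF d(1,3)]] by (simp add: gbracket_def)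
  ultimately show ?thesis by (simp add: gfib_iff)
qed

text \<open>The index \<open>False\<close> stands for the real and \<open>True\<close> for the imaginary part. On \<open>\<Gamma>\<close> of type
  \<open>(0,1)\<close>, all five terms of the bracket are values of the closed form \<open>(1 + \<i>) \<Omega>\<close>, and they add up
  to its value on \<open>([\<Delta>, \<Theta>], \<Gamma>)\<close>.\<close>

lemma bracket_T01:
  fixes \<Delta> \<Theta> G :: "bool \<Rightarrow> 'p \<Rightarrow> ('p, 'v) der" and \<alpha> \<beta> :: "bool \<Rightarrow> 'p \<Rightarrow> ('p, 'v) jet" and p :: 'p
  assumes dsec: "\<And>i. \<Delta> i \<in> dsec" "\<And>i. \<Theta> i \<in> dsec" "\<And>i. G i \<in> dsec"
    and jsec: "\<And>i. \<alpha> i \<in> jsec" "\<And>i. \<beta> i \<in> jsec"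
    and T: "\<And>q. (\<Delta> False q, \<Delta> True q) \<in> T01 q" "\<And>q. (\<Theta> False q, \<Theta> True q) \<in> T01 q"
      "\<And>q. (G False q, G True q) \<in> T01 q"
    and \<alpha>: "\<And>q \<Gamma>1 \<Gamma>2. (\<Gamma>1, \<Gamma>2) \<in> T01 q \<Longrightarrow>
      \<alpha> False q \<Gamma>2 + \<alpha> True q \<Gamma>1 = ImOm q (\<Delta> False q) (\<Delta> True q) \<Gamma>1 \<Gamma>2"
    and \<beta>: "\<And>q \<Gamma>1 \<Gamma>2. (\<Gamma>1, \<Gamma>2) \<in> T01 q \<Longrightarrow>
      \<beta> False q \<Gamma>2 + \<beta> True q \<Gamma>1 = ImOm q (\<Theta> False q) (\<Theta> True q) \<Gamma>1 \<Gamma>2"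
  defines "g \<equiv> \<lambda>i j k. snd (gbracket (\<lambda>q. (\<Delta> i q, \<alpha> i q)) (\<lambda>q. (\<Theta> j q, \<beta> j q)) p) (G k p)"
  shows "g False False True - g True True True + (g False True False + g True False False) =
    ImOm p (dbracket (\<Delta> False) (\<Theta> False) p - dbracket (\<Delta> True) (\<Theta> True) p)
      (dbracket (\<Delta> False) (\<Theta> True) p + dbracket (\<Delta> True) (\<Theta> False) p) (G False p) (G True p)"
proof -
  \<comment> \<open>The real part of the relation is its imaginary part on i \<Gamma> = (-
    \<Gamma>2, \<Gamma>1).\<close>
  have reOm: "\<psi> False q \<Gamma>1 - \<psi> True q \<Gamma>2 = Om q \<delta>1 \<Gamma>1 - Om q \<delta>2 \<Gamma>2 - (Om q \<delta>1 \<Gamma>2 + Om q \<delta>2 \<Gamma>1)"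
    if G: "(\<Gamma>1, \<Gamma>2) \<in> T01 q" and J: "\<And>i. \<psi> i \<in> jsec"
      and e: "\<And>\<Gamma>1 \<Gamma>2. (\<Gamma>1, \<Gamma>2) \<in> T01 q \<Longrightarrow> \<psi> False q \<Gamma>2 + \<psi> True q \<Gamma>1 = ImOm q \<delta>1 \<delta>2 \<Gamma>1 \<Gamma>2"
    for \<psi> :: "bool \<Rightarrow> 'p \<Rightarrow> ('p, 'v) jet" and q \<delta>1 \<delta>2 \<Gamma>1 \<Gamma>2
  proof -
    have d: "\<Gamma>2 \<in> D q" using T01_D[OF G] by simp
    show ?thesis using e[OF T01_rotate[OF G]]
      by (simp add: ImOm_def Om_right_minus[OF d] J1_uminus[OF jsec_J1[OF J] d] algebra_simps)
  qed
  note dD = dsec_D[OF dsec(1)] dsec_D[OF dsec(2)] dsec_D[OF dsec(3)]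
  \<comment> \<open>These are the terms of \<open>d2 Om = 0\<close> for all choices of real and
    imaginary parts.\<close>
  define a where "a i j k = \<Delta> i p (\<lambda>q. Om q (\<Theta> j q) (G k q))" for i j k
  define b where "b i j k = \<Theta> j p (\<lambda>q. Om q (\<Delta> i q) (G k q))" for i j k
  define c where "c i j k = G k p (\<lambda>q. Om q (\<Delta> i q) (\<Theta> j q))" for i j k
  define e where "e i j k = Om p (\<Theta> j p) (dbracket (\<Delta> i) (G k) p)" for i j k
  define f where "f i j k = Om p (\<Delta> i p) (dbracket (\<Theta> j) (G k) p)" for i j k
  have closed: "Om p (dbracket (\<Delta> i) (\<Theta> j) p) (G k p) = a i j k - b i j k + c i j k - e i j k + f i j k" for i j k
    using Om_closed[OF dsec(1)[of i] dsec(2)[of j] dsec(3)[of k], of p]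
      Om_antisym[of p "dbracket (\<Delta> i) (G k) p" "\<Theta> j p"] Om_antisym[of p "dbracket (\<Theta> j) (G k) p" "\<Delta> i p"]
    by (simp add: d2_def a_def b_def c_def e_def f_def algebra_simps)
  let ?F = False and ?T = True
  \<comment> \<open>E1, E3 and E5 differentiate imaginary parts of the relations, and E2, E4 and E6
    real parts: in an imaginary part, a real derivation meets the former and an imaginary one the
    latter.\<close>
  have E1: "\<Delta> i p (\<lambda>q. \<beta> ?F q (G ?T q)) + \<Delta> i p (\<lambda>q. \<beta> ?T q (G ?F q)) =
      a i ?F ?F - a i ?T ?T + (a i ?F ?T + a i ?T ?F)" for i
    unfolding a_def using \<beta>[OF T(3)] unfolding ImOm_def
    by (rule D_plus_relation[OF dD(1) jsec_sec[OF jsec(2) dsec(3)] jsec_sec[OF jsec(2) dsec(3)]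
        Om_sec[OF dsec(2,3)] Om_sec[OF dsec(2,3)] Om_sec[OF dsec(2,3)] Om_sec[OF dsec(2,3)]])
  have E2: "\<Delta> i p (\<lambda>q. \<beta> ?F q (G ?F q)) - \<Delta> i p (\<lambda>q. \<beta> ?T q (G ?T q)) =
      a i ?F ?F - a i ?T ?T - (a i ?F ?T + a i ?T ?F)" for i
    unfolding a_def using reOm[OF T(3) jsec(2) \<beta>]
    by (rule D_minus_relation[OF dD(1) jsec_sec[OF jsec(2) dsec(3)] jsec_sec[OF jsec(2) dsec(3)]
        Om_sec[OF dsec(2,3)] Om_sec[OF dsec(2,3)] Om_sec[OF dsec(2,3)] Om_sec[OF dsec(2,3)]])
  have E3: "\<Theta> j p (\<lambda>q. \<alpha> ?F q (G ?T q)) + \<Theta> j p (\<lambda>q. \<alpha> ?T q (G ?F q)) =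
      b ?F j ?F - b ?T j ?T + (b ?F j ?T + b ?T j ?F)" for j
    unfolding b_def using \<alpha>[OF T(3)] unfolding ImOm_def
    by (rule D_plus_relation[OF dD(2) jsec_sec[OF jsec(1) dsec(3)] jsec_sec[OF jsec(1) dsec(3)]
        Om_sec[OF dsec(1,3)] Om_sec[OF dsec(1,3)] Om_sec[OF dsec(1,3)] Om_sec[OF dsec(1,3)]])
  have E4: "\<Theta> j p (\<lambda>q. \<alpha> ?F q (G ?F q)) - \<Theta> j p (\<lambda>q. \<alpha> ?T q (G ?T q)) =
      b ?F j ?F - b ?T j ?T - (b ?F j ?T + b ?T j ?F)" for j
    unfolding b_def using reOm[OF T(3) jsec(1) \<alpha>]
    by (rule D_minus_relation[OF dD(2) jsec_sec[OF jsec(1) dsec(3)] jsec_sec[OF jsec(1) dsec(3)]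
        Om_sec[OF dsec(1,3)] Om_sec[OF dsec(1,3)] Om_sec[OF dsec(1,3)] Om_sec[OF dsec(1,3)]])
  have E5: "G k p (\<lambda>q. \<alpha> ?F q (\<Theta> ?T q)) + G k p (\<lambda>q. \<alpha> ?T q (\<Theta> ?F q)) =
      c ?F ?F k - c ?T ?T k + (c ?F ?T k + c ?T ?F k)" for k
    unfolding c_def using \<alpha>[OF T(2)] unfolding ImOm_def
    by (rule D_plus_relation[OF dD(3) jsec_sec[OF jsec(1) dsec(2)] jsec_sec[OF jsec(1) dsec(2)]
        Om_sec[OF dsec(1,2)] Om_sec[OF dsec(1,2)] Om_sec[OF dsec(1,2)] Om_sec[OF dsec(1,2)]])
  have E6: "G k p (\<lambda>q. \<alpha> ?F q (\<Theta> ?F q)) - G k p (\<lambda>q. \<alpha> ?T q (\<Theta> ?T q)) =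
      c ?F ?F k - c ?T ?T k - (c ?F ?T k + c ?T ?F k)" for k
    unfolding c_def using reOm[OF T(2) jsec(1) \<alpha>]
    by (rule D_minus_relation[OF dD(3) jsec_sec[OF jsec(1) dsec(2)] jsec_sec[OF jsec(1) dsec(2)]
        Om_sec[OF dsec(1,2)] Om_sec[OF dsec(1,2)] Om_sec[OF dsec(1,2)] Om_sec[OF dsec(1,2)]])
  have bD: "dbracket (\<Delta> i) (G k) p \<in> D p" "dbracket (\<Theta> j) (G k) p \<in> D p" "dbracket (\<Delta> i) (\<Theta> j) p \<in> D p" for i j k
    by (rule dsec_D[OF dbracket_dsec[OF dsec(1,3)]] dsec_D[OF dbracket_dsec[OF dsec(2,3)]]
        dsec_D[OF dbracket_dsec[OF dsec(1,2)]])+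
  note \<beta>J = jsec_J1[OF jsec(2)] and \<alpha>J = jsec_J1[OF jsec(1)]
  \<comment> \<open>The bracket of \<open>\<Delta>\<close> and \<open>G\<close> lies in
    \<open>T01\<close>, so the relation for \<open>\<beta>\<close> may be evaluated on it.\<close>
  have E7: "\<beta> ?F p (dbracket (\<Delta> ?F) (G ?T) p) + \<beta> ?F p (dbracket (\<Delta> ?T) (G ?F) p) +
      (\<beta> ?T p (dbracket (\<Delta> ?F) (G ?F) p) - \<beta> ?T p (dbracket (\<Delta> ?T) (G ?T) p)) =
      e ?F ?F ?F - e ?T ?F ?T - (e ?F ?T ?T + e ?T ?T ?F) + (e ?F ?F ?T + e ?T ?F ?F + (e ?F ?T ?F - e ?T ?T ?T))"
    using \<beta>[OF T01_involutive[OF dsec(1) dsec(1) T(1) dsec(3) dsec(3) T(3)], of p]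
    by (simp only: ImOm_def e_def J1_add[OF \<beta>J bD(1) bD(1)] J1_diff[OF \<beta>J bD(1) bD(1)]
        Om_right_add[OF bD(1) bD(1)] Om_right_diff[OF bD(1) bD(1)])
  have E8: "\<alpha> ?F p (dbracket (\<Theta> ?F) (G ?T) p) + \<alpha> ?F p (dbracket (\<Theta> ?T) (G ?F) p) +
      (\<alpha> ?T p (dbracket (\<Theta> ?F) (G ?F) p) - \<alpha> ?T p (dbracket (\<Theta> ?T) (G ?T) p)) =
      f ?F ?F ?F - f ?F ?T ?T - (f ?T ?F ?T + f ?T ?T ?F) + (f ?F ?F ?T + f ?F ?T ?F + (f ?T ?F ?F - f ?T ?T ?T))"
    using \<alpha>[OF T01_involutive[OF dsec(2) dsec(2) T(2) dsec(3) dsec(3) T(3)], of p]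
    by (simp only: ImOm_def f_def J1_add[OF \<alpha>J bD(2) bD(2)] J1_diff[OF \<alpha>J bD(2) bD(2)]
        Om_right_add[OF bD(2) bD(2)] Om_right_diff[OF bD(2) bD(2)])
  have "g ?F ?F ?T - g ?T ?T ?T + (g ?F ?T ?F + g ?T ?F ?F) =
      (\<Delta> ?F p (\<lambda>q. \<beta> ?F q (G ?T q)) + \<Delta> ?F p (\<lambda>q. \<beta> ?T q (G ?F q)))
    + (\<Delta> ?T p (\<lambda>q. \<beta> ?F q (G ?F q)) - \<Delta> ?T p (\<lambda>q. \<beta> ?T q (G ?T q)))
    - (\<Theta> ?F p (\<lambda>q. \<alpha> ?F q (G ?T q)) + \<Theta> ?F p (\<lambda>q. \<alpha> ?T q (G ?F q)))
    - (\<Theta> ?T p (\<lambda>q. \<alpha> ?F q (G ?F q)) - \<Theta> ?T p (\<lambda>q. \<alpha> ?T q (G ?T q)))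
    + (G ?F p (\<lambda>q. \<alpha> ?F q (\<Theta> ?T q)) + G ?F p (\<lambda>q. \<alpha> ?T q (\<Theta> ?F q)))
    + (G ?T p (\<lambda>q. \<alpha> ?F q (\<Theta> ?F q)) - G ?T p (\<lambda>q. \<alpha> ?T q (\<Theta> ?T q)))
    - (\<beta> ?F p (dbracket (\<Delta> ?F) (G ?T) p) + \<beta> ?F p (dbracket (\<Delta> ?T) (G ?F) p) +
      (\<beta> ?T p (dbracket (\<Delta> ?F) (G ?F) p) - \<beta> ?T p (dbracket (\<Delta> ?T) (G ?T) p)))
    + (\<alpha> ?F p (dbracket (\<Theta> ?F) (G ?T) p) + \<alpha> ?F p (dbracket (\<Theta> ?T) (G ?F) p) +
      (\<alpha> ?T p (dbracket (\<Theta> ?F) (G ?F) p) - \<alpha> ?T p (dbracket (\<Theta> ?T) (G ?T) p)))"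
    unfolding g_def gbracket_apply[OF dsec(1) jsec(1) dsec(2) jsec(2) dsec(3)]
    by (simp only: diff_conv_add_uminus minus_add_distrib minus_minus add_ac)
  also have "\<dots> = ImOm p (dbracket (\<Delta> ?F) (\<Theta> ?F) p - dbracket (\<Delta> ?T) (\<Theta> ?T) p)
      (dbracket (\<Delta> ?F) (\<Theta> ?T) p + dbracket (\<Delta> ?T) (\<Theta> ?F) p) (G ?F p) (G ?T p)"
    unfolding E1 E2 E3 E4 E5 E6 E7 E8 ImOm_def Om_left_add[OF bD(3) bD(3)] Om_left_diff[OF bD(3) bD(3)] closed
    by (simp only: diff_conv_add_uminus minus_add_distrib minus_minus add_ac)
  finally show ?thesis .
qed

lemma LL_involutive: "involutive LL"
  unfolding involutive_def
proof (intro ballI impI allI)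
  fix z w p
  assume z: "z \<in> cgsec" and w: "w \<in> cgsec" and L: "(\<forall>q. z q \<in> LL q) \<and> (\<forall>q. w q \<in> LL q)"
  define \<Delta> where "\<Delta> i q = fst ((if i then snd else fst) (z q))" for i q
  define \<alpha> where "\<alpha> i q = snd ((if i then snd else fst) (z q))" for i q
  define \<Theta> where "\<Theta> i q = fst ((if i then snd else fst) (w q))" for i q
  define \<beta> where "\<beta> i q = snd ((if i then snd else fst) (w q))" for i q
  have d: "\<Delta> i \<in> dsec" "\<alpha> i \<in> jsec" "\<Theta> i \<in> dsec" "\<beta> i \<in> jsec" for i
    using z w by (auto simp: cgsec_def gsec_def comp_def \<Delta>_def[abs_def] \<alpha>_def[abs_def] \<Theta>_def[abs_def] \<beta>_def[abs_def])
  have zL: "((\<Delta> False q, \<alpha> False q), (\<Delta> True q, \<alpha> True q)) \<in> LL q"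
    and wL: "((\<Theta> False q, \<beta> False q), (\<Theta> True q, \<beta> True q)) \<in> LL q" for q
    using L by (simp_all add: \<Delta>_def \<alpha>_def \<Theta>_def \<beta>_def)
  let ?b = "\<lambda>i j. gbracket (\<lambda>q. (\<Delta> i q, \<alpha> i q)) (\<lambda>q. (\<Theta> j q, \<beta> j q)) p"
  have gs: "(\<lambda>q. (\<Delta> i q, \<alpha> i q)) \<in> gsec" "(\<lambda>q. (\<Theta> i q, \<beta> i q)) \<in> gsec" for i
    using d[of i] by (simp_all add: gsec_def comp_def)
  have bg: "?b i j \<in> gfib p" for i j by (rule gbracket_gfib[OF gs])
  have fb: "fst (?b i j) = dbracket (\<Delta> i) (\<Theta> j) p" for i j by (simp add: gbracket_def comp_def)
  have eq: "cgbracket z w p = (?b False False - ?b True True, ?b False True + ?b True False)"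
    by (simp add: cgbracket_def \<Delta>_def \<alpha>_def \<Theta>_def \<beta>_def comp_def)
  have "((fst (?b False False - ?b True True), snd (?b False False - ?b True True)),
      (fst (?b False True + ?b True False), snd (?b False True + ?b True False))) \<in> LL p"
  proof (rule LL_T01I)
    show "(fst (?b False False - ?b True True), snd (?b False False - ?b True True)) \<in> gfib p"
      using gfib_add[OF bg gfib_minus[OF bg]] by (simp only: prod.collapse diff_conv_add_uminus)
    show "(fst (?b False True + ?b True False), snd (?b False True + ?b True False)) \<in> gfib p"
      using gfib_add[OF bg bg] by (simp only: prod.collapse)
    show "(fst (?b False False - ?b True True), fst (?b False True + ?b True False)) \<in> T01 p"
      unfolding fst_diff fst_add fb
      by (rule T01_involutive[OF d(1) d(1) LL_pairing_T01(1)[OF zL] d(3) d(3) LL_pairing_T01(1)[OF wL]])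
    \<comment> \<open>The test is at a point, while the bracket formula differentiates along
      sections; the test vector is therefore extended inside \<open>T01\<close>.\<close>
    fix \<Gamma>1 \<Gamma>2 assume "(\<Gamma>1, \<Gamma>2) \<in> T01 p"
    then obtain G1 G2 where G: "G1 \<in> dsec" "G2 \<in> dsec" "G1 p = \<Gamma>1" "G2 p = \<Gamma>2" "\<forall>q. (G1 q, G2 q) \<in> T01 q"
      by (rule T01_extend)
    define G where "G i = (if i then G2 else G1)" for i
    have Gd: "G i \<in> dsec" "(G False q, G True q) \<in> T01 q" "G False p = \<Gamma>1" "G True p = \<Gamma>2" for i q
      using G by (simp_all add: G_def)
    show "snd (?b False False - ?b True True) \<Gamma>2 + snd (?b False True + ?b True False) \<Gamma>1 =
        ImOm p (fst (?b False False - ?b True True)) (fst (?b False True + ?b True False)) \<Gamma>1 \<Gamma>2"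
      unfolding fst_diff fst_add fb
      using bracket_T01[OF d(1) d(3) Gd(1) d(2) d(4) LL_pairing_T01(1)[OF zL] LL_pairing_T01(1)[OF wL] Gd(2)
          LL_pairing_T01(2)[OF zL] LL_pairing_T01(2)[OF wL], of p]
      unfolding Gd(3,4) by simp
  qed
  then show "cgbracket z w p \<in> LL p" unfolding eq by (simp only: prod.collapse)
qed

lemma LL_generalized_contact: "generalized_contact LL"
  unfolding generalized_contact_def
  by (intro conjI allI LL_subbundle LL_maximally_isotropic LL_involutive LL_conj)

end

theorem lemma6p5:
  fixes P :: "('p::{t2_space, second_countable_topology}, 'e::real_normed_vector) atlas"
    and M :: "('m::{t2_space, second_countable_topology}, 'c::real_normed_vector) atlas"
    and F :: "('f::{t2_space, second_countable_topology}, 'd::real_normed_vector) atlas"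
    and I :: "'c \<Rightarrow> 'c"
    and \<pi> :: "'p \<Rightarrow> 'm"
    and L :: "'p \<Rightarrow> 'v::real_vector set"
    and Fr :: "('p set \<times> ('p \<Rightarrow> 'v)) set"
    and J :: "'p \<Rightarrow> ('p, 'v) jet \<Rightarrow> ('p, 'v) jet \<Rightarrow> 'v"
  assumes "complex_manifold I M"
    and "fiber_bundle P M F \<pi>"
    and "line_bundle P L Fr"
    and "line_bundle.jacobi_tensor P L Fr J"
    and "line_bundle.gives_contact_family P L Fr M \<pi> J"
  shows "\<exists>\<L>. line_bundle.generalized_contact P L Fr \<L> \<and>
    line_bundle.jacobi_structure_of P L Fr \<L> J"
proof -
  interpret line_bundle P L Fr by (rule assms(3))
  interpret fibered P L Fr M F \<pi> I
    by unfold_locales (rule assms)+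
  have "\<exists>S. finite S \<and> span S = (UNIV :: 'c set)"
    by (rule conjunct1[OF base.mfd[unfolded smooth_manifold_def]])
  then obtain S where S: "finite S" "span S = (UNIV :: 'c set)" by (elim exE conjE)
  have "\<exists>m bc cc. coords (2 * m) bc cc \<and> (\<forall>i<m. I (bc i) = bc (m + i)) \<and> (\<forall>i<m. I (bc (m + i)) = - bc i)"
  proof (rule exists_complex_coords[OF S I_linear I_I])
    fix m b c
    assume "coords (2 * m) b c" "\<And>i. i < m \<Longrightarrow> I (b i) = b (m + i)" "\<And>i. i < m \<Longrightarrow> I (b (m + i)) = - b i"
    then show ?thesis by (intro exI[of _ m] exI[of _ b] exI[of _ c] conjI allI impI)
  qed
  then obtain m bc cc where b: "coords (2 * m) bc cc"
    "\<forall>i<m. I (bc i) = bc (m + i)" "\<forall>i<m. I (bc (m + i)) = - bc i" by (elim exE conjE)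
  obtain k bd cd where f: "coords k (bd :: nat \<Rightarrow> 'd) cd" by (rule fib.model_coords)
  have "fibered_coords P L Fr M F \<pi> I m bc cc k bd cd"
    by (rule fibered_coords.intro[OF fibered_axioms], rule fibered_coords_axioms.intro)
      (use b f in simp_all)
  then interpret contact_setting P L Fr M F \<pi> I m bc cc k bd cd J
    by (rule contact_setting.intro[OF _ contact_setting_axioms.intro[OF assms(4,5)]])
  show ?thesis by (rule exI[of _ LL], rule conjI[OF LL_generalized_contact LL_jacobi])
qed

end
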